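(* Given an integer $k\ge1$ and $\Lambda\in[0,2\pi)$, there exists $a_0>0$ such that for every $a\in(0,a_0]$ and every $g\in\dot H^{\frac12}(\mathbb R,\mathbb S^1)$ with $E(g)\le\Lambda$ there exist $k+1$ distinct maps $u_0,\dots,u_k\in\dot H^{\frac12}(\mathbb R,\mathbb S^1)$ which are half-harmonic in $I_-\cup I_+=(-1,-a)\cup(a,1)$ and equal to $g$ in $\mathbb R\setminus(I_-\cup I_+)$. Moreover $E(u_j)<2\pi$, and in particular $\deg(u_j)=0$, for $j=0,\dots,k$.
   Context: $\mathbb S^1=\{z\in\mathbb C:|z|=1\}$, with $\mathbb C\simeq\mathbb R^2$. $\dot H^{\frac12}(\mathbb R,\mathbb C)$ is the space of measurable $u:\mathbb R\to\mathbb C$ (up to a.e. equality) with $\int_{\mathbb R}\int_{\mathbb R}\frac{|u(x)-u(y)|^2}{|x-y|^2}\,dx\,dy<\infty$, and $\dot H^{\frac12}(\mathbb R,\mathbb S^1)$ is its subset of maps with $|u(x)|=1$ for a.e. $x$. The energy is $E(u)=\int_{\mathbb R}|(-\Delta)^{\frac14}u|^2dx=\frac1{2\pi}\int_{\mathbb R}\int_{\mathbb R}\frac{|u(x)-u(y)|^2}{|x-y|^2}\,dx\,dy=\int_{\mathbb R^2_+}|\nabla\tilde u|^2\,dx\,dy$, where $\tilde u$ is the Poisson harmonic extension of $u$ to the upper half-plane $\mathbb R^2_+$. For an open set $A\subset\mathbb R$, a map $u\in\dot H^{\frac12}(\mathbb R,\mathbb S^1)$ is half-harmonic in $A$ if $(-\Delta)^{\frac12}u(x):=-\frac{\partial\tilde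 u}{\partial y}(x,0)\perp T_{u(x)}\mathbb S^1$ for $x\in A$. Equivalently, $u$ is a critical point of $E$ among maps in $\dot H^{\frac12}(\mathbb R,\mathbb S^1)$ with the same values in $\mathbb R\setminus A$. In weak form: for all $\varphi\in C_c^\infty(A,\mathbb R)$, $\int_{\mathbb R}\int_{\mathbb R}\frac{(u(x)-u(y))\cdot(i u(x)\varphi(x)-i u(y)\varphi(y))}{|x-y|^2}\,dx\,dy=0$, where $\cdot$ is the scalar product of $\mathbb R^2\simeq\mathbb C$. Half-harmonic maps in $A$ are known to be smooth in $A$. Degree: for $u\in\dot H^{\frac12}(\mathbb R,\mathbb S^1)$, $\deg(u):=\deg(u\circ\pi)\in\mathbb Z$, where $\pi:\mathbb S^1\setminus\{i\}\to\mathbb R$, $\pi(e^{i\theta})=\frac{\cos\theta}{1-\sin\theta}$, is the stereographic projection from the north pole (so $u\circ\pi\in H^{\frac12}(\mathbb S^1,\mathbb S^1)$). The degree on $H^{\frac12}(\mathbb S^1,\mathbb S^1)$ is the unique extension, continuous in the $H^{\frac12}$ norm, of the usual degree $\frac1{2\pi i}\int_{\mathbb S^1}\bar f f'\,d\theta$ of $C^1$ maps (equivalently $\deg f=\sum_{n\in\mathbb Z}n|\hat f(n)|^2$). *)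

theory Defs
  imports "HOL-Analysis.Analysis"
begin

section \<open>The space of circle-valued maps of finite half-energy\<close>

text \<open>
  Maps are represented by Lebesgue measurable functions, and equality of maps is equality
  almost everywhere. In the double integrals below the quotients take the value 0 on the
  diagonal, which is a null set. They are integrated against the Lebesgue measure of the plane,
  not against the Borel measure \<open>lborel \<Otimes>\<^sub>M lborel\<close>, because functions such as
  \<open>\<lambda>(x, y). u x\<close> need not be Borel measurable.
\<close>

definition gagliardo :: "(real \<Rightarrow> complex) \<Rightarrow> ennreal" where
  "gagliardo u = (\<integral>\<^sup>+ (x, y). ennreal ((cmod (u x - u y))\<^sup>2 / \<bar>x - y\<bar>\<^sup>2) \<partial>(lebesgue :: (real \<times> real) measure))"

definition Hdot_half :: "(real \<Rightarrow> complex) set" where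
  "Hdot_half = {u \<in> borel_measurable lebesgue. gagliardo u < \<infinity>}"

definition Hdot_half_circle :: "(real \<Rightarrow> complex) set" where
  "Hdot_half_circle = {u \<in> Hdot_half. AE x in lebesgue. cmod (u x) = 1}"

definition energy :: "(real \<Rightarrow> complex) \<Rightarrow> ennreal" where
  "energy u = ennreal (1 / (2 * pi)) * gagliardo u"

section \<open>Half-harmonic maps\<close>

definition test_function :: "real set \<Rightarrow> (real \<Rightarrow> real) \<Rightarrow> bool" where
  "test_function A \<phi> \<longleftrightarrow>
     (\<forall>n x. ((deriv ^^ n) \<phi>) differentiable (at x)) \<and>
     compact (closure {x. \<phi> x \<noteq> 0}) \<and> closure {x. \<phi> x \<noteq> 0} \<subseteq> A"

text \<open>
  The condition that \<open>(-\<Delta>)\<^sup>1\<^sup>/\<^sup>2 u(x)\<close> is orthogonal to the tangent line of the circle at \<open>u(x)\<close>,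
  which is spanned by \<open>\<i> u(x)\<close>, is understood in the weak sense for \<open>x\<close> in the open set \<open>A\<close>.
  For \<open>u\<close> of finite energy and a test function \<open>\<phi>\<close> the integrand is Lebesgue integrable (by
  the Cauchy-Schwarz inequality), so the Bochner integral is not a default value. The
  dot is the scalar product of the plane.
\<close>

definition half_harmonic_in :: "real set \<Rightarrow> (real \<Rightarrow> complex) \<Rightarrow> bool" where
  "half_harmonic_in A u \<longleftrightarrow>
     u \<in> Hdot_half_circle \<and>
     (\<forall>\<phi>. test_function A \<phi> \<longrightarrow>
        (LINT (x, y)|(lebesgue :: (real \<times> real) measure).
           ((u x - u y) \<bullet> (\<i> * u x * complex_of_real (\<phi> x) - \<i> * u y * complex_of_real (\<phi> y)))
             / \<bar>x - y\<bar>\<^sup>2) = 0)"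

section \<open>Degree\<close>

text \<open>
  Maps on the unit circle are functions on \<open>complex\<close> of which only the restriction to the circle
  matters. The circle carries the arc length measure, given by the angle in \<open>[0, 2\<pi>]\<close>.
\<close>

definition circle_norm2 :: "(complex \<Rightarrow> complex) \<Rightarrow> ennreal" where
  "circle_norm2 f =
     (\<integral>\<^sup>+ t. ennreal ((cmod (f (cis t)))\<^sup>2) \<partial>lebesgue_on {0..2 * pi}) +
     (\<integral>\<^sup>+ (s, t). ennreal ((cmod (f (cis s) - f (cis t)))\<^sup>2 / (cmod (cis s - cis t))\<^sup>2)
        \<partial>lebesgue_on ({0..2 * pi} \<times> {0..2 * pi}))"

definition circle_norm :: "(complex \<Rightarrow> complex) \<Rightarrow> real" where
  "circle_norm f = sqrt (enn2real (circle_norm2 f))"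

definition H_half_circle_maps :: "(complex \<Rightarrow> complex) set" where
  "H_half_circle_maps =
     {f. (\<lambda>t. f (cis t)) \<in> borel_measurable (lebesgue_on {0..2 * pi}) \<and>
         circle_norm2 f < \<infinity> \<and>
         (AE t in lebesgue_on {0..2 * pi}. cmod (f (cis t)) = 1)}"

definition C1_circle_map :: "(complex \<Rightarrow> complex) \<Rightarrow> bool" where
  "C1_circle_map f \<longleftrightarrow>
     (\<forall>z. cmod z = 1 \<longrightarrow> cmod (f z) = 1) \<and> (\<lambda>t. f (cis t)) C1_differentiable_on UNIV"

definition C1_degree :: "(complex \<Rightarrow> complex) \<Rightarrow> complex" where
  "C1_degree f = 1 / (2 * of_real pi * \<i>) *
     integral {0..2 * pi} (\<lambda>t. cnj (f (cis t)) * vector_derivative (\<lambda>s. f (cis s)) (at t))"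

text \<open>
  The degree is the unique continuous extension of the degree of \<open>C\<^sup>1\<close> maps. Extensionality fixes
  the value outside the space, so that the extension is unique as a HOL function. Continuity
  forces the degree to be invariant under changes of a map on a null set.
\<close>

definition is_circle_degree :: "((complex \<Rightarrow> complex) \<Rightarrow> int) \<Rightarrow> bool" where
  "is_circle_degree D \<longleftrightarrow>
     D \<in> extensional H_half_circle_maps \<and>
     (\<forall>f. C1_circle_map f \<longrightarrow> of_int (D f) = C1_degree f) \<and>
     (\<forall>f \<in> H_half_circle_maps. \<forall>\<epsilon>>0. \<exists>\<delta>>0. \<forall>g \<in> H_half_circle_maps.
        circle_norm (\<lambda>z. g z - f z) < \<delta> \<longrightarrow> dist (D g) (D f) < \<epsilon>)"

definition circle_degree :: "(complex \<Rightarrow> complex) \<Rightarrow> int" where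
  "circle_degree = (THE D. is_circle_degree D)"

text \<open>
  At \<open>\<theta>\<close> with \<open>z = cis \<theta>\<close> this is \<open>cos \<theta> / (1 - sin \<theta>)\<close>. The value at the north pole \<open>\<i>\<close> is
  irrelevant.
\<close>

definition stereographic :: "complex \<Rightarrow> real" where
  "stereographic z = Re z / (1 - Im z)"

definition degree_half :: "(real \<Rightarrow> complex) \<Rightarrow> int" where
  "degree_half u = circle_degree (u \<circ> stereographic)"

end

theory Submission
  imports Defs "HOL-Probability.Probability"
begin

text \<open>A bounded cutoff \<open>\<kappa>\<close> which is 1 near 0 and vanishes outside \<open>(-1, 1)\<close> can have arbitrarily small
  half-energy, because points of the line have zero capacity. Hence, for small \<open>a\<close>, the maps
  \<open>h\<^sub>j = g * cis (2 * pi * j * \<kappa>)\<close> with \<open>j \<le> k\<close> agree with \<open>g\<close> outside the two gaps and still have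
  energy below \<open>2 * pi\<close>, while relative to \<open>g\<close> they wind \<open>- j\<close> times on the right gap and \<open>j\<close> times
  on the left gap. The map \<open>u\<^sub>j\<close> minimizes the energy in the class of all \<open>u\<close> that agree with \<open>g\<close>
  outside the gaps and whose quotient by \<open>h\<^sub>j\<close> has degree 0 on either gap.

  The energy of a map is at least \<open>2 * pi\<close> times the modulus of its degree, by Bessel's inequality
  for smooth maps and by approximation with normalized averages in general. If a minimizing
  sequence lost some degree in the limit, its energy would therefore exceed that of the limit by
  \<open>2 * pi\<close>; since the infimum is below \<open>2 * pi\<close>, the class is closed and a minimizer exists. It is
  half-harmonic in the gaps because multiplication by \<open>cis (\<epsilon> * \<phi>)\<close> does not leave the class, and
  minimizers for different \<open>j\<close> differ because their degrees relative to \<open>g\<close> on the right gap do.\<close>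

section \<open>Integral inequalities\<close>

text \<open>The degree is not continuous along sequences that merely have bounded energy and
  converge almost everywhere: a bubble may shrink to a point and carry an integer away. Since the
  degree is additive under products, such a loss can be read off the quotient of the sequence by its
  limit. This quotient tends to 1, and up to cross terms that vanish in the limit its energy adds to
  that of the limit.

  The degree is specified as a continuous extension only, so it has to be built before it can be
  used: the energy bound makes the winding number of smooth maps locally constant in the norm, and
  this yields the extension. Stereographic projection carries the energy over to the line unchanged,
  because the squared chord is the squared distance times the Jacobians at both points.

  The strict inequality \<open>\<Lambda> < 2 * pi\<close> pays for the phase factors. The room that
  it leaves has to hold the \<open>k\<close>-th power of the phase factor whatever \<open>g\<close>
  is; hence \<open>a0\<close> is chosen from \<open>k\<close> and \<Lambda> alone.\<close>

lemma norm_add_sq_le: "(norm (a + b))\<^sup>2 \<le> 2 * (norm a)\<^sup>2 + 2 * (norm (b::'a::real_normed_vector))\<^sup>2"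
proof -
  have "(norm (a + b))\<^sup>2 \<le> (norm a + norm b)\<^sup>2"
    by (simp add: power_mono norm_triangle_ineq)
  also have "\<dots> \<le> 2 * (norm a)\<^sup>2 + 2 * (norm b)\<^sup>2"
    using zero_le_power2[of "norm a - norm b"] by (simp add: power2_eq_square algebra_simps)
  finally show ?thesis .
qed

lemma norm_diff_sq_le: "(norm (a - b))\<^sup>2 \<le> 2 * (norm a)\<^sup>2 + 2 * (norm (b::'a::real_normed_vector))\<^sup>2"
  using norm_add_sq_le[of a "- b"] by simp

text \<open>Weak convergence to 0, tested against one square-integrable \<open>P\<close>. The
  product is cut at \<open>Q n x = P x / \<epsilon>\<close>: below the cut it is dominated by
  \<open>P\<^sup>2 / \<epsilon>\<close>, and above it \<open>P\<close> is at most \<epsilon> times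
  \<open>Q n\<close>, so that the uniform bound on the second moments applies.\<close>

lemma nn_integral_cross_tendsto_0:
  fixes P :: "'a \<Rightarrow> real" and Q :: "nat \<Rightarrow> 'a \<Rightarrow> real"
  assumes [measurable]: "P \<in> borel_measurable M" "\<And>n. Q n \<in> borel_measurable M"
    and nonneg: "\<And>x. 0 \<le> P x" "\<And>n x. 0 \<le> Q n x"
    and P: "(\<integral>\<^sup>+x. ennreal ((P x)\<^sup>2) \<partial>M) < \<infinity>"
    and Q: "\<And>n. (\<integral>\<^sup>+x. ennreal ((Q n x)\<^sup>2) \<partial>M) \<le> ennreal C"
    and lim: "AE x in M. (\<lambda>n. Q n x) \<longlonglongrightarrow> 0"
  shows "(\<lambda>n. \<integral>\<^sup>+x. ennreal (P x * Q n x) \<partial>M) \<longlonglongrightarrow> 0"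
proof (rule order_tendstoI)
  fix a :: ennreal assume "0 < a"
  \<comment> \<open>\<open>C\<close> may be 0 or negative, in which case \<open>ennreal C\<close> is
    0; the maximum is a positive number to divide by.\<close>
  define C' where "C' = max C 1"
  have C': "C' > 0" "ennreal C \<le> ennreal C'" by (auto simp: C'_def ennreal_leI)
  obtain e where e: "0 < e" "ennreal e < a"
  proof -
    obtain b where b: "0 < b" "b < a" using dense[OF \<open>0 < a\<close>] by auto
    then have "b < top" using top.not_eq_extremum by fastforce
    then obtain e where "b = ennreal e" "0 \<le> e" by (cases b) auto
    with b show ?thesis by (intro that[of e]) auto
  qed
  define \<epsilon> where "\<epsilon> = e / (2 * C')"
  have \<epsilon>: "0 < \<epsilon>" "\<epsilon> * C' = e / 2" using e C' by (auto simp: \<epsilon>_def)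
  define R where "R n x = P x * min (Q n x) (P x / \<epsilon>)" for n x
  have [measurable]: "R n \<in> borel_measurable M" for n unfolding R_def by measurable
  have "(\<lambda>n. \<integral>\<^sup>+x. ennreal (R n x) \<partial>M) \<longlonglongrightarrow> (\<integral>\<^sup>+x. 0 \<partial>M)"
  proof (rule nn_integral_dominated_convergence[where w="\<lambda>x. ennreal ((P x)\<^sup>2 * (1/\<epsilon>))"])
    show "AE x in M. ennreal (R n x) \<le> ennreal ((P x)\<^sup>2 * (1/\<epsilon>))" for n
    proof (rule AE_I2, rule ennreal_leI)
      fix x
      have "R n x \<le> P x * (P x / \<epsilon>)"
        unfolding R_def by (intro mult_left_mono) (auto simp: nonneg)
      then show "R n x \<le> (P x)\<^sup>2 * (1/\<epsilon>)" by (simp add: power2_eq_square)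
    qed
    have "(\<integral>\<^sup>+x. ennreal ((P x)\<^sup>2 * (1/\<epsilon>)) \<partial>M) = (\<integral>\<^sup>+x. ennreal ((P x)\<^sup>2) \<partial>M) * ennreal (1/\<epsilon>)"
      using \<epsilon> by (subst nn_integral_multc[symmetric]) (auto simp flip: ennreal_mult)
    then show "(\<integral>\<^sup>+x. ennreal ((P x)\<^sup>2 * (1/\<epsilon>)) \<partial>M) < \<infinity>"
      using P by (simp add: ennreal_mult_less_top)
    show "AE x in M. (\<lambda>n. ennreal (R n x)) \<longlonglongrightarrow> 0"
      using lim
    proof eventually_elim
      case (elim x)
      have "(\<lambda>n. R n x) \<longlonglongrightarrow> P x * min 0 (P x / \<epsilon>)"
        unfolding R_def by (intro tendsto_intros elim)
      moreover have "min 0 (P x / \<epsilon>) = 0" using nonneg(1)[of x] \<epsilon> by simp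
      ultimately show ?case using tendsto_ennrealI by fastforce
    qed
  qed auto
  then have "(\<lambda>n. \<integral>\<^sup>+x. ennreal (R n x) \<partial>M) \<longlonglongrightarrow> 0" by simp
  then have "eventually (\<lambda>n. (\<integral>\<^sup>+x. ennreal (R n x) \<partial>M) < ennreal (e/2)) sequentially"
    using e by (intro order_tendstoD(2)) auto
  then show "eventually (\<lambda>n. (\<integral>\<^sup>+x. ennreal (P x * Q n x) \<partial>M) < a) sequentially"
  proof eventually_elim
    case (elim n)
    have "(\<integral>\<^sup>+x. ennreal (P x * Q n x) \<partial>M)
        \<le> (\<integral>\<^sup>+x. ennreal (R n x) + ennreal \<epsilon> * ennreal ((Q n x)\<^sup>2) \<partial>M)"
    proof (rule nn_integral_mono)
      fix x
      have R0: "0 \<le> R n x" using nonneg(1)[of x] nonneg(2)[of n x] \<epsilon> by (simp add: R_def)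
      have "P x * Q n x \<le> R n x + \<epsilon> * (Q n x)\<^sup>2"
      proof (cases "Q n x \<le> P x / \<epsilon>")
        case True
        then have "R n x = P x * Q n x" by (simp add: R_def)
        then show ?thesis using \<epsilon> by simp
      next
        case False
        then have "P x \<le> \<epsilon> * Q n x" using \<epsilon> by (simp add: field_simps)
        then have "P x * Q n x \<le> \<epsilon> * Q n x * Q n x"
          using nonneg by (intro mult_right_mono) auto
        then show ?thesis using R0 by (simp add: power2_eq_square mult.assoc)
      qed
      then have "ennreal (P x * Q n x) \<le> ennreal (R n x + \<epsilon> * (Q n x)\<^sup>2)" by (rule ennreal_leI)
      then show "ennreal (P x * Q n x) \<le> ennreal (R n x) + ennreal \<epsilon> * ennreal ((Q n x)\<^sup>2)"
        using R0 \<epsilon> by (simp add: ennreal_mult)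
    qed
    also have "\<dots> = (\<integral>\<^sup>+x. ennreal (R n x) \<partial>M) + ennreal \<epsilon> * (\<integral>\<^sup>+x. ennreal ((Q n x)\<^sup>2) \<partial>M)"
      by (simp add: nn_integral_add nn_integral_cmult)
    also have "\<dots> \<le> ennreal (e/2) + ennreal \<epsilon> * ennreal C'"
      using elim order_trans[OF Q[of n] C'(2)] by (intro add_mono mult_left_mono) auto
    also have "\<dots> = ennreal e"
      using \<epsilon> e C' by (simp flip: ennreal_mult ennreal_plus)
    also have "\<dots> < a" by fact
    finally show ?case .
  qed
qed auto

text \<open>Dominated convergence with a dominating function that changes with \<open>n\<close>:
  Fatou's lemma is applied to \<open>h n - f n\<close>. The bound of the integrals of
  \<open>h n\<close> by that of \<open>g\<close> is what convexity of the energy provides in the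
  application.\<close>

lemma nn_integral_tendsto_0_dominated_varying:
  fixes f h :: "nat \<Rightarrow> 'a \<Rightarrow> real" and g :: "'a \<Rightarrow> real"
  assumes [measurable]: "\<And>n. f n \<in> borel_measurable M" "\<And>n. h n \<in> borel_measurable M"
      "g \<in> borel_measurable M"
    and nonneg: "\<And>n x. 0 \<le> f n x" and le: "\<And>n x. f n x \<le> h n x"
    and h: "AE x in M. (\<lambda>n. h n x) \<longlonglongrightarrow> g x"
    and int: "\<And>n. (\<integral>\<^sup>+x. ennreal (h n x) \<partial>M) \<le> (\<integral>\<^sup>+x. ennreal (g x) \<partial>M)"
    and fin: "(\<integral>\<^sup>+x. ennreal (g x) \<partial>M) < \<infinity>"
    and lim: "AE x in M. (\<lambda>n. f n x) \<longlonglongrightarrow> 0"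
  shows "(\<lambda>n. \<integral>\<^sup>+x. ennreal (f n x) \<partial>M) \<longlonglongrightarrow> 0"
proof -
  let ?F = "\<lambda>n. \<integral>\<^sup>+x. ennreal (f n x) \<partial>M" and ?G = "\<integral>\<^sup>+x. ennreal (g x) \<partial>M"
  have F_le: "?F n \<le> ?G" for n
  proof -
    have "?F n \<le> (\<integral>\<^sup>+x. ennreal (h n x) \<partial>M)" by (intro nn_integral_mono ennreal_leI le)
    then show ?thesis using int[of n] by (rule order_trans)
  qed
  have "?G = (\<integral>\<^sup>+x. liminf (\<lambda>n. ennreal (h n x - f n x)) \<partial>M)"
  proof (rule nn_integral_cong_AE)
    show "AE x in M. ennreal (g x) = liminf (\<lambda>n. ennreal (h n x - f n x))"
      using h lim
    proof eventually_elim
      case (elim x)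
      have "(\<lambda>n. h n x - f n x) \<longlonglongrightarrow> g x - 0" by (intro tendsto_intros elim)
      then have "(\<lambda>n. ennreal (h n x - f n x)) \<longlonglongrightarrow> ennreal (g x)"
        using tendsto_ennrealI by fastforce
      then show ?case by (simp add: lim_imp_Liminf)
    qed
  qed
  also have "\<dots> \<le> liminf (\<lambda>n. \<integral>\<^sup>+x. ennreal (h n x - f n x) \<partial>M)"
    by (rule nn_integral_liminf) auto
  also have "\<dots> \<le> liminf (\<lambda>n. ?G - ?F n)"
  proof (rule Liminf_mono, rule always_eventually, rule allI)
    fix n
    have "(\<integral>\<^sup>+x. ennreal (h n x - f n x) \<partial>M) + ?F n
        = (\<integral>\<^sup>+x. ennreal (h n x) \<partial>M)"
      by (subst nn_integral_add[symmetric])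
        (auto intro!: nn_integral_cong simp: le nonneg simp flip: ennreal_plus)
    also have "\<dots> \<le> ?G" by fact
    finally have "(\<integral>\<^sup>+x. ennreal (h n x - f n x) \<partial>M) + ?F n \<le> ?G" .
    then show "(\<integral>\<^sup>+x. ennreal (h n x - f n x) \<partial>M) \<le> ?G - ?F n"
      by (simp add: ennreal_le_minus_iff)
  qed
  also have "\<dots> \<le> limsup (\<lambda>n. ?G) - limsup ?F"
    by (rule liminf_minus_ennreal) (rule F_le)
  also have "limsup (\<lambda>n. ?G) = ?G" by (simp add: Limsup_const)
  finally have le: "?G \<le> ?G - limsup ?F" .
  \<comment> \<open>Subtraction in \<open>ennreal\<close> is truncated and absorbed by infinity, so
    the finiteness of \<open>?G\<close> enters here.\<close>
  have "limsup ?F = 0"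
  proof (rule ccontr)
    assume ne: "limsup ?F \<noteq> 0"
    have "limsup ?F \<le> ?G"
      by (rule Limsup_bounded, rule always_eventually, rule allI) (rule F_le)
    then have "?G - limsup ?F < ?G"
      using ne fin by (intro ennreal_between) (auto simp: zero_less_iff_neq_zero intro: order_less_le_trans)
    with le show False by simp
  qed
  then show ?thesis by (intro tendsto_0_if_Limsup_eq_0_ennreal)
qed

text \<open>The sum of the \<open>f n\<close> has finite integral, so it is finite at almost every
  point. A summable rate thus gives convergence of the whole sequence, not just of a
  subsequence.\<close>

lemma AE_tendsto_0_of_summable_nn_integral:
  fixes f :: "nat \<Rightarrow> 'a \<Rightarrow> real"
  assumes [measurable]: "\<And>n. f n \<in> borel_measurable M"
    and nonneg: "\<And>n x. 0 \<le> f n x"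
    and int: "\<And>n. (\<integral>\<^sup>+x. ennreal (f n x) \<partial>M) \<le> ennreal (b n)"
    and b: "summable b" "\<And>n. 0 \<le> b n"
  shows "AE x in M. (\<lambda>n. f n x) \<longlonglongrightarrow> 0"
proof -
  have "(\<integral>\<^sup>+x. (\<Sum>n. ennreal (f n x)) \<partial>M) = (\<Sum>n. \<integral>\<^sup>+x. ennreal (f n x) \<partial>M)"
    by (rule nn_integral_suminf) auto
  also have "\<dots> \<le> (\<Sum>n. ennreal (b n))" by (intro suminf_le int) auto
  also have "\<dots> < \<infinity>" using b by (simp add: suminf_ennreal2)
  finally have "AE x in M. (\<Sum>n. ennreal (f n x)) \<noteq> \<infinity>"
    by (intro nn_integral_PInf_AE) auto
  then show ?thesis
  proof eventually_elim
    case (elim x)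
    then have "summable (\<lambda>n. f n x)" using nonneg by (intro summable_suminf_not_top) auto
    then show ?case by (rule summable_LIMSEQ_zero)
  qed
qed

lemma AE_pair_fst:
  assumes "sigma_finite_measure N" "AE x in M. P x"
  shows "AE z in M \<Otimes>\<^sub>M N. P (fst z)"
proof -
  interpret N: sigma_finite_measure N by fact
  obtain A where A: "{x\<in>space M. \<not> P x} \<subseteq> A" "emeasure M A = 0" "A \<in> sets M"
    using assms(2) by (rule AE_E)
  have "A \<times> space N \<in> null_sets (M \<Otimes>\<^sub>M N)"
    using A by (auto simp: null_sets_def N.emeasure_pair_measure_Times)
  then show ?thesis
    by (rule AE_I') (use A in \<open>auto simp: space_pair_measure\<close>)
qed

lemma AE_pair_snd:
  assumes "sigma_finite_measure N" "AE y in N. P y"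
  shows "AE z in M \<Otimes>\<^sub>M N. P (snd z)"
proof -
  interpret N: sigma_finite_measure N by fact
  obtain A where A: "{x\<in>space N. \<not> P x} \<subseteq> A" "emeasure N A = 0" "A \<in> sets N"
    using assms(2) by (rule AE_E)
  have "space M \<times> A \<in> null_sets (M \<Otimes>\<^sub>M N)"
    using A by (auto simp: null_sets_def N.emeasure_pair_measure_Times)
  then show ?thesis
    by (rule AE_I') (use A in \<open>auto simp: space_pair_measure\<close>)
qed

context prob_space
begin

text \<open>The variance identity, with Jensen's inequality as its consequence.\<close>

lemma norm_integral_sq_le:
  fixes Y :: "'a \<Rightarrow> complex"
  assumes [measurable]: "Y \<in> borel_measurable M" and bd: "\<And>x. cmod (Y x) \<le> B"
  shows "(\<integral>x. (cmod (Y x - (\<integral>x. Y x \<partial>M)))\<^sup>2 \<partial>M) = (\<integral>x. (cmod (Y x))\<^sup>2 \<partial>M) - (cmod (\<integral>x. Y x \<partial>M))\<^sup>2"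
    and "ennreal ((cmod (\<integral>x. Y x \<partial>M))\<^sup>2) \<le> (\<integral>\<^sup>+x. ennreal ((cmod (Y x))\<^sup>2) \<partial>M)"
proof -
  define c where "c = (\<integral>x. Y x \<partial>M)"
  have iY: "integrable M Y" using bd by (intro integrable_const_bound[where B=B]) auto
  have i2: "integrable M (\<lambda>x. (cmod (Y x))\<^sup>2)"
    using bd by (intro integrable_const_bound[where B="B\<^sup>2"]) (auto intro!: power_mono)
  have eq: "(cmod (Y x - c))\<^sup>2 = (cmod (Y x))\<^sup>2 - 2 * Re (cnj c * Y x) + (cmod c)\<^sup>2" for x
    unfolding cmod_power2 by (simp add: power2_eq_square algebra_simps)
  have ir: "integrable M (\<lambda>x. Re (cnj c * Y x))" using iY by (intro integrable_Re integrable_mult_right)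
  have re: "(\<integral>x. Re (cnj c * Y x) \<partial>M) = (cmod c)\<^sup>2"
    using iY by (simp add: integral_Re integrable_mult_right cmod_power2 power2_eq_square
        flip: c_def) (metis cmod_power2 power2_eq_square)
  have "(\<integral>x. (cmod (Y x - c))\<^sup>2 \<partial>M) = (\<integral>x. (cmod (Y x))\<^sup>2 \<partial>M) - 2 * (cmod c)\<^sup>2 + (cmod c)\<^sup>2"
  proof -
    define R where "R x = Re (cnj c * Y x)" for x
    have "integrable M R" "(\<integral>x. R x \<partial>M) = (cmod c)\<^sup>2" using ir re by (simp_all add: R_def[abs_def])
    then show ?thesis unfolding eq R_def[symmetric] using i2 by (simp add: prob_space)
  qed
  then show *: "(\<integral>x. (cmod (Y x - (\<integral>x. Y x \<partial>M)))\<^sup>2 \<partial>M)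
      = (\<integral>x. (cmod (Y x))\<^sup>2 \<partial>M) - (cmod (\<integral>x. Y x \<partial>M))\<^sup>2"
    by (simp add: c_def)
  have "0 \<le> (\<integral>x. (cmod (Y x - (\<integral>x. Y x \<partial>M)))\<^sup>2 \<partial>M)" by (rule integral_nonneg_AE) auto
  then have "(cmod (\<integral>x. Y x \<partial>M))\<^sup>2 \<le> (\<integral>x. (cmod (Y x))\<^sup>2 \<partial>M)" using * by simp
  then have "ennreal ((cmod (\<integral>x. Y x \<partial>M))\<^sup>2) \<le> ennreal (\<integral>x. (cmod (Y x))\<^sup>2 \<partial>M)"
    by (rule ennreal_leI)
  also have "\<dots> = (\<integral>\<^sup>+x. ennreal ((cmod (Y x))\<^sup>2) \<partial>M)"
    using i2 by (subst nn_integral_eq_integral) auto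
  finally show "ennreal ((cmod (\<integral>x. Y x \<partial>M))\<^sup>2) \<le> (\<integral>\<^sup>+x. ennreal ((cmod (Y x))\<^sup>2) \<partial>M)" .
qed

text \<open>As \<open>X\<close> is unimodular, the left side is its variance. Replacing the mean by
  an independent copy can only increase the mean square distance, by Jensen's inequality in
  \<open>y\<close>.\<close>

lemma one_minus_norm_expectation_sq_le:
  fixes X :: "'a \<Rightarrow> complex"
  assumes [measurable]: "X \<in> borel_measurable M" and un: "\<And>x. cmod (X x) = 1"
  shows "ennreal (1 - (cmod (\<integral>x. X x \<partial>M))\<^sup>2)
    \<le> (\<integral>\<^sup>+x. \<integral>\<^sup>+y. ennreal ((cmod (X x - X y))\<^sup>2) \<partial>M \<partial>M)"
proof -
  define c where "c = (\<integral>x. X x \<partial>M)"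
  have iX: "integrable M X" using un by (intro integrable_const_bound[where B=1]) auto
  have bd: "cmod (X x - X y) \<le> 2" for x y using norm_triangle_ineq4[of "X x" "X y"] un by simp
  have "cmod c \<le> 1"
    using integral_norm_bound[of M X] un by (simp add: c_def prob_space)
  then have bd2: "cmod (X x - c) \<le> 2" for x using norm_triangle_ineq4[of "X x" c] un[of x] by simp
  have "1 - (cmod c)\<^sup>2 = (\<integral>x. (cmod (X x - c))\<^sup>2 \<partial>M)"
    using norm_integral_sq_le(1)[of X 1] un by (simp add: c_def prob_space)
  then have "ennreal (1 - (cmod c)\<^sup>2) = (\<integral>\<^sup>+x. ennreal ((cmod (X x - c))\<^sup>2) \<partial>M)"
    using power_mono[OF bd2, of _ 2]
    by (subst nn_integral_eq_integral) (auto intro!: integrable_const_bound[where B="2\<^sup>2"])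
  also have "\<dots> \<le> (\<integral>\<^sup>+x. \<integral>\<^sup>+y. ennreal ((cmod (X x - X y))\<^sup>2) \<partial>M \<partial>M)"
  proof (rule nn_integral_mono)
    fix x
    have "(\<integral>y. X x - X y \<partial>M) = X x - c" using iX by (simp add: c_def prob_space)
    then show "ennreal ((cmod (X x - c))\<^sup>2) \<le> (\<integral>\<^sup>+y. ennreal ((cmod (X x - X y))\<^sup>2) \<partial>M)"
      using norm_integral_sq_le(2)[of "\<lambda>y. X x - X y" 2] bd by simp
  qed
  finally show ?thesis by (simp add: c_def)
qed

end

section \<open>Half-energy on the circle\<close>

text \<open>Maps on the circle are represented by \<open>2 * pi\<close>-periodic functions of the angle. The energy
  \<open>circ_gagl\<close> uses the chordal distance; \<open>circ_gagl\<close>, \<open>circ_L2\<close> and \<open>circ_nrm\<close> are squares of (semi)norms.\<close>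

definition circ :: "real measure" where
  "circ = density lborel (indicator {0..<2 * pi})"

lemma sets_circ [measurable_cong, simp]: "sets circ = sets borel"
  and space_circ [simp]: "space circ = UNIV"
  by (auto simp: circ_def)

lemma nn_integral_circ:
  assumes [measurable]: "f \<in> borel_measurable borel"
  shows "(\<integral>\<^sup>+t. f t \<partial>circ) = (\<integral>\<^sup>+t. f t * indicator {0..<2 * pi} t \<partial>lborel)"
  unfolding circ_def by (subst nn_integral_density) (auto simp: mult.commute)

lemma emeasure_circ: "emeasure circ UNIV = ennreal (2 * pi)"
  by (simp add: circ_def emeasure_density)

interpretation circ: finite_measure circ
  by standard (simp add: emeasure_circ)

interpretation circ2: pair_sigma_finite circ circ ..

lemma nn_integral_circ_shift:
  fixes f :: "real \<Rightarrow> ennreal"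
  assumes [measurable]: "f \<in> borel_measurable borel" and per: "\<And>t. f (t + 2 * pi) = f t"
    and \<tau>: "0 \<le> \<tau>" "\<tau> \<le> 2 * pi"
  shows "(\<integral>\<^sup>+t. f (t + \<tau>) \<partial>circ) = (\<integral>\<^sup>+t. f t \<partial>circ)"
proof -
  have "(\<integral>\<^sup>+t. f (t + \<tau>) \<partial>circ) = (\<integral>\<^sup>+t. f (\<tau> + 1 * t) * indicator {\<tau>..<2 * pi + \<tau>} (\<tau> + 1 * t) \<partial>lborel)"
    by (subst nn_integral_circ) (auto intro!: nn_integral_cong simp: add.commute split: split_indicator)
  also have "\<dots> = (\<integral>\<^sup>+t. f t * indicator {\<tau>..<2 * pi + \<tau>} t \<partial>lborel)"
    by (subst nn_integral_real_affine[where c=1 and t=\<tau>]) auto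
  also have "\<dots> = (\<integral>\<^sup>+t. f t * indicator {\<tau>..<2 * pi} t + f t * indicator {2 * pi..<2 * pi + \<tau>} t \<partial>lborel)"
    using \<tau> by (intro nn_integral_cong) (auto split: split_indicator)
  also have "\<dots> = (\<integral>\<^sup>+t. f t * indicator {\<tau>..<2 * pi} t \<partial>lborel)
      + (\<integral>\<^sup>+t. f t * indicator {2 * pi..<2 * pi + \<tau>} t \<partial>lborel)"
    by (intro nn_integral_add) auto
  also have "(\<integral>\<^sup>+t. f t * indicator {2 * pi..<2 * pi + \<tau>} t \<partial>lborel)
      = (\<integral>\<^sup>+t. f (2 * pi + 1 * t) * indicator {2 * pi..<2 * pi + \<tau>} (2 * pi + 1 * t) \<partial>lborel)"
    by (subst nn_integral_real_affine[where c=1 and t="2 * pi"]) auto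
  also have "\<dots> = (\<integral>\<^sup>+t. f t * indicator {0..<\<tau>} t \<partial>lborel)"
    using per by (intro nn_integral_cong) (auto simp: add.commute split: split_indicator)
  also have "(\<integral>\<^sup>+t. f t * indicator {\<tau>..<2 * pi} t \<partial>lborel) + (\<integral>\<^sup>+t. f t * indicator {0..<\<tau>} t \<partial>lborel)
      = (\<integral>\<^sup>+t. f t * indicator {\<tau>..<2 * pi} t + f t * indicator {0..<\<tau>} t \<partial>lborel)"
    by (intro nn_integral_add[symmetric]) auto
  also have "\<dots> = (\<integral>\<^sup>+t. f t \<partial>circ)"
    using \<tau> by (subst nn_integral_circ) (auto intro!: nn_integral_cong split: split_indicator)
  finally show ?thesis .
qed

text \<open>Where \<open>cis s = cis t\<close> the value is 0, since division by 0 yields 0. Several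
  estimates treat this case separately.\<close>

definition dquot :: "(real \<Rightarrow> complex) \<Rightarrow> real \<times> real \<Rightarrow> real" where
  "dquot F = (\<lambda>(s, t). (cmod (F s - F t))\<^sup>2 / (cmod (cis s - cis t))\<^sup>2)"

definition circ_gagl :: "(real \<Rightarrow> complex) \<Rightarrow> ennreal" where
  "circ_gagl F = (\<integral>\<^sup>+z. ennreal (dquot F z) \<partial>(circ \<Otimes>\<^sub>M circ))"

definition circ_L2 :: "(real \<Rightarrow> complex) \<Rightarrow> ennreal" where
  "circ_L2 F = (\<integral>\<^sup>+t. ennreal ((cmod (F t))\<^sup>2) \<partial>circ)"

definition periodic :: "(real \<Rightarrow> 'a) \<Rightarrow> bool" where
  "periodic F \<longleftrightarrow> (\<forall>t. F (t + 2 * pi) = F t)"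

lemma cis_measurable [measurable]: "cis \<in> borel_measurable borel"
  by (intro borel_measurable_continuous_onI continuous_intros)

lemma dquot_measurable [measurable]:
  assumes [measurable]: "F \<in> borel_measurable borel"
  shows "dquot F \<in> borel_measurable (borel \<Otimes>\<^sub>M borel)"
  unfolding dquot_def by measurable

lemma dquot_measurable_circ [measurable]:
  assumes [measurable]: "F \<in> borel_measurable borel"
  shows "dquot F \<in> borel_measurable (circ \<Otimes>\<^sub>M circ)"
  unfolding dquot_def by measurable

lemma dquot_nonneg [simp]: "0 \<le> dquot F z"
  by (simp add: dquot_def split: prod.split)

lemma cis_add_2pi [simp]: "cis (t + 2 * pi) = cis t"
  by (simp add: complex_eq_iff)

lemma cmod_cis_diff_shift: "cmod (cis (s + \<tau>) - cis (t + \<tau>)) = cmod (cis s - cis t)"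
proof -
  have "cis (s + \<tau>) - cis (t + \<tau>) = (cis s - cis t) * cis \<tau>"
    by (simp add: cis_mult algebra_simps)
  then show ?thesis by (simp add: norm_mult)
qed

lemma circ_gagl_iterated:
  assumes [measurable]: "F \<in> borel_measurable borel"
  shows "circ_gagl F = (\<integral>\<^sup>+s. \<integral>\<^sup>+t. ennreal (dquot F (s, t)) \<partial>circ \<partial>circ)"
  unfolding circ_gagl_def by (subst circ.nn_integral_fst[symmetric]) auto

lemma nn_integral_circ2_shift:
  fixes K :: "real \<times> real \<Rightarrow> ennreal"
  assumes [measurable]: "K \<in> borel_measurable (borel \<Otimes>\<^sub>M borel)"
    and per: "\<And>s t. K (s + 2 * pi, t) = K (s, t)" "\<And>s t. K (s, t + 2 * pi) = K (s, t)"
    and \<tau>: "0 \<le> \<tau>" "\<tau> \<le> 2 * pi" "0 \<le> \<sigma>" "\<sigma> \<le> 2 * pi"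
  shows "(\<integral>\<^sup>+s. \<integral>\<^sup>+t. K (s + \<sigma>, t + \<tau>) \<partial>circ \<partial>circ) = (\<integral>\<^sup>+s. \<integral>\<^sup>+t. K (s, t) \<partial>circ \<partial>circ)"
proof -
  have "(\<integral>\<^sup>+t. K (s + \<sigma>, t + \<tau>) \<partial>circ) = (\<integral>\<^sup>+t. K (s + \<sigma>, t) \<partial>circ)" for s
    by (rule nn_integral_circ_shift) (use \<tau> per in auto)
  moreover have "(\<integral>\<^sup>+s. \<integral>\<^sup>+t. K (s + \<sigma>, t) \<partial>circ \<partial>circ) = (\<integral>\<^sup>+s. \<integral>\<^sup>+t. K (s, t) \<partial>circ \<partial>circ)"
    by (rule nn_integral_circ_shift[where f="\<lambda>s. \<integral>\<^sup>+t. K (s, t) \<partial>circ"]) (use \<tau> per in auto)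
  ultimately show ?thesis by simp
qed

section \<open>Averages over short intervals\<close>

text \<open>An expectation under a uniform distribution, so that Jensen's inequality applies
  directly.\<close>

definition avg :: "real \<Rightarrow> (real \<Rightarrow> complex) \<Rightarrow> real \<Rightarrow> complex" where
  "avg h F t = (\<integral>\<tau>. F (t + \<tau>) \<partial>uniform_measure lborel {0..h})"

lemma prob_space_uniform_interval: "0 < h \<Longrightarrow> prob_space (uniform_measure lborel {0..h::real})"
  by (intro prob_space_uniform_measure) auto

lemma nn_integral_uniform_interval:
  assumes [measurable]: "f \<in> borel_measurable borel" and h: "0 < (h::real)"
  shows "(\<integral>\<^sup>+\<tau>. f \<tau> \<partial>uniform_measure lborel {0..h})
    = (\<integral>\<^sup>+\<tau>. f \<tau> * indicator {0..h} \<tau> \<partial>lborel) * ennreal (1 / h)"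
  using h by (subst nn_integral_uniform_measure)
    (auto simp: divide_ennreal_def inverse_ennreal inverse_eq_divide)

lemma nn_integral_uniform_interval_le:
  assumes [measurable]: "f \<in> borel_measurable borel" and h: "0 < (h::real)" "h \<le> 1"
  shows "(\<integral>\<^sup>+\<tau>. f \<tau> \<partial>uniform_measure lborel {0..h}) \<le> (\<integral>\<^sup>+\<tau>. f \<tau> \<partial>circ) * ennreal (1 / h)"
proof -
  have "1 < 2 * pi" using pi_gt3 by simp
  then have "(\<integral>\<^sup>+\<tau>. f \<tau> * indicator {0..h} \<tau> \<partial>lborel) \<le> (\<integral>\<^sup>+\<tau>. f \<tau> \<partial>circ)"
    using h by (subst nn_integral_circ) (auto intro!: nn_integral_mono split: split_indicator)
  then show ?thesis
    using h by (subst nn_integral_uniform_interval) (auto intro!: mult_right_mono)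
qed

lemma avg_measurable [measurable]:
  assumes [measurable]: "F \<in> borel_measurable borel" and h: "0 < h"
  shows "avg h F \<in> borel_measurable borel"
proof -
  interpret prob_space "uniform_measure lborel {0..h}" by (rule prob_space_uniform_interval[OF h])
  show ?thesis unfolding avg_def by measurable
qed

lemma avg_norm_le:
  assumes h: "0 < h" and [measurable]: "F \<in> borel_measurable borel" and un: "\<And>t. cmod (F t) = 1"
  shows "cmod (avg h F t) \<le> 1"
proof -
  interpret prob_space "uniform_measure lborel {0..h}" by (rule prob_space_uniform_interval[OF h])
  show ?thesis unfolding avg_def
    using integral_norm_bound[of "uniform_measure lborel {0..h}" "\<lambda>\<tau>. F (t + \<tau>)"] un
    using prob_space by simp
qed

lemma periodic_avg: "periodic F \<Longrightarrow> periodic (avg h F)"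
  unfolding periodic_def avg_def
  by (intro allI Bochner_Integration.integral_cong) (auto simp: add.assoc add.commute[of "2 * pi"], simp flip: add.assoc)

text \<open>The energy is convex and invariant under rotations: Jensen's inequality bounds the
  quotient of the average by the average of translated quotients, and every translate has the same
  integral.\<close>

lemma circ_gagl_avg_le:
  assumes h: "0 < h" "h \<le> 1" and F[measurable]: "F \<in> borel_measurable borel"
    and un: "\<And>t. cmod (F t) = 1" and per: "periodic F"
  shows "circ_gagl (avg h F) \<le> circ_gagl F"
proof -
  interpret prob_space "uniform_measure lborel {0..h}" by (rule prob_space_uniform_interval[OF h(1)])
  interpret cu: pair_sigma_finite circ "uniform_measure lborel {0..h}" ..
  let ?U = "uniform_measure lborel {0..h}"
  have bd: "cmod (F s - F t) \<le> 2" for s t using norm_triangle_ineq4[of "F s" "F t"] un by simp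
  have int: "integrable ?U (\<lambda>\<tau>. F (t + \<tau>))" for t
    using un by (intro integrable_const_bound[where B=1]) auto
  have pt: "ennreal (dquot (avg h F) (s, t)) \<le> (\<integral>\<^sup>+\<tau>. ennreal (dquot F (s + \<tau>, t + \<tau>)) \<partial>?U)" for s t
  proof -
    have "avg h F s - avg h F t = (\<integral>\<tau>. F (s + \<tau>) - F (t + \<tau>) \<partial>?U)"
      unfolding avg_def using int by simp
    then have *: "ennreal ((cmod (avg h F s - avg h F t))\<^sup>2) \<le> (\<integral>\<^sup>+\<tau>. ennreal ((cmod (F (s + \<tau>) - F (t + \<tau>)))\<^sup>2) \<partial>?U)"
      using norm_integral_sq_le(2)[of "\<lambda>\<tau>. F (s + \<tau>) - F (t + \<tau>)" 2] bd by simp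
    have "ennreal (dquot (avg h F) (s, t)) = ennreal ((cmod (avg h F s - avg h F t))\<^sup>2) * ennreal (1 / (cmod (cis s - cis t))\<^sup>2)"
      by (simp add: dquot_def flip: ennreal_mult)
    also have "\<dots> \<le> (\<integral>\<^sup>+\<tau>. ennreal ((cmod (F (s + \<tau>) - F (t + \<tau>)))\<^sup>2) \<partial>?U) * ennreal (1 / (cmod (cis s - cis t))\<^sup>2)"
      by (intro mult_right_mono *) auto
    also have "\<dots> = (\<integral>\<^sup>+\<tau>. ennreal ((cmod (F (s + \<tau>) - F (t + \<tau>)))\<^sup>2) * ennreal (1 / (cmod (cis s - cis t))\<^sup>2) \<partial>?U)"
      by (subst nn_integral_multc) auto
    also have "\<dots> = (\<integral>\<^sup>+\<tau>. ennreal (dquot F (s + \<tau>, t + \<tau>)) \<partial>?U)"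
      by (intro nn_integral_cong) (simp add: dquot_def cmod_cis_diff_shift flip: ennreal_mult)
    finally show ?thesis .
  qed
  have "circ_gagl (avg h F) \<le> (\<integral>\<^sup>+s. \<integral>\<^sup>+t. \<integral>\<^sup>+\<tau>. ennreal (dquot F (s + \<tau>, t + \<tau>)) \<partial>?U \<partial>circ \<partial>circ)"
    using h by (subst circ_gagl_iterated) (auto intro!: nn_integral_mono pt)
  also have "\<dots> = (\<integral>\<^sup>+s. \<integral>\<^sup>+\<tau>. \<integral>\<^sup>+t. ennreal (dquot F (s + \<tau>, t + \<tau>)) \<partial>circ \<partial>?U \<partial>circ)"
    by (intro nn_integral_cong cu.Fubini'[symmetric]) simp
  also have "\<dots> = (\<integral>\<^sup>+\<tau>. \<integral>\<^sup>+s. \<integral>\<^sup>+t. ennreal (dquot F (s + \<tau>, t + \<tau>)) \<partial>circ \<partial>circ \<partial>?U)"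
    by (intro cu.Fubini'[symmetric]) simp
  also have "\<dots> = (\<integral>\<^sup>+\<tau>. circ_gagl F \<partial>?U)"
  proof (rule nn_integral_cong_AE)
    have "AE \<tau> in ?U. \<tau> \<in> {0..h}" by (rule AE_uniform_measureI) auto
    then show "AE \<tau> in ?U. (\<integral>\<^sup>+s. \<integral>\<^sup>+t. ennreal (dquot F (s + \<tau>, t + \<tau>)) \<partial>circ \<partial>circ) = circ_gagl F"
    proof eventually_elim
      case (elim \<tau>)
      have "\<tau> \<le> 2 * pi" using elim h pi_gt3 by simp
      then show ?case
        unfolding circ_gagl_iterated[OF F] using elim per
        by (intro nn_integral_circ2_shift[where K="\<lambda>z. ennreal (dquot F z)"])
          (auto simp: dquot_def periodic_def)
    qed
  qed
  also have "\<dots> = circ_gagl F" using emeasure_space_1 by simp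
  finally show ?thesis .
qed

lemma norm_one_minus_cis_le: "0 \<le> \<tau> \<Longrightarrow> cmod (cis s - cis (s + \<tau>)) \<le> \<tau>"
proof -
  assume \<tau>: "0 \<le> \<tau>"
  have "cis s - cis (s + \<tau>) = cis s * (1 - cis \<tau>)" by (simp add: cis_mult algebra_simps)
  then have "(cmod (cis s - cis (s + \<tau>)))\<^sup>2 = (cmod (1 - cis \<tau>))\<^sup>2" by (simp add: norm_mult)
  also have "\<dots> = 2 - 2 * cos \<tau>"
    unfolding cmod_power2 using sin_cos_squared_add[of \<tau>] by (simp add: power2_eq_square algebra_simps)
  also have "\<dots> = 4 * (sin (\<tau>/2))\<^sup>2" using cos_double_sin[of "\<tau>/2"] by simp
  also have "\<dots> \<le> 4 * (\<tau>/2)\<^sup>2"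
    using abs_sin_x_le_abs_x[of "\<tau>/2"] by (simp add: abs_le_square_iff[symmetric])
  also have "\<dots> = \<tau>\<^sup>2" by (simp add: power2_eq_square)
  finally show ?thesis using \<tau> by (simp add: power2_le_iff_abs_le)
qed

text \<open>For offsets up to \<open>h\<close> the chord is at most \<open>h\<close>, so the squared
  increment is at most \<open>h\<^sup>2\<close> times the quotient. Averaging over an interval of
  length \<open>h\<close> uses up one of the two factors \<open>h\<close>.\<close>

lemma circ_L2_avg_diff_le:
  assumes h: "0 < h" "h \<le> 1" and F[measurable]: "F \<in> borel_measurable borel"
    and un: "\<And>t. cmod (F t) = 1" and per: "periodic F"
  shows "circ_L2 (\<lambda>t. avg h F t - F t) \<le> ennreal h * circ_gagl F"
proof -
  interpret prob_space "uniform_measure lborel {0..h}" by (rule prob_space_uniform_interval[OF h(1)])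
  let ?U = "uniform_measure lborel {0..h}"
  have bd: "cmod (F s - F t) \<le> 2" for s t using norm_triangle_ineq4[of "F s" "F t"] un by simp
  have int: "integrable ?U (\<lambda>\<tau>. F (t + \<tau>))" for t
    using un by (intro integrable_const_bound[where B=1]) auto
  have pt: "ennreal ((cmod (avg h F t - F t))\<^sup>2) \<le> ennreal h * (\<integral>\<^sup>+\<tau>. ennreal (dquot F (t, t + \<tau>)) \<partial>circ)" for t
  proof -
    have "avg h F t - F t = (\<integral>\<tau>. F (t + \<tau>) - F t \<partial>?U)"
      unfolding avg_def using int prob_space by simp
    then have "ennreal ((cmod (avg h F t - F t))\<^sup>2) \<le> (\<integral>\<^sup>+\<tau>. ennreal ((cmod (F (t + \<tau>) - F t))\<^sup>2) \<partial>?U)"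
      using norm_integral_sq_le(2)[of "\<lambda>\<tau>. F (t + \<tau>) - F t" 2] bd by simp
    also have "\<dots> = (\<integral>\<^sup>+\<tau>. ennreal ((cmod (F (t + \<tau>) - F t))\<^sup>2) * indicator {0..h} \<tau> \<partial>lborel) * ennreal (1/h)"
      using h by (subst nn_integral_uniform_interval) auto
    also have "(\<integral>\<^sup>+\<tau>. ennreal ((cmod (F (t + \<tau>) - F t))\<^sup>2) * indicator {0..h} \<tau> \<partial>lborel)
       \<le> (\<integral>\<^sup>+\<tau>. ennreal (h\<^sup>2) * ennreal (dquot F (t, t + \<tau>)) * indicator {0..<2*pi} \<tau> \<partial>lborel)"
    proof (rule nn_integral_mono)
      fix \<tau>
      show "ennreal ((cmod (F (t + \<tau>) - F t))\<^sup>2) * indicator {0..h} \<tau>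
        \<le> ennreal (h\<^sup>2) * ennreal (dquot F (t, t + \<tau>)) * indicator {0..<2*pi} \<tau>"
      proof (cases "\<tau> \<in> {0..h}")
        case True
        have \<tau>: "0 \<le> \<tau>" "\<tau> \<le> h" "\<tau> < 2 * pi" using True h pi_gt3 by auto
        let ?d = "cmod (cis t - cis (t + \<tau>))"
        have "(cmod (F (t + \<tau>) - F t))\<^sup>2 \<le> h\<^sup>2 * dquot F (t, t + \<tau>)"
        \<comment> \<open>If the chord vanishes, \<open>dquot\<close> is 0 by default and the
          increment itself has to vanish; \<tau> below \<open>2 * pi\<close> forces
          \<open>\<tau> = 0\<close>.\<close>
        proof (cases "?d = 0")
          case True
          then have "cis \<tau> = 1" by (simp add: flip: cis_mult)
          then have "cos \<tau> = 1" by (simp add: complex_eq_iff)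
          then obtain n :: int where n: "\<tau> = of_int n * 2 * pi" unfolding cos_one_2pi_int by blast
          have "of_int n * (2 * pi) < 1 * (2 * pi)" "0 \<le> of_int n * (2 * pi)"
            using \<tau> n by auto
          then have "n < 1" "0 \<le> n" using pi_gt_zero by (auto simp: mult_less_cancel_right zero_le_mult_iff)
          then have "\<tau> = 0" using n by simp
          then show ?thesis by simp
        next
          case False
          have "?d\<^sup>2 \<le> h\<^sup>2"
            using norm_one_minus_cis_le[of \<tau> t] \<tau> by (intro power_mono) auto
          then have "(cmod (F (t + \<tau>) - F t))\<^sup>2 * ?d\<^sup>2 \<le> (cmod (F (t + \<tau>) - F t))\<^sup>2 * h\<^sup>2"
            by (intro mult_left_mono) auto
          then show ?thesis
            using False by (simp add: dquot_def field_simps norm_minus_commute)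
        qed
        then have "ennreal ((cmod (F (t + \<tau>) - F t))\<^sup>2) \<le> ennreal (h\<^sup>2 * dquot F (t, t + \<tau>))"
          by (rule ennreal_leI)
        then show ?thesis using True \<tau> by (simp add: ennreal_mult)
      qed auto
    qed
    also have "\<dots> = ennreal (h\<^sup>2) * (\<integral>\<^sup>+\<tau>. ennreal (dquot F (t, t + \<tau>)) \<partial>circ)"
      by (subst nn_integral_circ) (auto simp: nn_integral_cmult mult.assoc)
    finally have "ennreal ((cmod (avg h F t - F t))\<^sup>2)
        \<le> ennreal (h\<^sup>2) * (\<integral>\<^sup>+\<tau>. ennreal (dquot F (t, t + \<tau>)) \<partial>circ) * ennreal (1/h)"
      by (simp add: mult_right_mono)
    also have "\<dots> = ennreal (h\<^sup>2 * (1/h)) * (\<integral>\<^sup>+\<tau>. ennreal (dquot F (t, t + \<tau>)) \<partial>circ)"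
      using h by (subst ennreal_mult) (auto simp: mult_ac)
    also have "h\<^sup>2 * (1/h) = h" using h by (simp add: power2_eq_square)
    finally show ?thesis .
  qed
  have "circ_L2 (\<lambda>t. avg h F t - F t) \<le> (\<integral>\<^sup>+t. ennreal h * (\<integral>\<^sup>+\<tau>. ennreal (dquot F (t, t + \<tau>)) \<partial>circ) \<partial>circ)"
    unfolding circ_L2_def by (intro nn_integral_mono pt)
  also have "\<dots> = ennreal h * (\<integral>\<^sup>+t. \<integral>\<^sup>+\<tau>. ennreal (dquot F (t, t + \<tau>)) \<partial>circ \<partial>circ)"
    by (rule nn_integral_cmult) simp
  also have "(\<integral>\<^sup>+t. \<integral>\<^sup>+\<tau>. ennreal (dquot F (t, t + \<tau>)) \<partial>circ \<partial>circ) = (\<integral>\<^sup>+t. \<integral>\<^sup>+\<tau>. ennreal (dquot F (t, \<tau>)) \<partial>circ \<partial>circ)"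
  proof (rule nn_integral_cong_AE)
    have "AE t in circ. t \<in> {0..<2*pi}"
      unfolding circ_def by (subst AE_density) (auto intro!: AE_I2 split: split_indicator_asm)
    then show "AE t in circ. (\<integral>\<^sup>+\<tau>. ennreal (dquot F (t, t + \<tau>)) \<partial>circ) = (\<integral>\<^sup>+\<tau>. ennreal (dquot F (t, \<tau>)) \<partial>circ)"
    proof eventually_elim
      case (elim t)
      have "(\<integral>\<^sup>+\<tau>. ennreal (dquot F (t, \<tau> + t)) \<partial>circ) = (\<integral>\<^sup>+\<tau>. ennreal (dquot F (t, \<tau>)) \<partial>circ)"
        by (rule nn_integral_circ_shift) (use elim per in \<open>auto simp: dquot_def periodic_def\<close>)
      then show ?case by (simp add: add.commute)
    qed
  qed
  finally show ?thesis by (simp add: circ_gagl_iterated)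
qed

section \<open>Periodic functions and reduction of angles\<close>

lemma periodic_int_shift:
  assumes "periodic F"
  shows "F (t + 2 * pi * of_int n) = F t"
proof -
  have nat: "F (t + 2 * pi * of_nat m) = F t" for m t
  proof (induction m)
    case (Suc m)
    have "F (t + 2 * pi * of_nat m + 2 * pi) = F (t + 2 * pi * of_nat m)"
      using assms by (simp add: periodic_def)
    then show ?case using Suc by (simp add: algebra_simps)
  qed simp
  show ?thesis
  proof (cases n)
    case (nonneg m)
    then show ?thesis using nat[of t m] by simp
  next
    case (neg m)
    have "F (t - 2 * pi * of_nat (Suc m) + 2 * pi * of_nat (Suc m)) = F (t - 2 * pi * of_nat (Suc m))"
      by (rule nat)
    moreover have "t + 2 * pi * of_int n = t - 2 * pi * of_nat (Suc m)"
    proof -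
      have "real_of_int n = - real (Suc m)" unfolding neg by simp
      then show ?thesis by (simp only: mult_minus_right)
    qed
    ultimately show ?thesis by (simp only: diff_add_cancel)
  qed
qed

lemma cis_eq_iff: "cis a = cis b \<longleftrightarrow> (\<exists>n::int. a = b + 2 * pi * of_int n)"
proof
  assume "cis a = cis b"
  then have "cos (a - b) = 1"
    using sin_cos_squared_add[of b] by (auto simp: cos_diff complex_eq_iff power2_eq_square add.commute)
  then obtain n :: int where "a - b = of_int n * 2 * pi" unfolding cos_one_2pi_int by blast
  then show "\<exists>n::int. a = b + 2 * pi * of_int n" by (intro exI[of _ n]) (simp add: algebra_simps)
next
  assume "\<exists>n::int. a = b + 2 * pi * of_int n"
  moreover have "periodic cis" by (simp add: periodic_def)
  ultimately show "cis a = cis b" using periodic_int_shift[of cis b] by auto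
qed

lemma periodic_cis_cong: "periodic F \<Longrightarrow> cis a = cis b \<Longrightarrow> F a = F b"
  by (auto simp: cis_eq_iff periodic_int_shift)

lemma ex_angle_reduce: "\<exists>s\<in>{0..<2 * pi}. cis s = cis t"
proof
  let ?n = "\<lfloor>t / (2 * pi)\<rfloor>"
  have *: "of_int ?n \<le> t / (2 * pi)" "t / (2 * pi) < of_int ?n + 1" by linarith+
  show "t - 2 * pi * of_int ?n \<in> {0..<2 * pi}"
    using pos_le_divide_eq[THEN iffD1, OF _ *(1)] pos_divide_less_eq[THEN iffD1, OF _ *(2)]
    by (simp add: algebra_simps)
  show "cis (t - 2 * pi * of_int ?n) = cis t"
    unfolding cis_eq_iff by (intro exI[of _ "- ?n"]) simp
qed

section \<open>Projecting averages back to the unit circle\<close>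

text \<open>The radial projection is Lipschitz away from the origin. The constant 4 is 2 divided by
  the radius 1 / 2.\<close>

lemma sgn_diff_le:
  fixes a b :: complex
  assumes "1 / 2 \<le> cmod a" "1 / 2 \<le> cmod b"
  shows "cmod (sgn a - sgn b) \<le> 4 * cmod (a - b)"
proof -
  have ab: "a \<noteq> 0" "b \<noteq> 0" using assms by auto
  have "sgn a - sgn b = (a - b) / of_real (cmod a) + b * (of_real (cmod b - cmod a) / of_real (cmod a * cmod b))"
    using ab by (simp add: sgn_eq field_simps)
  also have "cmod \<dots> \<le> cmod (a - b) / cmod a + cmod b * (\<bar>cmod b - cmod a\<bar> / (cmod a * cmod b))"
    by (rule order_trans[OF norm_triangle_ineq]) (simp add: norm_mult norm_divide flip: of_real_diff of_real_mult)
  also have "cmod b * (\<bar>cmod b - cmod a\<bar> / (cmod a * cmod b)) = \<bar>cmod b - cmod a\<bar> / cmod a"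
    using ab by simp
  also have "cmod (a - b) / cmod a + \<bar>cmod b - cmod a\<bar> / cmod a \<le> 2 * cmod (a - b) / cmod a"
    using norm_triangle_ineq3[of b a] ab by (simp add: norm_minus_commute field_simps)
  also have "\<dots> \<le> 2 * cmod (a - b) / (1 / 2)"
    using assms by (intro divide_left_mono) auto
  finally show ?thesis by simp
qed

definition near_diag :: "(real \<Rightarrow> complex) \<Rightarrow> real \<Rightarrow> ennreal" where
  "near_diag F h = (\<integral>\<^sup>+z. ennreal (dquot F z) * indicator {(s, t). cmod (cis s - cis t) \<le> h} z \<partial>(circ \<Otimes>\<^sub>M circ))"

text \<open>Absolute continuity of the integral. The strips shrink to the diagonal, where
  \<open>dquot\<close> is 0, so the integrands tend to 0 at every point.\<close>

lemma near_diag_tendsto_0: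
  assumes [measurable]: "F \<in> borel_measurable borel" and fin: "circ_gagl F < \<infinity>" and h: "h \<longlonglongrightarrow> 0"
  shows "(\<lambda>n. near_diag F (h n)) \<longlonglongrightarrow> 0"
proof -
  have "(\<lambda>n. near_diag F (h n)) \<longlonglongrightarrow> (\<integral>\<^sup>+z. 0 \<partial>(circ \<Otimes>\<^sub>M circ))"
    unfolding near_diag_def
  proof (rule nn_integral_dominated_convergence[where w="\<lambda>z. ennreal (dquot F z)"])
    show "(\<integral>\<^sup>+z. ennreal (dquot F z) \<partial>(circ \<Otimes>\<^sub>M circ)) < \<infinity>" using fin by (simp add: circ_gagl_def)
    show "AE z in circ \<Otimes>\<^sub>M circ. (\<lambda>n. ennreal (dquot F z) * indicator {(s, t). cmod (cis s - cis t) \<le> h n} z) \<longlonglongrightarrow> 0"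
    proof (rule AE_I2)
      fix z :: "real \<times> real"
      obtain s t where z: "z = (s, t)" by (cases z)
      show "(\<lambda>n. ennreal (dquot F z) * indicator {(s, t). cmod (cis s - cis t) \<le> h n} z) \<longlonglongrightarrow> 0"
      proof (cases "cis s = cis t")
        case True
        then show ?thesis by (simp add: z dquot_def)
      next
        case False
        then have "eventually (\<lambda>n. h n < cmod (cis s - cis t)) sequentially"
          using h by (intro order_tendstoD(2)[of _ 0]) auto
        then have "eventually (\<lambda>n. ennreal (dquot F z) * indicator {(s, t). cmod (cis s - cis t) \<le> h n} z = 0) sequentially"
          by eventually_elim (simp add: z)
        then show ?thesis by (rule tendsto_eventually)
      qed
    qed
  qed (auto split: split_indicator)
  then show ?thesis by simp
qed

text \<open>A unimodular function of finite half-energy has uniformly vanishing mean oscillation, so that its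
  short averages are uniformly close to the unit circle and can be projected back to it.\<close>

lemma one_minus_norm_avg_sq_le:
  assumes h: "0 < h" "h \<le> 1" and F[measurable]: "F \<in> borel_measurable borel"
    and un: "\<And>t. cmod (F t) = 1" and per: "periodic F"
  shows "ennreal (1 - (cmod (avg h F t))\<^sup>2) \<le> near_diag F h"
proof -
  interpret prob_space "uniform_measure lborel {0..h}" by (rule prob_space_uniform_interval[OF h(1)])
  let ?U = "uniform_measure lborel {0..h}"
  \<comment> \<open>The shift rule for double integrals covers offsets within one period, so
    \<open>t\<close> is reduced first.\<close>
  obtain t0 where t0: "t0 \<in> {0..<2*pi}" "cis t0 = cis t" using ex_angle_reduce by blast
  define \<Phi> where "\<Phi> z = ennreal (dquot F z) * indicator {(s, t). cmod (cis s - cis t) \<le> h} z" for z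
  have [measurable]: "\<Phi> \<in> borel_measurable (borel \<Otimes>\<^sub>M borel)" unfolding \<Phi>_def[abs_def] by measurable
  have AEU: "AE \<tau> in ?U. \<tau> \<in> {0..h}" by (rule AE_uniform_measureI) auto
  have pt: "ennreal ((cmod (F (t0 + \<tau>) - F (t0 + \<sigma>)))\<^sup>2) \<le> ennreal (h\<^sup>2) * \<Phi> (t0 + \<tau>, t0 + \<sigma>)"
    if "\<tau> \<in> {0..h}" "\<sigma> \<in> {0..h}" for \<tau> \<sigma>
  proof -
    let ?d = "cmod (cis (t0 + \<tau>) - cis (t0 + \<sigma>))"
    have d: "?d \<le> h"
    proof (cases "\<tau> \<le> \<sigma>")
      case True
      then show ?thesis using norm_one_minus_cis_le[of "\<sigma> - \<tau>" "t0 + \<tau>"] that by simp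
    next
      case False
      then show ?thesis using norm_one_minus_cis_le[of "\<tau> - \<sigma>" "t0 + \<sigma>"] that by (simp add: norm_minus_commute)
    qed
    have "(cmod (F (t0 + \<tau>) - F (t0 + \<sigma>)))\<^sup>2 \<le> h\<^sup>2 * dquot F (t0 + \<tau>, t0 + \<sigma>)"
    proof (cases "?d = 0")
      case True
      then have "F (t0 + \<tau>) = F (t0 + \<sigma>)" by (intro periodic_cis_cong[OF per]) simp
      then show ?thesis by simp
    next
      case False
      have "?d\<^sup>2 \<le> h\<^sup>2" using d by (intro power_mono) auto
      then have "(cmod (F (t0 + \<tau>) - F (t0 + \<sigma>)))\<^sup>2 * ?d\<^sup>2 \<le> (cmod (F (t0 + \<tau>) - F (t0 + \<sigma>)))\<^sup>2 * h\<^sup>2"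
        by (intro mult_left_mono) auto
      then show ?thesis using False by (simp add: dquot_def field_simps)
    qed
    then have "ennreal ((cmod (F (t0 + \<tau>) - F (t0 + \<sigma>)))\<^sup>2) \<le> ennreal (h\<^sup>2 * dquot F (t0 + \<tau>, t0 + \<sigma>))"
      by (rule ennreal_leI)
    then show ?thesis using d by (simp add: \<Phi>_def ennreal_mult)
  qed
  have "ennreal (1 - (cmod (avg h F t))\<^sup>2) = ennreal (1 - (cmod (avg h F t0))\<^sup>2)"
    using periodic_cis_cong[OF periodic_avg[OF per, of h] t0(2)] by simp
  also have "\<dots> \<le> (\<integral>\<^sup>+\<tau>. \<integral>\<^sup>+\<sigma>. ennreal ((cmod (F (t0 + \<tau>) - F (t0 + \<sigma>)))\<^sup>2) \<partial>?U \<partial>?U)"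
    unfolding avg_def by (rule one_minus_norm_expectation_sq_le) (use un in auto)
  also have "\<dots> \<le> (\<integral>\<^sup>+\<tau>. \<integral>\<^sup>+\<sigma>. ennreal (h\<^sup>2) * \<Phi> (t0 + \<tau>, t0 + \<sigma>) \<partial>?U \<partial>?U)"
  proof (rule nn_integral_mono_AE)
    show "AE \<tau> in ?U. (\<integral>\<^sup>+\<sigma>. ennreal ((cmod (F (t0 + \<tau>) - F (t0 + \<sigma>)))\<^sup>2) \<partial>?U)
        \<le> (\<integral>\<^sup>+\<sigma>. ennreal (h\<^sup>2) * \<Phi> (t0 + \<tau>, t0 + \<sigma>) \<partial>?U)"
      using AEU
    proof eventually_elim
      case (elim \<tau>)
      show ?case using AEU by (intro nn_integral_mono_AE, eventually_elim) (rule pt[OF elim])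
    qed
  qed
  \<comment> \<open>Enlarging both intervals to the full period costs \<open>1 / h\<close> each, and
    the two factors cancel \<open>h\<^sup>2\<close>.\<close>
  also have "\<dots> \<le> (\<integral>\<^sup>+\<tau>. (\<integral>\<^sup>+\<sigma>. ennreal (h\<^sup>2) * \<Phi> (t0 + \<tau>, t0 + \<sigma>) \<partial>circ) * ennreal (1/h) \<partial>?U)"
    using h by (intro nn_integral_mono nn_integral_uniform_interval_le) auto
  also have "\<dots> \<le> (\<integral>\<^sup>+\<tau>. (\<integral>\<^sup>+\<sigma>. ennreal (h\<^sup>2) * \<Phi> (t0 + \<tau>, t0 + \<sigma>) \<partial>circ) * ennreal (1/h) \<partial>circ) * ennreal (1/h)"
    using h by (intro nn_integral_uniform_interval_le) auto
  also have "\<dots> = ennreal (h\<^sup>2) * ennreal (1/h) * ennreal (1/h) * (\<integral>\<^sup>+\<tau>. \<integral>\<^sup>+\<sigma>. \<Phi> (t0 + \<tau>, t0 + \<sigma>) \<partial>circ \<partial>circ)"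
    by (subst nn_integral_cmult, simp, subst nn_integral_multc, simp, subst nn_integral_cmult, simp)
      (simp add: mult_ac)
  also have "ennreal (h\<^sup>2) * ennreal (1/h) * ennreal (1/h) = 1"
    using h by (simp add: power2_eq_square flip: ennreal_mult)
  also have "(\<integral>\<^sup>+\<tau>. \<integral>\<^sup>+\<sigma>. \<Phi> (t0 + \<tau>, t0 + \<sigma>) \<partial>circ \<partial>circ) = (\<integral>\<^sup>+\<tau>. \<integral>\<^sup>+\<sigma>. \<Phi> (\<tau> + t0, \<sigma> + t0) \<partial>circ \<partial>circ)"
    by (simp add: add.commute)
  also have "\<dots> = (\<integral>\<^sup>+\<tau>. \<integral>\<^sup>+\<sigma>. \<Phi> (\<tau>, \<sigma>) \<partial>circ \<partial>circ)"
    using per t0 by (intro nn_integral_circ2_shift)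
      (auto simp: \<Phi>_def dquot_def periodic_def split: split_indicator)
  also have "\<dots> = near_diag F h"
    unfolding near_diag_def \<Phi>_def by (subst circ.nn_integral_fst[symmetric]) auto
  finally show ?thesis by simp
qed

lemma dquot_diff_le:
  "dquot (\<lambda>t. F t - G t) z \<le> 2 * dquot F z + 2 * dquot G z"
proof (cases z)
  case (Pair s t)
  have "(cmod ((F s - F t) - (G s - G t)))\<^sup>2 \<le> 2 * (cmod (F s - F t))\<^sup>2 + 2 * (cmod (G s - G t))\<^sup>2"
    by (rule norm_diff_sq_le)
  then show ?thesis
    unfolding Pair dquot_def by (simp add: algebra_simps add_divide_distrib[symmetric] divide_right_mono)
qed

lemma circ_gagl_diff_le:
  assumes [measurable]: "F \<in> borel_measurable borel" "G \<in> borel_measurable borel"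
  shows "circ_gagl (\<lambda>t. F t - G t) \<le> 2 * circ_gagl F + 2 * circ_gagl G"
proof -
  have "circ_gagl (\<lambda>t. F t - G t) \<le> (\<integral>\<^sup>+z. 2 * ennreal (dquot F z) + 2 * ennreal (dquot G z) \<partial>(circ \<Otimes>\<^sub>M circ))"
    unfolding circ_gagl_def
  proof (rule nn_integral_mono)
    fix z
    have "ennreal (dquot (\<lambda>t. F t - G t) z) \<le> ennreal (2 * dquot F z + 2 * dquot G z)"
      by (rule ennreal_leI[OF dquot_diff_le])
    then show "ennreal (dquot (\<lambda>t. F t - G t) z) \<le> 2 * ennreal (dquot F z) + 2 * ennreal (dquot G z)"
      by (simp add: ennreal_mult)
  qed
  also have "\<dots> = 2 * circ_gagl F + 2 * circ_gagl G"
    unfolding circ_gagl_def by (simp add: nn_integral_add nn_integral_cmult)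
  finally show ?thesis .
qed

text \<open>The averages converge in mean square at rate \<open>h\<close>, so along powers of 1 / 2
  they converge almost everywhere. Convergence in energy follows by dominated convergence with
  varying bounds, because averaging does not increase the energy.\<close>

lemma sgn_avg_approximation:
  assumes F[measurable]: "F \<in> borel_measurable borel"
    and un: "\<And>t. cmod (F t) = 1" and per: "periodic F" and fin: "circ_gagl F < \<infinity>" and \<epsilon>: "(0::ennreal) < \<epsilon>"
  shows "\<exists>h. 0 < h \<and> h \<le> 1 \<and> (\<forall>t. 1 / 2 \<le> cmod (avg h F t)) \<and>
    circ_L2 (\<lambda>t. sgn (avg h F t) - F t) < \<epsilon> \<and> circ_gagl (\<lambda>t. sgn (avg h F t) - F t) < \<epsilon>"
proof -
  define k :: "nat \<Rightarrow> real" where "k n = (1/2) ^ n" for n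
  have k: "0 < k n" "k n \<le> 1" for n by (auto simp: k_def power_le_one)
  have k0: "k \<longlonglongrightarrow> 0" unfolding k_def by (rule LIMSEQ_power_zero) simp
  \<comment> \<open>A defect below 3 / 4, which is 1 minus the square of 1 / 2, keeps the averages
    outside the disc of radius 1 / 2.\<close>
  have "eventually (\<lambda>n. near_diag F (k n) < ennreal (3/4)) sequentially"
    using near_diag_tendsto_0[OF F fin k0] by (rule order_tendstoD(2)) simp
  then obtain N where N: "\<And>n. n \<ge> N \<Longrightarrow> near_diag F (k n) < ennreal (3/4)"
    unfolding eventually_sequentially by blast
  define h where "h n = k (n + N)" for n
  have h: "0 < h n" "h n \<le> 1" for n using k by (auto simp: h_def)
  define A where "A n = avg (h n) F" for n
  have [measurable]: "A n \<in> borel_measurable borel" for n unfolding A_def using h by measurable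
  have A_le: "cmod (A n t) \<le> 1" for n t unfolding A_def using h un by (intro avg_norm_le) auto
  have A_ge: "1 / 2 \<le> cmod (A n t)" for n t
  proof -
    have "ennreal (1 - (cmod (A n t))\<^sup>2) < ennreal (3/4)"
      using one_minus_norm_avg_sq_le[OF h F un per, of n t] N[of "n + N"]
      by (simp add: A_def h_def)
    then have "1 - (cmod (A n t))\<^sup>2 < 3/4"
      by (cases "1 - (cmod (A n t))\<^sup>2 \<ge> 0") (auto simp: ennreal_less_iff)
    then have "(1/2)\<^sup>2 \<le> (cmod (A n t))\<^sup>2" by (simp add: power2_eq_square)
    then show ?thesis by (simp add: abs_le_square_iff[symmetric])
  qed
  obtain C where C: "circ_gagl F = ennreal C" "0 \<le> C" using fin by (cases "circ_gagl F") auto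
  have "AE t in circ. (\<lambda>n. (cmod (A n t - F t))\<^sup>2) \<longlonglongrightarrow> 0"
  proof (rule AE_tendsto_0_of_summable_nn_integral)
    show "(\<integral>\<^sup>+t. ennreal ((cmod (A n t - F t))\<^sup>2) \<partial>circ) \<le> ennreal (h n * C)" for n
      using circ_L2_avg_diff_le[OF h F un per, of n] C h[of n] by (simp add: circ_L2_def A_def ennreal_mult)
    have "summable (\<lambda>n. (1/2::real) ^ n * ((1/2) ^ N * C))" by (intro summable_mult2 summable_geometric) simp
    then show "summable (\<lambda>n. h n * C)" by (simp add: h_def k_def power_add mult_ac)
  qed (use h C in \<open>auto intro!: mult_nonneg_nonneg simp: less_imp_le\<close>)
  then have AE1: "AE t in circ. (\<lambda>n. A n t) \<longlonglongrightarrow> F t"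
  proof eventually_elim
    case (elim t)
    then have "(\<lambda>n. sqrt ((cmod (A n t - F t))\<^sup>2)) \<longlonglongrightarrow> sqrt 0" by (rule tendsto_real_sqrt)
    then have "(\<lambda>n. cmod (A n t - F t)) \<longlonglongrightarrow> 0" by simp
    then show ?case by (rule LIM_zero_cancel[OF tendsto_norm_zero_cancel])
  qed
  define G where "G n t = sgn (A n t)" for n t
  have sgn_F: "sgn (F t) = F t" for t using un[of t] by (simp add: sgn_eq)
  have sgn_meas: "sgn \<in> borel_measurable (borel :: complex measure)"
    unfolding sgn_div_norm[abs_def] by measurable
  have [measurable]: "G n \<in> borel_measurable borel" for n
    unfolding G_def using measurable_compose[OF _ sgn_meas, of "A n"] by simp
  have G_lim: "(\<lambda>n. G n t) \<longlonglongrightarrow> F t" if "(\<lambda>n. A n t) \<longlonglongrightarrow> F t" for t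
  proof -
    have "(\<lambda>n. sgn (A n t)) \<longlonglongrightarrow> sgn (F t)" using un[of t] that by (intro tendsto_sgn) auto
    then show ?thesis by (simp add: G_def sgn_F)
  qed
  have G_le: "cmod (G n t) \<le> 1" for n t by (simp add: G_def norm_sgn)
  have "(\<lambda>n. circ_L2 (\<lambda>t. G n t - F t)) \<longlonglongrightarrow> (\<integral>\<^sup>+t. 0 \<partial>circ)"
    unfolding circ_L2_def
  proof (rule nn_integral_dominated_convergence[where w="\<lambda>_. ennreal 4"])
    show "AE t in circ. ennreal ((cmod (G n t - F t))\<^sup>2) \<le> ennreal 4" for n
    proof (intro AE_I2 ennreal_leI)
      fix t
      have "cmod (G n t - F t) \<le> 2" using norm_triangle_ineq4[of "G n t" "F t"] un[of t] G_le[of n t] by simp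
      then have "(cmod (G n t - F t))\<^sup>2 \<le> 2\<^sup>2" by (intro power_mono) auto
      then show "(cmod (G n t - F t))\<^sup>2 \<le> 4" by simp
    qed
    show "AE t in circ. (\<lambda>n. ennreal ((cmod (G n t - F t))\<^sup>2)) \<longlonglongrightarrow> 0"
      using AE1
    proof eventually_elim
      case (elim t)
      have "(\<lambda>n. (cmod (G n t - F t))\<^sup>2) \<longlonglongrightarrow> (cmod (F t - F t))\<^sup>2"
        by (intro tendsto_intros G_lim elim)
      then show ?case using tendsto_ennrealI by fastforce
    qed
  qed (simp_all add: emeasure_circ ennreal_mult_less_top)
  then have cN0: "(\<lambda>n. circ_L2 (\<lambda>t. G n t - F t)) \<longlonglongrightarrow> 0" by simp
  have AE2: "AE z in circ \<Otimes>\<^sub>M circ. (\<lambda>n. A n (fst z)) \<longlonglongrightarrow> F (fst z) \<and> (\<lambda>n. A n (snd z)) \<longlonglongrightarrow> F (snd z)"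
    using AE_pair_fst[OF circ.sigma_finite_measure_axioms AE1]
      AE_pair_snd[OF circ.sigma_finite_measure_axioms AE1] by (rule AE_conjI)
  have dq_le: "dquot (G n) z \<le> 16 * dquot (A n) z" for n z
  proof (cases z)
    case (Pair s t)
    have "(cmod (G n s - G n t))\<^sup>2 \<le> (4 * cmod (A n s - A n t))\<^sup>2"
      unfolding G_def by (intro power_mono sgn_diff_le A_ge) auto
    then have "(cmod (G n s - G n t))\<^sup>2 / (cmod (cis s - cis t))\<^sup>2
        \<le> (4 * cmod (A n s - A n t))\<^sup>2 / (cmod (cis s - cis t))\<^sup>2"
      by (intro divide_right_mono) auto
    then show ?thesis by (simp add: Pair dquot_def power_mult_distrib)
  qed
  have dq_lim: "(\<lambda>n. dquot (H n) (s, t)) \<longlonglongrightarrow> dquot H' (s, t)"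
    if "(\<lambda>n. H n s) \<longlonglongrightarrow> H' s" "(\<lambda>n. H n t) \<longlonglongrightarrow> H' t" for s t and H :: "nat \<Rightarrow> real \<Rightarrow> complex" and H'
    unfolding dquot_def by (cases "cis s = cis t") (auto intro!: tendsto_intros that)
  have "(\<lambda>n. \<integral>\<^sup>+z. ennreal (dquot (\<lambda>t. G n t - F t) z) \<partial>(circ \<Otimes>\<^sub>M circ)) \<longlonglongrightarrow> 0"
  proof (rule nn_integral_tendsto_0_dominated_varying)
    \<comment> \<open>32 is twice the square of the Lipschitz constant 4 of the projection; each
      factor 2 comes from the square of a difference. In the limit the two terms add up to
      34.\<close>
    show "dquot (\<lambda>t. G n t - F t) z \<le> 32 * dquot (A n) z + 2 * dquot F z" for n z
      using dquot_diff_le[of "G n" F z] dq_le[of n z] by simp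
    show "AE z in circ \<Otimes>\<^sub>M circ. (\<lambda>n. 32 * dquot (A n) z + 2 * dquot F z) \<longlonglongrightarrow> 34 * dquot F z"
      using AE2
    proof eventually_elim
      case (elim z)
      then have "(\<lambda>n. dquot (A n) z) \<longlonglongrightarrow> dquot F z" using dq_lim[of A "fst z" F "snd z"] by simp
      then have "(\<lambda>n. 32 * dquot (A n) z + 2 * dquot F z) \<longlonglongrightarrow> 32 * dquot F z + 2 * dquot F z"
        by (intro tendsto_intros)
      then show ?case by simp
    qed
    show "(\<integral>\<^sup>+z. ennreal (32 * dquot (A n) z + 2 * dquot F z) \<partial>(circ \<Otimes>\<^sub>M circ))
      \<le> (\<integral>\<^sup>+z. ennreal (34 * dquot F z) \<partial>(circ \<Otimes>\<^sub>M circ))" for n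
    proof -
      have "(\<integral>\<^sup>+z. ennreal (32 * dquot (A n) z + 2 * dquot F z) \<partial>(circ \<Otimes>\<^sub>M circ)) = 32 * circ_gagl (A n) + 2 * circ_gagl F"
        unfolding circ_gagl_def by (simp add: ennreal_mult nn_integral_add nn_integral_cmult)
      also have "\<dots> \<le> 32 * circ_gagl F + 2 * circ_gagl F"
        unfolding A_def using circ_gagl_avg_le[OF h F un per, of n] by (intro add_mono mult_left_mono) auto
      also have "\<dots> = 34 * circ_gagl F" unfolding distrib_right[symmetric] by simp
      also have "\<dots> = (\<integral>\<^sup>+z. ennreal (34 * dquot F z) \<partial>(circ \<Otimes>\<^sub>M circ))"
        unfolding circ_gagl_def by (simp add: ennreal_mult nn_integral_cmult)
      finally show ?thesis .
    qed
    show "(\<integral>\<^sup>+z. ennreal (34 * dquot F z) \<partial>(circ \<Otimes>\<^sub>M circ)) < \<infinity>"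
      using fin unfolding circ_gagl_def by (simp add: ennreal_mult nn_integral_cmult ennreal_mult_less_top)
    show "AE z in circ \<Otimes>\<^sub>M circ. (\<lambda>n. dquot (\<lambda>t. G n t - F t) z) \<longlonglongrightarrow> 0"
      using AE2
    proof eventually_elim
      case (elim z)
      have "(\<lambda>n. G n s - F s) \<longlonglongrightarrow> 0" if "s = fst z \<or> s = snd z" for s
        using elim G_lim that by (auto simp: LIM_zero_iff)
      then have "(\<lambda>n. dquot (\<lambda>t. G n t - F t) (fst z, snd z)) \<longlonglongrightarrow> dquot (\<lambda>_. 0) (fst z, snd z)"
        by (intro dq_lim) auto
      moreover have "dquot (\<lambda>_. 0) (fst z, snd z) = 0" by (simp add: dquot_def)
      ultimately show ?case by simp
    qed
  qed simp_all
  then have cS0: "(\<lambda>n. circ_gagl (\<lambda>t. G n t - F t)) \<longlonglongrightarrow> 0" by (simp add: circ_gagl_def)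
  have "eventually (\<lambda>n. circ_L2 (\<lambda>t. G n t - F t) < \<epsilon> \<and> circ_gagl (\<lambda>t. G n t - F t) < \<epsilon>) sequentially"
    using order_tendstoD(2)[OF cN0 \<epsilon>] order_tendstoD(2)[OF cS0 \<epsilon>] by eventually_elim auto
  then obtain n where "circ_L2 (\<lambda>t. G n t - F t) < \<epsilon>" "circ_gagl (\<lambda>t. G n t - F t) < \<epsilon>"
    unfolding eventually_sequentially by blast
  then show ?thesis
    using h[of n] A_ge[of n] by (intro exI[of _ "h n"]) (auto simp: G_def A_def)
qed

section \<open>Regularity of averages\<close>

lemma avg_eq_integral:
  assumes h: "0 < h" and [measurable]: "F \<in> borel_measurable borel" and bd: "\<And>t. cmod (F t) \<le> B"
  shows "F integrable_on {a..b}" and "avg h F t = (1 / h) *\<^sub>R integral {t..t + h} F"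
proof -
  have int: "set_integrable lborel {a..b} F" for a b
    unfolding set_integrable_def using bd
    by (intro integrableI_bounded_set[where A="{a..b}" and B=B])
      (auto simp: indicator_def emeasure_lborel_Icc_eq)
  show "F integrable_on {a..b}" using set_borel_integral_eq_integral(1)[OF int] .
  have "avg h F t = (\<integral>\<tau>. ((1 / h) * indicator {0..h} \<tau>) *\<^sub>R F (t + \<tau>) \<partial>lborel)"
  proof -
    have "uniform_measure lborel {0..h} = density lborel (\<lambda>\<tau>. ennreal ((1 / h) * indicator {0..h} \<tau>))"
      unfolding uniform_measure_def
    proof (intro density_cong AE_I2)
      fix x
      show "indicator {0..h} x / emeasure lborel {0..h} = ennreal ((1 / h) * indicator {0..h} x)"
        using h divide_ennreal[of 1 h] by (cases "x \<in> {0..h}") auto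
    qed auto
    then show ?thesis unfolding avg_def using h by (simp add: integral_density)
  qed
  also have "\<dots> = (1 / h) *\<^sub>R (\<integral>\<tau>. indicator {t..t + h} (t + 1 * \<tau>) *\<^sub>R F (t + 1 * \<tau>) \<partial>lborel)"
    by (subst integral_scaleR_right[symmetric]) (auto intro!: Bochner_Integration.integral_cong simp: indicator_def)
  also have "(\<integral>\<tau>. indicator {t..t + h} (t + 1 * \<tau>) *\<^sub>R F (t + 1 * \<tau>) \<partial>lborel) = (LINT \<tau>:{t..t + h}|lborel. F \<tau>)"
    unfolding set_lebesgue_integral_def by (subst (2) lborel_integral_real_affine[where c=1 and t=t]) auto
  also have "\<dots> = integral {t..t + h} F" by (rule set_borel_integral_eq_integral(2)[OF int])
  finally show "avg h F t = (1 / h) *\<^sub>R integral {t..t + h} F" .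
qed

text \<open>Moving the window from \<open>s\<close> to \<open>t\<close> exchanges two strips of
  length \<open>t - s\<close>, so the average is Lipschitz with constant
  \<open>2 * B / h\<close>.\<close>

lemma continuous_on_avg:
  assumes h: "0 < h" and F[measurable]: "F \<in> borel_measurable borel" and bd: "\<And>t. cmod (F t) \<le> B"
  shows "continuous_on UNIV (avg h F)"
proof -
  have B0: "0 \<le> B" using bd[of 0] norm_ge_zero order_trans by blast
  have key: "cmod (avg h F t - avg h F s) \<le> 2 * B / h * (t - s)" if "s \<le> t" for s t
  proof -
    note I = avg_eq_integral[OF h F bd]
    have "integral {s..t} F + integral {t..t + h} F = integral {s..t + h} F"
      using that h by (intro Henstock_Kurzweil_Integration.integral_combine I) auto
    moreover have "integral {s..s + h} F + integral {s + h..t + h} F = integral {s..t + h} F"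
      using that h by (intro Henstock_Kurzweil_Integration.integral_combine I) auto
    ultimately have "integral {t..t + h} F - integral {s..s + h} F = integral {s + h..t + h} F - integral {s..t} F"
      by (simp add: algebra_simps)
    then have "avg h F t - avg h F s = (1 / h) *\<^sub>R (integral {s + h..t + h} F - integral {s..t} F)"
      unfolding I(2) by (simp flip: scaleR_diff_right)
    moreover have "cmod (integral {s + h..t + h} F) \<le> B * (t - s)"
      using integrable_bound[OF B0 I(1)[of "s + h" "t + h", folded box_real(2)] bd] that by simp
    moreover have "cmod (integral {s..t} F) \<le> B * (t - s)"
      using integrable_bound[OF B0 I(1)[of "s" "t", folded box_real(2)] bd] that by simp
    ultimately have "cmod (avg h F t - avg h F s) \<le> (1 / h) * (B * (t - s) + B * (t - s))"
      using h by (auto simp: intro!: divide_right_mono order_trans[OF norm_triangle_ineq4] add_mono)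
    also have "\<dots> = 2 * B / h * (t - s)" by simp
    finally show ?thesis .
  qed
  have "(2 * B / h)-lipschitz_on UNIV (avg h F)"
  proof (rule lipschitz_onI)
    fix s t :: real
    show "dist (avg h F s) (avg h F t) \<le> 2 * B / h * dist s t"
      using key[of s t] key[of t s] by (cases "s \<le> t") (auto simp: dist_norm norm_minus_commute)
  qed (use h B0 in auto)
  then show ?thesis by (rule lipschitz_on_continuous_on)
qed

lemma C1_avg:
  assumes h: "0 < h" and F: "continuous_on UNIV F" and bd: "\<And>t. cmod (F t) \<le> B"
  shows "(avg h F has_vector_derivative (1 / h) *\<^sub>R (F (t + h) - F t)) (at t)"
proof -
  have [measurable]: "F \<in> borel_measurable borel" using F by (rule borel_measurable_continuous_onI)
  note I = avg_eq_integral[OF h this bd]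
  \<comment> \<open>The base point lies to the left of all arguments in use, so that integrals over
    adjacent intervals combine without sign cases.\<close>
  define P where "P s = integral {t - 1..s} F" for s
  have P: "(P has_vector_derivative F s) (at s)" if "s \<in> {t - 1<..<t + h + 1}" for s
  proof -
    have "(P has_vector_derivative F s) (at s within {t - 1..t + h + 1})"
      unfolding P_def using that F
      by (intro integral_has_vector_derivative) (auto intro: continuous_on_subset)
    moreover have "at s within {t - 1..t + h + 1} = at s"
      using that by (intro at_within_interior) auto
    ultimately show ?thesis by simp
  qed
  have "((\<lambda>s. P (s + h)) has_vector_derivative F (t + h)) (at t)"
  proof -
    have "((P \<circ> (\<lambda>s. s + h)) has_vector_derivative 1 *\<^sub>R F (t + h)) (at t)"
      using h by (intro vector_diff_chain_at P) (auto intro!: derivative_eq_intros)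
    then show ?thesis by (simp add: o_def)
  qed
  then have deriv: "((\<lambda>s. (1 / h) *\<^sub>R (P (s + h) - P s)) has_vector_derivative (1 / h) *\<^sub>R (F (t + h) - F t)) (at t)"
    using h by (intro bounded_linear.has_vector_derivative[OF bounded_linear_scaleR_right]
        has_vector_derivative_diff P) auto
  have "(1 / h) *\<^sub>R (P (s + h) - P s) = avg h F s" if "s \<in> {t - 1<..<t + 1}" for s
  proof -
    have "P s + integral {s..s + h} F = P (s + h)"
      unfolding P_def using that h by (intro Henstock_Kurzweil_Integration.integral_combine I) auto
    then have "integral {s..s + h} F = P (s + h) - P s" by (simp add: algebra_simps)
    then show ?thesis unfolding I(2) by simp
  qed
  then show ?thesis
    by (rule has_vector_derivative_transform_within_open[OF deriv open_greaterThanLessThan[of "t - 1" "t + 1"], rotated]) auto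
qed

lemma integrable_circ:
  fixes f :: "real \<Rightarrow> 'b::{banach, second_countable_topology}"
  assumes "f \<in> borel_measurable borel" "\<And>t. norm (f t) \<le> B"
  shows "integrable circ f"
  using assms by (intro circ.integrable_const_bound[where B=B]) auto

lemma measure_circ: "measure circ UNIV = 2 * pi"
  by (simp add: measure_def emeasure_circ)

lemma integral_circ_shift_real:
  fixes f :: "real \<Rightarrow> real"
  assumes [measurable]: "f \<in> borel_measurable borel" and bd: "\<And>t. \<bar>f t\<bar> \<le> B" and per: "periodic f"
    and \<tau>: "0 \<le> \<tau>" "\<tau> \<le> 2 * pi"
  shows "(\<integral>t. f (t + \<tau>) \<partial>circ) = (\<integral>t. f t \<partial>circ)"
proof -
  have int: "integrable circ f" "integrable circ (\<lambda>t. f (t + \<tau>))"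
    using bd by (auto intro!: integrable_circ)
  \<comment> \<open>Adding \<open>B\<close> makes the integrand nonnegative, and the shift rule for
    nonnegative integrals applies.\<close>
  have nn: "0 \<le> f t + B" for t using bd[of t] by linarith
  have "(\<integral>t. f (t + \<tau>) + B \<partial>circ) = enn2real (\<integral>\<^sup>+t. ennreal (f (t + \<tau>) + B) \<partial>circ)"
    using nn by (intro integral_eq_nn_integral) auto
  also have "(\<integral>\<^sup>+t. ennreal (f (t + \<tau>) + B) \<partial>circ) = (\<integral>\<^sup>+t. ennreal (f t + B) \<partial>circ)"
    by (rule nn_integral_circ_shift) (use per \<tau> in \<open>auto simp: periodic_def\<close>)
  also have "enn2real \<dots> = (\<integral>t. f t + B \<partial>circ)"
    using nn by (intro integral_eq_nn_integral[symmetric]) auto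
  finally show ?thesis using int by simp
qed

lemma integral_circ_shift:
  fixes f :: "real \<Rightarrow> complex"
  assumes [measurable]: "f \<in> borel_measurable borel" and bd: "\<And>t. cmod (f t) \<le> B" and per: "periodic f"
    and \<tau>: "0 \<le> \<tau>" "\<tau> \<le> 2 * pi"
  shows "(\<integral>t. f (t + \<tau>) \<partial>circ) = (\<integral>t. f t \<partial>circ)"
proof -
  have int: "integrable circ f" "integrable circ (\<lambda>t. f (t + \<tau>))"
    using bd by (auto intro!: integrable_circ)
  have 1: "(\<integral>t. Re (f (t + \<tau>)) \<partial>circ) = (\<integral>t. Re (f t) \<partial>circ)"
    by (rule integral_circ_shift_real[where B=B])
      (use per \<tau> bd in \<open>auto simp: periodic_def intro: order_trans[OF abs_Re_le_cmod]\<close>)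
  have 2: "(\<integral>t. Im (f (t + \<tau>)) \<partial>circ) = (\<integral>t. Im (f t) \<partial>circ)"
    by (rule integral_circ_shift_real[where B=B])
      (use per \<tau> bd in \<open>auto simp: periodic_def intro: order_trans[OF abs_Im_le_cmod]\<close>)
  show ?thesis using int 1 2 by (simp add: complex_eq_iff)
qed

section \<open>Fourier coefficients\<close>

lemma cnj_measurable [measurable]: "cnj \<in> borel_measurable borel"
  by (intro borel_measurable_continuous_onI continuous_intros)

definition chr :: "int \<Rightarrow> real \<Rightarrow> complex" where
  "chr n t = cis (of_int n * t)"

lemma chr_measurable [measurable]: "chr n \<in> borel_measurable borel"
  unfolding chr_def[abs_def] by measurable

lemma cmod_chr [simp]: "cmod (chr n t) = 1"
  and cnj_chr: "cnj (chr n t) = chr (- n) t"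
  and chr_mult: "chr n t * chr m t = chr (n + m) t"
  and chr_add: "chr n (s + t) = chr n s * chr n t"
  and chr_0 [simp]: "chr 0 t = 1" "chr n 0 = 1"
  by (auto simp: chr_def cis_mult cis_cnj algebra_simps)

lemma periodic_chr: "periodic (chr n)"
proof -
  have "chr n (t + 2 * pi) = chr n t" for t
    unfolding chr_def cis_eq_iff by (intro exI[of _ n]) (simp add: algebra_simps)
  then show ?thesis by (simp add: periodic_def)
qed

text \<open>For nonzero \<open>n\<close>, translation by \<open>pi / \<bar>of_int n\<bar>\<close>
  changes the sign of the character but not its integral.\<close>

lemma integral_chr: "(\<integral>t. chr n t \<partial>circ) = (if n = 0 then 2 * of_real pi else 0)"
proof (cases "n = 0")
  case False
  define \<tau> where "\<tau> = pi / \<bar>of_int n\<bar>"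
  have "1 \<le> \<bar>real_of_int n\<bar>" using False by linarith
  then have "\<tau> \<le> pi / 1" unfolding \<tau>_def by (intro divide_left_mono) auto
  moreover have "0 \<le> \<tau>" by (simp add: \<tau>_def)
  ultimately have \<tau>: "0 \<le> \<tau>" "\<tau> \<le> 2 * pi" using pi_gt_zero by linarith+
  have "chr n \<tau> = -1"
    using False by (cases "n > 0") (auto simp: chr_def \<tau>_def complex_eq_iff)
  then have "(\<integral>t. chr n (t + \<tau>) \<partial>circ) = - (\<integral>t. chr n t \<partial>circ)" by (simp add: chr_add)
  moreover have "(\<integral>t. chr n (t + \<tau>) \<partial>circ) = (\<integral>t. chr n t \<partial>circ)"
    by (rule integral_circ_shift[where B=1]) (use \<tau> periodic_chr in auto)
  ultimately show ?thesis using False by simp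
qed (simp add: measure_circ scaleR_conv_of_real)

definition coef :: "(real \<Rightarrow> complex) \<Rightarrow> int \<Rightarrow> complex" where
  "coef F n = (\<integral>t. F t * chr (- n) t \<partial>circ) / (2 * of_real pi)"

text \<open>A completed square with free coefficients: \<open>a = coef H\<close> leaves Bessel's
  inequality, and \<open>H = 0\<close> gives the norm of a trigonometric sum.\<close>

lemma L2_trig_distance:
  fixes H :: "real \<Rightarrow> complex"
  assumes [measurable]: "H \<in> borel_measurable borel" and bd: "\<And>t. cmod (H t) \<le> B" and J: "finite J"
  shows "(\<integral>t. (cmod (H t - (\<Sum>n\<in>J. a n * chr n t)))\<^sup>2 \<partial>circ)
    = (\<integral>t. (cmod (H t))\<^sup>2 \<partial>circ) - 2 * pi * (\<Sum>n\<in>J. (cmod (coef H n))\<^sup>2)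
      + 2 * pi * (\<Sum>n\<in>J. (cmod (a n - coef H n))\<^sup>2)"
proof -
  define T where "T t = (\<Sum>n\<in>J. a n * chr n t)" for t
  have [measurable]: "T \<in> borel_measurable borel" unfolding T_def[abs_def] by measurable
  define C where "C = (\<Sum>n\<in>J. cmod (a n))"
  have T_le: "cmod (T t) \<le> C" for t
    unfolding T_def C_def by (rule order_trans[OF norm_sum]) (simp add: norm_mult)
  have B0: "0 \<le> B" using bd[of 0] norm_ge_zero order_trans by blast
  have C0: "0 \<le> C" unfolding C_def by (simp add: sum_nonneg)
  have iH: "integrable circ (\<lambda>t. H t * chr m t)" for m
    using bd by (intro integrable_circ[where B=B]) (auto simp: norm_mult)
  have iC: "integrable circ (chr m)" for m by (intro integrable_circ[where B=1]) auto
  have HT: "(\<integral>t. H t * cnj (T t) \<partial>circ) = (\<Sum>n\<in>J. cnj (a n) * (2 * of_real pi * coef H n))"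
  proof -
    have "(\<integral>t. H t * cnj (T t) \<partial>circ) = (\<integral>t. (\<Sum>n\<in>J. cnj (a n) * (H t * chr (- n) t)) \<partial>circ)"
      by (simp add: T_def sum_distrib_left cnj_chr mult_ac)
    also have "\<dots> = (\<Sum>n\<in>J. cnj (a n) * (\<integral>t. H t * chr (- n) t \<partial>circ))"
      using iH by (subst Bochner_Integration.integral_sum) auto
    finally show ?thesis by (simp add: coef_def)
  qed
  have TT: "(\<integral>t. T t * cnj (T t) \<partial>circ) = (\<Sum>n\<in>J. 2 * of_real pi * (a n * cnj (a n)))"
  proof -
    have "(\<integral>t. T t * cnj (T t) \<partial>circ) = (\<integral>t. (\<Sum>n\<in>J. \<Sum>m\<in>J. (a n * cnj (a m)) * chr (n - m) t) \<partial>circ)"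
    proof (rule Bochner_Integration.integral_cong[OF refl])
      fix t
      have "a n * chr n t * cnj (a m * chr m t) = (a n * cnj (a m)) * chr (n - m) t" for n m
      proof -
        have "a n * chr n t * cnj (a m * chr m t) = (a n * cnj (a m)) * (chr n t * cnj (chr m t))"
          by (simp add: mult_ac)
        then show ?thesis by (simp only: cnj_chr chr_mult) simp
      qed
      then show "T t * cnj (T t) = (\<Sum>n\<in>J. \<Sum>m\<in>J. (a n * cnj (a m)) * chr (n - m) t)"
        unfolding T_def cnj_sum sum_product by (simp only:)
    qed
    also have "\<dots> = (\<Sum>n\<in>J. \<Sum>m\<in>J. (a n * cnj (a m)) * (\<integral>t. chr (n - m) t \<partial>circ))"
      using iC by (subst Bochner_Integration.integral_sum; (subst Bochner_Integration.integral_sum)?) auto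
    also have "\<dots> = (\<Sum>n\<in>J. \<Sum>m\<in>J. if m = n then 2 * of_real pi * (a n * cnj (a n)) else 0)"
      by (intro sum.cong refl) (auto simp: integral_chr)
    also have "\<dots> = (\<Sum>n\<in>J. 2 * of_real pi * (a n * cnj (a n)))"
      using J by (intro sum.cong refl) (simp add: sum.delta)
    finally show ?thesis .
  qed
  have iHT: "integrable circ (\<lambda>t. H t * cnj (T t))"
    using bd T_le B0 by (intro integrable_circ[where B="B * C"]) (auto simp: norm_mult intro!: mult_mono)
  have iTT: "integrable circ (\<lambda>t. T t * cnj (T t))"
    using T_le C0 by (intro integrable_circ[where B="C * C"]) (auto simp: norm_mult intro!: mult_mono)
  have iHH: "integrable circ (\<lambda>t. (cmod (H t))\<^sup>2)"
    using bd by (intro integrable_circ[where B="B\<^sup>2"]) (auto intro!: power_mono)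
  have eq: "(cmod (H t - T t))\<^sup>2 = (cmod (H t))\<^sup>2 - 2 * Re (H t * cnj (T t)) + Re (T t * cnj (T t))" for t
    unfolding cmod_power2 by (simp add: power2_eq_square algebra_simps)
  have "(\<integral>t. (cmod (H t - T t))\<^sup>2 \<partial>circ)
     = (\<integral>t. (cmod (H t))\<^sup>2 \<partial>circ) - 2 * Re (\<integral>t. H t * cnj (T t) \<partial>circ) + Re (\<integral>t. T t * cnj (T t) \<partial>circ)"
  proof -
    have "integrable circ (\<lambda>t. Re (H t * cnj (T t)))" "integrable circ (\<lambda>t. Re (T t * cnj (T t)))"
      by (intro integrable_Re iHT iTT)+
    then show ?thesis unfolding eq using iHH
      by (simp only: Bochner_Integration.integral_add Bochner_Integration.integral_diff
        Bochner_Integration.integrable_diff integrable_mult_right integral_mult_right_zero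
        integral_Re[OF iHT] integral_Re[OF iTT])
  qed
  also have "\<dots> = (\<integral>t. (cmod (H t))\<^sup>2 \<partial>circ) + (\<Sum>n\<in>J. - 2 * Re (cnj (a n) * (2 * of_real pi * coef H n)) + Re (2 * of_real pi * (a n * cnj (a n))))"
  proof -
    have lin: "- 2 * sum f J + sum g J = (\<Sum>n\<in>J. - 2 * f n + g n)" for f g :: "int \<Rightarrow> real"
      by (simp only: sum.distrib sum_distrib_left)
    show ?thesis unfolding HT TT Re_sum lin[symmetric] by (simp only: mult_minus_left)
  qed
  also have "(\<Sum>n\<in>J. - 2 * Re (cnj (a n) * (2 * of_real pi * coef H n)) + Re (2 * of_real pi * (a n * cnj (a n))))
     = (\<Sum>n\<in>J. - (2 * pi * (cmod (coef H n))\<^sup>2) + 2 * pi * (cmod (a n - coef H n))\<^sup>2)"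
    unfolding cmod_power2 by (intro sum.cong refl) (simp add: power2_eq_square algebra_simps)
  also have "\<dots> = - (2 * pi * (\<Sum>n\<in>J. (cmod (coef H n))\<^sup>2)) + 2 * pi * (\<Sum>n\<in>J. (cmod (a n - coef H n))\<^sup>2)"
    by (simp add: sum.distrib sum_subtractf sum_distrib_left sum_negf)
  finally show ?thesis by (simp add: T_def)
qed

lemma bessel_circ:
  fixes H :: "real \<Rightarrow> complex"
  assumes "H \<in> borel_measurable borel" "\<And>t. cmod (H t) \<le> B" "finite J"
  shows "2 * pi * (\<Sum>n\<in>J. (cmod (coef H n))\<^sup>2) \<le> (\<integral>t. (cmod (H t))\<^sup>2 \<partial>circ)"
proof -
  have "0 \<le> (\<integral>t. (cmod (H t - (\<Sum>n\<in>J. coef H n * chr n t)))\<^sup>2 \<partial>circ)" by (rule integral_nonneg_AE) auto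
  then show ?thesis unfolding L2_trig_distance[OF assms] by simp
qed

section \<open>The energy as a weighted integral over translations\<close>

text \<open>One-sided, hence a geometric sum; its squared modulus is \<open>N\<close> times the
  Fejer kernel.\<close>

definition dirichlet :: "nat \<Rightarrow> real \<Rightarrow> complex" where
  "dirichlet N t = (\<Sum>k<N. chr (int k) t)"

lemma dirichlet_measurable [measurable]: "dirichlet N \<in> borel_measurable borel"
  unfolding dirichlet_def[abs_def] by measurable

lemma cmod_dirichlet_le: "cmod (dirichlet N t) \<le> N"
  unfolding dirichlet_def by (rule order_trans[OF norm_sum]) simp

lemma dirichlet_mult: "dirichlet N t * (cis t - 1) = chr (int N) t - 1"
proof -
  have "(cis t - 1) * (\<Sum>k<N. cis t ^ k) = cis t ^ N - 1" by (rule power_diff_1_eq[symmetric])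
  moreover have "cis t ^ k = chr (int k) t" for k
    unfolding chr_def using Complex.DeMoivre[of t k] by simp
  ultimately show ?thesis by (simp add: dirichlet_def mult.commute)
qed

lemma integral_dirichlet_sq: "(\<integral>t. (cmod (dirichlet N t))\<^sup>2 \<partial>circ) = 2 * pi * N"
proof -
  have eq: "(\<Sum>n\<in>int ` {..<N}. 1 * chr n t) = dirichlet N t" for t
    unfolding dirichlet_def by (subst sum.reindex) (auto simp: inj_on_def)
  have "(\<integral>t. (cmod ((\<lambda>_. 0) t - (\<Sum>n\<in>int ` {..<N}. 1 * chr n t)))\<^sup>2 \<partial>circ) = 2 * pi * N"
    by (subst L2_trig_distance[where B=0]) (auto simp: coef_def card_image inj_on_def)
  then show ?thesis unfolding eq by simp
qed

text \<open>Writing one variable as a translate of the other makes the denominator depend on \<tau>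
  alone. What remains is the mean square distance between \<open>F\<close> and its translates, which
  Fourier coefficients diagonalize.\<close>

lemma circ_gagl_shift_form:
  assumes F[measurable]: "F \<in> borel_measurable borel" and per: "periodic F"
  shows "circ_gagl F = (\<integral>\<^sup>+\<tau>. \<integral>\<^sup>+t. ennreal ((cmod (F (t + \<tau>) - F t))\<^sup>2 / (cmod (cis \<tau> - 1))\<^sup>2) \<partial>circ \<partial>circ)"
proof -
  have cis: "cmod (cis t - cis (\<tau> + t)) = cmod (cis \<tau> - 1)" for t \<tau>
    using cmod_cis_diff_shift[of 0 t \<tau>] by (simp add: norm_minus_commute)
  have "circ_gagl F = (\<integral>\<^sup>+t. \<integral>\<^sup>+\<tau>. ennreal (dquot F (t, \<tau>)) \<partial>circ \<partial>circ)" by (rule circ_gagl_iterated[OF F])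
  also have "\<dots> = (\<integral>\<^sup>+t. \<integral>\<^sup>+\<tau>. ennreal (dquot F (t, \<tau> + t)) \<partial>circ \<partial>circ)"
  proof (rule nn_integral_cong_AE)
    have "AE t in circ. t \<in> {0..<2*pi}"
      unfolding circ_def by (subst AE_density) (auto intro!: AE_I2 split: split_indicator_asm)
    then show "AE t in circ. (\<integral>\<^sup>+\<tau>. ennreal (dquot F (t, \<tau>)) \<partial>circ) = (\<integral>\<^sup>+\<tau>. ennreal (dquot F (t, \<tau> + t)) \<partial>circ)"
    proof eventually_elim
      case (elim t)
      show ?case
        by (rule nn_integral_circ_shift[symmetric]) (use elim per in \<open>auto simp: dquot_def periodic_def\<close>)
    qed
  qed
  also have "\<dots> = (\<integral>\<^sup>+\<tau>. \<integral>\<^sup>+t. ennreal (dquot F (t, \<tau> + t)) \<partial>circ \<partial>circ)"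
    by (rule circ2.Fubini'[symmetric]) simp
  finally show ?thesis
    by (simp add: dquot_def cis norm_minus_commute add.commute)
qed

definition trans_sq :: "(real \<Rightarrow> complex) \<Rightarrow> real \<Rightarrow> real" where
  "trans_sq F \<tau> = (\<integral>t. (cmod (F (t + \<tau>) - F t))\<^sup>2 \<partial>circ)"

lemma trans_sq_nonneg: "0 \<le> trans_sq F \<tau>"
  unfolding trans_sq_def by (rule integral_nonneg_AE) auto

lemma trans_sq_measurable [measurable]:
  assumes [measurable]: "F \<in> borel_measurable borel"
  shows "trans_sq F \<in> borel_measurable borel"
  unfolding trans_sq_def[abs_def] by measurable

lemma circ_gagl_trans_sq:
  assumes F[measurable]: "F \<in> borel_measurable borel" and un: "\<And>t. cmod (F t) = 1" and per: "periodic F"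
  shows "circ_gagl F = (\<integral>\<^sup>+\<tau>. ennreal (trans_sq F \<tau> / (cmod (cis \<tau> - 1))\<^sup>2) \<partial>circ)"
  unfolding circ_gagl_shift_form[OF F per]
proof (rule nn_integral_cong)
  fix \<tau>
  have bd: "cmod (F (t + \<tau>) - F t) \<le> 2" for t using norm_triangle_ineq4[of "F (t + \<tau>)" "F t"] un by simp
  have "(\<integral>\<^sup>+t. ennreal ((cmod (F (t + \<tau>) - F t))\<^sup>2 / (cmod (cis \<tau> - 1))\<^sup>2) \<partial>circ)
      = (\<integral>\<^sup>+t. ennreal ((cmod (F (t + \<tau>) - F t))\<^sup>2) * ennreal (1 / (cmod (cis \<tau> - 1))\<^sup>2) \<partial>circ)"
    by (simp flip: ennreal_mult)
  also have "\<dots> = (\<integral>\<^sup>+t. ennreal ((cmod (F (t + \<tau>) - F t))\<^sup>2) \<partial>circ) * ennreal (1 / (cmod (cis \<tau> - 1))\<^sup>2)"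
    by (rule nn_integral_multc) simp
  also have "(\<integral>\<^sup>+t. ennreal ((cmod (F (t + \<tau>) - F t))\<^sup>2) \<partial>circ) = ennreal (trans_sq F \<tau>)"
    unfolding trans_sq_def using power_mono[OF bd, of _ 2]
    by (intro nn_integral_eq_integral integrable_circ[where B="2\<^sup>2"]) auto
  finally show "(\<integral>\<^sup>+t. ennreal ((cmod (F (t + \<tau>) - F t))\<^sup>2 / (cmod (cis \<tau> - 1))\<^sup>2) \<partial>circ)
      = ennreal (trans_sq F \<tau> / (cmod (cis \<tau> - 1))\<^sup>2)"
    using trans_sq_nonneg[of F \<tau>] by (simp flip: ennreal_mult)
qed

lemma AE_circ_cis_neq_1: "AE \<tau> in circ. \<tau> \<in> {0..<2 * pi} \<and> cis \<tau> \<noteq> 1"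
proof -
  have 1: "cis \<tau> \<noteq> 1" if "\<tau> \<in> {0<..<2 * pi}" for \<tau>
  proof
    assume "cis \<tau> = 1"
    then have "cis \<tau> = cis 0" by simp
    then obtain n :: int where n: "\<tau> = 2 * pi * of_int n" unfolding cis_eq_iff by auto
    have "0 < of_int n * (2 * pi)" "of_int n * (2 * pi) < 1 * (2 * pi)" using that n by (auto simp: mult_ac)
    then have "0 < n" "n < 1" using pi_gt_zero by (auto simp: mult_less_cancel_right zero_less_mult_iff)
    then show False by simp
  qed
  have "AE \<tau> in lborel. \<tau> \<noteq> (0::real)" by (rule AE_lborel_singleton)
  then have "AE \<tau> in lborel. 0 < (indicator {0..<2 * pi} \<tau> :: ennreal) \<longrightarrow> \<tau> \<in> {0..<2 * pi} \<and> cis \<tau> \<noteq> 1"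
    by eventually_elim (use 1 in \<open>auto split: split_indicator_asm\<close>)
  then show ?thesis unfolding circ_def by (subst AE_density) auto
qed

lemma coef_trans:
  assumes F[measurable]: "F \<in> borel_measurable borel" and un: "\<And>t. cmod (F t) = 1" and per: "periodic F"
    and \<tau>: "\<tau> \<in> {0..<2 * pi}"
  shows "coef (\<lambda>t. F (t + \<tau>) - F t) n = coef F n * (chr n \<tau> - 1)"
proof -
  have i1: "integrable circ (\<lambda>t. F (t + \<tau>) * chr (- n) t)" "integrable circ (\<lambda>t. F t * chr (- n) t)"
    using un by (auto intro!: integrable_circ[where B=1] simp: norm_mult)
  have "(\<integral>t. F (t + \<tau>) * chr (- n) t \<partial>circ) = (\<integral>t. chr n \<tau> * (F (t + \<tau>) * chr (- n) (t + \<tau>)) \<partial>circ)"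
  proof -
    have "chr n \<tau> * chr (- n) (t + \<tau>) = chr (- n) t" for t by (simp add: chr_def cis_mult algebra_simps)
    then have "chr n \<tau> * (F (t + \<tau>) * chr (- n) (t + \<tau>)) = F (t + \<tau>) * chr (- n) t" for t
      by (metis mult.left_commute)
    then show ?thesis by (simp only:)
  qed
  also have "\<dots> = chr n \<tau> * (\<integral>t. F (t + \<tau>) * chr (- n) (t + \<tau>) \<partial>circ)" by simp
  also have "(\<integral>t. F (t + \<tau>) * chr (- n) (t + \<tau>) \<partial>circ) = (\<integral>t. F t * chr (- n) t \<partial>circ)"
    using \<tau> per periodic_chr[of "- n"] un
    by (intro integral_circ_shift[where B=1 and f="\<lambda>t. F t * chr (- n) t"]) (auto simp: periodic_def norm_mult)
  finally show ?thesis unfolding coef_def using i1 by (simp add: left_diff_distrib diff_divide_distrib algebra_simps)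
qed

text \<open>The quotient is the squared modulus of a Dirichlet sum with \<bar>n\<bar> terms, and
  orthogonality counts the terms.\<close>

lemma nn_integral_fejer:
  "(\<integral>\<^sup>+\<tau>. ennreal ((cmod (chr n \<tau> - 1))\<^sup>2 / (cmod (cis \<tau> - 1))\<^sup>2) \<partial>circ) = ennreal (2 * pi * \<bar>of_int n\<bar>)"
proof -
  define N where "N = nat \<bar>n\<bar>"
  have *: "cmod (chr n \<tau> - 1) = cmod (chr (int N) \<tau> - 1)" for \<tau>
  proof (cases "0 \<le> n")
    case False
    have "chr (int N) \<tau> - 1 = cnj (chr n \<tau> - 1)" using False by (simp add: N_def cnj_chr)
    then show ?thesis by (simp only: complex_mod_cnj)
  qed (simp add: N_def)
  have "(\<integral>\<^sup>+\<tau>. ennreal ((cmod (chr n \<tau> - 1))\<^sup>2 / (cmod (cis \<tau> - 1))\<^sup>2) \<partial>circ)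
      = (\<integral>\<^sup>+\<tau>. ennreal ((cmod (dirichlet N \<tau>))\<^sup>2) \<partial>circ)"
  proof (rule nn_integral_cong_AE)
    show "AE \<tau> in circ. ennreal ((cmod (chr n \<tau> - 1))\<^sup>2 / (cmod (cis \<tau> - 1))\<^sup>2) = ennreal ((cmod (dirichlet N \<tau>))\<^sup>2)"
      using AE_circ_cis_neq_1
    proof eventually_elim
      case (elim \<tau>)
      have "cmod (chr n \<tau> - 1) = cmod (dirichlet N \<tau>) * cmod (cis \<tau> - 1)"
        unfolding * dirichlet_mult[symmetric] norm_mult ..
      then show ?case using elim by (simp add: power_mult_distrib)
    qed
  qed
  also have "\<dots> = ennreal (\<integral>\<tau>. (cmod (dirichlet N \<tau>))\<^sup>2 \<partial>circ)"
    using power_mono[OF cmod_dirichlet_le[of N], of _ 2]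
    by (intro nn_integral_eq_integral integrable_circ[where B="(real N)\<^sup>2"]) auto
  finally show ?thesis by (simp add: integral_dirichlet_sq N_def)
qed

text \<open>Translation by \<tau> multiplies the coefficient of index \<open>n\<close> in the
  increment by \<open>chr n \<tau> - 1\<close>. Bessel's inequality for each \<tau> contributes one
  factor \<open>2 * pi\<close>, the Fejer integral the other.\<close>

lemma circ_gagl_ge_coef_sum:
  assumes F[measurable]: "F \<in> borel_measurable borel" and un: "\<And>t. cmod (F t) = 1" and per: "periodic F"
    and J: "finite J"
  shows "ennreal (4 * pi\<^sup>2 * (\<Sum>n\<in>J. \<bar>of_int n\<bar> * (cmod (coef F n))\<^sup>2)) \<le> circ_gagl F"
proof -
  have bd: "cmod (F (t + \<tau>) - F t) \<le> 2" for t \<tau> using norm_triangle_ineq4[of "F (t + \<tau>)" "F t"] un by simp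
  have "ennreal (4 * pi\<^sup>2 * (\<Sum>n\<in>J. \<bar>of_int n\<bar> * (cmod (coef F n))\<^sup>2))
      = (\<Sum>n\<in>J. ennreal (2 * pi * (cmod (coef F n))\<^sup>2) * ennreal (2 * pi * \<bar>of_int n\<bar>))"
    by (simp add: sum_distrib_left power2_eq_square mult_ac flip: ennreal_mult)
  also have "\<dots> = (\<integral>\<^sup>+\<tau>. (\<Sum>n\<in>J. ennreal (2 * pi * (cmod (coef F n))\<^sup>2) * ennreal ((cmod (chr n \<tau> - 1))\<^sup>2 / (cmod (cis \<tau> - 1))\<^sup>2)) \<partial>circ)"
    by (simp add: nn_integral_sum nn_integral_cmult nn_integral_fejer)
  also have "\<dots> \<le> circ_gagl F"
    unfolding circ_gagl_trans_sq[OF F un per]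
  proof (rule nn_integral_mono_AE)
    show "AE \<tau> in circ. (\<Sum>n\<in>J. ennreal (2 * pi * (cmod (coef F n))\<^sup>2) * ennreal ((cmod (chr n \<tau> - 1))\<^sup>2 / (cmod (cis \<tau> - 1))\<^sup>2))
       \<le> ennreal (trans_sq F \<tau> / (cmod (cis \<tau> - 1))\<^sup>2)"
      using AE_circ_cis_neq_1
    proof eventually_elim
      case (elim \<tau>)
      have "2 * pi * (\<Sum>n\<in>J. (cmod (coef F n * (chr n \<tau> - 1)))\<^sup>2) \<le> trans_sq F \<tau>"
        using bessel_circ[of "\<lambda>t. F (t + \<tau>) - F t" 2 J] bd J elim
        by (simp add: coef_trans[OF F un per] trans_sq_def)
      then have "2 * pi * (\<Sum>n\<in>J. (cmod (coef F n * (chr n \<tau> - 1)))\<^sup>2) / (cmod (cis \<tau> - 1))\<^sup>2 \<le> trans_sq F \<tau> / (cmod (cis \<tau> - 1))\<^sup>2"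
        by (rule divide_right_mono) simp
      then have "ennreal (\<Sum>n\<in>J. 2 * pi * (cmod (coef F n))\<^sup>2 * ((cmod (chr n \<tau> - 1))\<^sup>2 / (cmod (cis \<tau> - 1))\<^sup>2))
          \<le> ennreal (trans_sq F \<tau> / (cmod (cis \<tau> - 1))\<^sup>2)"
        by (intro ennreal_leI) (simp add: sum_distrib_left sum_divide_distrib norm_mult power_mult_distrib mult_ac)
      then show ?case by (simp flip: ennreal_mult)
    qed
  qed
  finally show ?thesis .
qed

text \<open>Fourier coefficients of an autocorrelation are squared moduli. Once the character is
  absorbed into \<open>G\<close>, the double integral factors into the integral of \<open>G\<close>
  and its conjugate; pairing with \<open>chr m\<close> selects the index \<open>- m\<close>.\<close>

lemma integral_autocorrelation:
  assumes F[measurable]: "F \<in> borel_measurable borel" and un: "\<And>t. cmod (F t) = 1" and per: "periodic F"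
  shows "(\<integral>\<tau>. (\<integral>t. F (t + \<tau>) * cnj (F t) \<partial>circ) * chr m \<tau> \<partial>circ) = of_real (4 * pi\<^sup>2 * (cmod (coef F (- m)))\<^sup>2)"
proof -
  define G where "G t = F t * chr m t" for t
  have [measurable]: "G \<in> borel_measurable borel" unfolding G_def[abs_def] by measurable
  have unG: "cmod (G t) = 1" for t by (simp add: G_def norm_mult un)
  have perG: "periodic G" using per periodic_chr[of m] by (simp add: periodic_def G_def)
  interpret cc: finite_measure "circ \<Otimes>\<^sub>M circ"
    by (rule finite_measure_pair_measure) (rule circ.finite_measure_axioms)+
  have int: "integrable (circ \<Otimes>\<^sub>M circ) (\<lambda>(t, \<tau>). G (t + \<tau>) * cnj (G t))"
    by (intro cc.integrable_const_bound[where B=1]) (auto simp: norm_mult unG)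
  have "F (t + \<tau>) * cnj (F t) * chr m \<tau> = G (t + \<tau>) * cnj (G t)" for t \<tau>
  proof -
    have "chr m (t + \<tau>) * cnj (chr m t) = chr m \<tau>" by (simp add: chr_def cis_cnj cis_mult algebra_simps)
    then show ?thesis by (simp add: G_def mult_ac)
  qed
  then have "(\<integral>\<tau>. (\<integral>t. F (t + \<tau>) * cnj (F t) \<partial>circ) * chr m \<tau> \<partial>circ) = (\<integral>\<tau>. \<integral>t. G (t + \<tau>) * cnj (G t) \<partial>circ \<partial>circ)"
    by (simp flip: integral_mult_left_zero)
  also have "\<dots> = (\<integral>t. \<integral>\<tau>. G (t + \<tau>) * cnj (G t) \<partial>circ \<partial>circ)"
    by (rule circ2.Fubini_integral[OF int])
  also have "\<dots> = (\<integral>t. (\<integral>\<tau>. G \<tau> \<partial>circ) * cnj (G t) \<partial>circ)"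
  proof (rule integral_cong_AE)
    show "AE t in circ. (\<integral>\<tau>. G (t + \<tau>) * cnj (G t) \<partial>circ) = (\<integral>\<tau>. G \<tau> \<partial>circ) * cnj (G t)"
      using AE_circ_cis_neq_1
    proof eventually_elim
      case (elim t)
      have "(\<integral>\<tau>. G (\<tau> + t) \<partial>circ) = (\<integral>\<tau>. G \<tau> \<partial>circ)"
        by (rule integral_circ_shift[where B=1]) (use elim perG unG in auto)
      then show ?case by (simp add: add.commute)
    qed
  qed measurable
  also have "\<dots> = (\<integral>\<tau>. G \<tau> \<partial>circ) * cnj (\<integral>\<tau>. G \<tau> \<partial>circ)"
    by (simp add: integral_cnj)
  also have "(\<integral>\<tau>. G \<tau> \<partial>circ) = 2 * of_real pi * coef F (- m)" by (simp add: coef_def G_def)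
  finally show ?thesis
    by (simp add: complex_norm_square[symmetric] power2_eq_square mult_ac)
qed

text \<open>Since the Dirichlet sum satisfies \<open>cmod (dirichlet N \<tau>) \<le> 2 / cmod (cis \<tau> - 1)\<close>, the energy
  dominates the integral of \<open>trans_sq F\<close> against the Fejer kernel, whose Fourier coefficients are
  at most \<open>N\<close> and vanish outside \<open>{- N..N}\<close>. This makes Parseval's identity quantitative.\<close>

lemma parseval_defect_le:
  assumes F[measurable]: "F \<in> borel_measurable borel" and un: "\<And>t. cmod (F t) = 1" and per: "periodic F"
  shows "ennreal (pi * real N * (2 * pi - 2 * pi * (\<Sum>n\<in>{- int N..int N}. (cmod (coef F n))\<^sup>2))) \<le> circ_gagl F"
proof -
  define A where "A \<tau> = (\<integral>t. F (t + \<tau>) * cnj (F t) \<partial>circ)" for \<tau>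
  define S where "S = (\<Sum>n\<in>{- int N..int N}. (cmod (coef F n))\<^sup>2)"
  have [measurable]: "A \<in> borel_measurable borel" unfolding A_def[abs_def] by measurable
  have iFF: "integrable circ (\<lambda>t. F (t + \<tau>) * cnj (F t))" for \<tau>
    by (intro integrable_circ[where B=1]) (auto simp: norm_mult un)
  have A_le: "cmod (A \<tau>) \<le> 2 * pi" for \<tau>
    using integral_norm_bound[of circ "\<lambda>t. F (t + \<tau>) * cnj (F t)"] by (simp add: A_def norm_mult un measure_circ)
  have ts: "trans_sq F \<tau> = 4 * pi - 2 * Re (A \<tau>)" for \<tau>
  proof -
    have "(cmod (F (t + \<tau>) - F t))\<^sup>2 = 2 - 2 * Re (F (t + \<tau>) * cnj (F t))" for t
    proof -
      have "(cmod (F (t + \<tau>)))\<^sup>2 = 1" "(cmod (F t))\<^sup>2 = 1" by (simp_all add: un)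
      then show ?thesis unfolding cmod_power2 by (simp add: power2_eq_square algebra_simps)
    qed
    moreover have "integrable circ (\<lambda>t. Re (F (t + \<tau>) * cnj (F t)))" by (intro integrable_Re iFF)
    ultimately show ?thesis unfolding trans_sq_def A_def integral_Re[OF iFF, symmetric]
      by (simp add: measure_circ del: times_complex.sel complex_cnj)
  qed
  have dir_sq: "of_real ((cmod (dirichlet N \<tau>))\<^sup>2) = (\<Sum>j<N. \<Sum>k<N. chr (int j - int k) \<tau>)" for \<tau>
  proof -
    have "of_real ((cmod (dirichlet N \<tau>))\<^sup>2) = dirichlet N \<tau> * cnj (dirichlet N \<tau>)"
      by (rule complex_norm_square)
    also have "\<dots> = (\<Sum>j<N. \<Sum>k<N. chr (int j - int k) \<tau>)"
      by (simp add: dirichlet_def sum_product cnj_chr chr_mult)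
    finally show ?thesis .
  qed
  have iA: "integrable circ (\<lambda>\<tau>. A \<tau> * chr m \<tau>)" for m
    using A_le by (intro integrable_circ[where B="2 * pi"]) (auto simp: norm_mult)
  have iAD: "integrable circ (\<lambda>\<tau>. A \<tau> * of_real ((cmod (dirichlet N \<tau>))\<^sup>2))"
    unfolding dir_sq sum_distrib_left by (intro Bochner_Integration.integrable_sum iA)
  have "(\<integral>\<tau>. A \<tau> * of_real ((cmod (dirichlet N \<tau>))\<^sup>2) \<partial>circ)
      = (\<Sum>j<N. \<Sum>k<N. \<integral>\<tau>. A \<tau> * chr (int j - int k) \<tau> \<partial>circ)"
    unfolding dir_sq sum_distrib_left
    using iA by (simp add: Bochner_Integration.integral_sum Bochner_Integration.integrable_sum)
  also have "\<dots> = of_real (\<Sum>j<N. \<Sum>k<N. 4 * pi\<^sup>2 * (cmod (coef F (int k - int j)))\<^sup>2)"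
    unfolding A_def integral_autocorrelation[OF F un per] by simp
  finally have AD: "Re (\<integral>\<tau>. A \<tau> * of_real ((cmod (dirichlet N \<tau>))\<^sup>2) \<partial>circ)
      = (\<Sum>j<N. \<Sum>k<N. 4 * pi\<^sup>2 * (cmod (coef F (int k - int j)))\<^sup>2)"
    by (simp only: Re_complex_of_real)
  \<comment> \<open>For fixed \<open>j\<close> the differences \<open>int k - int j\<close> are
    distinct and lie between \<open>- int N\<close> and \<open>int N\<close>, so each row is at most
    \<open>S\<close>.\<close>
  also have "\<dots> \<le> (\<Sum>j<N. 4 * pi\<^sup>2 * S)"
  proof (rule sum_mono)
    fix j assume "j \<in> {..<N}"
    then have "(\<Sum>k<N. (cmod (coef F (int k - int j)))\<^sup>2) \<le> S"
      unfolding S_def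
      by (subst sum.reindex[of "\<lambda>k. int k - int j" "{..<N}" "\<lambda>n. (cmod (coef F n))\<^sup>2", unfolded o_def, symmetric])
        (auto simp: inj_on_def intro!: sum_mono2)
    then show "(\<Sum>k<N. 4 * pi\<^sup>2 * (cmod (coef F (int k - int j)))\<^sup>2) \<le> 4 * pi\<^sup>2 * S"
      by (simp add: sum_distrib_left[symmetric] mult_left_mono)
  qed
  finally have AD_le: "Re (\<integral>\<tau>. A \<tau> * of_real ((cmod (dirichlet N \<tau>))\<^sup>2) \<partial>circ) \<le> real N * (4 * pi\<^sup>2 * S)"
    by simp
  have iD: "integrable circ (\<lambda>\<tau>. (cmod (dirichlet N \<tau>))\<^sup>2)"
    using power_mono[OF cmod_dirichlet_le[of N], of _ 2]
    by (intro integrable_circ[where B="(real N)\<^sup>2"]) auto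
  have eq: "trans_sq F \<tau> * (cmod (dirichlet N \<tau>))\<^sup>2 = 4 * pi * (cmod (dirichlet N \<tau>))\<^sup>2
      - 2 * Re (A \<tau> * of_real ((cmod (dirichlet N \<tau>))\<^sup>2))" for \<tau>
    by (simp add: ts algebra_simps)
  have iTS: "integrable circ (\<lambda>\<tau>. trans_sq F \<tau> * (cmod (dirichlet N \<tau>))\<^sup>2)"
    unfolding eq using iD iAD by (intro Bochner_Integration.integrable_diff integrable_mult_right integrable_Re)
  have "(\<integral>\<tau>. trans_sq F \<tau> * (cmod (dirichlet N \<tau>))\<^sup>2 \<partial>circ)
      = 4 * pi * (2 * pi * N) - 2 * Re (\<integral>\<tau>. A \<tau> * of_real ((cmod (dirichlet N \<tau>))\<^sup>2) \<partial>circ)"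
    unfolding eq using iD integrable_Re[OF iAD]
    by (simp only: Bochner_Integration.integral_diff integrable_mult_right integral_mult_right_zero
        integral_Re[OF iAD] integral_dirichlet_sq)
  then have "4 * (pi * real N * (2 * pi - 2 * pi * S)) \<le> (\<integral>\<tau>. trans_sq F \<tau> * (cmod (dirichlet N \<tau>))\<^sup>2 \<partial>circ)"
    using AD_le by (simp add: algebra_simps power2_eq_square)
  then have "ennreal (4 * (pi * real N * (2 * pi - 2 * pi * S))) \<le> ennreal (\<integral>\<tau>. trans_sq F \<tau> * (cmod (dirichlet N \<tau>))\<^sup>2 \<partial>circ)"
    by (rule ennreal_leI)
  also have "\<dots> = (\<integral>\<^sup>+\<tau>. ennreal (trans_sq F \<tau> * (cmod (dirichlet N \<tau>))\<^sup>2) \<partial>circ)"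
    using iTS trans_sq_nonneg by (intro nn_integral_eq_integral[symmetric]) auto
  also have "\<dots> \<le> (\<integral>\<^sup>+\<tau>. 4 * ennreal (trans_sq F \<tau> / (cmod (cis \<tau> - 1))\<^sup>2) \<partial>circ)"
  proof (rule nn_integral_mono_AE)
    show "AE \<tau> in circ. ennreal (trans_sq F \<tau> * (cmod (dirichlet N \<tau>))\<^sup>2) \<le> 4 * ennreal (trans_sq F \<tau> / (cmod (cis \<tau> - 1))\<^sup>2)"
      using AE_circ_cis_neq_1
    proof eventually_elim
      case (elim \<tau>)
      have "cmod (dirichlet N \<tau>) * cmod (cis \<tau> - 1) \<le> 2"
        unfolding norm_mult[symmetric] dirichlet_mult
        using norm_triangle_ineq4[of "chr (int N) \<tau>" 1] by simp
      then have "(cmod (dirichlet N \<tau>) * cmod (cis \<tau> - 1))\<^sup>2 \<le> 2\<^sup>2"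
        by (intro power_mono) auto
      then have "(cmod (dirichlet N \<tau>))\<^sup>2 \<le> 4 / (cmod (cis \<tau> - 1))\<^sup>2"
        using elim by (simp add: power_mult_distrib pos_le_divide_eq)
      then have "trans_sq F \<tau> * (cmod (dirichlet N \<tau>))\<^sup>2 \<le> trans_sq F \<tau> * (4 / (cmod (cis \<tau> - 1))\<^sup>2)"
        by (rule mult_left_mono) (rule trans_sq_nonneg)
      then have "ennreal (trans_sq F \<tau> * (cmod (dirichlet N \<tau>))\<^sup>2) \<le> ennreal (4 * (trans_sq F \<tau> / (cmod (cis \<tau> - 1))\<^sup>2))"
        by (intro ennreal_leI) (simp add: mult_ac)
      also have "\<dots> = 4 * ennreal (trans_sq F \<tau> / (cmod (cis \<tau> - 1))\<^sup>2)"
        by (subst ennreal_mult) (auto simp: trans_sq_nonneg)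
      finally show ?case .
    qed
  qed
  also have "\<dots> = 4 * circ_gagl F"
    unfolding circ_gagl_trans_sq[OF F un per] by (rule nn_integral_cmult) simp
  finally have *: "ennreal (4 * (pi * real N * (2 * pi - 2 * pi * S))) \<le> 4 * circ_gagl F" .
  show ?thesis
  proof (cases "circ_gagl F")
    case (real C)
    then have "ennreal (4 * (pi * real N * (2 * pi - 2 * pi * S))) \<le> ennreal (4 * C)"
      using * by (simp add: ennreal_mult)
    then have "4 * (pi * real N * (2 * pi - 2 * pi * S)) \<le> 4 * C"
      using real by (subst (asm) ennreal_le_iff) auto
    then show ?thesis using real by (simp add: S_def[symmetric] ennreal_leI)
  qed simp
qed

section \<open>Winding numbers of smooth maps\<close>

lemma integral_circ_HK:
  fixes f :: "real \<Rightarrow> complex"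
  assumes f: "continuous_on UNIV f"
  shows "(\<integral>t. f t \<partial>circ) = integral {0..2 * pi} f" and "continuous_on UNIV f \<Longrightarrow> f integrable_on {0..2 * pi}"
proof -
  have [measurable]: "f \<in> borel_measurable borel" using f by (rule borel_measurable_continuous_onI)
  have int: "set_integrable lborel {0..2 * pi} f"
    by (rule borel_integrable_atLeastAtMost'[OF continuous_on_subset[OF f]]) auto
  have c: "circ = density lborel (\<lambda>x. ennreal (indicator {0..<2 * pi} x))"
    unfolding circ_def by (intro density_cong AE_I2) (auto split: split_indicator)
  have "(\<integral>t. f t \<partial>circ) = (\<integral>t. indicator {0..<2 * pi} t *\<^sub>R f t \<partial>lborel)"
    unfolding c by (subst integral_density) auto
  also have "\<dots> = (LINT t:{0..2 * pi}|lborel. f t)"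
    unfolding set_lebesgue_integral_def
  proof (rule integral_cong_AE)
    have "AE t in lborel. t \<noteq> 2 * pi" by (rule AE_lborel_singleton)
    then show "AE t in lborel. indicator {0..<2 * pi} t *\<^sub>R f t = indicator {0..2 * pi} t *\<^sub>R f t"
      by eventually_elim (auto split: split_indicator)
  qed auto
  also have "\<dots> = integral {0..2 * pi} f" by (rule set_borel_integral_eq_integral(2)[OF int])
  finally show "(\<integral>t. f t \<partial>circ) = integral {0..2 * pi} f" .
  show "f integrable_on {0..2 * pi}" by (rule set_borel_integral_eq_integral(1)[OF int])
qed

text \<open>The derivative is an explicit argument, so that the winding integrals of products and
  conjugates can be written down.\<close>

definition C1_periodic :: "(real \<Rightarrow> complex) \<Rightarrow> (real \<Rightarrow> complex) \<Rightarrow> bool" where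
  "C1_periodic F F' \<longleftrightarrow> (\<forall>t. (F has_vector_derivative F' t) (at t)) \<and> continuous_on UNIV F' \<and> periodic F"

lemma C1_periodicD:
  assumes "C1_periodic F F'"
  shows "(F has_vector_derivative F' t) (at t)" "continuous_on UNIV F'" "periodic F" "continuous_on UNIV F"
    "periodic F'"
proof -
  show d: "(F has_vector_derivative F' t) (at t)" for t using assms by (simp add: C1_periodic_def)
  show "continuous_on UNIV F'" and per: "periodic F" using assms by (auto simp: C1_periodic_def)
  show "continuous_on UNIV F"
    using d by (intro continuous_at_imp_continuous_on ballI has_vector_derivative_continuous)
  show "periodic F'"
    unfolding periodic_def
  proof
    fix t
    have "((F \<circ> (\<lambda>t. t + 2 * pi)) has_vector_derivative 1 *\<^sub>R F' (t + 2 * pi)) (at t)"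
      by (intro vector_diff_chain_at d) (auto intro!: derivative_eq_intros)
    moreover have "F \<circ> (\<lambda>t. t + 2 * pi) = F" using per by (auto simp: periodic_def)
    ultimately show "F' (t + 2 * pi) = F' t" using vector_derivative_unique_at[OF d[of t]] by simp
  qed
qed

lemma integral_circ_derivative:
  assumes "C1_periodic F F'"
  shows "(\<integral>t. F' t \<partial>circ) = 0"
proof -
  note C = C1_periodicD[OF assms]
  have "(F' has_integral (F (2 * pi) - F 0)) {0..2 * pi}"
    by (rule fundamental_theorem_of_calculus) (auto intro: has_vector_derivative_at_within C)
  moreover have "F (0 + 2 * pi) = F 0" using C(3) unfolding periodic_def by blast
  ultimately have "integral {0..2 * pi} F' = 0" by (simp add: integral_unique)
  then show ?thesis by (simp add: integral_circ_HK[OF C(2)])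
qed

lemma periodic_continuous_bounded:
  fixes F :: "real \<Rightarrow> complex"
  assumes "continuous_on UNIV F" "periodic F"
  obtains B where "0 \<le> B" "\<And>t. cmod (F t) \<le> B"
proof -
  have "compact (F ` {0..2 * pi})"
    by (intro compact_continuous_image continuous_on_subset[OF assms(1)]) auto
  then obtain B where B: "\<And>t. t \<in> {0..2 * pi} \<Longrightarrow> cmod (F t) \<le> B"
    using compact_imp_bounded bounded_iff by (metis imageI)
  have all: "cmod (F t) \<le> B" for t
  proof -
    obtain s where "s \<in> {0..<2 * pi}" "cis s = cis t" using ex_angle_reduce by blast
    then show ?thesis using B[of s] periodic_cis_cong[OF assms(2), of s t] by simp
  qed
  moreover have "0 \<le> B" using all[of 0] norm_ge_zero order_trans by blast
  ultimately show thesis using that by blast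
qed

lemma has_vector_derivative_chr: "(chr n has_vector_derivative \<i> * of_int n * chr n t) (at t)"
proof -
  have "((\<lambda>z. exp (\<i> * of_int n * z)) has_field_derivative \<i> * of_int n * exp (\<i> * of_int n * of_real t)) (at (of_real t))"
    by (auto intro!: derivative_eq_intros)
  from has_vector_derivative_real_field[OF this]
  show ?thesis by (simp add: chr_def[abs_def] cis_conv_exp mult.assoc)
qed

lemma coef_derivative:
  assumes C1: "C1_periodic F F'"
  shows "coef F' n = \<i> * of_int n * coef F n"
proof -
  note C = C1_periodicD[OF C1]
  have [measurable]: "F \<in> borel_measurable borel" "F' \<in> borel_measurable borel"
    using C by (auto intro: borel_measurable_continuous_onI)
  obtain B B' where B: "\<And>t. cmod (F t) \<le> B" "\<And>t. cmod (F' t) \<le> B'"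
    using periodic_continuous_bounded[OF C(4,3)] periodic_continuous_bounded[OF C(2,5)] by metis
  have contc: "continuous_on UNIV (chr m)" for m
    using has_vector_derivative_chr by (intro continuous_at_imp_continuous_on ballI has_vector_derivative_continuous)
  have "C1_periodic (\<lambda>t. F t * chr (- n) t) (\<lambda>t. F t * (\<i> * of_int (- n) * chr (- n) t) + F' t * chr (- n) t)"
    unfolding C1_periodic_def
  proof (intro conjI allI)
    show "((\<lambda>t. F t * chr (- n) t) has_vector_derivative F t * (\<i> * of_int (- n) * chr (- n) t) + F' t * chr (- n) t) (at t)" for t
      by (rule has_vector_derivative_mult[OF C(1) has_vector_derivative_chr])
    show "continuous_on UNIV (\<lambda>t. F t * (\<i> * of_int (- n) * chr (- n) t) + F' t * chr (- n) t)"
      by (intro continuous_intros C contc)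
    show "periodic (\<lambda>t. F t * chr (- n) t)" using C(3) periodic_chr by (simp add: periodic_def)
  qed
  from integral_circ_derivative[OF this]
  have "(\<integral>t. (- \<i> * of_int n) * (F t * chr (- n) t) + F' t * chr (- n) t \<partial>circ) = 0" by (simp add: mult_ac)
  moreover have "integrable circ (\<lambda>t. F t * chr (- n) t)" "integrable circ (\<lambda>t. F' t * chr (- n) t)"
    using B by (auto intro!: integrable_circ simp: norm_mult)
  ultimately have "(\<integral>t. F' t * chr (- n) t \<partial>circ) = \<i> * of_int n * (\<integral>t. F t * chr (- n) t \<partial>circ)" by simp
  then show ?thesis by (simp add: coef_def)
qed

text \<open>\<open>2 * pi * \<i>\<close> times the degree: for unimodular \<open>F\<close> the
  integrand is the logarithmic derivative.\<close>

definition wind :: "(real \<Rightarrow> complex) \<Rightarrow> (real \<Rightarrow> complex) \<Rightarrow> complex" where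
  "wind F F' = (\<integral>t. cnj (F t) * F' t \<partial>circ)"

text \<open>Formally \<open>wind F F'\<close> is the sum of \<open>2 * pi * \<i> * n * (cmod (coef F n))\<^sup>2\<close>. Truncating it
  costs little because \<open>F'\<close> is bounded and the Parseval defect of \<open>F\<close> tends to 0.\<close>

lemma wind_bound:
  assumes C1: "C1_periodic F F'" and un: "\<And>t. cmod (F t) = 1"
  shows "ennreal (2 * pi * cmod (wind F F')) \<le> circ_gagl F"
proof (cases "circ_gagl F")
  case (real C)
  note D = C1_periodicD[OF C1]
  have F[measurable]: "F \<in> borel_measurable borel" and [measurable]: "F' \<in> borel_measurable borel"
    using D by (auto intro: borel_measurable_continuous_onI)
  obtain B where B: "0 \<le> B" "\<And>t. cmod (F' t) \<le> B" using periodic_continuous_bounded[OF D(2,5)] by metis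
  have "cmod (wind F F') \<le> C / (2 * pi)"
  proof (rule field_le_epsilon)
    fix e :: real assume "0 < e"
    \<comment> \<open>The final error is \<open>B * (2 * pi + 1) * \<eta>\<close>; the added 1 keeps
      the denominator positive when \<open>B = 0\<close>.\<close>
    define \<eta> where "\<eta> = e / (B * (2 * pi + 1) + 1)"
    have den: "0 < B * (2 * pi + 1) + 1" using B by (simp add: add_nonneg_pos)
    have \<eta>: "0 < \<eta>" "B * (2 * pi + 1) * \<eta> \<le> e"
    proof -
      show "0 < \<eta>" using \<open>0 < e\<close> den by (simp add: \<eta>_def)
      then have "B * (2 * pi + 1) * \<eta> \<le> (B * (2 * pi + 1) + 1) * \<eta>" by (intro mult_right_mono) auto
      also have "\<dots> = e" using den by (simp add: \<eta>_def)
      finally show "B * (2 * pi + 1) * \<eta> \<le> e" .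
    qed
    \<comment> \<open>Large enough for the bound \<open>C / (pi * real N)\<close> of the Parseval
      defect to be at most \<open>\<eta>\<^sup>2\<close>.\<close>
    obtain N :: nat where N: "C / (pi * \<eta>\<^sup>2) < real N" using reals_Archimedean2 by blast
    have N0: "0 < real N" using N real \<eta> by (meson divide_nonneg_nonneg le_less_trans mult_nonneg_nonneg pi_ge_zero zero_le_power2)
    define J where "J = {- int N..int N}"
    define T where "T t = (\<Sum>n\<in>J. coef F n * chr n t)" for t
    have [measurable]: "T \<in> borel_measurable borel" unfolding T_def[abs_def] by measurable
    define \<delta> where "\<delta> = (\<integral>t. (cmod (F t - T t))\<^sup>2 \<partial>circ)"
    have \<delta>_eq: "\<delta> = 2 * pi - 2 * pi * (\<Sum>n\<in>J. (cmod (coef F n))\<^sup>2)"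
      unfolding \<delta>_def T_def by (subst L2_trig_distance[where B=1]) (auto simp: un J_def measure_circ)
    have "ennreal (pi * real N * \<delta>) \<le> ennreal C"
      using parseval_defect_le[OF F un D(3), of N] real by (simp add: \<delta>_eq J_def)
    then have "pi * real N * \<delta> \<le> C" using real by (subst (asm) ennreal_le_iff) auto
    then have "\<delta> \<le> C / (pi * real N)" using N0 by (simp add: pos_le_divide_eq mult_ac)
    also have "C / (pi * real N) \<le> \<eta>\<^sup>2"
    proof -
      have "C \<le> real N * (pi * \<eta>\<^sup>2)" using N \<eta> by (simp add: pos_divide_less_eq)
      then show ?thesis using N0 by (simp add: pos_divide_le_eq mult_ac)
    qed
    finally have \<delta>_le: "\<delta> \<le> \<eta>\<^sup>2" .
    have T_bd: "cmod (T t) \<le> (\<Sum>n\<in>J. cmod (coef F n))" for t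
      unfolding T_def by (rule order_trans[OF norm_sum]) (simp add: norm_mult)
    define K where "K = 1 + (\<Sum>n\<in>J. cmod (coef F n))"
    have FT_bd: "cmod (F t - T t) \<le> K" for t
      using norm_triangle_ineq4[of "F t" "T t"] T_bd[of t] by (simp add: un K_def)
    have K0: "0 \<le> K" using FT_bd[of 0] norm_ge_zero order_trans by blast
    have i0: "integrable circ (\<lambda>t. cnj (F t) * F' t)" using B by (intro integrable_circ[where B=B]) (auto simp: norm_mult un)
    have i1: "integrable circ (\<lambda>t. cnj (T t) * F' t)"
      using B T_bd by (intro integrable_circ[where B="(\<Sum>n\<in>J. cmod (coef F n)) * B"])
        (auto simp: norm_mult intro!: mult_mono sum_nonneg)
    have i2: "integrable circ (\<lambda>t. F' t * chr m t)" for m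
      using B by (intro integrable_circ[where B=B]) (auto simp: norm_mult)
    have i3: "integrable circ (\<lambda>t. (cmod (F t - T t))\<^sup>2)"
      using FT_bd by (intro integrable_circ[where B="K\<^sup>2"]) (auto intro!: power_mono)
    have "(\<integral>t. cnj (T t) * F' t \<partial>circ) = (\<integral>t. (\<Sum>n\<in>J. cnj (coef F n) * (F' t * chr (- n) t)) \<partial>circ)"
      by (simp add: T_def sum_distrib_left sum_distrib_right cnj_chr mult_ac)
    also have "\<dots> = (\<Sum>n\<in>J. cnj (coef F n) * (2 * of_real pi * coef F' n))"
      using i2 by (subst Bochner_Integration.integral_sum) (auto simp: coef_def)
    also have "\<dots> = 2 * of_real pi * \<i> * (\<Sum>n\<in>J. of_int n * of_real ((cmod (coef F n))\<^sup>2))"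
      unfolding coef_derivative[OF C1] complex_norm_square by (simp add: sum_distrib_left mult_ac)
    finally have "cmod (\<integral>t. cnj (T t) * F' t \<partial>circ) = 2 * pi * cmod (\<Sum>n\<in>J. of_int n * of_real ((cmod (coef F n))\<^sup>2))"
      by (simp add: norm_mult)
    also have "\<dots> \<le> 2 * pi * (\<Sum>n\<in>J. \<bar>of_int n\<bar> * (cmod (coef F n))\<^sup>2)"
      by (intro mult_left_mono order_trans[OF norm_sum]) (auto simp: norm_mult norm_power)
    also have "\<dots> \<le> C / (2 * pi)"
    proof -
      have "4 * pi\<^sup>2 * (\<Sum>n\<in>J. \<bar>of_int n\<bar> * (cmod (coef F n))\<^sup>2) \<le> C"
        using circ_gagl_ge_coef_sum[OF F un D(3), of J] real by (simp add: J_def)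
      then show ?thesis by (simp add: pos_le_divide_eq power2_eq_square mult_ac)
    qed
    finally have 1: "cmod (\<integral>t. cnj (T t) * F' t \<partial>circ) \<le> C / (2 * pi)" .
    have "cmod (\<integral>t. cnj (F t) * F' t - cnj (T t) * F' t \<partial>circ) \<le> (\<integral>t. cmod (cnj (F t) * F' t - cnj (T t) * F' t) \<partial>circ)"
      by (rule integral_norm_bound)
    also have "\<dots> \<le> (\<integral>t. B * (\<eta> + (cmod (F t - T t))\<^sup>2 / \<eta>) \<partial>circ)"
    proof (rule integral_mono)
      show "integrable circ (\<lambda>t. cmod (cnj (F t) * F' t - cnj (T t) * F' t))" using i0 i1 by auto
      show "integrable circ (\<lambda>t. B * (\<eta> + (cmod (F t - T t))\<^sup>2 / \<eta>))"
        using i3 by (intro integrable_mult_right Bochner_Integration.integrable_add) (auto simp: circ.integrable_const)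
      fix t
      let ?x = "cmod (F t - T t)"
      \<comment> \<open>A pointwise substitute for the Cauchy-Schwarz inequality; the derivative is
        bounded by \<open>B\<close>.\<close>
      have "?x \<le> \<eta> + ?x\<^sup>2 / \<eta>"
      proof (cases "?x \<le> \<eta>")
        case True then show ?thesis using \<eta> by (simp add: add_increasing2)
      next
        case False
        then have "?x * \<eta> \<le> ?x * ?x" by (intro mult_left_mono) auto
        then have "?x \<le> ?x\<^sup>2 / \<eta>" using \<eta> by (simp add: pos_le_divide_eq power2_eq_square)
        then show ?thesis using \<eta> by linarith
      qed
      then have "?x * cmod (F' t) \<le> (\<eta> + ?x\<^sup>2 / \<eta>) * B" using B \<eta> by (intro mult_mono) auto
      moreover have "cmod (cnj (F t) * F' t - cnj (T t) * F' t) = ?x * cmod (F' t)"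
        by (simp add: norm_mult flip: left_diff_distrib complex_cnj_diff)
      ultimately show "cmod (cnj (F t) * F' t - cnj (T t) * F' t) \<le> B * (\<eta> + ?x\<^sup>2 / \<eta>)" by (simp add: mult.commute)
    qed
    also have "\<dots> = B * (2 * pi * \<eta> + \<delta> / \<eta>)"
      using i3 by (simp add: \<delta>_def measure_circ circ.integrable_const)
    also have "\<dots> \<le> B * (2 * pi * \<eta> + \<eta>)"
    proof -
      have "\<delta> / \<eta> \<le> \<eta>" using \<delta>_le \<eta> by (simp add: pos_divide_le_eq power2_eq_square)
      then show ?thesis using B by (intro mult_left_mono) auto
    qed
    also have "\<dots> = B * (2 * pi + 1) * \<eta>" by (simp add: algebra_simps)
    also have "\<dots> \<le> e" by fact
    finally have 2: "cmod (wind F F' - (\<integral>t. cnj (T t) * F' t \<partial>circ)) \<le> e"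
      using i0 i1 by (simp add: wind_def)
    show "cmod (wind F F') \<le> C / (2 * pi) + e"
      using 1 2 norm_triangle_sub[of "wind F F'" "\<integral>t. cnj (T t) * F' t \<partial>circ"] by linarith
  qed
  then have "2 * pi * cmod (wind F F') \<le> C" by (simp add: pos_le_divide_eq mult_ac)
  then show ?thesis using real by (simp add: ennreal_leI)
qed simp

text \<open>The product of \<open>F\<close> with the exponential of minus a primitive of
  \<open>cnj (F t) * F' t\<close> is constant. By periodicity the exponential of the integral over
  one period is 1.\<close>

lemma wind_integer:
  assumes C1: "C1_periodic F F'" and un: "\<And>t. cmod (F t) = 1"
  obtains n :: int where "wind F F' = 2 * of_real pi * \<i> * of_int n"
proof -
  note D = C1_periodicD[OF C1]
  define q where "q t = cnj (F t) * F' t" for t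
  have cq: "continuous_on UNIV q" unfolding q_def[abs_def] by (intro continuous_intros D)
  define P where "P s = integral {0..s} q" for s
  have dP: "(P has_vector_derivative q s) (at s within {0..2 * pi})" if "s \<in> {0..2 * pi}" for s
    unfolding P_def using that cq by (intro integral_has_vector_derivative continuous_on_subset[OF cq]) auto
  have dE: "((\<lambda>s. F s * exp (- P s)) has_vector_derivative 0) (at s within {0..2 * pi})" if s: "s \<in> {0..2 * pi}" for s
  proof -
    have "((\<lambda>s. exp (- P s)) has_vector_derivative (- q s) * exp (- P s)) (at s within {0..2 * pi})"
    proof -
      have "((\<lambda>s. - P s) has_vector_derivative - q s) (at s within {0..2 * pi})"
        by (intro has_vector_derivative_minus dP s)
      moreover have "(exp has_field_derivative exp (- P s)) (at (- P s) within (\<lambda>s. - P s) ` {0..2 * pi})"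
        by (rule has_field_derivative_at_within[OF DERIV_exp])
      ultimately show ?thesis
        using field_vector_diff_chain_within[of "\<lambda>s. - P s" "- q s" s "{0..2*pi}" exp "exp (- P s)"] by (simp add: o_def)
    qed
    from has_vector_derivative_mult[OF has_vector_derivative_at_within[OF D(1)] this]
    have "((\<lambda>s. F s * exp (- P s)) has_vector_derivative F s * ((- q s) * exp (- P s)) + F' s * exp (- P s)) (at s within {0..2 * pi})" .
    moreover have "F s * cnj (F s) = 1" using un[of s] complex_norm_square[of "F s"] by simp
    then have "F s * ((- q s) * exp (- P s)) + F' s * exp (- P s) = 0"
      by (simp add: q_def algebra_simps)
    ultimately show ?thesis by simp
  qed
  have "F (2 * pi) * exp (- P (2 * pi)) = F 0 * exp (- P 0)"
    by (rule has_derivative_zero_unique[of "{0..2 * pi}"])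
      (use dE in \<open>auto simp: has_vector_derivative_def\<close>)
  moreover have "F (0 + 2 * pi) = F 0" using D(3) unfolding periodic_def by blast
  moreover have "F 0 \<noteq> 0" using un[of 0] by auto
  ultimately have "exp (- P (2 * pi)) = 1" by (simp add: P_def)
  then obtain n :: int where n: "Re (- P (2 * pi)) = 0" "Im (- P (2 * pi)) = of_int (2 * n) * pi" unfolding exp_eq_1 by blast
  have "wind F F' = P (2 * pi)"
    unfolding wind_def P_def q_def[symmetric] by (rule integral_circ_HK(1)[OF cq])
  also have "\<dots> = 2 * of_real pi * \<i> * of_int (- n)"
  proof -
    have "Re (P (2 * pi)) = 0" "Im (P (2 * pi)) = - (2 * pi * of_int n)" using n by (simp_all add: algebra_simps)
    then show ?thesis by (simp add: complex_eq_iff)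
  qed
  finally show thesis by (rule that)
qed

lemma wind_mult:
  assumes F: "C1_periodic F F'" "\<And>t. cmod (F t) = 1" and G: "C1_periodic G G'" "\<And>t. cmod (G t) = 1"
  shows "C1_periodic (\<lambda>t. F t * G t) (\<lambda>t. F t * G' t + F' t * G t)"
    and "wind (\<lambda>t. F t * G t) (\<lambda>t. F t * G' t + F' t * G t) = wind F F' + wind G G'"
proof -
  note D = C1_periodicD[OF F(1)] and E = C1_periodicD[OF G(1)]
  show "C1_periodic (\<lambda>t. F t * G t) (\<lambda>t. F t * G' t + F' t * G t)"
    unfolding C1_periodic_def using D(3) E(3)
    by (auto intro!: has_vector_derivative_mult continuous_intros D E simp: periodic_def)
  have [measurable]: "F \<in> borel_measurable borel" "F' \<in> borel_measurable borel"
    "G \<in> borel_measurable borel" "G' \<in> borel_measurable borel"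
    using D E by (auto intro: borel_measurable_continuous_onI)
  obtain B B' where B: "\<And>t. cmod (F' t) \<le> B" "\<And>t. cmod (G' t) \<le> B'"
    using periodic_continuous_bounded[OF D(2,5)] periodic_continuous_bounded[OF E(2,5)] by metis
  have eq: "cnj (F t * G t) * (F t * G' t + F' t * G t) = cnj (F t) * F' t + cnj (G t) * G' t" for t
  proof -
    have "F t * cnj (F t) = 1" "G t * cnj (G t) = 1"
      using F(2)[of t] G(2)[of t] complex_norm_square[of "F t"] complex_norm_square[of "G t"] by auto
    then have "cnj (F t) * F t = 1" "cnj (G t) * G t = 1" by (auto simp: mult.commute)
    then show ?thesis by (simp add: algebra_simps)
  qed
  have "integrable circ (\<lambda>t. cnj (F t) * F' t)" "integrable circ (\<lambda>t. cnj (G t) * G' t)"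
    using B F(2) G(2) by (auto intro!: integrable_circ simp: norm_mult)
  then show "wind (\<lambda>t. F t * G t) (\<lambda>t. F t * G' t + F' t * G t) = wind F F' + wind G G'"
    unfolding wind_def eq by simp
qed

text \<open>Compares the shorter arc with the chord. Through it, functions that are Lipschitz in the
  angle become Lipschitz in the chordal distance.\<close>

lemma min_le_sin:
  assumes "0 \<le> \<alpha>" "\<alpha> \<le> pi"
  shows "min \<alpha> (pi - \<alpha>) \<le> 2 * sin \<alpha>"
proof -
  have small: "x \<le> 2 * sin x" if "0 \<le> x" "x \<le> pi / 3" for x
  proof -
    have "2 * sin 0 - 0 \<le> 2 * sin x - x"
    proof (rule DERIV_nonneg_imp_nondecreasing[of 0 x "\<lambda>x. 2 * sin x - x"])
      show "0 \<le> x" by fact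
      fix y assume y: "0 \<le> y" "y \<le> x"
      have "cos (pi / 3) \<le> cos y" using y that by (intro cos_monotone_0_pi_le) auto
      then show "\<exists>d. ((\<lambda>x. 2 * sin x - x) has_real_derivative d) (at y) \<and> 0 \<le> d"
        by (intro exI[of _ "2 * cos y - 1"] conjI) (auto intro!: derivative_eq_intros simp: cos_60)
    qed
    then show ?thesis by simp
  qed
  \<comment> \<open>Beyond \<open>pi / 3\<close>, \<open>2 * sin x\<close> is at least
    \<open>sqrt 3\<close>, hence at least 1.7, while \<open>x\<close> is at most
    \<open>pi / 2\<close>, hence at most 1.6.\<close>
  have half: "x \<le> 2 * sin x" if "0 \<le> x" "x \<le> pi / 2" for x
  proof (cases "x \<le> pi / 3")
    case False
    have "sin (pi / 3) \<le> sin x" using False that by (intro sin_monotone_2pi_le) auto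
    moreover have "17 / 10 \<le> sqrt 3" by (rule real_le_rsqrt) (simp add: power2_eq_square)
    moreover have "pi \<le> 32 / 10" using pi_approx by simp
    ultimately show ?thesis using that by (simp add: sin_60)
  qed (use small that in auto)
  show ?thesis
  proof (cases "\<alpha> \<le> pi / 2")
    case True then show ?thesis using half[of \<alpha>] assms by simp
  next
    case False then show ?thesis using half[of "pi - \<alpha>"] assms by simp
  qed
qed

lemma cmod_cis_minus_1:
  assumes "0 \<le> \<tau>" "\<tau> \<le> 2 * pi"
  shows "cmod (cis \<tau> - 1) = 2 * sin (\<tau> / 2)"
proof -
  have "(cmod (cis \<tau> - 1))\<^sup>2 = 2 - 2 * cos \<tau>"
    unfolding cmod_power2 using sin_cos_squared_add[of \<tau>] by (simp add: power2_eq_square algebra_simps)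
  also have "\<dots> = (2 * sin (\<tau> / 2))\<^sup>2" using cos_double_sin[of "\<tau>/2"] by (simp add: power_mult_distrib)
  finally show ?thesis by (rule power2_eq_imp_eq) (use assms sin_ge_zero[of "\<tau> / 2"] in auto)
qed

text \<open>An increment is bounded by the shorter of the arcs \<tau> and
  \<open>2 * pi - \<tau>\<close>, hence by a multiple of the chord, so the difference quotient is
  bounded.\<close>

lemma C1_periodic_circ_gagl_finite:
  assumes C1: "C1_periodic F F'"
  shows "circ_gagl F < \<infinity>"
proof -
  note D = C1_periodicD[OF C1]
  have F[measurable]: "F \<in> borel_measurable borel" using D by (auto intro: borel_measurable_continuous_onI)
  obtain B where B: "0 \<le> B" "\<And>t. cmod (F' t) \<le> B" using periodic_continuous_bounded[OF D(2,5)] by metis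
  have lip: "cmod (F s - F t) \<le> B * \<bar>s - t\<bar>" for s t
  proof -
    have "norm (F s - F t) \<le> B * norm (s - t)"
    proof (rule differentiable_bound[of UNIV F "\<lambda>x h. h *\<^sub>R F' x"])
      show "(F has_derivative (\<lambda>h. h *\<^sub>R F' x)) (at x within UNIV)" for x
        using D(1)[of x] by (simp add: has_vector_derivative_def)
      show "onorm (\<lambda>h. h *\<^sub>R F' x) \<le> B" for x
        using B by (intro onorm_bound) (auto simp: mult.commute[of B] intro!: mult_left_mono)
    qed auto
    then show ?thesis by simp
  qed
  have key: "cmod (F (t + \<tau>) - F t) \<le> 2 * B * cmod (cis \<tau> - 1)" if \<tau>: "0 \<le> \<tau>" "\<tau> \<le> 2 * pi" for t \<tau>
  proof -
    have "cmod (F (t + \<tau>) - F t) \<le> B * \<tau>" using lip[of "t + \<tau>" t] \<tau> by simp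
    moreover have "cmod (F (t + \<tau>) - F t) \<le> B * (2 * pi - \<tau>)"
    proof -
      have "F (t + 2 * pi) = F t" using D(3) by (simp add: periodic_def)
      then show ?thesis using lip[of "t + \<tau>" "t + 2 * pi"] \<tau> by simp
    qed
    ultimately have "cmod (F (t + \<tau>) - F t) \<le> B * (2 * min (\<tau> / 2) (pi - \<tau> / 2))"
      by (auto simp: min_def)
    also have "\<dots> \<le> B * (2 * (2 * sin (\<tau> / 2)))"
      using min_le_sin[of "\<tau> / 2"] \<tau> B by (intro mult_left_mono) auto
    finally show ?thesis using cmod_cis_minus_1[OF \<tau>] by simp
  qed
  have "circ_gagl F \<le> (\<integral>\<^sup>+\<tau>. \<integral>\<^sup>+t. ennreal ((2 * B)\<^sup>2) \<partial>circ \<partial>circ)"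
    unfolding circ_gagl_shift_form[OF F D(3)]
  proof (rule nn_integral_mono_AE)
    show "AE \<tau> in circ. (\<integral>\<^sup>+t. ennreal ((cmod (F (t + \<tau>) - F t))\<^sup>2 / (cmod (cis \<tau> - 1))\<^sup>2) \<partial>circ)
       \<le> (\<integral>\<^sup>+t. ennreal ((2 * B)\<^sup>2) \<partial>circ)"
      using AE_circ_cis_neq_1
    proof eventually_elim
      case (elim \<tau>)
      show ?case
      proof (rule nn_integral_mono, rule ennreal_leI)
        fix t
        have "(cmod (F (t + \<tau>) - F t))\<^sup>2 \<le> (2 * B * cmod (cis \<tau> - 1))\<^sup>2"
          using elim by (intro power_mono key) auto
        then show "(cmod (F (t + \<tau>) - F t))\<^sup>2 / (cmod (cis \<tau> - 1))\<^sup>2 \<le> (2 * B)\<^sup>2"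
          using elim by (simp add: pos_divide_le_eq power_mult_distrib)
      qed
    qed
  qed
  also have "\<dots> < \<infinity>" by (simp add: emeasure_circ ennreal_mult_less_top)
  finally show ?thesis .
qed

section \<open>Degree of circle maps of finite half-energy\<close>

text \<open>Borel representatives for which every property holds at every point, which keeps null
  sets out of the arguments on the circle. \<open>H_half_borel_version\<close> provides one for each
  element of the space.\<close>

definition circ_map :: "(real \<Rightarrow> complex) \<Rightarrow> bool" where
  "circ_map F \<longleftrightarrow> F \<in> borel_measurable borel \<and> periodic F \<and> (\<forall>t. cmod (F t) = 1) \<and> circ_gagl F < \<infinity>"

lemma hmapD:
  assumes "circ_map F"
  shows "F \<in> borel_measurable borel" "periodic F" "\<And>t. cmod (F t) = 1" "circ_gagl F < \<infinity>"
  using assms by (auto simp: circ_map_def)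

definition circ_nrm :: "(real \<Rightarrow> complex) \<Rightarrow> ennreal" where
  "circ_nrm F = circ_L2 F + circ_gagl F"

lemma C1_circ_map: "C1_periodic F F' \<Longrightarrow> (\<And>t. cmod (F t) = 1) \<Longrightarrow> circ_map F"
  using C1_periodic_circ_gagl_finite[of F F'] C1_periodicD[of F F']
  by (auto simp: circ_map_def intro: borel_measurable_continuous_onI)

lemma circ_L2_add_le:
  assumes [measurable]: "F \<in> borel_measurable borel" "G \<in> borel_measurable borel"
  shows "circ_L2 (\<lambda>t. F t + G t) \<le> 2 * circ_L2 F + 2 * circ_L2 G"
proof -
  have "circ_L2 (\<lambda>t. F t + G t) \<le> (\<integral>\<^sup>+t. 2 * ennreal ((cmod (F t))\<^sup>2) + 2 * ennreal ((cmod (G t))\<^sup>2) \<partial>circ)"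
    unfolding circ_L2_def
  proof (rule nn_integral_mono)
    fix t
    have "ennreal ((cmod (F t + G t))\<^sup>2) \<le> ennreal (2 * (cmod (F t))\<^sup>2 + 2 * (cmod (G t))\<^sup>2)"
      by (rule ennreal_leI[OF norm_add_sq_le])
    then show "ennreal ((cmod (F t + G t))\<^sup>2) \<le> 2 * ennreal ((cmod (F t))\<^sup>2) + 2 * ennreal ((cmod (G t))\<^sup>2)"
      by (simp add: ennreal_mult)
  qed
  also have "\<dots> = 2 * circ_L2 F + 2 * circ_L2 G"
    unfolding circ_L2_def by (simp add: nn_integral_add nn_integral_cmult)
  finally show ?thesis .
qed

lemma circ_gagl_uminus: "circ_gagl (\<lambda>t. - F t) = circ_gagl F"
  unfolding circ_gagl_def dquot_def
  by (intro nn_integral_cong) (simp add: norm_minus_commute split: prod.split)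

lemma circ_gagl_add_le:
  assumes [measurable]: "F \<in> borel_measurable borel" "G \<in> borel_measurable borel"
  shows "circ_gagl (\<lambda>t. F t + G t) \<le> 2 * circ_gagl F + 2 * circ_gagl G"
  using circ_gagl_diff_le[of F "\<lambda>t. - G t"] by (simp add: circ_gagl_uminus)

lemma circ_nrm_add_le:
  assumes [measurable]: "F \<in> borel_measurable borel" "G \<in> borel_measurable borel"
  shows "circ_nrm (\<lambda>t. F t + G t) \<le> 2 * circ_nrm F + 2 * circ_nrm G"
proof -
  have "circ_nrm (\<lambda>t. F t + G t) \<le> (2 * circ_L2 F + 2 * circ_L2 G) + (2 * circ_gagl F + 2 * circ_gagl G)"
    unfolding circ_nrm_def by (intro add_mono circ_L2_add_le circ_gagl_add_le) auto
  then show ?thesis by (simp add: circ_nrm_def algebra_simps)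
qed

lemma circ_nrm_triangle:
  assumes [measurable]: "F \<in> borel_measurable borel" "G \<in> borel_measurable borel" "H \<in> borel_measurable borel"
  shows "circ_nrm (\<lambda>t. F t - H t) \<le> 2 * circ_nrm (\<lambda>t. F t - G t) + 2 * circ_nrm (\<lambda>t. G t - H t)"
  using circ_nrm_add_le[of "\<lambda>t. F t - G t" "\<lambda>t. G t - H t"] by simp

text \<open>Bookkeeping for the triangle inequality of a squared norm, whose two terms carry a
  factor 2.\<close>

lemma ennreal_quarter_sum_less:
  fixes \<epsilon> :: ennreal
  assumes "a < ennreal (e / 4)" "b < ennreal (e / 4)" "0 < e"
  shows "2 * a + 2 * b < ennreal e"
proof -
  obtain a' where a: "a = ennreal a'" "0 \<le> a'" using assms(1) by (cases a) auto
  obtain b' where b: "b = ennreal b'" "0 \<le> b'" using assms(2) by (cases b) auto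
  note ab = a b
  then have "a' < e / 4" "b' < e / 4" using assms by (auto simp: ennreal_less_iff)
  then have "2 * a' + 2 * b' < e" by simp
  moreover have "2 * a + 2 * b = ennreal (2 * a' + 2 * b')" using ab by (simp add: ennreal_mult)
  ultimately show ?thesis using ab by (simp only: ennreal_less_iff)
qed

lemma circ_map_approx:
  assumes F: "circ_map F" and e: "0 < e"
  obtains h where "0 < h" "h \<le> 1" "\<And>t. avg h F t \<noteq> 0" "circ_nrm (\<lambda>t. sgn (avg h F t) - F t) < ennreal e"
    "circ_map (\<lambda>t. sgn (avg h F t))"
proof -
  note H = hmapD[OF F]
  note [measurable] = H(1)
  obtain h where h: "0 < h" "h \<le> 1" "\<And>t. 1 / 2 \<le> cmod (avg h F t)"
    "circ_L2 (\<lambda>t. sgn (avg h F t) - F t) < ennreal (e / 4)" "circ_gagl (\<lambda>t. sgn (avg h F t) - F t) < ennreal (e / 4)"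
    using sgn_avg_approximation[OF H(1,3,2,4), of "ennreal (e / 4)"] e by auto
  have nz: "avg h F t \<noteq> 0" for t using h(3)[of t] by auto
  have n: "circ_nrm (\<lambda>t. sgn (avg h F t) - F t) < ennreal e"
  proof -
    have "circ_nrm (\<lambda>t. sgn (avg h F t) - F t) \<le> 2 * circ_L2 (\<lambda>t. sgn (avg h F t) - F t) + 2 * circ_gagl (\<lambda>t. sgn (avg h F t) - F t)"
      unfolding circ_nrm_def by (intro add_mono) (simp_all add: mult_2)
    also have "\<dots> < ennreal e" by (rule ennreal_quarter_sum_less[OF h(4,5) e])
    finally show ?thesis .
  qed
  have sgn_meas: "sgn \<in> borel_measurable (borel :: complex measure)"
    unfolding sgn_div_norm[abs_def] by measurable
  have [measurable]: "avg h F \<in> borel_measurable borel" using h(1) by measurable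
  have m[measurable]: "(\<lambda>t. sgn (avg h F t)) \<in> borel_measurable borel"
    using measurable_compose[OF _ sgn_meas, of "avg h F"] by simp
  have "circ_gagl (\<lambda>t. (sgn (avg h F t) - F t) + F t) \<le> 2 * circ_gagl (\<lambda>t. sgn (avg h F t) - F t) + 2 * circ_gagl F"
    by (rule circ_gagl_add_le) auto
  also have "\<dots> < \<infinity>" using h(5) H(4) by (auto simp: ennreal_mult_less_top intro: order_less_trans)
  finally have "circ_gagl (\<lambda>t. sgn (avg h F t)) < \<infinity>" by simp
  then have "circ_map (\<lambda>t. sgn (avg h F t))"
    using m periodic_avg[OF H(2), of h] nz by (auto simp: circ_map_def periodic_def norm_sgn)
  then show thesis using that h nz n by blast
qed

lemma C1_sgn:
  assumes "C1_periodic F F'" and nz: "\<And>t. F t \<noteq> 0"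
  obtains G' where "C1_periodic (\<lambda>t. sgn (F t)) G'"
proof -
  note D = C1_periodicD[OF assms(1)]
  define N where "N t = (F t \<bullet> F' t) / cmod (F t)" for t
  have dN: "((\<lambda>t. cmod (F t)) has_real_derivative N t) (at t)" for t
  proof -
    have "((\<lambda>t. sqrt (F t \<bullet> F t)) has_real_derivative (2 * (F t \<bullet> F' t)) * (inverse (sqrt (F t \<bullet> F t)) / 2)) (at t)"
    proof -
      have "((\<lambda>t. F t \<bullet> F t) has_real_derivative 2 * (F t \<bullet> F' t)) (at t)"
      proof -
        have "((\<lambda>t. F t \<bullet> F t) has_derivative (\<lambda>h. F t \<bullet> (h *\<^sub>R F' t) + (h *\<^sub>R F' t) \<bullet> F t)) (at t)"
          using D(1)[of t] unfolding has_vector_derivative_def by (intro has_derivative_inner)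
        moreover have "(\<lambda>h. F t \<bullet> (h *\<^sub>R F' t) + (h *\<^sub>R F' t) \<bullet> F t) = (*) (2 * (F t \<bullet> F' t))"
          by (auto simp: fun_eq_iff inner_commute)
        ultimately show ?thesis by (simp add: has_field_derivative_def)
      qed
      then have "((\<lambda>t. sqrt (F t \<bullet> F t)) has_real_derivative (inverse (sqrt (F t \<bullet> F t)) / 2) * (2 * (F t \<bullet> F' t))) (at t)"
        by (intro DERIV_chain2[OF DERIV_real_sqrt]) (use nz[of t] in auto)
      then show ?thesis by (simp only: mult.commute)
    qed
    then show ?thesis by (simp add: norm_eq_sqrt_inner N_def field_simps)
  qed
  define G' where "G' t = inverse (cmod (F t)) *\<^sub>R F' t + (- (inverse (cmod (F t)) * N t * inverse (cmod (F t)))) *\<^sub>R F t" for t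
  have "C1_periodic (\<lambda>t. inverse (cmod (F t)) *\<^sub>R F t) G'"
    unfolding C1_periodic_def
  proof (intro conjI allI)
    fix t
    have "((\<lambda>t. inverse (cmod (F t))) has_real_derivative - (inverse (cmod (F t)) * N t * inverse (cmod (F t)))) (at t)"
      using nz by (intro DERIV_inverse'[OF dN]) auto
    from has_vector_derivative_scaleR[OF this D(1)]
    show "((\<lambda>t. inverse (cmod (F t)) *\<^sub>R F t) has_vector_derivative G' t) (at t)" by (simp add: G'_def)
  next
    show "continuous_on UNIV G'"
      unfolding G'_def N_def using nz by (intro continuous_intros D) auto
    show "periodic (\<lambda>t. inverse (cmod (F t)) *\<^sub>R F t)" using D(3) by (simp add: periodic_def)
  qed
  then show thesis using that by (simp add: sgn_div_norm)
qed

text \<open>One round of averaging and projecting makes the map continuous, a second round makes it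
  continuously differentiable.\<close>

lemma C1_dense:
  assumes F: "circ_map F" and e: "0 < e"
  obtains G G' where "C1_periodic G G'" "\<And>t. cmod (G t) = 1" "circ_nrm (\<lambda>t. G t - F t) < ennreal e"
proof -
  note H = hmapD[OF F]
  obtain h where h: "0 < h" "h \<le> 1" "\<And>t. avg h F t \<noteq> 0" "circ_nrm (\<lambda>t. sgn (avg h F t) - F t) < ennreal (e / 4)"
    and hm: "circ_map (\<lambda>t. sgn (avg h F t))"
    using circ_map_approx[OF F, of "e / 4"] e by auto
  define F1 where "F1 t = sgn (avg h F t)" for t
  have F1: "circ_map F1" using hm unfolding F1_def .
  note H1 = hmapD[OF F1]
  have cont: "continuous_on UNIV F1"
    unfolding F1_def using h continuous_on_avg[OF h(1) H(1), of 1] H(3)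
    by (intro continuous_on_sgn) auto
  obtain k where k: "0 < k" "k \<le> 1" "\<And>t. avg k F1 t \<noteq> 0" "circ_nrm (\<lambda>t. sgn (avg k F1 t) - F1 t) < ennreal (e / 4)"
    and km: "circ_map (\<lambda>t. sgn (avg k F1 t))"
    using circ_map_approx[OF F1, of "e / 4"] e by auto
  have "C1_periodic (avg k F1) (\<lambda>t. (1 / k) *\<^sub>R (F1 (t + k) - F1 t))"
    unfolding C1_periodic_def
  proof (intro conjI allI)
    show "(avg k F1 has_vector_derivative (1 / k) *\<^sub>R (F1 (t + k) - F1 t)) (at t)" for t
      by (rule C1_avg[OF k(1) cont, of 1]) (simp add: H1(3))
    have "continuous_on UNIV (\<lambda>t. F1 (t + k))"
      by (rule continuous_on_compose2[OF cont]) (auto intro!: continuous_intros)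
    then show "continuous_on UNIV (\<lambda>t. (1 / k) *\<^sub>R (F1 (t + k) - F1 t))" by (intro continuous_intros cont)
    show "periodic (avg k F1)" by (rule periodic_avg[OF H1(2)])
  qed
  then obtain G' where G: "C1_periodic (\<lambda>t. sgn (avg k F1 t)) G'" using C1_sgn k(3) by blast
  have "circ_nrm (\<lambda>t. sgn (avg k F1 t) - F t) \<le> 2 * circ_nrm (\<lambda>t. sgn (avg k F1 t) - F1 t) + 2 * circ_nrm (\<lambda>t. F1 t - F t)"
    by (rule circ_nrm_triangle) (use H H1 hmapD[OF km] in auto)
  also have "\<dots> < ennreal e"
    using ennreal_quarter_sum_less[OF k(4) h(4)[folded F1_def] e] .
  finally show thesis using that[OF G] k(3) by (simp add: norm_sgn)
qed

section \<open>Products and conjugates of circle maps\<close>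

lemma circ_gagl_eq_0_const: "circ_gagl (\<lambda>t. c) = 0"
  by (simp add: circ_gagl_def dquot_def)

lemma circ_gagl_diff_const: "circ_gagl (\<lambda>t. F t - c) = circ_gagl F"
  by (simp add: circ_gagl_def dquot_def)

text \<open>The norm does not control the supremum, so a term such as
  \<open>A n t * (H s - H t)\<close> cannot be estimated by norms alone. It tends to 0 by dominated
  convergence, for which the rate \<open>(1/2)^n\<close> provides convergence almost
  everywhere.\<close>

lemma circ_map_mult_tendsto:
  fixes Fn Hn :: "nat \<Rightarrow> real \<Rightarrow> complex"
  assumes hm: "\<And>n. circ_map (Fn n)" "\<And>n. circ_map (Hn n)" "circ_map F" "circ_map H"
    and lim: "\<And>n. circ_nrm (\<lambda>t. Fn n t - F t) \<le> ennreal ((1/2)^n)" "\<And>n. circ_nrm (\<lambda>t. Hn n t - H t) \<le> ennreal ((1/2)^n)"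
  shows "(\<lambda>n. circ_nrm (\<lambda>t. Fn n t * Hn n t - F t * H t)) \<longlonglongrightarrow> 0"
proof -
  note [measurable] = hmapD(1)[OF hm(1)] hmapD(1)[OF hm(2)] hmapD(1)[OF hm(3)] hmapD(1)[OF hm(4)]
  note un = hmapD(3)[OF hm(1)] hmapD(3)[OF hm(2)] hmapD(3)[OF hm(3)] hmapD(3)[OF hm(4)]
  define A where "A n t = Fn n t - F t" for n t
  define B where "B n t = Hn n t - H t" for n t
  have [measurable]: "A n \<in> borel_measurable borel" "B n \<in> borel_measurable borel" for n
    unfolding A_def[abs_def] B_def[abs_def] by measurable
  have bd: "cmod (A n t) \<le> 2" "cmod (B n t) \<le> 2" for n t
    unfolding A_def B_def using norm_triangle_ineq4[of "Fn n t" "F t"] norm_triangle_ineq4[of "Hn n t" "H t"] un by simp_all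
  have half0: "(\<lambda>n. ennreal ((1/2)^n)) \<longlonglongrightarrow> 0"
    using tendsto_ennrealI[OF LIMSEQ_power_zero[of "1/2::real"]] by simp
  have circ_L2_le: "circ_L2 (A n) \<le> ennreal ((1/2)^n)" "circ_L2 (B n) \<le> ennreal ((1/2)^n)"
    and circ_gagl_le: "circ_gagl (A n) \<le> ennreal ((1/2)^n)" "circ_gagl (B n) \<le> ennreal ((1/2)^n)" for n
  proof -
    have "circ_L2 X \<le> circ_nrm X" "circ_gagl X \<le> circ_nrm X" for X by (simp_all add: circ_nrm_def)
    then show "circ_L2 (A n) \<le> ennreal ((1/2)^n)" "circ_L2 (B n) \<le> ennreal ((1/2)^n)"
      "circ_gagl (A n) \<le> ennreal ((1/2)^n)" "circ_gagl (B n) \<le> ennreal ((1/2)^n)"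
      using lim[of n] unfolding A_def[abs_def] B_def[abs_def] by (blast intro: order_trans)+
  qed
  have tz: "X \<longlonglongrightarrow> 0" if "\<And>n. X n \<le> ennreal ((1/2)^n)" for X :: "nat \<Rightarrow> ennreal"
    by (rule tendsto_sandwich[OF _ _ tendsto_const half0]) (auto simp: that)
  have AEz: "AE z in circ \<Otimes>\<^sub>M circ. (\<lambda>n. (cmod (X n (snd z)))\<^sup>2) \<longlonglongrightarrow> 0"
    if X[measurable]: "\<And>n. X n \<in> borel_measurable borel" and X2: "\<And>n. circ_L2 (X n) \<le> ennreal ((1/2)^n)" for X :: "nat \<Rightarrow> real \<Rightarrow> complex"
  proof -
    have "AE t in circ. (\<lambda>n. (cmod (X n t))\<^sup>2) \<longlonglongrightarrow> 0"
      by (rule AE_tendsto_0_of_summable_nn_integral[where b="\<lambda>n. (1/2)^n"])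
        (use X2 in \<open>auto simp: circ_L2_def\<close>)
    then show ?thesis by (rule AE_pair_snd[OF circ.sigma_finite_measure_axioms])
  qed
  have wt: "(\<lambda>n. \<integral>\<^sup>+z. ennreal ((cmod (X n (snd z)))\<^sup>2 * dquot K z) \<partial>(circ \<Otimes>\<^sub>M circ)) \<longlonglongrightarrow> 0"
    if X[measurable]: "\<And>n. X n \<in> borel_measurable borel" and X2: "\<And>n. circ_L2 (X n) \<le> ennreal ((1/2)^n)"
      and Xb: "\<And>n t. cmod (X n t) \<le> 2" and K[measurable]: "K \<in> borel_measurable borel" and Kf: "circ_gagl K < \<infinity>"
    for X :: "nat \<Rightarrow> real \<Rightarrow> complex" and K
  proof -
    have "(\<lambda>n. \<integral>\<^sup>+z. ennreal ((cmod (X n (snd z)))\<^sup>2 * dquot K z) \<partial>(circ \<Otimes>\<^sub>M circ)) \<longlonglongrightarrow> (\<integral>\<^sup>+z. 0 \<partial>(circ \<Otimes>\<^sub>M circ))"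
    proof (rule nn_integral_dominated_convergence[where w="\<lambda>z. ennreal (4 * dquot K z)"])
      show "AE z in circ \<Otimes>\<^sub>M circ. ennreal ((cmod (X n (snd z)))\<^sup>2 * dquot K z) \<le> ennreal (4 * dquot K z)" for n
      proof (intro AE_I2 ennreal_leI mult_right_mono)
        show "(cmod (X n (snd z)))\<^sup>2 \<le> 4" for z :: "real \<times> real" using power_mono[OF Xb, of n "snd z" 2] by simp
      qed simp
      show "(\<integral>\<^sup>+z. ennreal (4 * dquot K z) \<partial>(circ \<Otimes>\<^sub>M circ)) < \<infinity>"
        using Kf unfolding circ_gagl_def by (simp add: ennreal_mult nn_integral_cmult ennreal_mult_less_top)
      show "AE z in circ \<Otimes>\<^sub>M circ. (\<lambda>n. ennreal ((cmod (X n (snd z)))\<^sup>2 * dquot K z)) \<longlonglongrightarrow> 0"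
        using AEz[OF X X2]
      proof eventually_elim
        case (elim z)
        have "(\<lambda>n. (cmod (X n (snd z)))\<^sup>2 * dquot K z) \<longlonglongrightarrow> 0 * dquot K z" by (intro tendsto_mult elim tendsto_const)
        then show ?case using tendsto_ennrealI by fastforce
      qed
    qed auto
    then show ?thesis by simp
  qed
  define P where "P n t = Fn n t * Hn n t - F t * H t" for n t
  have [measurable]: "P n \<in> borel_measurable borel" for n unfolding P_def[abs_def] by measurable
  have pt: "dquot (P n) z \<le> 4 * dquot (A n) z + 36 * dquot (B n) z
      + 4 * ((cmod (A n (snd z)))\<^sup>2 * dquot H z) + 4 * ((cmod (B n (snd z)))\<^sup>2 * dquot F z)" for n z
  proof (cases z)
    case (Pair s t)
    \<comment> \<open>Increments of \<open>A n\<close> and \<open>B n\<close> come with bounded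
      factors, and otherwise the values of \<open>A n\<close> and \<open>B n\<close> meet only
      increments of the fixed maps. The two increments of \<open>B n\<close>, with factors 2 and 1,
      lead to the constant 36, four times the square of 3.\<close>
    have "P n s - P n t = (A n s - A n t) * Hn n s + A n t * (H s - H t) + A n t * (B n s - B n t)
        + (F s - F t) * B n t + F s * (B n s - B n t)"
      by (simp add: P_def A_def B_def algebra_simps)
    also have "cmod \<dots> \<le> cmod ((A n s - A n t) * Hn n s) + cmod (A n t * (H s - H t)) + cmod (A n t * (B n s - B n t))
        + cmod ((F s - F t) * B n t) + cmod (F s * (B n s - B n t))"
      by (intro order_trans[OF norm_triangle_ineq] add_right_mono order_refl)
    also have "\<dots> \<le> cmod (A n s - A n t) + cmod (A n t) * cmod (H s - H t) + 2 * cmod (B n s - B n t)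
        + cmod (F s - F t) * cmod (B n t) + cmod (B n s - B n t)"
      using bd(1)[of n t] un by (intro add_mono) (auto simp: norm_mult intro!: mult_right_mono)
    finally have "cmod (P n s - P n t) \<le> cmod (A n s - A n t) + 3 * cmod (B n s - B n t)
        + cmod (A n t) * cmod (H s - H t) + cmod (B n t) * cmod (F s - F t)" by (simp add: algebra_simps)
    then have "(cmod (P n s - P n t))\<^sup>2 \<le> (cmod (A n s - A n t) + 3 * cmod (B n s - B n t)
        + cmod (A n t) * cmod (H s - H t) + cmod (B n t) * cmod (F s - F t))\<^sup>2" by (intro power_mono) auto
    also have "\<dots> \<le> 4 * ((cmod (A n s - A n t))\<^sup>2 + (3 * cmod (B n s - B n t))\<^sup>2
        + (cmod (A n t) * cmod (H s - H t))\<^sup>2 + (cmod (B n t) * cmod (F s - F t))\<^sup>2)"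
    proof -
      have "(a + b + c + d)\<^sup>2 \<le> 4 * (a\<^sup>2 + b\<^sup>2 + c\<^sup>2 + d\<^sup>2)" for a b c d :: real
      proof -
        have "0 \<le> (a - b)\<^sup>2 + (a - c)\<^sup>2 + (a - d)\<^sup>2 + (b - c)\<^sup>2 + (b - d)\<^sup>2 + (c - d)\<^sup>2" by simp
        then show ?thesis by (simp add: power2_eq_square algebra_simps)
      qed
      then show ?thesis .
    qed
    finally have "(cmod (P n s - P n t))\<^sup>2 / (cmod (cis s - cis t))\<^sup>2 \<le> 4 * ((cmod (A n s - A n t))\<^sup>2 + (3 * cmod (B n s - B n t))\<^sup>2
        + (cmod (A n t) * cmod (H s - H t))\<^sup>2 + (cmod (B n t) * cmod (F s - F t))\<^sup>2) / (cmod (cis s - cis t))\<^sup>2"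
      by (rule divide_right_mono) simp
    then show ?thesis by (simp add: Pair dquot_def power_mult_distrib add_divide_distrib algebra_simps)
  qed
  have "(\<lambda>n. circ_gagl (P n)) \<longlonglongrightarrow> 0"
  proof (rule tendsto_sandwich[OF _ _ tendsto_const])
    show "eventually (\<lambda>n. circ_gagl (P n) \<le> 4 * circ_gagl (A n) + 36 * circ_gagl (B n)
      + 4 * (\<integral>\<^sup>+z. ennreal ((cmod (A n (snd z)))\<^sup>2 * dquot H z) \<partial>(circ \<Otimes>\<^sub>M circ))
      + 4 * (\<integral>\<^sup>+z. ennreal ((cmod (B n (snd z)))\<^sup>2 * dquot F z) \<partial>(circ \<Otimes>\<^sub>M circ))) sequentially"
    proof (rule always_eventually, rule allI)
      fix n
      have "circ_gagl (P n) \<le> (\<integral>\<^sup>+z. 4 * ennreal (dquot (A n) z) + 36 * ennreal (dquot (B n) z)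
          + 4 * ennreal ((cmod (A n (snd z)))\<^sup>2 * dquot H z) + 4 * ennreal ((cmod (B n (snd z)))\<^sup>2 * dquot F z) \<partial>(circ \<Otimes>\<^sub>M circ))"
        unfolding circ_gagl_def
      proof (rule nn_integral_mono)
        fix z
        have "ennreal (dquot (P n) z) \<le> ennreal (4 * dquot (A n) z + 36 * dquot (B n) z
          + 4 * ((cmod (A n (snd z)))\<^sup>2 * dquot H z) + 4 * ((cmod (B n (snd z)))\<^sup>2 * dquot F z))"
          by (rule ennreal_leI[OF pt])
        then show "ennreal (dquot (P n) z) \<le> 4 * ennreal (dquot (A n) z) + 36 * ennreal (dquot (B n) z)
          + 4 * ennreal ((cmod (A n (snd z)))\<^sup>2 * dquot H z) + 4 * ennreal ((cmod (B n (snd z)))\<^sup>2 * dquot F z)"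
          by (simp add: ennreal_mult)
      qed
      also have "\<dots> = 4 * circ_gagl (A n) + 36 * circ_gagl (B n)
        + 4 * (\<integral>\<^sup>+z. ennreal ((cmod (A n (snd z)))\<^sup>2 * dquot H z) \<partial>(circ \<Otimes>\<^sub>M circ))
        + 4 * (\<integral>\<^sup>+z. ennreal ((cmod (B n (snd z)))\<^sup>2 * dquot F z) \<partial>(circ \<Otimes>\<^sub>M circ))"
        unfolding circ_gagl_def by (simp add: nn_integral_add nn_integral_cmult)
      finally show "circ_gagl (P n) \<le> \<dots>" .
    qed
    have "(\<lambda>n. 4 * circ_gagl (A n) + 36 * circ_gagl (B n)
      + 4 * (\<integral>\<^sup>+z. ennreal ((cmod (A n (snd z)))\<^sup>2 * dquot H z) \<partial>(circ \<Otimes>\<^sub>M circ))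
      + 4 * (\<integral>\<^sup>+z. ennreal ((cmod (B n (snd z)))\<^sup>2 * dquot F z) \<partial>(circ \<Otimes>\<^sub>M circ))) \<longlonglongrightarrow> 4 * 0 + 36 * 0 + 4 * 0 + 4 * 0"
      using hmapD(4)[OF hm(3)] hmapD(4)[OF hm(4)]
      by (intro tendsto_add ennreal_tendsto_cmult tz circ_gagl_le wt circ_L2_le bd) auto
    then show "(\<lambda>n. 4 * circ_gagl (A n) + 36 * circ_gagl (B n)
      + 4 * (\<integral>\<^sup>+z. ennreal ((cmod (A n (snd z)))\<^sup>2 * dquot H z) \<partial>(circ \<Otimes>\<^sub>M circ))
      + 4 * (\<integral>\<^sup>+z. ennreal ((cmod (B n (snd z)))\<^sup>2 * dquot F z) \<partial>(circ \<Otimes>\<^sub>M circ))) \<longlonglongrightarrow> 0" by simp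
  qed auto
  moreover have "(\<lambda>n. circ_L2 (P n)) \<longlonglongrightarrow> 0"
  proof (rule tendsto_sandwich[OF _ _ tendsto_const])
    show "eventually (\<lambda>n. circ_L2 (P n) \<le> 2 * circ_L2 (A n) + 2 * circ_L2 (B n)) sequentially"
    proof (rule always_eventually, rule allI)
      fix n
      have "circ_L2 (P n) = circ_L2 (\<lambda>t. A n t * Hn n t + F t * B n t)" by (simp add: P_def[abs_def] A_def B_def algebra_simps)
      also have "\<dots> \<le> 2 * circ_L2 (\<lambda>t. A n t * Hn n t) + 2 * circ_L2 (\<lambda>t. F t * B n t)" by (rule circ_L2_add_le) auto
      also have "\<dots> = 2 * circ_L2 (A n) + 2 * circ_L2 (B n)" by (simp add: circ_L2_def norm_mult un)
      finally show "circ_L2 (P n) \<le> 2 * circ_L2 (A n) + 2 * circ_L2 (B n)" .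
    qed
    have "(\<lambda>n. 2 * circ_L2 (A n) + 2 * circ_L2 (B n)) \<longlonglongrightarrow> 2 * 0 + 2 * 0"
      by (intro tendsto_add ennreal_tendsto_cmult tz circ_L2_le) auto
    then show "(\<lambda>n. 2 * circ_L2 (A n) + 2 * circ_L2 (B n)) \<longlonglongrightarrow> 0" by simp
  qed auto
  ultimately have "(\<lambda>n. circ_L2 (P n) + circ_gagl (P n)) \<longlonglongrightarrow> 0 + 0" by (intro tendsto_add)
  then show ?thesis by (simp add: circ_nrm_def P_def[abs_def])
qed

lemma circ_gagl_cnj: "circ_gagl (\<lambda>t. cnj (F t)) = circ_gagl F"
proof -
  have "cmod (cnj a - cnj b) = cmod (a - b)" for a b by (simp only: complex_cnj_diff[symmetric] complex_mod_cnj)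
  then show ?thesis unfolding circ_gagl_def dquot_def by simp
qed

lemma circ_L2_cnj_diff: "circ_L2 (\<lambda>t. cnj (F t) - cnj (G t)) = circ_L2 (\<lambda>t. F t - G t)"
  unfolding circ_L2_def by (simp only: complex_cnj_diff[symmetric] complex_mod_cnj)

lemma circ_nrm_cnj_diff: "circ_nrm (\<lambda>t. cnj (F t) - cnj (G t)) = circ_nrm (\<lambda>t. F t - G t)"
  using circ_gagl_cnj[of "\<lambda>t. F t - G t"] by (simp add: circ_nrm_def circ_L2_cnj_diff)

lemma circ_map_cnj: "circ_map F \<Longrightarrow> circ_map (\<lambda>t. cnj (F t))"
  unfolding circ_map_def circ_gagl_cnj periodic_def by (auto intro: measurable_compose[OF _ cnj_measurable])

lemma circ_gagl_mult_le:
  assumes [measurable]: "F \<in> borel_measurable borel" "G \<in> borel_measurable borel"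
    and un: "\<And>t. cmod (F t) = 1" "\<And>t. cmod (G t) = 1"
  shows "circ_gagl (\<lambda>t. F t * G t) \<le> 2 * circ_gagl F + 2 * circ_gagl G"
proof -
  have pt: "dquot (\<lambda>t. F t * G t) z \<le> 2 * dquot F z + 2 * dquot G z" for z
  proof (cases z)
    case (Pair s t)
    have "F s * G s - F t * G t = (F s - F t) * G s + F t * (G s - G t)" by (simp add: algebra_simps)
    then have "(cmod (F s * G s - F t * G t))\<^sup>2 \<le> 2 * (cmod ((F s - F t) * G s))\<^sup>2 + 2 * (cmod (F t * (G s - G t)))\<^sup>2"
      by (metis norm_add_sq_le)
    then have "(cmod (F s * G s - F t * G t))\<^sup>2 \<le> 2 * (cmod (F s - F t))\<^sup>2 + 2 * (cmod (G s - G t))\<^sup>2"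
      by (simp add: norm_mult un)
    then show ?thesis
      unfolding Pair dquot_def by (simp add: algebra_simps add_divide_distrib[symmetric] divide_right_mono)
  qed
  have "circ_gagl (\<lambda>t. F t * G t) \<le> (\<integral>\<^sup>+z. 2 * ennreal (dquot F z) + 2 * ennreal (dquot G z) \<partial>(circ \<Otimes>\<^sub>M circ))"
    unfolding circ_gagl_def
  proof (rule nn_integral_mono)
    fix z
    have "ennreal (dquot (\<lambda>t. F t * G t) z) \<le> ennreal (2 * dquot F z + 2 * dquot G z)"
      by (rule ennreal_leI[OF pt])
    then show "ennreal (dquot (\<lambda>t. F t * G t) z) \<le> 2 * ennreal (dquot F z) + 2 * ennreal (dquot G z)"
      by (simp add: ennreal_mult)
  qed
  also have "\<dots> = 2 * circ_gagl F + 2 * circ_gagl G"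
    unfolding circ_gagl_def by (simp add: nn_integral_add nn_integral_cmult)
  finally show ?thesis .
qed

lemma circ_map_mult:
  assumes "circ_map F" "circ_map G"
  shows "circ_map (\<lambda>t. F t * G t)"
proof -
  note [measurable] = hmapD(1)[OF assms(1)] hmapD(1)[OF assms(2)]
  have "circ_gagl (\<lambda>t. F t * G t) < \<infinity>"
    by (rule order_le_less_trans[OF circ_gagl_mult_le])
      (use hmapD[OF assms(1)] hmapD[OF assms(2)] in \<open>auto simp: ennreal_mult_less_top\<close>)
  then show ?thesis
    using hmapD[OF assms(1)] hmapD[OF assms(2)] by (auto simp: circ_map_def periodic_def norm_mult)
qed

lemma less_ennreal_minD:
  assumes "x < ennreal (min a b)"
  shows "x < ennreal a" "x < ennreal b"
  using assms by (meson ennreal_leI min.cobounded1 min.cobounded2 order_less_le_trans)+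

lemma wind_cnj:
  assumes F: "C1_periodic F F'" "\<And>t. cmod (F t) = 1"
  shows "C1_periodic (\<lambda>t. cnj (F t)) (\<lambda>t. cnj (F' t))"
    and "wind (\<lambda>t. cnj (F t)) (\<lambda>t. cnj (F' t)) = - wind F F'"
proof -
  note D = C1_periodicD[OF F(1)]
  show "C1_periodic (\<lambda>t. cnj (F t)) (\<lambda>t. cnj (F' t))"
    unfolding C1_periodic_def using D(3)
    by (auto intro!: bounded_linear.has_vector_derivative[OF bounded_linear_cnj] continuous_intros D simp: periodic_def)
  obtain n :: int where n: "wind F F' = 2 * of_real pi * \<i> * of_int n" using wind_integer[OF F] .
  have "wind (\<lambda>t. cnj (F t)) (\<lambda>t. cnj (F' t)) = cnj (wind F F')"
    using Bochner_Integration.integral_cnj[of circ "\<lambda>t. cnj (F t) * F' t"] by (simp add: wind_def)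
  then show "wind (\<lambda>t. cnj (F t)) (\<lambda>t. cnj (F' t)) = - wind F F'" by (simp add: n)
qed

text \<open>By integrality a nonzero winding integral has modulus at least \<open>2 * pi\<close>,
  and then \<open>wind_bound\<close> gives energy at least \<open>4 * pi\<^sup>2\<close>.\<close>

lemma wind_eq_0:
  assumes F: "C1_periodic F F'" "\<And>t. cmod (F t) = 1" and small: "circ_gagl F < ennreal (4 * pi\<^sup>2)"
  shows "wind F F' = 0"
proof -
  obtain n :: int where n: "wind F F' = 2 * of_real pi * \<i> * of_int n" using wind_integer[OF F] .
  have "ennreal (2 * pi * cmod (wind F F')) < ennreal (4 * pi\<^sup>2)"
    by (rule order_le_less_trans[OF wind_bound[OF F] small])
  then have "2 * pi * cmod (wind F F') < 4 * pi\<^sup>2" by (simp add: ennreal_less_iff)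
  moreover have "cmod (wind F F') = 2 * pi * \<bar>of_int n\<bar>" unfolding n by (simp add: norm_mult)
  ultimately have "4 * pi\<^sup>2 * \<bar>of_int n\<bar> < 4 * pi\<^sup>2 * (1::real)"
    by (simp only: power2_eq_square)
  moreover have "0 < 4 * pi\<^sup>2" by simp
  ultimately have "\<bar>real_of_int n\<bar> < 1" using mult_less_cancel_left_pos by blast
  then have "n = 0" by linarith
  then show ?thesis using n by simp
qed

section \<open>The degree as a locally constant extension of the winding number\<close>

definition C1_near :: "(real \<Rightarrow> complex) \<Rightarrow> real \<Rightarrow> (real \<Rightarrow> complex) \<Rightarrow> (real \<Rightarrow> complex) \<Rightarrow> bool" where
  "C1_near F \<delta> G G' \<longleftrightarrow> C1_periodic G G' \<and> (\<forall>t. cmod (G t) = 1) \<and> circ_nrm (\<lambda>t. G t - F t) < ennreal \<delta>"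

text \<open>The quotient of two maps close to \<open>F\<close> has small energy, hence winding number 0.\<close>

lemma wind_locally_constant:
  assumes F: "circ_map F"
  shows "\<exists>\<delta>>0. \<forall>G1 G1' G2 G2'. C1_near F \<delta> G1 G1' \<longrightarrow> C1_near F \<delta> G2 G2' \<longrightarrow> wind G1 G1' = wind G2 G2'"
proof (rule ccontr)
  assume neg: "\<not> ?thesis"
  \<comment> \<open>Radii \<open>(1/2)^n\<close> supply the rate that
    \<open>circ_map_mult_tendsto\<close> asks for.\<close>
  have "\<exists>G1 G1' G2 G2'. C1_near F ((1/2)^n) G1 G1' \<and> C1_near F ((1/2)^n) G2 G2' \<and> wind G1 G1' \<noteq> wind G2 G2'" for n
  proof -
    have "(0::real) < (1/2)^n" by simp
    with neg show ?thesis by blast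
  qed
  then obtain G1 G1' G2 G2' where G0:
    "\<And>n. C1_near F ((1/2)^n) (G1 n) (G1' n)" "\<And>n. C1_near F ((1/2)^n) (G2 n) (G2' n)"
    "\<And>n. wind (G1 n) (G1' n) \<noteq> wind (G2 n) (G2' n)" by metis
  have G:
    "\<And>n. C1_periodic (G1 n) (G1' n)" "\<And>n t. cmod (G1 n t) = 1" "\<And>n. circ_nrm (\<lambda>t. G1 n t - F t) < ennreal ((1/2)^n)"
    "\<And>n. C1_periodic (G2 n) (G2' n)" "\<And>n t. cmod (G2 n t) = 1" "\<And>n. circ_nrm (\<lambda>t. G2 n t - F t) < ennreal ((1/2)^n)"
    using G0(1,2) unfolding C1_near_def by blast+
  have "(\<lambda>n. circ_nrm (\<lambda>t. G1 n t * cnj (G2 n t) - F t * cnj (F t))) \<longlonglongrightarrow> 0"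
    by (rule circ_map_mult_tendsto)
      (use G in \<open>auto simp: circ_nrm_cnj_diff intro: less_imp_le F circ_map_cnj C1_circ_map[OF G(1,2)] C1_circ_map[OF G(4,5)]\<close>)
  moreover have "F t * cnj (F t) = 1" for t
    using hmapD(3)[OF F, of t] complex_norm_square[of "F t"] by simp
  ultimately have "(\<lambda>n. circ_nrm (\<lambda>t. G1 n t * cnj (G2 n t) - 1)) \<longlonglongrightarrow> 0" by simp
  then have "eventually (\<lambda>n. circ_nrm (\<lambda>t. G1 n t * cnj (G2 n t) - 1) < ennreal (4 * pi\<^sup>2)) sequentially"
    by (rule order_tendstoD(2)) simp
  then obtain n where n: "circ_nrm (\<lambda>t. G1 n t * cnj (G2 n t) - 1) < ennreal (4 * pi\<^sup>2)"
    unfolding eventually_sequentially by blast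
  have "circ_gagl (\<lambda>t. G1 n t * cnj (G2 n t)) \<le> circ_nrm (\<lambda>t. G1 n t * cnj (G2 n t) - 1)"
    by (simp add: circ_nrm_def circ_gagl_diff_const)
  then have small: "circ_gagl (\<lambda>t. G1 n t * cnj (G2 n t)) < ennreal (4 * pi\<^sup>2)" using n by (rule order_le_less_trans)
  note c = wind_cnj[OF G(4,5), of n]
  have un: "cmod (cnj (G2 n t)) = 1" for t by (simp add: G)
  note m = wind_mult[OF G(1,2) c(1) un, of n]
  have "wind (\<lambda>t. G1 n t * cnj (G2 n t)) (\<lambda>t. G1 n t * cnj (G2' n t) + G1' n t * cnj (G2 n t)) = 0"
    by (rule wind_eq_0[OF m(1) _ small]) (simp add: norm_mult G)
  then show False using m(2) c(2) G0(3)[of n] by simp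
qed

text \<open>The winding number shared by all smooth maps close to \<open>F\<close>. Local constancy
  gives existence; density of smooth maps keeps the condition from being vacuous and gives
  uniqueness.\<close>

definition hdeg :: "(real \<Rightarrow> complex) \<Rightarrow> int" where
  "hdeg F = (THE n. \<exists>\<delta>>0. \<forall>G G'. C1_periodic G G' \<longrightarrow> (\<forall>t. cmod (G t) = 1) \<longrightarrow>
    circ_nrm (\<lambda>t. G t - F t) < ennreal \<delta> \<longrightarrow> wind G G' = 2 * of_real pi * \<i> * of_int n)"

lemma hdeg:
  assumes F: "circ_map F"
  shows "\<exists>\<delta>>0. \<forall>G G'. C1_periodic G G' \<longrightarrow> (\<forall>t. cmod (G t) = 1) \<longrightarrow>
    circ_nrm (\<lambda>t. G t - F t) < ennreal \<delta> \<longrightarrow> wind G G' = 2 * of_real pi * \<i> * of_int (hdeg F)"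
  unfolding hdeg_def
proof (rule theI')
  obtain \<delta> where \<delta>0: "0 < \<delta>" "\<And>G1 G1' G2 G2'. C1_near F \<delta> G1 G1' \<Longrightarrow> C1_near F \<delta> G2 G2' \<Longrightarrow> wind G1 G1' = wind G2 G2'"
    using wind_locally_constant[OF F] by blast
  have \<delta>: "0 < \<delta>" "C1_periodic G1 G1' \<Longrightarrow> (\<And>t. cmod (G1 t) = 1) \<Longrightarrow>
    circ_nrm (\<lambda>t. G1 t - F t) < ennreal \<delta> \<Longrightarrow> C1_periodic G2 G2' \<Longrightarrow> (\<And>t. cmod (G2 t) = 1) \<Longrightarrow>
    circ_nrm (\<lambda>t. G2 t - F t) < ennreal \<delta> \<Longrightarrow> wind G1 G1' = wind G2 G2'" for G1 G1' G2 G2'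
    using \<delta>0 by (auto simp: C1_near_def)
  obtain G G' where G: "C1_periodic G G'" "\<And>t. cmod (G t) = 1" "circ_nrm (\<lambda>t. G t - F t) < ennreal \<delta>"
    using C1_dense[OF F \<delta>(1)] by blast
  obtain n :: int where n: "wind G G' = 2 * of_real pi * \<i> * of_int n" using wind_integer[OF G(1,2)] .
  show "\<exists>!n::int. \<exists>\<delta>>0. \<forall>G G'. C1_periodic G G' \<longrightarrow> (\<forall>t. cmod (G t) = 1) \<longrightarrow>
    circ_nrm (\<lambda>t. G t - F t) < ennreal \<delta> \<longrightarrow> wind G G' = 2 * of_real pi * \<i> * of_int n"
  proof (rule ex1I[of _ n])
    show "\<exists>\<delta>>0. \<forall>G G'. C1_periodic G G' \<longrightarrow> (\<forall>t. cmod (G t) = 1) \<longrightarrow>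
      circ_nrm (\<lambda>t. G t - F t) < ennreal \<delta> \<longrightarrow> wind G G' = 2 * of_real pi * \<i> * of_int n"
      using \<delta>(1) \<delta>(2)[OF _ _ _ G] n by (intro exI[of _ \<delta>]) auto
    fix m :: int
    assume "\<exists>\<delta>>0. \<forall>G G'. C1_periodic G G' \<longrightarrow> (\<forall>t. cmod (G t) = 1) \<longrightarrow>
      circ_nrm (\<lambda>t. G t - F t) < ennreal \<delta> \<longrightarrow> wind G G' = 2 * of_real pi * \<i> * of_int m"
    then obtain \<delta>' where \<delta>': "0 < \<delta>'" "\<And>G G'. C1_periodic G G' \<Longrightarrow> (\<And>t. cmod (G t) = 1) \<Longrightarrow>
      circ_nrm (\<lambda>t. G t - F t) < ennreal \<delta>' \<Longrightarrow> wind G G' = 2 * of_real pi * \<i> * of_int m" by blast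
    obtain K K' where K: "C1_periodic K K'" "\<And>t. cmod (K t) = 1" "circ_nrm (\<lambda>t. K t - F t) < ennreal (min \<delta> \<delta>')"
      using C1_dense[OF F, of "min \<delta> \<delta>'"] \<delta>(1) \<delta>'(1) by auto
    have "circ_nrm (\<lambda>t. K t - F t) < ennreal \<delta>" "circ_nrm (\<lambda>t. K t - F t) < ennreal \<delta>'"
      using less_ennreal_minD[OF K(3)] .
    then have "wind G G' = 2 * of_real pi * \<i> * of_int m"
      using \<delta>(2)[OF G K(1,2)] \<delta>'(2)[OF K(1,2)] by simp
    then show "m = n" using n by simp
  qed
qed

lemma hdeg_C1:
  assumes G: "C1_periodic G G'" "\<And>t. cmod (G t) = 1" and hF: "circ_map F" and 0: "circ_nrm (\<lambda>t. G t - F t) = 0"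
  shows "wind G G' = 2 * of_real pi * \<i> * of_int (hdeg F)"
  using hdeg[OF hF] G 0 by auto

text \<open>One smooth map close enough to \<open>G\<close> computes both degrees.\<close>

lemma hdeg_locally_constant:
  assumes F: "circ_map F"
  obtains \<delta> where "0 < \<delta>" "\<And>G. circ_map G \<Longrightarrow> circ_nrm (\<lambda>t. G t - F t) < ennreal \<delta> \<Longrightarrow> hdeg G = hdeg F"
proof -
  obtain \<delta> where \<delta>: "0 < \<delta>" "\<And>G G'. C1_periodic G G' \<Longrightarrow> (\<And>t. cmod (G t) = 1) \<Longrightarrow>
      circ_nrm (\<lambda>t. G t - F t) < ennreal \<delta> \<Longrightarrow> wind G G' = 2 * of_real pi * \<i> * of_int (hdeg F)"
    using hdeg[OF F] by blast
  show thesis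
  proof (rule that[of "\<delta> / 4"])
    fix G assume G: "circ_map G" and near: "circ_nrm (\<lambda>t. G t - F t) < ennreal (\<delta> / 4)"
    obtain \<delta>' where \<delta>': "0 < \<delta>'" "\<And>K K'. C1_periodic K K' \<Longrightarrow> (\<And>t. cmod (K t) = 1) \<Longrightarrow>
        circ_nrm (\<lambda>t. K t - G t) < ennreal \<delta>' \<Longrightarrow> wind K K' = 2 * of_real pi * \<i> * of_int (hdeg G)"
      using hdeg[OF G] by blast
    obtain K K' where K: "C1_periodic K K'" "\<And>t. cmod (K t) = 1" "circ_nrm (\<lambda>t. K t - G t) < ennreal (min (\<delta> / 4) \<delta>')"
      using C1_dense[OF G, of "min (\<delta> / 4) \<delta>'"] \<delta>(1) \<delta>'(1) by auto
    have k: "circ_nrm (\<lambda>t. K t - G t) < ennreal (\<delta> / 4)" "circ_nrm (\<lambda>t. K t - G t) < ennreal \<delta>'"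
      using less_ennreal_minD[OF K(3)] .
    have "circ_nrm (\<lambda>t. K t - F t) \<le> 2 * circ_nrm (\<lambda>t. K t - G t) + 2 * circ_nrm (\<lambda>t. G t - F t)"
      using hmapD(1)[OF C1_circ_map[OF K(1,2)]] hmapD(1)[OF G] hmapD(1)[OF F] by (rule circ_nrm_triangle)
    also have "\<dots> < ennreal \<delta>" by (rule ennreal_quarter_sum_less[OF k(1) near \<delta>(1)])
    finally have "wind K K' = 2 * of_real pi * \<i> * of_int (hdeg F)" by (rule \<delta>(2)[OF K(1,2)])
    then show "hdeg G = hdeg F" using \<delta>'(2)[OF K(1,2) k(2)] by simp
  qed (use \<delta> in simp)
qed

lemma C1_dense_seq:
  assumes F: "circ_map F"
  obtains G G' where "\<And>n. C1_periodic (G n) (G' n)" "\<And>n t. cmod (G n t) = 1"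
    "\<And>n. circ_nrm (\<lambda>t. G n t - F t) \<le> ennreal ((1/2)^n)" "\<And>n. circ_map (G n)"
    "eventually (\<lambda>n. wind (G n) (G' n) = 2 * of_real pi * \<i> * of_int (hdeg F)) sequentially"
proof -
  have "\<exists>G G'. C1_periodic G G' \<and> (\<forall>t. cmod (G t) = 1) \<and> circ_nrm (\<lambda>t. G t - F t) < ennreal ((1/2)^n)" for n :: nat
  proof -
    obtain G G' where "C1_periodic G G'" "\<And>t. cmod (G t) = 1" "circ_nrm (\<lambda>t. G t - F t) < ennreal ((1/2)^n)"
      using C1_dense[OF F, of "(1/2)^n"] by auto
    then show ?thesis by blast
  qed
  then obtain G G' where G: "\<And>n. C1_periodic (G n) (G' n)" "\<And>n t. cmod (G n t) = 1"
    "\<And>n. circ_nrm (\<lambda>t. G n t - F t) < ennreal ((1/2)^n)" by metis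
  obtain \<delta> where \<delta>: "0 < \<delta>" "\<And>G G'. C1_periodic G G' \<Longrightarrow> (\<And>t. cmod (G t) = 1) \<Longrightarrow>
      circ_nrm (\<lambda>t. G t - F t) < ennreal \<delta> \<Longrightarrow> wind G G' = 2 * of_real pi * \<i> * of_int (hdeg F)"
    using hdeg[OF F] by blast
  have "eventually (\<lambda>n. (1/2::real)^n < \<delta>) sequentially"
    using \<delta>(1) by (intro order_tendstoD(2)[OF LIMSEQ_power_zero]) auto
  then have "eventually (\<lambda>n. wind (G n) (G' n) = 2 * of_real pi * \<i> * of_int (hdeg F)) sequentially"
  proof eventually_elim
    case (elim n)
    then have "circ_nrm (\<lambda>t. G n t - F t) < ennreal \<delta>"
      by (intro order_less_le_trans[OF G(3)] ennreal_leI) simp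
    then show ?case by (rule \<delta>(2)[OF G(1,2)])
  qed
  moreover have "circ_nrm (\<lambda>t. G n t - F t) \<le> ennreal ((1/2)^n)" "circ_map (G n)" for n
    using G(3)[of n] C1_circ_map[OF G(1,2), of n] by (auto intro: less_imp_le)
  ultimately show thesis using that[of G G'] G(1,2) by blast
qed

text \<open>Products of smooth approximations approximate the product, and winding numbers of smooth
  maps add.\<close>

lemma hdeg_mult:
  assumes F: "circ_map F" and H: "circ_map H"
  shows "hdeg (\<lambda>t. F t * H t) = hdeg F + hdeg H"
proof -
  obtain A A' where A: "\<And>n. C1_periodic (A n) (A' n)" "\<And>n t. cmod (A n t) = 1"
    "\<And>n. circ_nrm (\<lambda>t. A n t - F t) \<le> ennreal ((1/2)^n)" "\<And>n. circ_map (A n)"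
    "eventually (\<lambda>n. wind (A n) (A' n) = 2 * of_real pi * \<i> * of_int (hdeg F)) sequentially"
    using C1_dense_seq[OF F] by blast
  obtain B B' where B: "\<And>n. C1_periodic (B n) (B' n)" "\<And>n t. cmod (B n t) = 1"
    "\<And>n. circ_nrm (\<lambda>t. B n t - H t) \<le> ennreal ((1/2)^n)" "\<And>n. circ_map (B n)"
    "eventually (\<lambda>n. wind (B n) (B' n) = 2 * of_real pi * \<i> * of_int (hdeg H)) sequentially"
    using C1_dense_seq[OF H] by blast
  obtain \<delta> where \<delta>: "0 < \<delta>" "\<And>G G'. C1_periodic G G' \<Longrightarrow> (\<And>t. cmod (G t) = 1) \<Longrightarrow>
      circ_nrm (\<lambda>t. G t - F t * H t) < ennreal \<delta> \<Longrightarrow> wind G G' = 2 * of_real pi * \<i> * of_int (hdeg (\<lambda>t. F t * H t))"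
    using hdeg[OF circ_map_mult[OF F H]] by blast
  have "(\<lambda>n. circ_nrm (\<lambda>t. A n t * B n t - F t * H t)) \<longlonglongrightarrow> 0"
    by (rule circ_map_mult_tendsto) (use A B F H in auto)
  then have "eventually (\<lambda>n. circ_nrm (\<lambda>t. A n t * B n t - F t * H t) < ennreal \<delta>) sequentially"
    using \<delta>(1) by (intro order_tendstoD(2)) auto
  then have "eventually (\<lambda>n. hdeg (\<lambda>t. F t * H t) = hdeg F + hdeg H) sequentially"
    using A(5) B(5)
  proof eventually_elim
    case (elim n)
    note m = wind_mult[OF A(1,2) B(1,2), of n n]
    have "wind (\<lambda>t. A n t * B n t) (\<lambda>t. A n t * B' n t + A' n t * B n t)
        = 2 * of_real pi * \<i> * of_int (hdeg (\<lambda>t. F t * H t))"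
      using elim by (intro \<delta>(2)[OF m(1)]) (auto simp: norm_mult A B)
    then have "of_real (2 * pi) * \<i> * of_int (hdeg (\<lambda>t. F t * H t)) = of_real (2 * pi) * \<i> * of_int (hdeg F + hdeg H)"
      using elim m(2) by (simp add: algebra_simps)
    then have "(of_int (hdeg (\<lambda>t. F t * H t)) :: complex) = of_int (hdeg F + hdeg H)"
      unfolding mult_cancel_left by simp
    then show ?case by (simp only: of_int_eq_iff)
  qed
  then show ?thesis by simp
qed

text \<open>Young's inequality. For small \<open>r\<close> the factor of the first term is close to
  1, so strict energy bounds survive small perturbations.\<close>

lemma add_sq_le_weighted:
  fixes x y r :: real
  assumes "0 < r"
  shows "(x + y)\<^sup>2 \<le> (1 + r) * x\<^sup>2 + (1 + 1 / r) * y\<^sup>2"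
proof -
  have "0 \<le> (r * x - y)\<^sup>2 / r" using assms by simp
  also have "\<dots> = r * x\<^sup>2 - 2 * x * y + y\<^sup>2 / r"
    using assms by (simp add: power2_eq_square field_simps)
  finally show ?thesis by (simp add: power2_eq_square algebra_simps)
qed

lemma circ_gagl_le_near:
  assumes "0 < r" "r < 1" and a: "ennreal a = circ_gagl F" "0 \<le> a" and b: "circ_gagl G \<le> ennreal b" "0 \<le> b"
    and [measurable]: "F \<in> borel_measurable borel" "G \<in> borel_measurable borel"
  shows "circ_gagl (\<lambda>t. F t + G t) \<le> ennreal ((1 + r) * a + (1 + 1 / r) * b)"
proof -
  have pt: "dquot (\<lambda>t. F t + G t) z \<le> (1 + r) * dquot F z + (1 + 1 / r) * dquot G z" for z
  proof (cases z)
    case (Pair s t)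
    have "cmod (F s + G s - (F t + G t)) \<le> cmod (F s - F t) + cmod (G s - G t)"
      using norm_triangle_ineq[of "F s - F t" "G s - G t"] by (simp add: algebra_simps)
    then have "(cmod (F s + G s - (F t + G t)))\<^sup>2 \<le> (cmod (F s - F t) + cmod (G s - G t))\<^sup>2" by (intro power_mono) auto
    also have "\<dots> \<le> (1 + r) * (cmod (F s - F t))\<^sup>2 + (1 + 1 / r) * (cmod (G s - G t))\<^sup>2"
      by (rule add_sq_le_weighted[OF assms(1)])
    finally have "(cmod (F s + G s - (F t + G t)))\<^sup>2 / (cmod (cis s - cis t))\<^sup>2
      \<le> ((1 + r) * (cmod (F s - F t))\<^sup>2 + (1 + 1 / r) * (cmod (G s - G t))\<^sup>2) / (cmod (cis s - cis t))\<^sup>2"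
      by (rule divide_right_mono) simp
    then show ?thesis unfolding Pair dquot_def by (simp add: add_divide_distrib)
  qed
  have "circ_gagl (\<lambda>t. F t + G t) \<le> (\<integral>\<^sup>+z. ennreal (1 + r) * ennreal (dquot F z) + ennreal (1 + 1 / r) * ennreal (dquot G z) \<partial>(circ \<Otimes>\<^sub>M circ))"
    unfolding circ_gagl_def
  proof (rule nn_integral_mono)
    fix z
    have "ennreal (dquot (\<lambda>t. F t + G t) z) \<le> ennreal ((1 + r) * dquot F z + (1 + 1 / r) * dquot G z)"
      by (rule ennreal_leI[OF pt])
    then show "ennreal (dquot (\<lambda>t. F t + G t) z) \<le> ennreal (1 + r) * ennreal (dquot F z) + ennreal (1 + 1 / r) * ennreal (dquot G z)"
      using assms(1) by (subst (asm) ennreal_plus) (auto simp: ennreal_mult)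
  qed
  also have "\<dots> = ennreal (1 + r) * circ_gagl F + ennreal (1 + 1 / r) * circ_gagl G"
    unfolding circ_gagl_def by (simp add: nn_integral_add nn_integral_cmult)
  also have "\<dots> \<le> ennreal (1 + r) * ennreal a + ennreal (1 + 1 / r) * ennreal b"
    unfolding a(1)[symmetric] by (intro add_mono mult_left_mono b) auto
  also have "\<dots> = ennreal ((1 + r) * a + (1 + 1 / r) * b)" using assms by (simp add: ennreal_mult)
  finally show ?thesis .
qed

text \<open>A smooth approximation \<open>K\<close> still lies below the threshold, so its winding
  number is 0. The weighted inequality keeps the factor of \<open>circ_gagl F\<close> close to 1,
  which the plain factor 2 would not.\<close>

lemma hdeg_eq_0:
  assumes F: "circ_map F" and small: "circ_gagl F < ennreal (4 * pi\<^sup>2)"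
  shows "hdeg F = 0"
proof -
  obtain a where a: "ennreal a = circ_gagl F" "0 \<le> a" using small by (cases "circ_gagl F") auto
  then have a2: "a < 4 * pi\<^sup>2" using small by (metis ennreal_less_iff)
  have "((\<lambda>r. (1 + r) * a) \<longlongrightarrow> (1 + 0) * a) (at_right 0)" by (intro tendsto_intros)
  then have "eventually (\<lambda>r. (1 + r) * a < 4 * pi\<^sup>2) (at_right 0)"
    using a2 by (intro order_tendstoD(2)) auto
  moreover have "eventually (\<lambda>r::real. r < 1) (at_right 0)" by (intro order_tendstoD(2)) auto
  moreover have "eventually (\<lambda>r::real. 0 < r) (at_right 0)" by (rule eventually_at_right_less)
  ultimately have "eventually (\<lambda>r. (1 + r) * a < 4 * pi\<^sup>2 \<and> r < 1 \<and> 0 < r) (at_right (0::real))"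
    by eventually_elim auto
  then obtain r where r: "(1 + r) * a < 4 * pi\<^sup>2" "r < 1" "0 < r"
    using eventually_happens[of _ "at_right (0::real)"] by auto
  \<comment> \<open>With this value the bound becomes the midpoint of \<open>(1 + r) * a\<close> and
    \<open>4 * pi\<^sup>2\<close>.\<close>
  define b where "b = (4 * pi\<^sup>2 - (1 + r) * a) / (2 * (1 + 1 / r))"
  have b: "0 < b" "(1 + r) * a + (1 + 1 / r) * b < 4 * pi\<^sup>2"
  proof -
    have p: "0 < 1 + 1 / r" using r by (simp add: add_pos_pos)
    then show "0 < b" unfolding b_def using r(1) by (intro divide_pos_pos) auto
    define q X where "q = 1 + 1 / r" and "X = (1 + r) * a"
    have "q * b = (4 * pi\<^sup>2 - X) / 2" using p unfolding b_def q_def[symmetric] X_def[symmetric] by simp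
    then show "(1 + r) * a + (1 + 1 / r) * b < 4 * pi\<^sup>2"
      using r(1) unfolding q_def[symmetric] X_def[symmetric] by simp
  qed
  obtain \<delta> where \<delta>: "0 < \<delta>" "\<And>G G'. C1_periodic G G' \<Longrightarrow> (\<And>t. cmod (G t) = 1) \<Longrightarrow>
      circ_nrm (\<lambda>t. G t - F t) < ennreal \<delta> \<Longrightarrow> wind G G' = 2 * of_real pi * \<i> * of_int (hdeg F)"
    using hdeg[OF F] by blast
  obtain K K' where K: "C1_periodic K K'" "\<And>t. cmod (K t) = 1" "circ_nrm (\<lambda>t. K t - F t) < ennreal (min b \<delta>)"
    using C1_dense[OF F, of "min b \<delta>"] \<delta>(1) b(1) by auto
  have k: "circ_nrm (\<lambda>t. K t - F t) < ennreal b" "circ_nrm (\<lambda>t. K t - F t) < ennreal \<delta>"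
    using less_ennreal_minD[OF K(3)] .
  have "circ_gagl (\<lambda>t. K t - F t) \<le> ennreal b"
  proof -
    have "circ_gagl (\<lambda>t. K t - F t) \<le> circ_nrm (\<lambda>t. K t - F t)" by (simp add: circ_nrm_def)
    then show ?thesis using k(1) by (meson less_imp_le order_trans)
  qed
  then have "circ_gagl (\<lambda>t. F t + (K t - F t)) \<le> ennreal ((1 + r) * a + (1 + 1 / r) * b)"
    using hmapD(1)[OF C1_circ_map[OF K(1,2)]] hmapD(1)[OF F] r a b
    by (intro circ_gagl_le_near) auto
  also have "\<dots> < ennreal (4 * pi\<^sup>2)" using b a r by (subst ennreal_less_iff) (auto intro!: add_nonneg_nonneg mult_nonneg_nonneg)
  finally have "circ_gagl K < ennreal (4 * pi\<^sup>2)" by simp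
  then have "wind K K' = 0" by (rule wind_eq_0[OF K(1,2)])
  then show ?thesis using \<delta>(2)[OF K(1,2) k(2)] by simp
qed

section \<open>Agreement with the degree on the unit circle\<close>

lemma AE_lebesgue_pair:
  assumes "AE t in lebesgue. P (t::real)"
  shows "AE z in (lebesgue :: (real \<times> real) measure). P (fst z) \<and> P (snd z)"
proof -
  have "AE t in lborel. P t" using assms by (simp add: AE_completion_iff)
  then have "AE z in lborel \<Otimes>\<^sub>M lborel. P (fst z) \<and> P (snd z)"
    using AE_pair_fst[OF sigma_finite_lborel] AE_pair_snd[OF sigma_finite_lborel] by (intro AE_conjI) auto
  then show ?thesis unfolding lborel_prod by (rule AE_completion)
qed

lemma nn_integral_lebesgue_on_circ:
  assumes [measurable]: "g \<in> borel_measurable borel"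
  shows "(\<integral>\<^sup>+t. g t \<partial>lebesgue_on {0..2 * pi}) = (\<integral>\<^sup>+t. g t \<partial>circ)"
proof -
  have "(\<integral>\<^sup>+t. g t \<partial>lebesgue_on {0..2 * pi}) = (\<integral>\<^sup>+t. g t * indicator {0..2 * pi} t \<partial>lborel)"
    by (subst nn_integral_restrict_space) (auto simp: nn_integral_completion)
  also have "\<dots> = (\<integral>\<^sup>+t. g t * indicator {0..<2 * pi} t \<partial>lborel)"
  proof (rule nn_integral_cong_AE)
    have "AE t in lborel. t \<noteq> 2 * pi" by (rule AE_lborel_singleton)
    then show "AE t in lborel. g t * indicator {0..2 * pi} t = g t * indicator {0..<2 * pi} t"
      by eventually_elim (auto split: split_indicator)
  qed
  finally show ?thesis by (simp add: nn_integral_circ)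
qed

lemma nn_integral_lebesgue_on_circ2:
  assumes [measurable]: "g \<in> borel_measurable (borel \<Otimes>\<^sub>M borel)"
  shows "(\<integral>\<^sup>+z. g z \<partial>lebesgue_on ({0..2 * pi} \<times> {0..2 * pi})) = (\<integral>\<^sup>+z. g z \<partial>(circ \<Otimes>\<^sub>M circ))"
proof -
  have S: "{0..2 * pi} \<times> {0..2 * pi} \<in> sets (lebesgue :: (real \<times> real) measure)"
    by (intro lmeasurable_compact[THEN fmeasurableD] compact_Times) auto
  have "(\<integral>\<^sup>+z. g z \<partial>lebesgue_on ({0..2 * pi} \<times> {0..2 * pi})) = (\<integral>\<^sup>+z. g z * indicator ({0..2 * pi} \<times> {0..2 * pi}) z \<partial>lborel)"
    using S by (subst nn_integral_restrict_space) (auto simp: nn_integral_completion)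
  also have "\<dots> = (\<integral>\<^sup>+z. g z * indicator ({0..2 * pi} \<times> {0..2 * pi}) z \<partial>(lborel \<Otimes>\<^sub>M lborel))" by (simp add: lborel_prod)
  also have "\<dots> = (\<integral>\<^sup>+z. g z * indicator {0..<2 * pi} (fst z) * indicator {0..<2 * pi} (snd z) \<partial>(lborel \<Otimes>\<^sub>M lborel))"
  proof (rule nn_integral_cong_AE)
    have "AE t in lborel. t \<noteq> 2 * pi" by (rule AE_lborel_singleton)
    then have "AE z in lborel \<Otimes>\<^sub>M lborel. fst z \<noteq> 2 * pi \<and> snd z \<noteq> 2 * pi"
      using AE_pair_fst[OF sigma_finite_lborel] AE_pair_snd[OF sigma_finite_lborel] by (intro AE_conjI) auto
    then show "AE z in lborel \<Otimes>\<^sub>M lborel. g z * indicator ({0..2 * pi} \<times> {0..2 * pi}) z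
        = g z * indicator {0..<2 * pi} (fst z) * indicator {0..<2 * pi} (snd z)"
      by eventually_elim (auto split: split_indicator)
  qed
  also have "\<dots> = (\<integral>\<^sup>+s. \<integral>\<^sup>+t. g (s, t) * indicator {0..<2 * pi} s * indicator {0..<2 * pi} t \<partial>lborel \<partial>lborel)"
    by (subst lborel.nn_integral_fst[symmetric]) auto
  also have "\<dots> = (\<integral>\<^sup>+s. (\<integral>\<^sup>+t. g (s, t) \<partial>circ) * indicator {0..<2 * pi} s \<partial>lborel)"
  proof (rule nn_integral_cong)
    fix s
    have "(\<integral>\<^sup>+t. g (s, t) * indicator {0..<2 * pi} s * indicator {0..<2 * pi} t \<partial>lborel)
        = (\<integral>\<^sup>+t. (g (s, t) * indicator {0..<2 * pi} t) * indicator {0..<2 * pi} s \<partial>lborel)"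
      by (simp add: mult_ac)
    also have "\<dots> = (\<integral>\<^sup>+t. g (s, t) * indicator {0..<2 * pi} t \<partial>lborel) * indicator {0..<2 * pi} s"
      by (rule nn_integral_multc) auto
    finally show "(\<integral>\<^sup>+t. g (s, t) * indicator {0..<2 * pi} s * indicator {0..<2 * pi} t \<partial>lborel)
        = (\<integral>\<^sup>+t. g (s, t) \<partial>circ) * indicator {0..<2 * pi} s"
      by (simp add: nn_integral_circ)
  qed
  also have "\<dots> = (\<integral>\<^sup>+s. \<integral>\<^sup>+t. g (s, t) \<partial>circ \<partial>circ)"
    by (simp add: nn_integral_circ)
  also have "\<dots> = (\<integral>\<^sup>+z. g z \<partial>(circ \<Otimes>\<^sub>M circ))"
    by (subst circ.nn_integral_fst) auto
  finally show ?thesis .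
qed

abbreviation ae_on_circle :: "(complex \<Rightarrow> complex) \<Rightarrow> (real \<Rightarrow> complex) \<Rightarrow> bool" where
  "ae_on_circle f F \<equiv> (AE t in lebesgue_on {0..2 * pi}. f (cis t) = F t)"

lemma circle_norm2_eq_circ_nrm:
  assumes [measurable]: "F \<in> borel_measurable borel" and eq: "ae_on_circle f F"
  shows "circle_norm2 f = circ_nrm F"
proof -
  have S: "{0..2 * pi} \<times> {0..2 * pi} \<in> sets (lebesgue :: (real \<times> real) measure)"
    by (intro lmeasurable_compact[THEN fmeasurableD] compact_Times) auto
  have "AE t in lebesgue. t \<in> {0..2 * pi} \<longrightarrow> f (cis t) = F t"
    using eq by (subst (asm) AE_restrict_space_iff) auto
  from AE_lebesgue_pair[OF this]
  have "AE z in lebesgue. z \<in> {0..2 * pi} \<times> {0..2 * pi} \<longrightarrow> f (cis (fst z)) = F (fst z) \<and> f (cis (snd z)) = F (snd z)"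
    by eventually_elim auto
  then have eq2: "AE z in lebesgue_on ({0..2 * pi} \<times> {0..2 * pi}). f (cis (fst z)) = F (fst z) \<and> f (cis (snd z)) = F (snd z)"
    using S by (subst AE_restrict_space_iff) auto
  have "(\<integral>\<^sup>+t. ennreal ((cmod (f (cis t)))\<^sup>2) \<partial>lebesgue_on {0..2 * pi}) = (\<integral>\<^sup>+t. ennreal ((cmod (F t))\<^sup>2) \<partial>lebesgue_on {0..2 * pi})"
    using eq by (intro nn_integral_cong_AE, eventually_elim) simp
  also have "\<dots> = circ_L2 F" unfolding circ_L2_def by (rule nn_integral_lebesgue_on_circ) simp
  finally have 1: "(\<integral>\<^sup>+t. ennreal ((cmod (f (cis t)))\<^sup>2) \<partial>lebesgue_on {0..2 * pi}) = circ_L2 F" .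
  have "(\<integral>\<^sup>+(s, t). ennreal ((cmod (f (cis s) - f (cis t)))\<^sup>2 / (cmod (cis s - cis t))\<^sup>2) \<partial>lebesgue_on ({0..2 * pi} \<times> {0..2 * pi}))
    = (\<integral>\<^sup>+z. ennreal (dquot F z) \<partial>lebesgue_on ({0..2 * pi} \<times> {0..2 * pi}))"
    using eq2 by (intro nn_integral_cong_AE, eventually_elim) (auto simp: dquot_def split: prod.split)
  also have "\<dots> = circ_gagl F" unfolding circ_gagl_def by (rule nn_integral_lebesgue_on_circ2) simp
  finally show ?thesis unfolding circle_norm2_def circ_nrm_def 1 by simp
qed

lemma circ_L2_unit: "(\<And>t. cmod (F t) = 1) \<Longrightarrow> circ_L2 F = ennreal (2 * pi)"
  by (simp add: circ_L2_def emeasure_circ)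

lemma lebesgue_borel_version:
  fixes f :: "'a::euclidean_space \<Rightarrow> complex"
  assumes "f \<in> borel_measurable lebesgue"
  obtains g where "g \<in> borel_measurable borel" "AE x in lebesgue. f x = g x"
proof -
  have "(\<lambda>x. Re (f x)) \<in> borel_measurable (completion lborel)" "(\<lambda>x. Im (f x)) \<in> borel_measurable (completion lborel)"
    using assms by auto
  then obtain p q where p: "p \<in> borel_measurable lborel" "AE x in lborel. Re (f x) = p x"
    and q: "q \<in> borel_measurable lborel" "AE x in lborel. Im (f x) = q x"
    using completion_ex_borel_measurable_real by metis
  show thesis
  proof (rule that[of "\<lambda>x. Complex (p x) (q x)"])
    have "(\<lambda>x. complex_of_real (p x) + \<i> * complex_of_real (q x)) \<in> borel_measurable borel"
      using p(1) q(1) by simp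
    then show "(\<lambda>x. Complex (p x) (q x)) \<in> borel_measurable borel" by (simp add: Complex_eq)
    have "AE x in lborel. f x = Complex (p x) (q x)"
      using p(2) q(2) by eventually_elim (simp add: complex_eq_iff)
    then show "AE x in lebesgue. f x = Complex (p x) (q x)" by (rule AE_completion)
  qed
qed

lemma H_half_borel_version:
  assumes f: "f \<in> H_half_circle_maps"
  obtains F where "circ_map F" "ae_on_circle f F"
proof -
  have m: "(\<lambda>t. f (cis t)) \<in> borel_measurable (lebesgue_on {0..2 * pi})" and fin: "circle_norm2 f < \<infinity>"
    and un: "AE t in lebesgue_on {0..2 * pi}. cmod (f (cis t)) = 1"
    using f by (auto simp: H_half_circle_maps_def)
  have "(\<lambda>t. if t \<in> {0..2 * pi} then f (cis t) else 0) \<in> borel_measurable lebesgue"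
    by (rule borel_measurable_if_I[OF m]) simp
  then obtain g where g[measurable]: "g \<in> borel_measurable borel"
    and ae: "AE t in lebesgue. (if t \<in> {0..2 * pi} then f (cis t) else 0) = g t"
    using lebesgue_borel_version by blast
  \<comment> \<open>Reducing the angle makes the representative periodic at every point; the default
    1, where the modulus is not 1, makes it unimodular at every point.\<close>
  define r where "r t = t - 2 * pi * of_int \<lfloor>t / (2 * pi)\<rfloor>" for t :: real
  define F where "F t = (if cmod (g (r t)) = 1 then g (r t) else 1)" for t
  have [measurable]: "r \<in> borel_measurable borel" unfolding r_def[abs_def] by measurable
  have F[measurable]: "F \<in> borel_measurable borel" unfolding F_def[abs_def] by measurable
  have "r (t + 2 * pi) = r t" for t by (simp add: r_def add_divide_distrib algebra_simps)
  then have per: "periodic F" by (simp add: periodic_def F_def)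
  have unF: "cmod (F t) = 1" for t by (simp add: F_def)
  have r_id: "r t = t" if "t \<in> {0..2 * pi}" "t \<noteq> 2 * pi" for t
  proof -
    have "\<lfloor>t / (2 * pi)\<rfloor> = 0" using that by (auto simp: floor_eq_iff)
    then show ?thesis by (simp add: r_def)
  qed
  have "AE t in lebesgue. t \<in> {0..2 * pi} \<longrightarrow> cmod (f (cis t)) = 1"
    using un by (subst (asm) AE_restrict_space_iff) auto
  moreover have "AE t in lebesgue. t \<noteq> 2 * pi" by (rule AE_completion[OF AE_lborel_singleton])
  ultimately have "AE t in lebesgue. t \<in> {0..2 * pi} \<longrightarrow> f (cis t) = F t"
    using ae by eventually_elim (auto simp: F_def r_id)
  then have aeF: "ae_on_circle f F" by (subst AE_restrict_space_iff) auto
  have "circ_gagl F < \<infinity>"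
    using fin circle_norm2_eq_circ_nrm[OF F aeF] by (simp add: circ_nrm_def)
  then have "circ_map F" using F per unF by (simp add: circ_map_def)
  then show thesis using aeF that by blast
qed

lemma H_half_circle_mapsI:
  assumes F: "circ_map F" and eq: "\<And>t. f (cis t) = F t"
  shows "f \<in> H_half_circle_maps"
proof -
  note H = hmapD[OF F]
  have m: "(\<lambda>t. f (cis t)) \<in> borel_measurable (lebesgue_on {0..2 * pi})"
    unfolding eq using H(1) by (intro measurable_restrict_space1 measurable_completion) auto
  have "circle_norm2 f < \<infinity>"
    using H(4) circle_norm2_eq_circ_nrm[OF H(1), of f] by (simp add: eq circ_nrm_def circ_L2_unit[OF H(3)])
  then show ?thesis using m by (simp add: H_half_circle_maps_def eq H)
qed

definition on_circle :: "(real \<Rightarrow> complex) \<Rightarrow> complex \<Rightarrow> complex" where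
  "on_circle F z = F (SOME t. cis t = z)"

lemma on_circle_cis: "periodic F \<Longrightarrow> on_circle F (cis t) = F t"
  unfolding on_circle_def
  by (rule someI2[of "\<lambda>s. cis s = cis t" t]) (auto intro: periodic_cis_cong)

lemma ae_on_circle_refl: "periodic F \<Longrightarrow> ae_on_circle (on_circle F) F"
  by (simp add: on_circle_cis)

lemma C1_circle_map_on_circle:
  assumes "C1_periodic G G'" "\<And>t. cmod (G t) = 1"
  shows "C1_circle_map (on_circle G)" "C1_degree (on_circle G) = wind G G' / (2 * of_real pi * \<i>)"
proof -
  note D = C1_periodicD[OF assms(1)]
  have eq: "(\<lambda>t. on_circle G (cis t)) = G" using D(3) by (simp add: on_circle_cis fun_eq_iff)
  show "C1_circle_map (on_circle G)"
    unfolding C1_circle_map_def eq C1_differentiable_on_def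
    using assms(2) D(1,2) by (auto simp: on_circle_def)
  have "C1_degree (on_circle G) = 1 / (2 * of_real pi * \<i>) * integral {0..2 * pi} (\<lambda>t. cnj (G t) * G' t)"
    unfolding C1_degree_def eq using vector_derivative_at[OF D(1)] by (simp add: on_circle_cis[OF D(3)])
  also have "integral {0..2 * pi} (\<lambda>t. cnj (G t) * G' t) = wind G G'"
    unfolding wind_def by (rule integral_circ_HK(1)[symmetric]) (intro continuous_intros D)
  finally show "C1_degree (on_circle G) = wind G G' / (2 * of_real pi * \<i>)" by simp
qed

lemma C1_circle_mapD:
  assumes "C1_circle_map f"
  obtains G' where "C1_periodic (\<lambda>t. f (cis t)) G'" "\<And>t. cmod (f (cis t)) = 1"
    "C1_degree f = wind (\<lambda>t. f (cis t)) G' / (2 * of_real pi * \<i>)"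
proof -
  obtain G' where G': "\<And>t. ((\<lambda>t. f (cis t)) has_vector_derivative G' t) (at t)" "continuous_on UNIV G'"
    using assms by (auto simp: C1_circle_map_def C1_differentiable_on_def)
  have C: "C1_periodic (\<lambda>t. f (cis t)) G'" using G' by (simp add: C1_periodic_def periodic_def)
  have un: "cmod (f (cis t)) = 1" for t using assms by (simp add: C1_circle_map_def)
  have "C1_degree f = 1 / (2 * of_real pi * \<i>) * integral {0..2 * pi} (\<lambda>t. cnj (f (cis t)) * G' t)"
    unfolding C1_degree_def using vector_derivative_at[OF G'(1)] by simp
  also have "integral {0..2 * pi} (\<lambda>t. cnj (f (cis t)) * G' t) = wind (\<lambda>t. f (cis t)) G'"
    unfolding wind_def by (rule integral_circ_HK(1)[symmetric]) (intro continuous_intros C1_periodicD[OF C])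
  finally show thesis using that[OF C un] by simp
qed

definition borel_version :: "(complex \<Rightarrow> complex) \<Rightarrow> real \<Rightarrow> complex" where
  "borel_version f = (SOME F. circ_map F \<and> ae_on_circle f F)"

lemma borel_version:
  assumes "f \<in> H_half_circle_maps"
  shows "circ_map (borel_version f)" "ae_on_circle f (borel_version f)"
proof -
  have "\<exists>F. circ_map F \<and> ae_on_circle f F" using H_half_borel_version[OF assms] by blast
  then have "circ_map (borel_version f) \<and> ae_on_circle f (borel_version f)"
    unfolding borel_version_def by (rule someI_ex)
  then show "circ_map (borel_version f)" "ae_on_circle f (borel_version f)" by auto
qed

lemma circle_norm2_diff:
  assumes "circ_map F" "ae_on_circle f F" "circ_map G" "ae_on_circle g G"
  shows "circle_norm2 (\<lambda>z. g z - f z) = circ_nrm (\<lambda>t. G t - F t)"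
proof (rule circle_norm2_eq_circ_nrm)
  show "(\<lambda>t. G t - F t) \<in> borel_measurable borel"
    using hmapD(1)[OF assms(1)] hmapD(1)[OF assms(3)] by measurable
  show "ae_on_circle (\<lambda>z. g z - f z) (\<lambda>t. G t - F t)"
    using assms(2,4) by eventually_elim simp
qed

lemma circ_nrm_diff_finite:
  assumes "circ_map F" "circ_map G"
  shows "circ_nrm (\<lambda>t. G t - F t) < \<infinity>"
proof -
  note H = hmapD[OF assms(1)] hmapD[OF assms(2)]
  have "circ_nrm (\<lambda>t. G t - F t) \<le> 2 * circ_nrm (\<lambda>t. G t - 0) + 2 * circ_nrm (\<lambda>t. 0 - F t)"
    by (rule circ_nrm_triangle) (use H in auto)
  also have "circ_nrm (\<lambda>t. 0 - F t) = circ_nrm F" by (simp add: circ_nrm_def circ_gagl_uminus circ_L2_def)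
  also have "2 * circ_nrm (\<lambda>t. G t - 0) + 2 * circ_nrm F < \<infinity>"
    using H by (simp add: circ_nrm_def circ_L2_unit ennreal_mult_less_top)
  finally show ?thesis .
qed

lemma circle_norm_less_iff:
  assumes "circ_map F" "ae_on_circle f F" "circ_map G" "ae_on_circle g G" and \<delta>: "0 < \<delta>"
  shows "circle_norm (\<lambda>z. g z - f z) < sqrt \<delta> \<longleftrightarrow> circ_nrm (\<lambda>t. G t - F t) < ennreal \<delta>"
proof -
  obtain c where c: "circ_nrm (\<lambda>t. G t - F t) = ennreal c" "0 \<le> c"
    using circ_nrm_diff_finite[OF assms(1,3)] by (cases "circ_nrm (\<lambda>t. G t - F t)") auto
  then show ?thesis
    using \<delta> unfolding circle_norm_def circle_norm2_diff[OF assms(1-4)] by (simp add: ennreal_less_iff)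
qed

definition hdegree :: "(complex \<Rightarrow> complex) \<Rightarrow> int" where
  "hdegree f = (if f \<in> H_half_circle_maps then hdeg (borel_version f) else undefined)"

text \<open>Two representatives of a map are at distance 0, and by local constancy they have the
  same degree. So the choice made by \<open>borel_version\<close> is immaterial.\<close>

lemma hdegree_eq:
  assumes F: "circ_map F" "\<And>t. f (cis t) = F t"
  shows "hdegree f = hdeg F"
proof -
  have f: "f \<in> H_half_circle_maps" by (rule H_half_circle_mapsI[OF F])
  note B = borel_version[OF f]
  have "circ_nrm (\<lambda>t. F t - borel_version f t) = circle_norm2 (\<lambda>z. f z - f z)"
    by (rule circle_norm2_diff[symmetric]) (use F B in \<open>auto simp: F(2)\<close>)
  also have "\<dots> = circ_nrm (\<lambda>t. 0)" by (rule circle_norm2_eq_circ_nrm) auto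
  also have "\<dots> = 0" by (simp add: circ_nrm_def circ_L2_def circ_gagl_eq_0_const)
  finally have 0: "circ_nrm (\<lambda>t. F t - borel_version f t) = 0" .
  obtain \<delta> where "0 < \<delta>" "\<And>G. circ_map G \<Longrightarrow> circ_nrm (\<lambda>t. G t - borel_version f t) < ennreal \<delta> \<Longrightarrow> hdeg G = hdeg (borel_version f)"
    using hdeg_locally_constant[OF B(1)] by blast
  then show ?thesis using F(1) 0 f by (simp add: hdegree_def)
qed

lemma is_circle_degree_hdegree: "is_circle_degree hdegree"
  unfolding is_circle_degree_def
proof (intro conjI allI ballI impI)
  show "hdegree \<in> extensional H_half_circle_maps" by (simp add: extensional_def hdegree_def)
  fix f assume "C1_circle_map f"
  then obtain G' where G: "C1_periodic (\<lambda>t. f (cis t)) G'" "\<And>t. cmod (f (cis t)) = 1"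
    "C1_degree f = wind (\<lambda>t. f (cis t)) G' / (2 * of_real pi * \<i>)"
    using C1_circle_mapD by blast
  have h: "circ_map (\<lambda>t. f (cis t))" by (rule C1_circ_map[OF G(1,2)])
  have "circ_nrm (\<lambda>t. f (cis t) - f (cis t)) = 0" by (simp add: circ_nrm_def circ_L2_def circ_gagl_eq_0_const)
  from hdeg_C1[OF G(1,2) h this] show "of_int (hdegree f) = C1_degree f"
    unfolding G(3) using hdegree_eq[OF h, of f] by simp
next
  fix f and \<epsilon> :: real assume f: "f \<in> H_half_circle_maps" and \<epsilon>: "0 < \<epsilon>"
  note B = borel_version[OF f]
  obtain \<delta> where \<delta>: "0 < \<delta>" "\<And>G. circ_map G \<Longrightarrow> circ_nrm (\<lambda>t. G t - borel_version f t) < ennreal \<delta> \<Longrightarrow> hdeg G = hdeg (borel_version f)"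
    using hdeg_locally_constant[OF B(1)] by blast
  show "\<exists>\<delta>>0. \<forall>g\<in>H_half_circle_maps. circle_norm (\<lambda>z. g z - f z) < \<delta> \<longrightarrow> dist (hdegree g) (hdegree f) < \<epsilon>"
  proof (intro exI[of _ "sqrt \<delta>"] conjI ballI impI)
    fix g assume g: "g \<in> H_half_circle_maps" and near: "circle_norm (\<lambda>z. g z - f z) < sqrt \<delta>"
    note C = borel_version[OF g]
    have "hdeg (borel_version g) = hdeg (borel_version f)"
      using near circle_norm_less_iff[OF B C \<delta>(1)] by (intro \<delta>(2) C) auto
    then show "dist (hdegree g) (hdegree f) < \<epsilon>" using f g \<epsilon> by (simp add: hdegree_def)
  qed (use \<delta> in simp)
qed

text \<open>Integer-valued continuous functions are locally constant. Near \<open>f\<close> there is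
  a smooth map on which both degrees are prescribed, and both are constant on the way there.\<close>

lemma is_circle_degree_unique:
  assumes D: "is_circle_degree D"
  shows "D = hdegree"
proof
  fix f
  show "D f = hdegree f"
  proof (cases "f \<in> H_half_circle_maps")
    case False
    then show ?thesis using D by (simp add: is_circle_degree_def extensional_def hdegree_def)
  next
    case True
    note B = borel_version[OF True]
    obtain \<delta>1 where d1: "0 < \<delta>1" "\<And>g. g \<in> H_half_circle_maps \<Longrightarrow> circle_norm (\<lambda>z. g z - f z) < \<delta>1 \<Longrightarrow> dist (D g) (D f) < 1"
      using D True unfolding is_circle_degree_def by (meson zero_less_one)
    obtain \<delta>2 where d2: "0 < \<delta>2" "\<And>g. g \<in> H_half_circle_maps \<Longrightarrow> circle_norm (\<lambda>z. g z - f z) < \<delta>2 \<Longrightarrow> dist (hdegree g) (hdegree f) < 1"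
      using is_circle_degree_hdegree True unfolding is_circle_degree_def by (meson zero_less_one)
    \<comment> \<open>Squared because \<open>circle_norm\<close> is a norm while
      \<open>circ_nrm\<close> is the square of one.\<close>
    define \<delta> where "\<delta> = (min \<delta>1 \<delta>2)\<^sup>2"
    have \<delta>: "0 < \<delta>" "sqrt \<delta> = min \<delta>1 \<delta>2" using d1 d2 by (auto simp: \<delta>_def)
    obtain G G' where G: "C1_periodic G G'" "\<And>t. cmod (G t) = 1" "circ_nrm (\<lambda>t. G t - borel_version f t) < ennreal \<delta>"
      using C1_dense[OF B(1) \<delta>(1)] by blast
    define g where "g = on_circle G"
    have per: "periodic G" using C1_periodicD[OF G(1)] by blast
    have hG: "circ_map G" by (rule C1_circ_map[OF G(1,2)])
    have ag: "ae_on_circle g G" unfolding g_def by (rule ae_on_circle_refl[OF per])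
    have gH: "g \<in> H_half_circle_maps" unfolding g_def by (rule H_half_circle_mapsI[OF hG on_circle_cis[OF per]])
    have "circle_norm (\<lambda>z. g z - f z) < min \<delta>1 \<delta>2"
      using circle_norm_less_iff[OF B hG ag \<delta>(1)] G(3) \<delta>(2) by simp
    then have "dist (D g) (D f) < 1" "dist (hdegree g) (hdegree f) < 1" using d1 d2 gH by auto
    then have eq: "D g = D f" "hdegree g = hdegree f" by (auto simp: dist_of_int dist_real_def)
    have C1: "C1_circle_map g" unfolding g_def by (rule C1_circle_map_on_circle[OF G(1,2)])
    then have "(of_int (D g) :: complex) = of_int (hdegree g)"
      using D is_circle_degree_hdegree unfolding is_circle_degree_def by metis
    then show ?thesis using eq by simp
  qed
qed

lemma circle_degree_eq_hdeg:
  assumes "circ_map F" "\<And>t. f (cis t) = F t"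
  shows "circle_degree f = hdeg F"
proof -
  have "circle_degree = hdegree"
    unfolding circle_degree_def
    by (rule the_equality) (auto intro: is_circle_degree_hdegree is_circle_degree_unique)
  then show ?thesis using hdegree_eq[of F f] assms by simp
qed

section \<open>Stereographic projection\<close>

lemma one_plus_sq_pos: "0 < 1 + (x::real)\<^sup>2"
  by (simp add: add_pos_nonneg)

lemma one_plus_sq_neq_0: "1 + (x::real)\<^sup>2 \<noteq> 0"
  using one_plus_sq_pos[of x] by (rule less_imp_neq[symmetric])

text \<open>This window is the range of \<open>ang\<close>: one period, cut at the angle of the
  north pole.\<close>

lemma periodic_nn_integral_window:
  fixes P :: "real \<Rightarrow> ennreal"
  assumes [measurable]: "P \<in> borel_measurable borel" and per: "periodic P"
  shows "(\<integral>\<^sup>+s. P s * indicator {- 3 * pi / 2<..<pi / 2} s \<partial>lborel) = (\<integral>\<^sup>+t. P t \<partial>circ)"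
proof -
  have "(\<integral>\<^sup>+s. P s * indicator {- 3 * pi / 2<..<pi / 2} s \<partial>lborel)
      = (\<integral>\<^sup>+t. P (- 3 * pi / 2 + 1 * t) * indicator {- 3 * pi / 2<..<pi / 2} (- 3 * pi / 2 + 1 * t) \<partial>lborel)"
    by (subst nn_integral_real_affine[where c=1 and t="- 3 * pi / 2"]) auto
  also have "\<dots> = (\<integral>\<^sup>+t. P (t + pi / 2) * indicator {0..<2 * pi} t \<partial>lborel)"
  proof (rule nn_integral_cong_AE)
    have "AE t in lborel. t \<noteq> (0::real)" by (rule AE_lborel_singleton)
    then show "AE t in lborel. P (- 3 * pi / 2 + 1 * t) * indicator {- 3 * pi / 2<..<pi / 2} (- 3 * pi / 2 + 1 * t)
        = P (t + pi / 2) * indicator {0..<2 * pi} t"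
    proof eventually_elim
      case (elim t)
      have "P ((- 3 * pi / 2 + t) + 2 * pi) = P (- 3 * pi / 2 + t)" using per unfolding periodic_def by blast
      moreover have "(- 3 * pi / 2 + t) + 2 * pi = t + pi / 2" by simp
      ultimately have "P (- 3 * pi / 2 + 1 * t) = P (t + pi / 2)" by (simp only: mult_1)
      moreover have "- 3 * pi / 2 + 1 * t \<in> {- 3 * pi / 2<..<pi / 2} \<longleftrightarrow> t \<in> {0..<2 * pi}" using elim by auto
      ultimately show ?case by (simp add: indicator_def)
    qed
  qed
  also have "\<dots> = (\<integral>\<^sup>+t. P (t + pi / 2) \<partial>circ)" by (simp add: nn_integral_circ)
  also have "\<dots> = (\<integral>\<^sup>+t. P t \<partial>circ)"
    by (rule nn_integral_circ_shift) (use per in \<open>auto simp: periodic_def\<close>)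
  finally show ?thesis .
qed

text \<open>The angle of the point of the circle that projects to \<open>x\<close>; the origin
  corresponds to the south pole, and both ends of the line to the north pole.\<close>

definition ang :: "real \<Rightarrow> real" where
  "ang x = 2 * arctan x - pi / 2"

lemma ang_measurable [measurable]: "ang \<in> borel_measurable borel"
  unfolding ang_def[abs_def] by (intro borel_measurable_continuous_onI continuous_intros)

text \<open>Substitution on compact intervals that exhaust the line, followed by a monotone limit on
  both sides. The weight is the derivative of \<open>ang\<close>.\<close>

lemma nn_integral_circ_subst:
  fixes P :: "real \<Rightarrow> ennreal"
  assumes [measurable]: "P \<in> borel_measurable borel" and per: "periodic P"
  shows "(\<integral>\<^sup>+t. P t \<partial>circ) = (\<integral>\<^sup>+x. P (ang x) * ennreal (2 / (1 + x\<^sup>2)) \<partial>lborel)"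
proof -
  have sub: "(\<integral>\<^sup>+s. P s * indicator {ang (- real n)..ang (real n)} s \<partial>lborel)
      = (\<integral>\<^sup>+x. P (ang x) * ennreal (2 / (1 + x\<^sup>2)) * indicator {- real n..real n} x \<partial>lborel)" if "0 < n" for n
  proof (rule nn_integral_substitution_aux[where f=P and g=ang and g'="\<lambda>x. 2 / (1 + x\<^sup>2)" and a="- real n" and b="real n"])
    fix x :: real
    have "((\<lambda>x. 2 * arctan x - pi / 2) has_real_derivative 2 * inverse (1 + x\<^sup>2) - 0) (at x)"
      by (intro DERIV_diff DERIV_cmult DERIV_arctan DERIV_const)
    then show "(ang has_real_derivative 2 / (1 + x\<^sup>2)) (at x)"
      by (simp only: ang_def[abs_def] divide_inverse diff_0_right)
    show "0 \<le> 2 / (1 + x\<^sup>2)" by simp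
  next
    show "continuous_on {- real n..real n} (\<lambda>x. 2 / (1 + x\<^sup>2))"
      by (rule continuous_on_divide[OF continuous_on_const continuous_on_add[OF continuous_on_const
          continuous_on_power[OF continuous_on_id]]]) (simp add: one_plus_sq_neq_0)
    show "- real n < real n" using that by simp
  qed simp_all
  have mono: "ang x < ang y" if "x < y" for x y using that by (simp add: ang_def arctan_monotone)
  have rng: "- 3 * pi / 2 < ang x" "ang x < pi / 2" for x using arctan_lbound[of x] arctan_ubound[of x] by (auto simp: ang_def)
  have surj: "\<exists>x. ang x = s" if "s \<in> {- 3 * pi / 2<..<pi / 2}" for s
  proof
    have "arctan (tan (s / 2 + pi / 4)) = s / 2 + pi / 4" using that by (intro arctan_tan) auto
    then show "ang (tan (s / 2 + pi / 4)) = s" by (simp add: ang_def)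
  qed
  have "(\<integral>\<^sup>+t. P t \<partial>circ) = (\<integral>\<^sup>+s. P s * indicator {- 3 * pi / 2<..<pi / 2} s \<partial>lborel)"
    by (rule periodic_nn_integral_window[symmetric]) (use assms in auto)
  also have "\<dots> = (\<integral>\<^sup>+s. (SUP n. P s * indicator {ang (- real (Suc n))..ang (real (Suc n))} s) \<partial>lborel)"
  proof (rule nn_integral_cong)
    fix s
    show "P s * indicator {- 3 * pi / 2<..<pi / 2} s = (SUP n. P s * indicator {ang (- real (Suc n))..ang (real (Suc n))} s)"
    proof (cases "s \<in> {- 3 * pi / 2<..<pi / 2}")
      case True
      then obtain x where x: "ang x = s" using surj by blast
      obtain n where n: "\<bar>x\<bar> < real n" using reals_Archimedean2 by blast
      then have "- real (Suc n) < x" "x < real (Suc n)" by auto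
      then have "s \<in> {ang (- real (Suc n))..ang (real (Suc n))}"
        using mono[of "- real (Suc n)" x] mono[of x "real (Suc n)"] x by (simp add: less_imp_le del: of_nat_Suc)
      then have "P s \<le> (SUP n. P s * indicator {ang (- real (Suc n))..ang (real (Suc n))} s)"
        by (intro SUP_upper2[of n]) auto
      moreover have "(SUP n. P s * indicator {ang (- real (Suc n))..ang (real (Suc n))} s) \<le> P s"
        by (intro SUP_least) (auto split: split_indicator)
      ultimately show ?thesis using True by simp
    next
      case False
      then have "s \<notin> {ang (- real (Suc n))..ang (real (Suc n))}" for n
        using rng[of "- real (Suc n)"] rng[of "real (Suc n)"] by auto
      then show ?thesis using False by simp
    qed
  qed
  also have "\<dots> = (SUP n. \<integral>\<^sup>+s. P s * indicator {ang (- real (Suc n))..ang (real (Suc n))} s \<partial>lborel)"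
  proof (rule nn_integral_monotone_convergence_SUP)
    show "incseq (\<lambda>n s. P s * indicator {ang (- real (Suc n))..ang (real (Suc n))} s)"
      unfolding incseq_def le_fun_def
    proof (intro allI impI mult_left_mono)
      fix m n :: nat and s assume "m \<le> n"
      then have "ang (- real (Suc n)) \<le> ang (- real (Suc m))" "ang (real (Suc m)) \<le> ang (real (Suc n))"
        by (simp_all add: ang_def arctan_le_iff)
      then show "(indicator {ang (- real (Suc m))..ang (real (Suc m))} s :: ennreal) \<le> indicator {ang (- real (Suc n))..ang (real (Suc n))} s"
        by (auto split: split_indicator)
    qed auto
  qed auto
  also have "\<dots> = (SUP n. \<integral>\<^sup>+x. P (ang x) * ennreal (2 / (1 + x\<^sup>2)) * indicator {- real (Suc n)..real (Suc n)} x \<partial>lborel)"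
    by (intro SUP_cong refl sub) simp
  also have "\<dots> = (\<integral>\<^sup>+x. (SUP n. P (ang x) * ennreal (2 / (1 + x\<^sup>2)) * indicator {- real (Suc n)..real (Suc n)} x) \<partial>lborel)"
  proof (rule nn_integral_monotone_convergence_SUP[symmetric])
    show "incseq (\<lambda>n x. P (ang x) * ennreal (2 / (1 + x\<^sup>2)) * indicator {- real (Suc n)..real (Suc n)} x)"
      unfolding incseq_def le_fun_def by (intro allI impI mult_left_mono) (auto split: split_indicator)
  qed auto
  also have "\<dots> = (\<integral>\<^sup>+x. P (ang x) * ennreal (2 / (1 + x\<^sup>2)) \<partial>lborel)"
  proof (rule nn_integral_cong)
    fix x
    obtain n where n: "\<bar>x\<bar> < real n" using reals_Archimedean2 by blast
    let ?c = "P (ang x) * ennreal (2 / (1 + x\<^sup>2))"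
    have "x \<in> {- real (Suc n)..real (Suc n)}" using n by auto
    then have "?c \<le> (SUP n. ?c * indicator {- real (Suc n)..real (Suc n)} x)"
      by (intro SUP_upper2[of n]) (auto simp del: of_nat_Suc)
    moreover have "(SUP n. ?c * indicator {- real (Suc n)..real (Suc n)} x) \<le> ?c"
      by (intro SUP_least) (auto split: split_indicator)
    ultimately show "(SUP n. ?c * indicator {- real (Suc n)..real (Suc n)} x) = ?c" by simp
  qed
  finally show ?thesis .
qed

lemma cis_ang: "cis (ang x) = Complex (2 * x / (1 + x\<^sup>2)) (- (1 - x\<^sup>2) / (1 + x\<^sup>2))"
proof -
  have p: "0 < 1 + x\<^sup>2" by (simp add: add_pos_nonneg)
  have sq: "(sqrt (1 + x\<^sup>2))\<^sup>2 = 1 + x\<^sup>2" using p by simp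
  have "sin (2 * arctan x) = 2 * x / (1 + x\<^sup>2)"
    unfolding sin_double sin_arctan cos_arctan using sq by (simp add: power2_eq_square)
  moreover have "cos (2 * arctan x) = (1 - x\<^sup>2) / (1 + x\<^sup>2)"
    unfolding cos_double sin_arctan cos_arctan using sq by (simp add: power_divide diff_divide_distrib)
  moreover have "- ((1 - x\<^sup>2) / (1 + x\<^sup>2)) = (x\<^sup>2 - 1) / (1 + x\<^sup>2)"
    unfolding minus_divide_left by simp
  ultimately show ?thesis by (simp add: ang_def complex_eq_iff cos_diff sin_diff)
qed

lemma stereographic_cis_ang: "stereographic (cis (ang x)) = x"
proof -
  have p: "1 + x\<^sup>2 \<noteq> 0" by (rule one_plus_sq_neq_0)
  then have "1 - (- (1 - x\<^sup>2) / (1 + x\<^sup>2)) = 2 / (1 + x\<^sup>2)" by (simp add: field_simps)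
  then show ?thesis unfolding stereographic_def cis_ang using p by simp
qed

text \<open>The factor of \<open>(x - y)\<^sup>2\<close> is the product of the Jacobians
  \<open>2 / (1 + x\<^sup>2)\<close> and \<open>2 / (1 + y\<^sup>2)\<close>. This cancellation makes
  the double integral invariant under stereographic projection.\<close>

lemma cmod_cis_ang_diff: "(cmod (cis (ang x) - cis (ang y)))\<^sup>2 = 4 * (x - y)\<^sup>2 / ((1 + x\<^sup>2) * (1 + y\<^sup>2))"
proof -
  have p: "1 + x\<^sup>2 \<noteq> 0" "1 + y\<^sup>2 \<noteq> 0" by (rule one_plus_sq_neq_0)+
  have 1: "2 * x / (1 + x\<^sup>2) - 2 * y / (1 + y\<^sup>2) = 2 * ((x - y) * (1 - x * y)) / ((1 + x\<^sup>2) * (1 + y\<^sup>2))"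
    using p by (simp add: field_simps) (simp add: power2_eq_square algebra_simps)
  have 2: "- (1 - x\<^sup>2) / (1 + x\<^sup>2) - - (1 - y\<^sup>2) / (1 + y\<^sup>2) = 2 * ((x - y) * (x + y)) / ((1 + x\<^sup>2) * (1 + y\<^sup>2))"
    using p by (simp add: field_simps) (simp add: power2_eq_square algebra_simps)
  have 3: "(1 - x * y)\<^sup>2 + (x + y)\<^sup>2 = (1 + x\<^sup>2) * (1 + y\<^sup>2)" by (simp add: power2_eq_square algebra_simps)
  have "(cmod (cis (ang x) - cis (ang y)))\<^sup>2
      = 4 * (x - y)\<^sup>2 * ((1 - x * y)\<^sup>2 + (x + y)\<^sup>2) / ((1 + x\<^sup>2) * (1 + y\<^sup>2))\<^sup>2"
  proof -
    have "(2 * (a * b) / D)\<^sup>2 + (2 * (a * c) / D)\<^sup>2 = 4 * a\<^sup>2 * (b\<^sup>2 + c\<^sup>2) / D\<^sup>2" for a b c D :: real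
      by (simp add: power_divide power_mult_distrib distrib_left add_divide_distrib)
    then show ?thesis unfolding cmod_power2 cis_ang minus_complex.sel complex.sel 1 2 by simp
  qed
  also have "\<dots> = 4 * (x - y)\<^sup>2 / ((1 + x\<^sup>2) * (1 + y\<^sup>2))"
    unfolding 3 using p by (simp add: power2_eq_square)
  finally show ?thesis .
qed

section \<open>Half-energy and degree on the line\<close>

definition lquot :: "(real \<Rightarrow> complex) \<Rightarrow> real \<times> real \<Rightarrow> real" where
  "lquot u = (\<lambda>(x, y). (cmod (u x - u y))\<^sup>2 / \<bar>x - y\<bar>\<^sup>2)"

text \<open>Agrees with \<open>gagliardo\<close> for Borel maps; the product measure gives access to
  Tonelli's theorem.\<close>

definition gagl :: "(real \<Rightarrow> complex) \<Rightarrow> ennreal" where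
  "gagl u = (\<integral>\<^sup>+z. ennreal (lquot u z) \<partial>(lborel \<Otimes>\<^sub>M lborel))"

lemma lquot_nonneg [simp]: "0 \<le> lquot u z"
  by (simp add: lquot_def split: prod.split)

lemma lquot_measurable [measurable]:
  assumes [measurable]: "u \<in> borel_measurable borel"
  shows "lquot u \<in> borel_measurable (lborel \<Otimes>\<^sub>M lborel)"
  unfolding lquot_def by measurable

lemma gagliardo_eq_gagl:
  assumes [measurable]: "v \<in> borel_measurable borel" and eq: "AE x in lebesgue. u x = v x"
  shows "gagliardo u = gagl v"
proof -
  have "gagliardo u = (\<integral>\<^sup>+z. ennreal (lquot v z) \<partial>(lebesgue :: (real \<times> real) measure))"
    unfolding gagliardo_def using AE_lebesgue_pair[OF eq]
    by (intro nn_integral_cong_AE, eventually_elim) (auto simp: lquot_def split: prod.split)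
  also have "\<dots> = gagl v" unfolding gagl_def lborel_prod by (rule nn_integral_completion)
  finally show ?thesis .
qed

definition circ_of :: "(real \<Rightarrow> complex) \<Rightarrow> real \<Rightarrow> complex" where
  "circ_of u t = u (stereographic (cis t))"

lemma circ_of_measurable [measurable]:
  assumes [measurable]: "u \<in> borel_measurable borel"
  shows "circ_of u \<in> borel_measurable borel"
proof -
  have [measurable]: "(\<lambda>t. stereographic (cis t)) \<in> borel_measurable borel"
    unfolding stereographic_def cis.sel by measurable
  show ?thesis unfolding circ_of_def[abs_def] by measurable
qed

lemma periodic_circ_of: "periodic (circ_of u)"
  by (simp add: periodic_def circ_of_def)

lemma circ_gagl_circ_of:
  assumes u[measurable]: "u \<in> borel_measurable borel"
  shows "circ_gagl (circ_of u) = gagl u"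
proof -
  let ?U = "circ_of u"
  have cU: "?U (ang x) = u x" for x by (simp add: circ_of_def stereographic_cis_ang)
  have per: "?U (t + 2 * pi) = ?U t" for t using periodic_circ_of[of u] by (simp add: periodic_def)
  have "circ_gagl ?U = (\<integral>\<^sup>+s. \<integral>\<^sup>+t. ennreal (dquot ?U (s, t)) \<partial>circ \<partial>circ)" by (rule circ_gagl_iterated) simp
  also have "\<dots> = (\<integral>\<^sup>+s. \<integral>\<^sup>+y. ennreal (dquot ?U (s, ang y)) * ennreal (2 / (1 + y\<^sup>2)) \<partial>lborel \<partial>circ)"
    by (intro nn_integral_cong nn_integral_circ_subst) (auto simp: periodic_def dquot_def per)
  also have "\<dots> = (\<integral>\<^sup>+x. (\<integral>\<^sup>+y. ennreal (dquot ?U (ang x, ang y)) * ennreal (2 / (1 + y\<^sup>2)) \<partial>lborel) * ennreal (2 / (1 + x\<^sup>2)) \<partial>lborel)"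
    by (intro nn_integral_circ_subst) (auto simp: periodic_def dquot_def per)
  also have "\<dots> = (\<integral>\<^sup>+x. \<integral>\<^sup>+y. ennreal (dquot ?U (ang x, ang y)) * ennreal (2 / (1 + y\<^sup>2)) * ennreal (2 / (1 + x\<^sup>2)) \<partial>lborel \<partial>lborel)"
    by (intro nn_integral_cong nn_integral_multc[symmetric]) simp
  also have "\<dots> = (\<integral>\<^sup>+x. \<integral>\<^sup>+y. ennreal (lquot u (x, y)) \<partial>lborel \<partial>lborel)"
  proof (intro nn_integral_cong)
    fix x y :: real
    have p: "0 < 1 + x\<^sup>2" "0 < 1 + y\<^sup>2" by (simp_all add: add_pos_nonneg)
    have "dquot ?U (ang x, ang y) * (2 / (1 + y\<^sup>2)) * (2 / (1 + x\<^sup>2)) = lquot u (x, y)"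
      using p unfolding dquot_def lquot_def by (simp add: cU cmod_cis_ang_diff)
    then show "ennreal (dquot ?U (ang x, ang y)) * ennreal (2 / (1 + y\<^sup>2)) * ennreal (2 / (1 + x\<^sup>2)) = ennreal (lquot u (x, y))"
      using p by (simp flip: ennreal_mult)
  qed
  also have "\<dots> = gagl u"
    unfolding gagl_def by (subst lborel.nn_integral_fst[symmetric]) auto
  finally show ?thesis .
qed

definition line_map :: "(real \<Rightarrow> complex) \<Rightarrow> bool" where
  "line_map u \<longleftrightarrow> u \<in> borel_measurable borel \<and> (\<forall>x. cmod (u x) = 1) \<and> gagl u < \<infinity>"

lemma lmapD:
  assumes "line_map u"
  shows "u \<in> borel_measurable borel" "\<And>x. cmod (u x) = 1" "gagl u < \<infinity>"
  using assms by (auto simp: line_map_def)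

lemma circ_map_circ_of: "line_map u \<Longrightarrow> circ_map (circ_of u)"
  using periodic_circ_of[of u] circ_gagl_circ_of[of u]
  by (auto simp: line_map_def circ_map_def circ_of_def)

lemma degree_half_eq: "line_map u \<Longrightarrow> degree_half u = hdeg (circ_of u)"
  unfolding degree_half_def
  by (rule circle_degree_eq_hdeg[OF circ_map_circ_of]) (auto simp: circ_of_def)

lemma line_map_of_circ_map: "u \<in> borel_measurable borel \<Longrightarrow> (\<And>x. cmod (u x) = 1) \<Longrightarrow> circ_map (circ_of u) \<Longrightarrow> line_map u"
  using circ_gagl_circ_of[of u] by (simp add: line_map_def circ_map_def)

lemma line_map_mult:
  assumes "line_map u" "line_map v"
  shows "line_map (\<lambda>x. u x * v x)"
proof (rule line_map_of_circ_map)
  show "(\<lambda>x. u x * v x) \<in> borel_measurable borel" using lmapD(1)[OF assms(1)] lmapD(1)[OF assms(2)] by measurable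
  show "cmod (u x * v x) = 1" for x using lmapD[OF assms(1)] lmapD[OF assms(2)] by (simp add: norm_mult)
  show "circ_map (circ_of (\<lambda>x. u x * v x))"
    using circ_map_mult[OF circ_map_circ_of[OF assms(1)] circ_map_circ_of[OF assms(2)]] by (simp add: circ_of_def[abs_def])
qed

lemma line_map_cnj:
  assumes "line_map u"
  shows "line_map (\<lambda>x. cnj (u x))"
proof (rule line_map_of_circ_map)
  show "(\<lambda>x. cnj (u x)) \<in> borel_measurable borel" using lmapD(1)[OF assms] by measurable
  show "cmod (cnj (u x)) = 1" for x using lmapD[OF assms] by simp
  show "circ_map (circ_of (\<lambda>x. cnj (u x)))" using circ_map_cnj[OF circ_map_circ_of[OF assms]] by (simp add: circ_of_def[abs_def])
qed

lemma degree_half_mult: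
  assumes "line_map u" "line_map v"
  shows "degree_half (\<lambda>x. u x * v x) = degree_half u + degree_half v"
  using hdeg_mult[OF circ_map_circ_of[OF assms(1)] circ_map_circ_of[OF assms(2)]]
  by (simp add: degree_half_eq assms line_map_mult circ_of_def[abs_def])

lemma degree_half_eq_0: "line_map u \<Longrightarrow> gagl u < ennreal (4 * pi\<^sup>2) \<Longrightarrow> degree_half u = 0"
  using hdeg_eq_0[OF circ_map_circ_of[of u]] lmapD(1)[of u] by (simp add: degree_half_eq circ_gagl_circ_of)

lemma gagl_const: "gagl (\<lambda>x. c) = 0"
  by (simp add: gagl_def lquot_def)

lemma line_map_const: "cmod c = 1 \<Longrightarrow> line_map (\<lambda>x. c)"
  by (simp add: line_map_def gagl_const)

lemma gagl_cong_AE: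
  assumes "AE x in lborel. u x = v x"
  shows "gagl u = gagl v"
proof -
  have "AE z in lborel \<Otimes>\<^sub>M lborel. u (fst z) = v (fst z) \<and> u (snd z) = v (snd z)"
    using AE_pair_fst[OF sigma_finite_lborel assms] AE_pair_snd[OF sigma_finite_lborel assms] by (rule AE_conjI)
  then show ?thesis unfolding gagl_def
    by (intro nn_integral_cong_AE, eventually_elim) (auto simp: lquot_def split: prod.split)
qed

lemma degree_half_AE_1:
  assumes "line_map u" "AE x in lborel. u x = 1"
  shows "degree_half u = 0"
  using gagl_cong_AE[OF assms(2)] by (intro degree_half_eq_0 assms) (simp add: gagl_const)

lemma degree_half_cnj:
  assumes "line_map u"
  shows "degree_half (\<lambda>x. cnj (u x)) = - degree_half u"
proof -
  have "u x * cnj (u x) = 1" for x using lmapD(2)[OF assms, of x] complex_norm_square[of "u x"] by simp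
  then have "degree_half u + degree_half (\<lambda>x. cnj (u x)) = degree_half (\<lambda>x. 1)"
    using degree_half_mult[OF assms line_map_cnj[OF assms]] by simp
  also have "\<dots> = 0" by (rule degree_half_AE_1) (auto simp: line_map_const)
  finally show ?thesis by simp
qed

lemma gagl_cis_le:
  fixes \<eta> :: "real \<Rightarrow> real"
  assumes [measurable]: "\<eta> \<in> borel_measurable borel"
  shows "gagl (\<lambda>x. cis (c * \<eta> x)) \<le> ennreal (c\<^sup>2) * gagl (\<lambda>x. of_real (\<eta> x))"
proof -
  have lip: "cmod (cis a - cis b) \<le> \<bar>a - b\<bar>" for a b
    using norm_one_minus_cis_le[of "b - a" a] norm_one_minus_cis_le[of "a - b" b]
    by (cases "a \<le> b") (auto simp: norm_minus_commute)
  have pt: "lquot (\<lambda>x. cis (c * \<eta> x)) z \<le> c\<^sup>2 * lquot (\<lambda>x. of_real (\<eta> x)) z" for z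
  proof (cases z)
    case (Pair x y)
    have "(cmod (cis (c * \<eta> x) - cis (c * \<eta> y)))\<^sup>2 \<le> \<bar>c * \<eta> x - c * \<eta> y\<bar>\<^sup>2" by (intro power_mono lip) auto
    also have "\<dots> = c\<^sup>2 * (cmod (of_real (\<eta> x) - of_real (\<eta> y)))\<^sup>2"
      by (simp add: power_mult_distrib flip: right_diff_distrib of_real_diff)
    finally have "(cmod (cis (c * \<eta> x) - cis (c * \<eta> y)))\<^sup>2 / \<bar>x - y\<bar>\<^sup>2
        \<le> c\<^sup>2 * (cmod (of_real (\<eta> x) - of_real (\<eta> y)))\<^sup>2 / \<bar>x - y\<bar>\<^sup>2"
      by (rule divide_right_mono) simp
    then show ?thesis by (simp add: Pair lquot_def)
  qed
  have "gagl (\<lambda>x. cis (c * \<eta> x)) \<le> (\<integral>\<^sup>+z. ennreal (c\<^sup>2) * ennreal (lquot (\<lambda>x. of_real (\<eta> x)) z) \<partial>(lborel \<Otimes>\<^sub>M lborel))"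
    unfolding gagl_def using ennreal_leI[OF pt] by (intro nn_integral_mono) (simp add: ennreal_mult)
  also have "\<dots> \<le> ennreal (c\<^sup>2) * gagl (\<lambda>x. of_real (\<eta> x))"
    unfolding gagl_def by (subst nn_integral_cmult) auto
  finally show ?thesis .
qed

lemma ang_surj:
  assumes "s \<in> {- 3 * pi / 2<..<pi / 2}"
  shows "\<exists>x. ang x = s"
proof
  have "arctan (tan (s / 2 + pi / 4)) = s / 2 + pi / 4" using assms by (intro arctan_tan) auto
  then show "ang (tan (s / 2 + pi / 4)) = s" by (simp add: ang_def)
qed

lemma line_map_power:
  assumes "line_map u"
  shows "line_map (\<lambda>x. u x ^ m)" and "degree_half (\<lambda>x. u x ^ m) = int m * degree_half u"
proof (induction m)
  case 0
  show "line_map (\<lambda>x. u x ^ 0)" by (simp add: line_map_const)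
  show "degree_half (\<lambda>x. u x ^ 0) = int 0 * degree_half u"
    using degree_half_AE_1[of "\<lambda>x. 1"] by (simp add: line_map_const)
next
  case (Suc m)
  show "line_map (\<lambda>x. u x ^ Suc m)" using line_map_mult[OF assms Suc(1)] by simp
  show "degree_half (\<lambda>x. u x ^ Suc m) = int (Suc m) * degree_half u"
    using degree_half_mult[OF assms Suc(1)] Suc(2) by (simp add: algebra_simps)
qed

text \<open>The phase factor is the \<open>m\<close>-th power of one with phase \<open>c / m\<close> times \<open>\<eta>\<close>, whose energy is
  below the threshold of \<open>degree_half_eq_0\<close> for large \<open>m\<close>.\<close>

lemma degree_half_cis:
  fixes \<eta> :: "real \<Rightarrow> real"
  assumes [measurable]: "\<eta> \<in> borel_measurable borel" and fin: "gagl (\<lambda>x. of_real (\<eta> x)) < \<infinity>"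
  shows "line_map (\<lambda>x. cis (c * \<eta> x))" and "degree_half (\<lambda>x. cis (c * \<eta> x)) = 0"
proof -
  have l: "line_map (\<lambda>x. cis (c * \<eta> x))" for c
  proof -
    have "gagl (\<lambda>x. cis (c * \<eta> x)) < \<infinity>"
      by (rule order_le_less_trans[OF gagl_cis_le]) (use fin in \<open>auto simp: ennreal_mult_less_top\<close>)
    then show ?thesis by (simp add: line_map_def)
  qed
  then show "line_map (\<lambda>x. cis (c * \<eta> x))" .
  obtain A where A: "gagl (\<lambda>x. of_real (\<eta> x)) = ennreal A" "0 \<le> A" using fin by (cases "gagl (\<lambda>x. of_real (\<eta> x))") auto
  obtain m :: nat where m: "c\<^sup>2 * A + 1 < real m" using reals_Archimedean2 by blast
  have m1: "1 \<le> real m" using m A by (smt (verit) mult_nonneg_nonneg zero_le_power2)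
  have "gagl (\<lambda>x. cis ((c / m) * \<eta> x)) \<le> ennreal ((c / m)\<^sup>2) * ennreal A"
    using gagl_cis_le[of \<eta> "c / m"] A by simp
  also have "\<dots> = ennreal ((c / m)\<^sup>2 * A)" using A by (simp add: ennreal_mult)
  also have "\<dots> < ennreal (4 * pi\<^sup>2)"
  proof -
    have "c\<^sup>2 * A \<le> (real m)\<^sup>2 * 1"
    proof -
      have "c\<^sup>2 * A \<le> real m * 1" using m by simp
      also have "\<dots> \<le> real m * real m" using m1 by (intro mult_left_mono) auto
      finally show ?thesis by (simp add: power2_eq_square)
    qed
    then have "(c / m)\<^sup>2 * A \<le> 1" using m1 by (simp add: power_divide pos_divide_le_eq)
    also have "1 < 4 * pi\<^sup>2"
    proof -
      have "1 * 1 < pi * pi" using pi_gt3 by (intro mult_strict_mono) auto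
      then show ?thesis by (simp add: power2_eq_square)
    qed
    finally show ?thesis using A by (simp add: ennreal_less_iff)
  qed
  finally have 0: "degree_half (\<lambda>x. cis ((c / m) * \<eta> x)) = 0" by (intro degree_half_eq_0 l)
  have "cis ((c / m) * \<eta> x) ^ m = cis (c * \<eta> x)" for x
    using Complex.DeMoivre[of "(c / m) * \<eta> x" m] m1 by simp
  then show "degree_half (\<lambda>x. cis (c * \<eta> x)) = 0"
    using line_map_power(2)[OF l, of "c / m" m] 0 by simp
qed

section \<open>Criteria for finite energy on the line\<close>

lemma nn_integral_inverse_one_plus_sq: "(\<integral>\<^sup>+x. ennreal (2 / (1 + x\<^sup>2)) \<partial>lborel) = ennreal (2 * pi)"
  using nn_integral_circ_subst[of "\<lambda>_. 1"] by (simp add: periodic_def emeasure_circ)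

lemma sin_arctan_diff: "sin (arctan y - arctan x) = (y - x) / (sqrt (1 + x\<^sup>2) * sqrt (1 + y\<^sup>2))"
  unfolding sin_diff sin_arctan cos_arctan by (simp add: diff_divide_distrib mult.commute)

text \<open>The decaying term is a multiple of the product of the two Jacobians, so its integral
  over the plane is a multiple of the squared length of the circle.\<close>

lemma gagl_finite_of_decay:
  assumes K: "0 \<le> K" and v[measurable]: "v \<in> borel_measurable borel" and fin: "gagl v < \<infinity>"
    and le: "\<And>x y. lquot u (x, y) \<le> lquot v (x, y) + K / ((1 + x\<^sup>2) * (1 + y\<^sup>2))"
  shows "gagl u < \<infinity>"
proof -
  let ?D = "\<lambda>z. ennreal (2 / (1 + (fst z)\<^sup>2)) * ennreal (2 / (1 + (snd z)\<^sup>2))"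
  have D: "(\<integral>\<^sup>+z. ?D z \<partial>(lborel \<Otimes>\<^sub>M lborel)) = ennreal (2 * pi) * ennreal (2 * pi)"
  proof -
    have "(\<integral>\<^sup>+z. ?D z \<partial>(lborel \<Otimes>\<^sub>M lborel))
        = (\<integral>\<^sup>+x. \<integral>\<^sup>+y. ennreal (2 / (1 + x\<^sup>2)) * ennreal (2 / (1 + y\<^sup>2)) \<partial>lborel \<partial>lborel)"
      by (subst lborel.nn_integral_fst[symmetric]) auto
    also have "\<dots> = ennreal (2 * pi) * ennreal (2 * pi)"
      by (simp add: nn_integral_cmult nn_integral_multc nn_integral_inverse_one_plus_sq)
    finally show ?thesis .
  qed
  have "gagl u \<le> (\<integral>\<^sup>+z. ennreal (lquot v z) + ennreal K * ?D z \<partial>(lborel \<Otimes>\<^sub>M lborel))"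
    unfolding gagl_def
  proof (rule nn_integral_mono)
    fix z :: "real \<times> real"
    obtain x y where z: "z = (x, y)" by (cases z)
    have "lquot u z \<le> lquot v z + K / ((1 + x\<^sup>2) * (1 + y\<^sup>2))" using le z by simp
    also have "K / ((1 + x\<^sup>2) * (1 + y\<^sup>2)) \<le> K * ((2 / (1 + x\<^sup>2)) * (2 / (1 + y\<^sup>2)))"
      using K by (simp add: divide_right_mono one_plus_sq_pos less_imp_le)
    finally have "ennreal (lquot u z) \<le> ennreal (lquot v z + K * ((2 / (1 + x\<^sup>2)) * (2 / (1 + y\<^sup>2))))"
      by (intro ennreal_leI) simp
    also have "\<dots> = ennreal (lquot v z) + ennreal (K * ((2 / (1 + x\<^sup>2)) * (2 / (1 + y\<^sup>2))))"
      using K by (intro ennreal_plus) (auto intro!: mult_nonneg_nonneg divide_nonneg_nonneg)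
    also have "ennreal (K * ((2 / (1 + x\<^sup>2)) * (2 / (1 + y\<^sup>2)))) = ennreal K * ?D z"
      using K unfolding z fst_conv snd_conv
      by (subst ennreal_mult; (subst ennreal_mult)?) (auto intro!: mult_nonneg_nonneg divide_nonneg_nonneg)
    finally show "ennreal (lquot u z) \<le> ennreal (lquot v z) + ennreal K * ?D z" .
  qed
  also have "\<dots> = gagl v + ennreal K * (\<integral>\<^sup>+z. ?D z \<partial>(lborel \<Otimes>\<^sub>M lborel))"
    unfolding gagl_def by (subst nn_integral_add) (auto simp: nn_integral_cmult)
  also have "\<dots> < \<infinity>" unfolding D using fin by (simp add: ennreal_mult_less_top)
  finally show ?thesis .
qed

text \<open>Being Lipschitz in \<open>arctan\<close> means being Lipschitz in the angle on the
  circle cut at the north pole. The common limit closes the cut, so increments can be measured along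
  either arc and hence by the chord.\<close>

lemma gagl_finite_arctan_lipschitz:
  fixes \<eta> :: "real \<Rightarrow> real"
  assumes lip: "\<And>x y. \<bar>\<eta> x - \<eta> y\<bar> \<le> K * \<bar>arctan x - arctan y\<bar>"
    and top: "(\<eta> \<longlongrightarrow> l) at_top" and bot: "(\<eta> \<longlongrightarrow> l) at_bot"
  shows "gagl (\<lambda>x. of_real (\<eta> x)) < \<infinity>"
proof -
  have K: "0 \<le> K"
  proof -
    have "0 \<le> K * \<bar>arctan 1 - arctan 0\<bar>" using lip[of 1 0] by linarith
    then show ?thesis using pi_gt_zero by (simp add: arctan_one zero_le_mult_iff)
  qed
  \<comment> \<open>The second argument of the Lipschitz bound is sent to infinity.\<close>
  have up: "\<bar>\<eta> y - l\<bar> \<le> K * \<bar>arctan y - pi / 2\<bar>" for y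
  proof (rule tendsto_le)
    show "((\<lambda>z. K * \<bar>arctan y - arctan z\<bar>) \<longlongrightarrow> K * \<bar>arctan y - pi / 2\<bar>) at_top"
      by (intro tendsto_intros tendsto_arctan_at_top)
    show "((\<lambda>z. \<bar>\<eta> y - \<eta> z\<bar>) \<longlongrightarrow> \<bar>\<eta> y - l\<bar>) at_top" by (intro tendsto_intros top)
  qed (auto intro!: always_eventually lip)
  have down: "\<bar>\<eta> y - l\<bar> \<le> K * \<bar>arctan y - (- (pi / 2))\<bar>" for y
  proof (rule tendsto_le)
    show "((\<lambda>z. K * \<bar>arctan y - arctan z\<bar>) \<longlongrightarrow> K * \<bar>arctan y - (- (pi / 2))\<bar>) at_bot"
      by (intro tendsto_intros tendsto_arctan_at_bot)
    show "((\<lambda>z. \<bar>\<eta> y - \<eta> z\<bar>) \<longlongrightarrow> \<bar>\<eta> y - l\<bar>) at_bot" by (intro tendsto_intros bot)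
  qed (auto intro!: always_eventually lip)
  have key: "\<bar>\<eta> x - \<eta> y\<bar> \<le> K * (2 * ((y - x) / (sqrt (1 + x\<^sup>2) * sqrt (1 + y\<^sup>2))))" if "x \<le> y" for x y
  proof -
    define \<alpha> where "\<alpha> = arctan y - arctan x"
    have \<alpha>: "0 \<le> \<alpha>" "\<alpha> \<le> pi"
      using that arctan_lbound[of x] arctan_ubound[of y] by (auto simp: \<alpha>_def arctan_le_iff)
    have 1: "\<bar>\<eta> x - \<eta> y\<bar> \<le> K * \<alpha>" using lip[of x y] \<alpha> by (simp add: \<alpha>_def)
    \<comment> \<open>The other arc, through the point at infinity, where \<eta> has the value
      \<open>l\<close>.\<close>
    have "\<bar>\<eta> x - \<eta> y\<bar> \<le> \<bar>\<eta> x - l\<bar> + \<bar>\<eta> y - l\<bar>" by linarith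
    also have "\<dots> \<le> K * (arctan x + pi / 2) + K * (pi / 2 - arctan y)"
      using up[of y] down[of x] arctan_lbound[of x] arctan_ubound[of y] by (intro add_mono) auto
    also have "\<dots> = K * (pi - \<alpha>)" by (simp add: \<alpha>_def algebra_simps)
    finally have 2: "\<bar>\<eta> x - \<eta> y\<bar> \<le> K * (pi - \<alpha>)" .
    have "\<bar>\<eta> x - \<eta> y\<bar> \<le> K * min \<alpha> (pi - \<alpha>)" using 1 2 by (auto simp: min_def)
    also have "\<dots> \<le> K * (2 * sin \<alpha>)" using min_le_sin[OF \<alpha>] K by (intro mult_left_mono) auto
    finally show ?thesis unfolding \<alpha>_def sin_arctan_diff .
  qed
  have key2: "\<bar>\<eta> x - \<eta> y\<bar> \<le> K * (2 * (\<bar>x - y\<bar> / (sqrt (1 + x\<^sup>2) * sqrt (1 + y\<^sup>2))))" for x y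
    using key[of x y] key[of y x] by (cases "x \<le> y") (auto simp: mult.commute abs_minus_commute)
  show ?thesis
  proof (rule gagl_finite_of_decay[of "4 * K\<^sup>2" "\<lambda>x. 0"])
    fix x y :: real
    have "\<bar>\<eta> x - \<eta> y\<bar>\<^sup>2 \<le> (K * (2 * (\<bar>x - y\<bar> / (sqrt (1 + x\<^sup>2) * sqrt (1 + y\<^sup>2)))))\<^sup>2"
      by (intro power_mono key2) auto
    also have "\<dots> = 4 * K\<^sup>2 * \<bar>x - y\<bar>\<^sup>2 / ((1 + x\<^sup>2) * (1 + y\<^sup>2))"
      using one_plus_sq_pos[of x] one_plus_sq_pos[of y] by (simp add: power_mult_distrib power_divide less_imp_le)
    finally have "\<bar>\<eta> x - \<eta> y\<bar>\<^sup>2 / \<bar>x - y\<bar>\<^sup>2 \<le> (4 * K\<^sup>2 * \<bar>x - y\<bar>\<^sup>2 / ((1 + x\<^sup>2) * (1 + y\<^sup>2))) / \<bar>x - y\<bar>\<^sup>2"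
      by (rule divide_right_mono) simp
    also have "\<dots> \<le> 4 * K\<^sup>2 / ((1 + x\<^sup>2) * (1 + y\<^sup>2))"
      by (cases "x = y") (auto simp: one_plus_sq_pos less_imp_le intro!: divide_nonneg_nonneg mult_nonneg_nonneg)
    finally show "lquot (\<lambda>x. of_real (\<eta> x)) (x, y) \<le> lquot (\<lambda>x. 0) (x, y) + 4 * K\<^sup>2 / ((1 + x\<^sup>2) * (1 + y\<^sup>2))"
      by (simp add: lquot_def flip: of_real_diff)
  qed (simp_all add: gagl_const)
qed

section \<open>Maps of known degree\<close>

lemma AE_circ_cis_neq_i: "AE t in circ. cis t \<noteq> \<i>"
proof -
  have 1: "t = pi / 2" if "t \<in> {0..<2 * pi}" "cis t = \<i>" for t
  proof -
    have "cis t = cis (pi / 2)" using that by simp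
    then obtain n :: int where n: "t = pi / 2 + 2 * pi * of_int n" unfolding cis_eq_iff by auto
    have "- 1 * (2 * pi) < of_int n * (2 * pi)" "of_int n * (2 * pi) < 1 * (2 * pi)"
    proof -
      have "of_int n * (2 * pi) = t - pi / 2" using n by (simp add: mult_ac)
      moreover have "0 \<le> t" "t < 2 * pi" using that by auto
      ultimately show "- 1 * (2 * pi) < of_int n * (2 * pi)" "of_int n * (2 * pi) < 1 * (2 * pi)"
        using pi_gt_zero by linarith+
    qed
    then have "- 1 < real_of_int n" "real_of_int n < 1" using pi_gt_zero by (simp_all only: mult_less_cancel_right)
    then have "n = 0" by linarith
    then show ?thesis using n by simp
  qed
  have "AE t in lborel. t \<noteq> pi / 2" by (rule AE_lborel_singleton)
  then have "AE t in lborel. 0 < (indicator {0..<2 * pi} t :: ennreal) \<longrightarrow> cis t \<noteq> \<i>"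
    by eventually_elim (use 1 in \<open>auto split: split_indicator_asm\<close>)
  then show ?thesis unfolding circ_def by (subst AE_density) auto
qed

lemma circ_of_ang: "cis t \<noteq> \<i> \<Longrightarrow> circ_of (\<lambda>x. cis (ang x)) t = cis t"
proof -
  assume t: "cis t \<noteq> \<i>"
  obtain s0 where s0: "s0 \<in> {0..<2 * pi}" "cis s0 = cis t" using ex_angle_reduce by blast
  have ne: "s0 \<noteq> pi / 2" using s0(2) t by (metis cis_pi_half)
  obtain s where s: "s \<in> {- 3 * pi / 2<..<pi / 2}" "cis s = cis t"
  proof (cases "s0 < pi / 2")
    case True then show thesis using that[of s0] s0 by auto
  next
    case False
    have "cis (s0 - 2 * pi) = cis t" using cis_add_2pi[of "s0 - 2 * pi"] s0 by simp
    then show thesis using that[of "s0 - 2 * pi"] s0 False ne by auto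
  qed
  obtain x where "ang x = s" using ang_surj[OF s(1)] by blast
  then show ?thesis using s(2) stereographic_cis_ang[of x] by (simp add: circ_of_def)
qed

lemma circ_gagl_cong_AE:
  assumes "AE t in circ. F t = G t"
  shows "circ_gagl F = circ_gagl G"
proof -
  have "AE z in circ \<Otimes>\<^sub>M circ. F (fst z) = G (fst z) \<and> F (snd z) = G (snd z)"
    using AE_pair_fst[OF circ.sigma_finite_measure_axioms assms] AE_pair_snd[OF circ.sigma_finite_measure_axioms assms]
    by (rule AE_conjI)
  then show ?thesis unfolding circ_gagl_def
    by (intro nn_integral_cong_AE, eventually_elim) (auto simp: dquot_def split: prod.split)
qed

text \<open>Transported to the circle this is the identity map, except on the null set of angles of
  the north pole, so its winding integral is explicit.\<close>

lemma degree_half_ang: "line_map (\<lambda>x. cis (ang x))" "degree_half (\<lambda>x. cis (ang x)) = 1"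
proof -
  let ?v = "\<lambda>x. cis (ang x)"
  have chr1: "chr 1 = cis" by (simp add: chr_def fun_eq_iff)
  have C1: "C1_periodic cis (\<lambda>t. \<i> * cis t)"
    using has_vector_derivative_chr[of 1] unfolding C1_periodic_def chr1
    by (auto intro!: continuous_intros simp: periodic_def)
  have ae: "AE t in circ. circ_of ?v t = cis t" using AE_circ_cis_neq_i by eventually_elim (rule circ_of_ang)
  have fin: "gagl ?v < \<infinity>"
    using circ_gagl_circ_of[of ?v] circ_gagl_cong_AE[OF ae] C1_periodic_circ_gagl_finite[OF C1] by simp
  then show l: "line_map ?v" by (simp add: line_map_def)
  have ae0: "AE t in circ. cis t - circ_of ?v t = 0" using ae by eventually_elim simp
  have "circ_L2 (\<lambda>t. cis t - circ_of ?v t) = (\<integral>\<^sup>+t. 0 \<partial>circ)"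
    unfolding circ_L2_def using ae0 by (intro nn_integral_cong_AE, eventually_elim) simp
  moreover have "circ_gagl (\<lambda>t. cis t - circ_of ?v t) = circ_gagl (\<lambda>t. 0)" by (rule circ_gagl_cong_AE[OF ae0])
  ultimately have "circ_nrm (\<lambda>t. cis t - circ_of ?v t) = 0" by (simp add: circ_nrm_def circ_gagl_eq_0_const)
  from hdeg_C1[OF C1 _ circ_map_circ_of[OF l] this]
  have "wind cis (\<lambda>t. \<i> * cis t) = 2 * of_real pi * \<i> * of_int (degree_half ?v)"
    by (simp add: degree_half_eq[OF l])
  moreover have "wind cis (\<lambda>t. \<i> * cis t) = 2 * of_real pi * \<i>"
  proof -
    have "cnj (cis t) * (\<i> * cis t) = \<i>" for t
    proof -
      have "cnj (cis t) * (\<i> * cis t) = \<i> * (cis t * cnj (cis t))" by (simp add: mult_ac)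
      also have "cis t * cnj (cis t) = 1" using complex_norm_square[of "cis t"] by simp
      finally show ?thesis by simp
    qed
    then show ?thesis by (simp only: wind_def) (simp add: measure_circ scaleR_conv_of_real)
  qed
  ultimately show "degree_half ?v = 1" by simp
qed

text \<open>Multiplying by the degree one map \<open>\<lambda>x. cis (ang x)\<close> unwinds the phase, so that the product
  has a single-valued phase of finite energy.\<close>

lemma degree_half_one_sided_phase:
  fixes \<kappa> :: "real \<Rightarrow> real"
  assumes [measurable]: "\<kappa> \<in> borel_measurable borel"
    and lip: "\<And>x y. \<bar>\<kappa> x - \<kappa> y\<bar> \<le> K * \<bar>arctan x - arctan y\<bar>"
    and 0: "\<kappa> 0 = 1" and 1: "\<And>x. 1 \<le> x \<Longrightarrow> \<kappa> x = 0"
  shows "line_map (\<lambda>x. if 0 < x then cis (2 * pi * \<kappa> x) else 1)"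
    and "degree_half (\<lambda>x. if 0 < x then cis (2 * pi * \<kappa> x) else 1) = - 1"
proof -
  let ?w = "\<lambda>x. if 0 < x then cis (2 * pi * \<kappa> x) else 1"
  let ?v = "\<lambda>x. cis (ang x)"
  \<comment> \<open>On the left half-line the phase is a full turn instead of 0. This is invisible
    under \<open>cis\<close> but gives \<eta> the same limit \<open>pi / 2\<close> at both
    ends.\<close>
  define \<eta> where "\<eta> x = 2 * pi * (if 0 < x then \<kappa> x else 1) + ang x" for x
  have [measurable]: "\<eta> \<in> borel_measurable borel" unfolding \<eta>_def[abs_def] by measurable
  have K: "0 \<le> K"
  proof -
    have "0 \<le> K * \<bar>arctan 1 - arctan 0\<bar>" using lip[of 1 0] by linarith
    then show ?thesis using pi_gt_zero by (simp add: arctan_one zero_le_mult_iff)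
  qed
  have lip2: "\<bar>(if 0 < x then \<kappa> x else 1) - (if 0 < y then \<kappa> y else 1)\<bar> \<le> K * \<bar>arctan x - arctan y\<bar>" for x y
  proof -
    have clamp: "(if 0 < z then \<kappa> z else 1) = \<kappa> (max 0 z)" for z by (auto simp: 0 max_def)
    have "\<bar>\<kappa> (max 0 x) - \<kappa> (max 0 y)\<bar> \<le> K * \<bar>arctan (max 0 x) - arctan (max 0 y)\<bar>" by (rule lip)
    also have "\<dots> \<le> K * \<bar>arctan x - arctan y\<bar>"
    proof (rule mult_left_mono[OF _ K])
      have "arctan (max 0 z) = max 0 (arctan z)" for z
        by (cases "0 \<le> z") (auto simp: max_def)
      moreover have "\<bar>max 0 a - max 0 b\<bar> \<le> \<bar>a - b\<bar>" for a b :: real by (auto simp: max_def)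
      ultimately show "\<bar>arctan (max 0 x) - arctan (max 0 y)\<bar> \<le> \<bar>arctan x - arctan y\<bar>" by simp
    qed
    finally show ?thesis unfolding clamp .
  qed
  have lip3: "\<bar>\<eta> x - \<eta> y\<bar> \<le> (2 * pi * K + 2) * \<bar>arctan x - arctan y\<bar>" for x y
  proof -
    let ?a = "(if 0 < x then \<kappa> x else 1) - (if 0 < y then \<kappa> y else 1)"
    have "\<eta> x - \<eta> y = 2 * pi * ?a + 2 * (arctan x - arctan y)" by (simp add: \<eta>_def ang_def algebra_simps)
    then have "\<bar>\<eta> x - \<eta> y\<bar> \<le> \<bar>2 * pi * ?a\<bar> + \<bar>2 * (arctan x - arctan y)\<bar>" by (simp only: abs_triangle_ineq)
    also have "\<dots> = 2 * pi * \<bar>?a\<bar> + 2 * \<bar>arctan x - arctan y\<bar>" by (simp only: abs_mult) simp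
    also have "\<dots> \<le> 2 * pi * (K * \<bar>arctan x - arctan y\<bar>) + 2 * \<bar>arctan x - arctan y\<bar>"
      by (intro add_mono mult_left_mono lip2) auto
    finally show ?thesis by (simp add: algebra_simps)
  qed
  have "(\<eta> \<longlongrightarrow> 2 * pi * 0 + (2 * (pi / 2) - pi / 2)) at_top"
  proof (rule Lim_transform_eventually)
    show "((\<lambda>x. 2 * pi * 0 + (2 * arctan x - pi / 2)) \<longlongrightarrow> 2 * pi * 0 + (2 * (pi / 2) - pi / 2)) at_top"
      by (intro tendsto_intros tendsto_arctan_at_top)
    show "eventually (\<lambda>x. 2 * pi * 0 + (2 * arctan x - pi / 2) = \<eta> x) at_top"
      using eventually_ge_at_top[of "1::real"] by eventually_elim (simp add: \<eta>_def ang_def 1)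
  qed
  then have top: "(\<eta> \<longlongrightarrow> pi / 2) at_top" by simp
  have "(\<eta> \<longlongrightarrow> 2 * pi * 1 + (2 * (- (pi / 2)) - pi / 2)) at_bot"
  proof (rule Lim_transform_eventually)
    show "((\<lambda>x. 2 * pi * 1 + (2 * arctan x - pi / 2)) \<longlongrightarrow> 2 * pi * 1 + (2 * (- (pi / 2)) - pi / 2)) at_bot"
      by (intro tendsto_intros tendsto_arctan_at_bot)
    show "eventually (\<lambda>x. 2 * pi * 1 + (2 * arctan x - pi / 2) = \<eta> x) at_bot"
      using eventually_le_at_bot[of "0::real"] by eventually_elim (simp add: \<eta>_def ang_def)
  qed
  then have bot: "(\<eta> \<longlongrightarrow> pi / 2) at_bot" by simp
  have fin: "gagl (\<lambda>x. of_real (\<eta> x)) < \<infinity>" by (rule gagl_finite_arctan_lipschitz[OF lip3 top bot])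
  have le: "line_map (\<lambda>x. cis (\<eta> x))" and de: "degree_half (\<lambda>x. cis (\<eta> x)) = 0"
    using degree_half_cis[OF _ fin, of 1] by simp_all
  have eq: "cis (\<eta> x) * cnj (?v x) = ?w x" for x
  proof -
    have "cis (\<eta> x) * cnj (?v x) = cis (2 * pi * (if 0 < x then \<kappa> x else 1))"
      by (simp add: \<eta>_def cis_cnj cis_mult)
    then show ?thesis by (simp split: if_splits)
  qed
  show "line_map ?w" using line_map_mult[OF le line_map_cnj[OF degree_half_ang(1)]] unfolding eq .
  show "degree_half ?w = - 1"
    using degree_half_mult[OF le line_map_cnj[OF degree_half_ang(1)]] degree_half_cnj[OF degree_half_ang(1)]
      degree_half_ang(2) de unfolding eq by simp
qed

section \<open>Cutoffs of small energy\<close>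

lemma sqrt_lquot: "sqrt (lquot u (x, y)) = cmod (u x - u y) / \<bar>x - y\<bar>"
  by (simp add: lquot_def real_sqrt_divide)

text \<open>For unimodular maps the increment of a product is at least the difference between the
  moduli of the increments of its factors. So the energies of the factors add up to at most that of
  the product wherever the cross term is small.\<close>

lemma gagl_cross_mult:
  assumes [measurable]: "u \<in> borel_measurable borel" "w \<in> borel_measurable borel"
    and un: "\<And>x. cmod (u x) = 1" "\<And>x. cmod (w x) = 1"
  shows "gagl u + gagl w \<le> gagl (\<lambda>x. u x * w x)
    + 2 * (\<integral>\<^sup>+z. ennreal (sqrt (lquot u z) * sqrt (lquot w z)) \<partial>(lborel \<Otimes>\<^sub>M lborel))"
proof -
  have pt: "lquot u z + lquot w z \<le> lquot (\<lambda>x. u x * w x) z + 2 * (sqrt (lquot u z) * sqrt (lquot w z))" for z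
  proof (cases z)
    case (Pair x y)
    let ?p = "cmod (u x - u y)" and ?q = "cmod (w x - w y)"
    have "u x * w x - u y * w y = (u x - u y) * w x - u y * (w y - w x)" by (simp add: algebra_simps)
    then have "\<bar>?p - ?q\<bar> \<le> cmod (u x * w x - u y * w y)"
      using norm_triangle_ineq3[of "(u x - u y) * w x" "u y * (w y - w x)"]
      by (simp add: norm_mult un norm_minus_commute)
    then have "\<bar>?p - ?q\<bar>\<^sup>2 \<le> (cmod (u x * w x - u y * w y))\<^sup>2" by (intro power_mono) auto
    then have "?p\<^sup>2 + ?q\<^sup>2 \<le> (cmod (u x * w x - u y * w y))\<^sup>2 + 2 * (?p * ?q)" by (simp add: power2_diff)
    then have "(?p\<^sup>2 + ?q\<^sup>2) / \<bar>x - y\<bar>\<^sup>2 \<le> ((cmod (u x * w x - u y * w y))\<^sup>2 + 2 * (?p * ?q)) / \<bar>x - y\<bar>\<^sup>2"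
      by (rule divide_right_mono) simp
    then show ?thesis
      unfolding Pair sqrt_lquot unfolding lquot_def
      by (simp add: add_divide_distrib power2_eq_square)
  qed
  have "gagl u + gagl w = (\<integral>\<^sup>+z. ennreal (lquot u z + lquot w z) \<partial>(lborel \<Otimes>\<^sub>M lborel))"
    unfolding gagl_def by (simp add: nn_integral_add)
  also have "\<dots> \<le> (\<integral>\<^sup>+z. ennreal (lquot (\<lambda>x. u x * w x) z) + 2 * ennreal (sqrt (lquot u z) * sqrt (lquot w z)) \<partial>(lborel \<Otimes>\<^sub>M lborel))"
  proof (rule nn_integral_mono)
    fix z
    have "ennreal (lquot u z + lquot w z) \<le> ennreal (lquot (\<lambda>x. u x * w x) z + 2 * (sqrt (lquot u z) * sqrt (lquot w z)))"
      by (rule ennreal_leI[OF pt])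
    also have "\<dots> = ennreal (lquot (\<lambda>x. u x * w x) z) + ennreal (2 * (sqrt (lquot u z) * sqrt (lquot w z)))"
      by (rule ennreal_plus) auto
    also have "ennreal (2 * (sqrt (lquot u z) * sqrt (lquot w z))) = 2 * ennreal (sqrt (lquot u z) * sqrt (lquot w z))"
      by (subst ennreal_mult) auto
    finally show "ennreal (lquot u z + lquot w z) \<le> ennreal (lquot (\<lambda>x. u x * w x) z) + 2 * ennreal (sqrt (lquot u z) * sqrt (lquot w z))" .
  qed
  also have "\<dots> = gagl (\<lambda>x. u x * w x) + 2 * (\<integral>\<^sup>+z. ennreal (sqrt (lquot u z) * sqrt (lquot w z)) \<partial>(lborel \<Otimes>\<^sub>M lborel))"
    unfolding gagl_def by (subst nn_integral_add) (auto simp: nn_integral_cmult)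
  finally show ?thesis .
qed

text \<open>The Lipschitz condition is stated in \<open>arctan\<close>, that is in the angle on the
  circle, to fit \<open>gagl_finite_arctan_lipschitz\<close>.\<close>

definition cutoff :: "real \<Rightarrow> (real \<Rightarrow> real) \<Rightarrow> bool" where
  "cutoff a \<kappa> \<longleftrightarrow> (\<exists>K. \<forall>x y. \<bar>\<kappa> x - \<kappa> y\<bar> \<le> K * \<bar>arctan x - arctan y\<bar>) \<and>
    (\<forall>x. \<bar>x\<bar> \<le> a \<longrightarrow> \<kappa> x = 1) \<and> (\<forall>x. 1 \<le> \<bar>x\<bar> \<longrightarrow> \<kappa> x = 0)"

lemma cutoff_continuous:
  assumes "cutoff a \<kappa>"
  shows "continuous_on UNIV \<kappa>"
proof -
  obtain K where K: "\<And>x y. \<bar>\<kappa> x - \<kappa> y\<bar> \<le> K * \<bar>arctan x - arctan y\<bar>" using assms by (auto simp: cutoff_def)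
  have "(\<kappa> \<longlongrightarrow> \<kappa> x) (at x)" for x
  proof (rule LIM_zero_cancel, rule Lim_null_comparison)
    show "eventually (\<lambda>y. norm (\<kappa> y - \<kappa> x) \<le> K * \<bar>arctan y - arctan x\<bar>) (at x)"
      using K by (simp add: always_eventually)
    have "((\<lambda>y. K * \<bar>arctan y - arctan x\<bar>) \<longlongrightarrow> K * \<bar>arctan x - arctan x\<bar>) (at x)"
      by (intro tendsto_intros)
    then show "((\<lambda>y. K * \<bar>arctan y - arctan x\<bar>) \<longlongrightarrow> 0) (at x)" by simp
  qed
  then show ?thesis by (simp add: continuous_on_def)
qed

lemma cutoff_measurable: "cutoff a \<kappa> \<Longrightarrow> \<kappa> \<in> borel_measurable borel"
  by (intro borel_measurable_continuous_onI cutoff_continuous)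

lemma cutoff_gagl_finite:
  assumes "cutoff a \<kappa>"
  shows "gagl (\<lambda>x. of_real (\<kappa> x)) < \<infinity>"
proof -
  obtain K where K: "\<And>x y. \<bar>\<kappa> x - \<kappa> y\<bar> \<le> K * \<bar>arctan x - arctan y\<bar>" using assms by (auto simp: cutoff_def)
  show ?thesis
  proof (rule gagl_finite_arctan_lipschitz[OF K])
    have "eventually (\<lambda>x. 0 = \<kappa> x) at_top"
      using eventually_ge_at_top[of "1::real"] by eventually_elim (use assms in \<open>auto simp: cutoff_def\<close>)
    then show "(\<kappa> \<longlongrightarrow> 0) at_top" by (rule Lim_transform_eventually[OF tendsto_const])
    have "eventually (\<lambda>x. 0 = \<kappa> x) at_bot"
      using eventually_le_at_bot[of "-1::real"] by eventually_elim (use assms in \<open>auto simp: cutoff_def\<close>)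
    then show "(\<kappa> \<longlongrightarrow> 0) at_bot" by (rule Lim_transform_eventually[OF tendsto_const])
  qed
qed

lemma cutoff_exists: "\<exists>a>0. \<exists>\<kappa>. cutoff a \<kappa>"
proof -
  \<comment> \<open>A trapezoid in the angle: 1 while \<open>\<bar>arctan x\<bar>\<close> is at most
    \<open>pi / 8\<close>, and 0 once it reaches \<open>pi / 4\<close>, the value at
    \<open>x = 1\<close>.\<close>
  define \<kappa> where "\<kappa> x = max 0 (min 1 (2 - (8 / pi) * \<bar>arctan x\<bar>))" for x
  define a where "a = tan (pi / 8)"
  have a: "0 < a" unfolding a_def by (rule tan_gt_zero) auto
  have at_a: "arctan a = pi / 8" unfolding a_def by (intro arctan_tan) auto
  have lip: "\<bar>\<kappa> x - \<kappa> y\<bar> \<le> (8 / pi) * \<bar>arctan x - arctan y\<bar>" for x y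
  proof -
    have "\<bar>max 0 (min 1 p) - max 0 (min 1 q)\<bar> \<le> \<bar>p - q\<bar>" for p q :: real by (auto simp: max_def min_def)
    then have "\<bar>\<kappa> x - \<kappa> y\<bar> \<le> \<bar>(2 - (8 / pi) * \<bar>arctan x\<bar>) - (2 - (8 / pi) * \<bar>arctan y\<bar>)\<bar>"
      unfolding \<kappa>_def .
    also have "\<dots> = \<bar>(8 / pi) * (\<bar>arctan y\<bar> - \<bar>arctan x\<bar>)\<bar>"
    proof -
      have "(2 - c * p) - (2 - c * q) = c * (q - p)" for c p q :: real by (simp add: algebra_simps)
      then show ?thesis by (simp only:)
    qed
    also have "\<dots> = (8 / pi) * \<bar>\<bar>arctan y\<bar> - \<bar>arctan x\<bar>\<bar>"
    proof -
      have "0 \<le> 8 / pi" by simp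
      then show ?thesis by (simp only: abs_mult abs_of_nonneg)
    qed
    also have "\<dots> \<le> (8 / pi) * \<bar>arctan x - arctan y\<bar>" by (intro mult_left_mono) auto
    finally show ?thesis .
  qed
  have one: "\<kappa> x = 1" if "\<bar>x\<bar> \<le> a" for x
  proof -
    have "arctan x \<le> arctan a" "arctan (- a) \<le> arctan x" using that by (auto simp: arctan_le_iff)
    then have "\<bar>arctan x\<bar> \<le> pi / 8" by (simp add: at_a arctan_minus)
    then have "(8 / pi) * \<bar>arctan x\<bar> \<le> (8 / pi) * (pi / 8)" by (intro mult_left_mono) auto
    then show ?thesis by (simp add: \<kappa>_def)
  qed
  have zero: "\<kappa> x = 0" if "1 \<le> \<bar>x\<bar>" for x
  proof -
    have "pi / 4 \<le> \<bar>arctan x\<bar>"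
    proof (cases "0 \<le> x")
      case True
      then have "1 \<le> x" using that by simp
      then have "arctan 1 \<le> arctan x" by (simp only: arctan_le_iff)
      then show ?thesis unfolding arctan_one by linarith
    next
      case False
      then have "x \<le> - 1" using that by simp
      then have "arctan x \<le> arctan (- 1)" by (simp only: arctan_le_iff)
      then show ?thesis unfolding arctan_minus arctan_one by linarith
    qed
    then have "(8 / pi) * (pi / 4) \<le> (8 / pi) * \<bar>arctan x\<bar>" by (intro mult_left_mono) auto
    then show ?thesis by (simp add: \<kappa>_def)
  qed
  have "cutoff a \<kappa>" unfolding cutoff_def using lip one zero by blast
  then show ?thesis using a by blast
qed

text \<open>Makes the class of cutoffs stable under dilations. The derivative of
  \<open>s * arctan t - arctan (s * t)\<close> is nonnegative.\<close>

lemma arctan_scale_le: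
  assumes s: "1 \<le> s"
  shows "\<bar>arctan (s * x) - arctan (s * y)\<bar> \<le> s * \<bar>arctan x - arctan y\<bar>"
proof -
  have key: "arctan (s * y) - arctan (s * x) \<le> s * (arctan y - arctan x)" if "x \<le> y" for x y
  proof -
    have "s * arctan x - arctan (s * x) \<le> s * arctan y - arctan (s * y)"
    proof (rule DERIV_nonneg_imp_nondecreasing[OF that])
      fix t
      have "((\<lambda>t. s * arctan t - arctan (s * t)) has_real_derivative s * inverse (1 + t\<^sup>2) - inverse (1 + (s * t)\<^sup>2) * s) (at t)"
        by (intro DERIV_diff DERIV_cmult DERIV_arctan DERIV_chain2[OF DERIV_arctan])
          (auto intro!: derivative_eq_intros)
      moreover have "0 \<le> s * inverse (1 + t\<^sup>2) - inverse (1 + (s * t)\<^sup>2) * s"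
      proof -
        have "1 + t\<^sup>2 \<le> 1 + (s * t)\<^sup>2"
        proof -
          have "1 * t\<^sup>2 \<le> s\<^sup>2 * t\<^sup>2" using s by (intro mult_right_mono) (auto simp: one_le_power)
          then show ?thesis by (simp add: power_mult_distrib)
        qed
        then have "inverse (1 + (s * t)\<^sup>2) \<le> inverse (1 + t\<^sup>2)" by (intro le_imp_inverse_le one_plus_sq_pos)
        then have "inverse (1 + (s * t)\<^sup>2) * s \<le> inverse (1 + t\<^sup>2) * s" using s by (intro mult_right_mono) auto
        then show ?thesis by (simp add: mult.commute)
      qed
      ultimately show "\<exists>d. ((\<lambda>t. s * arctan t - arctan (s * t)) has_real_derivative d) (at t) \<and> 0 \<le> d" by blast
    qed
    then show ?thesis by (simp add: algebra_simps)
  qed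
  show ?thesis
  proof (cases "x \<le> y")
    case True
    then have "arctan x \<le> arctan y" "arctan (s * x) \<le> arctan (s * y)"
      using s by (auto simp: arctan_le_iff mult_left_mono)
    then show ?thesis using key[OF True] by simp
  next
    case False
    then have le: "y \<le> x" by simp
    then have "arctan y \<le> arctan x" "arctan (s * y) \<le> arctan (s * x)"
      using s by (auto simp: arctan_le_iff mult_left_mono)
    then show ?thesis using key[OF le] by simp
  qed
qed

lemma lquot_scale: "s > 0 \<Longrightarrow> lquot (\<lambda>x. u (s * x)) (x, y) = s\<^sup>2 * lquot u (s * x, s * y)"
proof -
  assume s: "s > 0"
  have "\<bar>s * x - s * y\<bar>\<^sup>2 = s\<^sup>2 * \<bar>x - y\<bar>\<^sup>2" by (simp add: power_mult_distrib flip: right_diff_distrib)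
  then show ?thesis using s by (simp add: lquot_def)
qed

text \<open>The kernel has the homogeneity of the inverse area element. This scale invariance is
  what lets cutoffs be squeezed towards a point at no cost.\<close>

lemma gagl_scale:
  assumes u[measurable]: "u \<in> borel_measurable borel" and s: "0 < s"
  shows "gagl (\<lambda>x. u (s * x)) = gagl u"
proof -
  have "gagl (\<lambda>x. u (s * x)) = (\<integral>\<^sup>+x. \<integral>\<^sup>+y. ennreal (lquot (\<lambda>x. u (s * x)) (x, y)) \<partial>lborel \<partial>lborel)"
    unfolding gagl_def by (subst lborel.nn_integral_fst[symmetric]) auto
  also have "\<dots> = (\<integral>\<^sup>+x. ennreal s * (ennreal s * (\<integral>\<^sup>+y. ennreal (lquot u (s * x, s * y)) \<partial>lborel)) \<partial>lborel)"
  proof (rule nn_integral_cong)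
    fix x
    have "(\<integral>\<^sup>+y. ennreal (lquot (\<lambda>x. u (s * x)) (x, y)) \<partial>lborel) = (\<integral>\<^sup>+y. ennreal (s * s) * ennreal (lquot u (s * x, s * y)) \<partial>lborel)"
      using s by (intro nn_integral_cong) (simp add: lquot_scale power2_eq_square ennreal_mult)
    also have "\<dots> = ennreal (s * s) * (\<integral>\<^sup>+y. ennreal (lquot u (s * x, s * y)) \<partial>lborel)" by (rule nn_integral_cmult) simp
    finally show "(\<integral>\<^sup>+y. ennreal (lquot (\<lambda>x. u (s * x)) (x, y)) \<partial>lborel) = ennreal s * (ennreal s * (\<integral>\<^sup>+y. ennreal (lquot u (s * x, s * y)) \<partial>lborel))"
      using s by (simp add: ennreal_mult mult.assoc)
  qed
  also have "\<dots> = (\<integral>\<^sup>+x. ennreal s * (\<integral>\<^sup>+y. ennreal (lquot u (s * x, y)) \<partial>lborel) \<partial>lborel)"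
  proof (rule nn_integral_cong)
    fix x
    show "ennreal s * (ennreal s * (\<integral>\<^sup>+y. ennreal (lquot u (s * x, s * y)) \<partial>lborel)) = ennreal s * (\<integral>\<^sup>+y. ennreal (lquot u (s * x, y)) \<partial>lborel)"
      using s by (subst (2) nn_integral_real_affine[where c=s and t=0]) auto
  qed
  also have "\<dots> = ennreal s * (\<integral>\<^sup>+x. \<integral>\<^sup>+y. ennreal (lquot u (s * x, y)) \<partial>lborel \<partial>lborel)"
    by (rule nn_integral_cmult) measurable
  also have "\<dots> = (\<integral>\<^sup>+x. \<integral>\<^sup>+y. ennreal (lquot u (x, y)) \<partial>lborel \<partial>lborel)"
    using s by (subst (2) nn_integral_real_affine[where c=s and t=0]) auto
  also have "\<dots> = gagl u" unfolding gagl_def by (subst lborel.nn_integral_fst[symmetric]) auto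
  finally show ?thesis .
qed

lemma AE_lborel_pair_neq: "AE z in lborel \<Otimes>\<^sub>M lborel. fst z \<noteq> (c::real) \<and> snd z \<noteq> (c::real)"
  using AE_pair_fst[OF sigma_finite_lborel AE_lborel_singleton] AE_pair_snd[OF sigma_finite_lborel AE_lborel_singleton]
  by (rule AE_conjI)

text \<open>The functions \<open>\<kappa>\<close> and \<open>\<lambda>x. \<kappa> (n * x)\<close> have the same energy and are almost orthogonal for
  large \<open>n\<close>, so their mean has about half the energy.\<close>

lemma cutoff_improve:
  assumes \<kappa>: "cutoff a \<kappa>" and a: "0 < a"
  shows "\<exists>a'>0. \<exists>\<kappa>'. cutoff a' \<kappa>' \<and> gagl (\<lambda>x. of_real (\<kappa>' x)) \<le> ennreal (3 / 4) * gagl (\<lambda>x. of_real (\<kappa> x))"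
proof (cases "gagl (\<lambda>x. of_real (\<kappa> x)) = 0")
  case True
  then show ?thesis using assms by (intro exI[of _ a] conjI exI[of _ \<kappa>]) auto
next
  case False
  define v where "v x = complex_of_real (\<kappa> x)" for x
  have [measurable]: "\<kappa> \<in> borel_measurable borel" by (rule cutoff_measurable[OF \<kappa>])
  have [measurable]: "v \<in> borel_measurable borel" unfolding v_def[abs_def] by measurable
  obtain C where C: "gagl v = ennreal C" "0 \<le> C"
    using cutoff_gagl_finite[OF \<kappa>] unfolding v_def[abs_def] by (cases "gagl (\<lambda>x. of_real (\<kappa> x))") auto
  define w where "w n x = v (real (Suc n) * x)" for n x
  have [measurable]: "w n \<in> borel_measurable borel" for n unfolding w_def[abs_def] by measurable
  have gw: "gagl (w n) = gagl v" for n unfolding w_def[abs_def] by (rule gagl_scale) auto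
  have "(\<lambda>n. \<integral>\<^sup>+z. ennreal (sqrt (lquot v z) * sqrt (lquot (w n) z)) \<partial>(lborel \<Otimes>\<^sub>M lborel)) \<longlonglongrightarrow> 0"
  proof (rule nn_integral_cross_tendsto_0[where C=C])
    show "(\<integral>\<^sup>+z. ennreal ((sqrt (lquot v z))\<^sup>2) \<partial>(lborel \<Otimes>\<^sub>M lborel)) < \<infinity>" using C by (simp add: gagl_def)
    show "(\<integral>\<^sup>+z. ennreal ((sqrt (lquot (w n) z))\<^sup>2) \<partial>(lborel \<Otimes>\<^sub>M lborel)) \<le> ennreal C" for n
      using gw[of n] C by (simp add: gagl_def)
    \<comment> \<open>The supports of the dilates shrink to the origin, so every other point is
      eventually outside them.\<close>
    have v0: "eventually (\<lambda>n. w n x = 0) sequentially" if "x \<noteq> 0" for x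
    proof -
      obtain N :: nat where N: "1 / \<bar>x\<bar> < real N" using reals_Archimedean2 by blast
      show ?thesis
        using eventually_ge_at_top[of N]
      proof eventually_elim
        case (elim n)
        then have "1 / \<bar>x\<bar> \<le> real (Suc n)" using N by linarith
        then have "1 \<le> \<bar>real (Suc n) * x\<bar>" using that by (simp add: abs_mult pos_divide_le_eq)
        then have "\<kappa> (real (Suc n) * x) = 0" using \<kappa> unfolding cutoff_def by blast
        then show ?case by (simp add: w_def v_def)
      qed
    qed
    show "AE z in lborel \<Otimes>\<^sub>M lborel. (\<lambda>n. sqrt (lquot (w n) z)) \<longlonglongrightarrow> 0"
      using AE_lborel_pair_neq[of 0]
    proof eventually_elim
      case (elim z)
      have "eventually (\<lambda>n. sqrt (lquot (w n) z) = 0) sequentially"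
      proof -
        have "eventually (\<lambda>n. w n (fst z) = 0 \<and> w n (snd z) = 0) sequentially"
          using v0[of "fst z"] v0[of "snd z"] elim by (simp add: eventually_conj)
        then show ?thesis by eventually_elim (simp add: lquot_def case_prod_beta)
      qed
      then show ?case by (rule tendsto_eventually)
    qed
  qed auto
  \<comment> \<open>With the cross integral below \<open>C / 2\<close> the mean has energy at most a
    quarter of \<open>C + C + C\<close>.\<close>
  moreover have "0 < ennreal (C / 2)" using False C by (auto simp: v_def[abs_def])
  ultimately have "eventually (\<lambda>n. (\<integral>\<^sup>+z. ennreal (sqrt (lquot v z) * sqrt (lquot (w n) z)) \<partial>(lborel \<Otimes>\<^sub>M lborel)) < ennreal (C / 2)) sequentially"
    by (rule order_tendstoD(2))
  then obtain n where n: "(\<integral>\<^sup>+z. ennreal (sqrt (lquot v z) * sqrt (lquot (w n) z)) \<partial>(lborel \<Otimes>\<^sub>M lborel)) < ennreal (C / 2)"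
    unfolding eventually_sequentially by blast
  define s where "s = real (Suc n)"
  have s: "1 \<le> s" by (simp add: s_def)
  define \<kappa>' where "\<kappa>' x = (\<kappa> x + \<kappa> (s * x)) / 2" for x
  have cut: "cutoff (a / s) \<kappa>'"
  proof -
    obtain K where K: "\<And>x y. \<bar>\<kappa> x - \<kappa> y\<bar> \<le> K * \<bar>arctan x - arctan y\<bar>" using \<kappa> by (auto simp: cutoff_def)
    have K0: "0 \<le> K"
    proof -
      have "0 \<le> K * \<bar>arctan 1 - arctan 0\<bar>" using K[of 1 0] by linarith
      then show ?thesis using pi_gt_zero by (simp add: arctan_one zero_le_mult_iff)
    qed
    have "\<bar>\<kappa>' x - \<kappa>' y\<bar> \<le> (K + K * s) * \<bar>arctan x - arctan y\<bar>" for x y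
    proof -
      have "\<bar>\<kappa>' x - \<kappa>' y\<bar> \<le> \<bar>\<kappa> x - \<kappa> y\<bar> + \<bar>\<kappa> (s * x) - \<kappa> (s * y)\<bar>" unfolding \<kappa>'_def by argo
      also have "\<dots> \<le> K * \<bar>arctan x - arctan y\<bar> + K * \<bar>arctan (s * x) - arctan (s * y)\<bar>" by (intro add_mono K)
      also have "\<dots> \<le> K * \<bar>arctan x - arctan y\<bar> + K * (s * \<bar>arctan x - arctan y\<bar>)"
        by (intro add_left_mono mult_left_mono arctan_scale_le s K0)
      finally show ?thesis by (simp add: algebra_simps)
    qed
    moreover have "\<kappa>' x = 1" if "\<bar>x\<bar> \<le> a / s" for x
    proof -
      have "\<bar>s * x\<bar> \<le> a" using that s by (simp add: abs_mult pos_le_divide_eq mult.commute)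
      moreover have "\<bar>x\<bar> \<le> a"
      proof -
        have "a / s \<le> a / 1" using a s by (intro divide_left_mono) auto
        then show ?thesis using that by simp
      qed
      ultimately show ?thesis using \<kappa> by (simp add: cutoff_def \<kappa>'_def)
    qed
    moreover have "\<kappa>' x = 0" if "1 \<le> \<bar>x\<bar>" for x
    proof -
      have "1 * 1 \<le> s * \<bar>x\<bar>" using that s by (intro mult_mono) auto
      then have "1 \<le> \<bar>s * x\<bar>" using s by (simp add: abs_mult)
      then show ?thesis using \<kappa> that by (simp add: cutoff_def \<kappa>'_def)
    qed
    ultimately show ?thesis unfolding cutoff_def by blast
  qed
  have pt: "lquot (\<lambda>x. of_real (\<kappa>' x)) z \<le> 1 / 4 * (lquot v z + lquot (w n) z + 2 * (sqrt (lquot v z) * sqrt (lquot (w n) z)))" for z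
  proof (cases z)
    case (Pair x y)
    let ?p = "cmod (v x - v y)" and ?q = "cmod (w n x - w n y)"
    have "of_real (\<kappa>' x) - of_real (\<kappa>' y) = ((v x - v y) + (w n x - w n y)) / (2 :: complex)"
      by (simp add: \<kappa>'_def v_def w_def s_def diff_divide_distrib add_divide_distrib)
    then have "cmod (of_real (\<kappa>' x) - of_real (\<kappa>' y)) = cmod ((v x - v y) + (w n x - w n y)) / 2"
      by (simp only: norm_divide norm_numeral)
    then have "cmod (of_real (\<kappa>' x) - of_real (\<kappa>' y)) \<le> (?p + ?q) / 2"
      using divide_right_mono[OF norm_triangle_ineq[of "v x - v y" "w n x - w n y"], of 2] by (simp only:)
    then have "(cmod (of_real (\<kappa>' x) - of_real (\<kappa>' y)))\<^sup>2 \<le> ((?p + ?q) / 2)\<^sup>2" by (intro power_mono) auto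
    also have "\<dots> = 1 / 4 * (?p\<^sup>2 + ?q\<^sup>2 + 2 * (?p * ?q))" by (simp add: power2_eq_square algebra_simps)
    finally have "(cmod (of_real (\<kappa>' x) - of_real (\<kappa>' y)))\<^sup>2 / \<bar>x - y\<bar>\<^sup>2 \<le> 1 / 4 * (?p\<^sup>2 + ?q\<^sup>2 + 2 * (?p * ?q)) / \<bar>x - y\<bar>\<^sup>2"
      by (rule divide_right_mono) simp
    also have "1 / 4 * (p\<^sup>2 + q\<^sup>2 + 2 * (p * q)) / D\<^sup>2 = 1 / 4 * (p\<^sup>2 / D\<^sup>2 + q\<^sup>2 / D\<^sup>2 + 2 * ((p / D) * (q / D)))" for p q D :: real
      by (cases "D = 0") (auto simp: field_simps power2_eq_square)
    finally show ?thesis unfolding Pair sqrt_lquot unfolding lquot_def by simp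
  qed
  have "gagl (\<lambda>x. of_real (\<kappa>' x)) \<le> (\<integral>\<^sup>+z. ennreal (1 / 4) * (ennreal (lquot v z) + ennreal (lquot (w n) z) + 2 * ennreal (sqrt (lquot v z) * sqrt (lquot (w n) z))) \<partial>(lborel \<Otimes>\<^sub>M lborel))"
    unfolding gagl_def
  proof (rule nn_integral_mono)
    fix z
    have "ennreal (lquot (\<lambda>x. of_real (\<kappa>' x)) z) \<le> ennreal (1 / 4 * (lquot v z + lquot (w n) z + 2 * (sqrt (lquot v z) * sqrt (lquot (w n) z))))"
      by (rule ennreal_leI[OF pt])
    also have "\<dots> = ennreal (1 / 4) * (ennreal (lquot v z) + ennreal (lquot (w n) z) + 2 * ennreal (sqrt (lquot v z) * sqrt (lquot (w n) z)))"
    proof -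
      have "ennreal (1 / 4 * (p + q + 2 * c)) = ennreal (1 / 4) * (ennreal p + ennreal q + 2 * ennreal c)"
        if "0 \<le> p" "0 \<le> q" "0 \<le> c" for p q c :: real
        using that by (subst ennreal_mult) (auto simp: ennreal_mult)
      then show ?thesis by simp
    qed
    finally show "ennreal (lquot (\<lambda>x. of_real (\<kappa>' x)) z) \<le> ennreal (1 / 4) * (ennreal (lquot v z) + ennreal (lquot (w n) z) + 2 * ennreal (sqrt (lquot v z) * sqrt (lquot (w n) z)))" .
  qed
  also have "\<dots> = ennreal (1 / 4) * (gagl v + gagl (w n) + 2 * (\<integral>\<^sup>+z. ennreal (sqrt (lquot v z) * sqrt (lquot (w n) z)) \<partial>(lborel \<Otimes>\<^sub>M lborel)))"
    unfolding gagl_def by (simp add: nn_integral_add nn_integral_cmult)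
  also have "\<dots> \<le> ennreal (1 / 4) * (ennreal C + ennreal C + 2 * ennreal (C / 2))"
    using n C by (intro mult_left_mono add_mono) (auto simp: gw)
  also have "ennreal C + ennreal C + 2 * ennreal (C / 2) = ennreal (3 * C)"
  proof -
    have "2 * ennreal (C / 2) = ennreal (2 * (C / 2))" using C by (subst ennreal_mult) auto
    then show ?thesis using C by (simp flip: ennreal_plus)
  qed
  also have "ennreal (1 / 4) * ennreal (3 * C) = ennreal (3 / 4) * gagl v"
    using C by (simp flip: ennreal_mult)
  finally have "gagl (\<lambda>x. of_real (\<kappa>' x)) \<le> ennreal (3 / 4) * gagl (\<lambda>x. of_real (\<kappa> x))"
    by (simp add: v_def[abs_def])
  moreover have "0 < a / s" using a s by simp
  ultimately show ?thesis using cut by blast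
qed

text \<open>The gain of a factor 3 / 4 is iterated; the plateau shrinks at every round but keeps
  positive width.\<close>

lemma cutoff_small_energy:
  assumes "0 < \<epsilon>"
  shows "\<exists>a>0. \<exists>\<kappa>. cutoff a \<kappa> \<and> gagl (\<lambda>x. of_real (\<kappa> x)) \<le> ennreal \<epsilon>"
proof -
  obtain a0 \<kappa>0 where k0: "0 < a0" "cutoff a0 \<kappa>0" using cutoff_exists by blast
  obtain C where C: "gagl (\<lambda>x. of_real (\<kappa>0 x)) = ennreal C" "0 \<le> C"
    using cutoff_gagl_finite[OF k0(2)] by (cases "gagl (\<lambda>x. of_real (\<kappa>0 x))") auto
  have "\<exists>a>0. \<exists>\<kappa>. cutoff a \<kappa> \<and> gagl (\<lambda>x. of_real (\<kappa> x)) \<le> ennreal ((3 / 4) ^ m * C)" for m :: nat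
  proof (induction m)
    case 0
    have "gagl (\<lambda>x. of_real (\<kappa>0 x)) \<le> ennreal ((3 / 4) ^ 0 * C)" using C by simp
    then show ?case using k0 by blast
  next
    case (Suc m)
    then obtain a \<kappa> where k: "0 < a" "cutoff a \<kappa>" "gagl (\<lambda>x. of_real (\<kappa> x)) \<le> ennreal ((3 / 4) ^ m * C)" by blast
    obtain a' \<kappa>' where k': "0 < a'" "cutoff a' \<kappa>'" "gagl (\<lambda>x. of_real (\<kappa>' x)) \<le> ennreal (3 / 4) * gagl (\<lambda>x. of_real (\<kappa> x))"
      using cutoff_improve[OF k(2,1)] by blast
    have "gagl (\<lambda>x. of_real (\<kappa>' x)) \<le> ennreal (3 / 4) * ennreal ((3 / 4) ^ m * C)"
      using k(3) by (intro order_trans[OF k'(3)] mult_left_mono) auto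
    also have "\<dots> = ennreal ((3 / 4) ^ Suc m * C)" using C by (simp add: mult.assoc flip: ennreal_mult)
    finally show ?case using k' by blast
  qed
  moreover have "(\<lambda>m. (3 / 4) ^ m * C) \<longlonglongrightarrow> 0 * C" by (intro tendsto_mult tendsto_const LIMSEQ_power_zero) simp
  then have "eventually (\<lambda>m. (3 / 4) ^ m * C < \<epsilon>) sequentially" using assms by (intro order_tendstoD(2)) auto
  then obtain m where "(3 / 4) ^ m * C < \<epsilon>" unfolding eventually_sequentially by blast
  ultimately show ?thesis by (meson ennreal_leI less_imp_le order_trans)
qed

section \<open>Compactness\<close>

lemma subsequence_all_convergent:
  fixes f :: "nat \<Rightarrow> nat \<Rightarrow> complex"
  assumes bd: "\<And>n i. cmod (f n i) \<le> B"
  obtains r :: "nat \<Rightarrow> nat" where "strict_mono r" "\<And>i. convergent (\<lambda>n. f (r n) i)"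
proof -
  interpret subseqs "\<lambda>i s. convergent (\<lambda>n. f (s n) i)"
  proof
    fix i and s :: "nat \<Rightarrow> nat" assume "strict_mono s"
    have "bounded (range (\<lambda>n. f (s n) i))" using bd by (auto simp: bounded_iff)
    then obtain l r where "strict_mono r" "((\<lambda>n. f (s n) i) \<circ> r) \<longlonglongrightarrow> l"
      using bounded_imp_convergent_subsequence by blast
    then show "\<exists>r'. strict_mono r' \<and> convergent (\<lambda>n. f ((s \<circ> r') n) i)"
      by (intro exI[of _ r]) (auto simp: o_def convergent_def)
  qed
  have "convergent (\<lambda>n. f (diagseq n) i)" for i
  proof -
    \<comment> \<open>The diagonal sequence runs inside the subsequence chosen for index
      \<open>i\<close> only from \<open>Suc i\<close> on.\<close>
    have "convergent (\<lambda>n. f ((diagseq \<circ> (+) (Suc i)) n) i)"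
    proof (rule diagseq_holds)
      fix r s :: "nat \<Rightarrow> nat" and n
      assume "strict_mono r" "convergent (\<lambda>k. f (s k) n)"
      then show "convergent (\<lambda>k. f ((s \<circ> r) k) n)"
        using convergent_subseq_convergent[of "\<lambda>k. f (s k) n" r] by (simp add: o_def)
    qed
    then obtain l where "(\<lambda>n. f (diagseq (n + Suc i)) i) \<longlonglongrightarrow> l" by (auto simp: convergent_def add.commute)
    then have "(\<lambda>n. f (diagseq n) i) \<longlonglongrightarrow> l" by (rule LIMSEQ_offset)
    then show ?thesis by (auto simp: convergent_def)
  qed
  then show thesis using that subseq_diagseq by blast
qed

section \<open>Poincare's inequality and block averages\<close>

text \<open>The second moment is the squared mean plus the variance. The variance is bounded by the
  mean square distance of two independent points, and their distance, at most \<open>l\<close>,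
  turns it into the energy on the square over \<open>J\<close>.\<close>

lemma interval_poincare:
  fixes d :: "real \<Rightarrow> complex" and \<alpha> l :: real
  assumes d[measurable]: "d \<in> borel_measurable borel" and bd: "\<And>x. cmod (d x) \<le> B" and l: "0 < l"
  defines "J \<equiv> {\<alpha>..<\<alpha> + l}"
  shows "(\<integral>\<^sup>+x. ennreal ((cmod (d x))\<^sup>2) * indicator J x \<partial>lborel)
    \<le> ennreal (l * (cmod (\<integral>x. d x \<partial>uniform_measure lborel J))\<^sup>2)
      + ennreal l * (\<integral>\<^sup>+z. ennreal (lquot d z) * indicator (J \<times> J) z \<partial>(lborel \<Otimes>\<^sub>M lborel))"
proof -
  let ?U = "uniform_measure lborel J"
  have J[measurable]: "J \<in> sets borel" by (simp add: J_def)
  have eJ: "emeasure lborel J = ennreal l" using l by (simp add: J_def)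
  interpret prob_space ?U using l by (intro prob_space_uniform_measure) (auto simp: eJ)
  define c where "c = (\<integral>x. d x \<partial>?U)"
  have nnU: "(\<integral>\<^sup>+x. f x \<partial>?U) = (\<integral>\<^sup>+x. f x * indicator J x \<partial>lborel) * ennreal (1 / l)"
    if [measurable]: "f \<in> borel_measurable borel" for f
  proof -
    have "(\<integral>\<^sup>+x. f x \<partial>?U) = (\<integral>\<^sup>+x. f x * indicator J x \<partial>lborel) / ennreal l"
      by (subst nn_integral_uniform_measure) (auto simp: eJ)
    also have "\<dots> = (\<integral>\<^sup>+x. f x * indicator J x \<partial>lborel) * ennreal (1 / l)"
      using l by (simp add: divide_ennreal_def inverse_ennreal inverse_eq_divide)
    finally show ?thesis .
  qed
  have B0: "0 \<le> B" using bd[of 0] norm_ge_zero order_trans by blast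
  have bd2: "cmod (d x - d y) \<le> 2 * B" for x y
    using norm_triangle_ineq4[of "d x" "d y"] bd[of x] bd[of y] by simp
  have id: "integrable ?U d" using bd by (intro integrable_const_bound[where B=B]) auto
  have id2: "integrable ?U (\<lambda>x. (cmod (d x))\<^sup>2)" using bd B0 by (intro integrable_const_bound[where B="B\<^sup>2"]) (auto intro!: power_mono)
  have cB: "cmod c \<le> B"
  proof -
    have "cmod c \<le> (\<integral>x. cmod (d x) \<partial>?U)" unfolding c_def by (rule integral_norm_bound)
    also have "\<dots> \<le> (\<integral>x. B \<partial>?U)" using id bd by (intro integral_mono) auto
    finally show ?thesis using prob_space by simp
  qed
  have bdc: "cmod (d x - c) \<le> 2 * B" for x using norm_triangle_ineq4[of "d x" c] bd[of x] cB by simp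
  have idc: "integrable ?U (\<lambda>x. (cmod (d x - c))\<^sup>2)"
    using power_mono[OF bdc, of _ 2] by (intro integrable_const_bound[where B="(2 * B)\<^sup>2"]) auto
  have "(\<integral>\<^sup>+x. ennreal ((cmod (d x))\<^sup>2) \<partial>?U) = ennreal (\<integral>x. (cmod (d x))\<^sup>2 \<partial>?U)"
    using id2 by (intro nn_integral_eq_integral) auto
  also have "(\<integral>x. (cmod (d x))\<^sup>2 \<partial>?U) = (cmod c)\<^sup>2 + (\<integral>x. (cmod (d x - c))\<^sup>2 \<partial>?U)"
    using norm_integral_sq_le(1)[of d B] bd by (simp add: c_def)
  also have "ennreal \<dots> = ennreal ((cmod c)\<^sup>2) + ennreal (\<integral>x. (cmod (d x - c))\<^sup>2 \<partial>?U)"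
    by (intro ennreal_plus integral_nonneg_AE) auto
  also have "ennreal (\<integral>x. (cmod (d x - c))\<^sup>2 \<partial>?U) = (\<integral>\<^sup>+x. ennreal ((cmod (d x - c))\<^sup>2) \<partial>?U)"
    using idc by (intro nn_integral_eq_integral[symmetric]) auto
  also have "\<dots> \<le> (\<integral>\<^sup>+x. \<integral>\<^sup>+y. ennreal ((cmod (d x - d y))\<^sup>2) \<partial>?U \<partial>?U)"
  proof (rule nn_integral_mono)
    fix x
    have "(\<integral>y. d x - d y \<partial>?U) = d x - c" using id prob_space by (simp add: c_def)
    then show "ennreal ((cmod (d x - c))\<^sup>2) \<le> (\<integral>\<^sup>+y. ennreal ((cmod (d x - d y))\<^sup>2) \<partial>?U)"
      using norm_integral_sq_le(2)[of "\<lambda>y. d x - d y" "2 * B"] bd2 by simp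
  qed
  also have "\<dots> \<le> (\<integral>\<^sup>+x. \<integral>\<^sup>+y. ennreal (l\<^sup>2) * ennreal (lquot d (x, y)) \<partial>?U \<partial>?U)"
  proof -
    have AEU: "AE x in ?U. x \<in> J" by (rule AE_uniform_measureI) auto
    have pt: "ennreal ((cmod (d x - d y))\<^sup>2) \<le> ennreal (l\<^sup>2) * ennreal (lquot d (x, y))" if "x \<in> J" "y \<in> J" for x y
    proof -
      have "\<bar>x - y\<bar>\<^sup>2 \<le> l\<^sup>2" using that by (intro power_mono) (auto simp: J_def)
      then have "(cmod (d x - d y))\<^sup>2 * \<bar>x - y\<bar>\<^sup>2 \<le> (cmod (d x - d y))\<^sup>2 * l\<^sup>2" by (rule mult_left_mono) simp
      then have "(cmod (d x - d y))\<^sup>2 \<le> l\<^sup>2 * lquot d (x, y)"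
        by (cases "x = y") (auto simp: lquot_def pos_le_divide_eq mult.commute)
      then have "ennreal ((cmod (d x - d y))\<^sup>2) \<le> ennreal (l\<^sup>2 * lquot d (x, y))" by (rule ennreal_leI)
      then show ?thesis by (simp add: ennreal_mult)
    qed
    show ?thesis
    proof (rule nn_integral_mono_AE)
      show "AE x in ?U. (\<integral>\<^sup>+y. ennreal ((cmod (d x - d y))\<^sup>2) \<partial>?U) \<le> (\<integral>\<^sup>+y. ennreal (l\<^sup>2) * ennreal (lquot d (x, y)) \<partial>?U)"
        using AEU
      proof eventually_elim
        case (elim x)
        show ?case using AEU by (intro nn_integral_mono_AE, eventually_elim) (rule pt[OF elim])
      qed
    qed
  qed
  also have "\<dots> = (\<integral>\<^sup>+x. (\<integral>\<^sup>+y. ennreal (l\<^sup>2) * ennreal (lquot d (x, y)) * indicator J y \<partial>lborel) * ennreal (1 / l) * indicator J x \<partial>lborel) * ennreal (1 / l)"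
    by (subst nnU, measurable, subst nnU, auto)
  also have "\<dots> = (\<integral>\<^sup>+x. ennreal l * (\<integral>\<^sup>+y. ennreal (lquot d (x, y)) * indicator J y * indicator J x \<partial>lborel) \<partial>lborel) * ennreal (1 / l)"
  proof -
    have "(\<integral>\<^sup>+y. ennreal (l\<^sup>2) * ennreal (lquot d (x, y)) * indicator J y \<partial>lborel) * ennreal (1 / l) * indicator J x
        = ennreal l * (\<integral>\<^sup>+y. ennreal (lquot d (x, y)) * indicator J y * indicator J x \<partial>lborel)" for x
    proof -
      have "(\<integral>\<^sup>+y. ennreal (l\<^sup>2) * ennreal (lquot d (x, y)) * indicator J y \<partial>lborel)
          = ennreal (l\<^sup>2) * (\<integral>\<^sup>+y. ennreal (lquot d (x, y)) * indicator J y \<partial>lborel)"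
        unfolding mult.assoc by (rule nn_integral_cmult) measurable
      moreover have "(\<integral>\<^sup>+y. ennreal (lquot d (x, y)) * indicator J y * indicator J x \<partial>lborel)
          = (\<integral>\<^sup>+y. ennreal (lquot d (x, y)) * indicator J y \<partial>lborel) * indicator J x"
        by (rule nn_integral_multc) measurable
      moreover have "ennreal (l\<^sup>2) * ennreal (1 / l) = ennreal l"
        using l by (simp add: power2_eq_square flip: ennreal_mult)
      ultimately show ?thesis by (metis (no_types, lifting) mult.assoc mult.commute)
    qed
    then show ?thesis by simp
  qed
  also have "\<dots> = (\<integral>\<^sup>+x. \<integral>\<^sup>+y. ennreal (lquot d (x, y)) * indicator J y * indicator J x \<partial>lborel \<partial>lborel) * (ennreal l * ennreal (1 / l))"
    by (subst nn_integral_cmult) (auto simp: mult_ac)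
  also have "ennreal l * ennreal (1 / l) = 1" using l by (simp flip: ennreal_mult)
  also have "(\<integral>\<^sup>+x. \<integral>\<^sup>+y. ennreal (lquot d (x, y)) * indicator J y * indicator J x \<partial>lborel \<partial>lborel)
      = (\<integral>\<^sup>+z. ennreal (lquot d z) * indicator (J \<times> J) z \<partial>(lborel \<Otimes>\<^sub>M lborel))"
    by (subst lborel.nn_integral_fst[symmetric]) (auto simp: indicator_times mult_ac intro!: nn_integral_cong)
  finally have main: "(\<integral>\<^sup>+x. ennreal ((cmod (d x))\<^sup>2) \<partial>?U)
      \<le> ennreal ((cmod c)\<^sup>2) + (\<integral>\<^sup>+z. ennreal (lquot d z) * indicator (J \<times> J) z \<partial>(lborel \<Otimes>\<^sub>M lborel))"
    by (simp add: add_left_mono)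
  have "(\<integral>\<^sup>+x. ennreal ((cmod (d x))\<^sup>2) * indicator J x \<partial>lborel) = ennreal l * (\<integral>\<^sup>+x. ennreal ((cmod (d x))\<^sup>2) \<partial>?U)"
  proof -
    have "ennreal l * ennreal (1 / l) = 1" using l by (simp flip: ennreal_mult)
    moreover have "(\<integral>\<^sup>+x. ennreal ((cmod (d x))\<^sup>2) \<partial>?U)
        = (\<integral>\<^sup>+x. ennreal ((cmod (d x))\<^sup>2) * indicator J x \<partial>lborel) * ennreal (1 / l)"
      by (rule nnU) measurable
    ultimately show ?thesis by (simp only: mult.left_commute[of "ennreal l"] mult_1_right)
  qed
  also have "\<dots> \<le> ennreal l * (ennreal ((cmod c)\<^sup>2) + (\<integral>\<^sup>+z. ennreal (lquot d z) * indicator (J \<times> J) z \<partial>(lborel \<Otimes>\<^sub>M lborel)))"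
    by (rule mult_left_mono[OF main]) simp
  finally show ?thesis using l by (simp add: c_def distrib_left ennreal_mult)
qed

text \<open>For \<open>i < N\<close> these are the tiles of the interval from -1 to 1, half-open so
  that they are disjoint.\<close>

definition block :: "nat \<Rightarrow> nat \<Rightarrow> real set" where
  "block N i = {- 1 + 2 / real N * real i..<- 1 + 2 / real N * real i + 2 / real N}"

lemma mem_block_iff:
  assumes "0 < N"
  shows "x \<in> block N i \<longleftrightarrow> \<lfloor>real N * (x + 1) / 2\<rfloor> = int i"
proof -
  have N: "0 < real N" using assms by simp
  have "\<lfloor>real N * (x + 1) / 2\<rfloor> = int i \<longleftrightarrow> real i \<le> real N * (x + 1) / 2 \<and> real N * (x + 1) / 2 < real i + 1"
    by (simp add: floor_eq_iff)
  also have "\<dots> \<longleftrightarrow> x \<in> block N i"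
    using N by (simp add: block_def field_simps)
  finally show ?thesis by simp
qed

lemma sum_indicator_block_le:
  assumes "0 < N"
  shows "(\<Sum>i<N. indicator (block N i \<times> block N i) z) \<le> (1 :: ennreal)"
proof -
  define k where "k = nat \<lfloor>real N * (fst z + 1) / 2\<rfloor>"
  have "(\<Sum>i<N. indicator (block N i \<times> block N i) z) \<le> (\<Sum>i<N. if i = k then 1 else (0 :: ennreal))"
    by (intro sum_mono) (auto simp: mem_block_iff[OF assms] k_def split: split_indicator)
  also have "\<dots> \<le> 1" by (simp add: sum.delta')
  finally show ?thesis .
qed

lemma indicator_interval_le_sum_block:
  assumes N: "0 < N"
  shows "indicator {- 1<..<1} x \<le> (\<Sum>i<N. indicator (block N i) x :: ennreal)"
proof (cases "x \<in> {- 1<..<1}")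
  case True
  define k where "k = nat \<lfloor>real N * (x + 1) / 2\<rfloor>"
  have "0 \<le> real N * (x + 1) / 2" "real N * (x + 1) / 2 < real N"
    using True N by (simp_all add: mult_less_cancel_left_pos)
  then have "x \<in> block N k" "k < N" unfolding mem_block_iff[OF N] k_def by (auto simp: nat_less_iff floor_less_iff)
  then have "indicator (block N k) x \<le> (\<Sum>i<N. indicator (block N i) x :: ennreal)"
    by (intro member_le_sum) auto
  then show ?thesis using True \<open>x \<in> block N k\<close> by simp
qed simp

text \<open>Poincare's inequality is summed over the blocks. The squares over distinct blocks are
  disjoint, so their energies add up to at most \<open>gagl d\<close>.\<close>

lemma L2_le_block_averages:
  fixes d :: "real \<Rightarrow> complex"
  assumes d[measurable]: "d \<in> borel_measurable borel" and bd: "\<And>x. cmod (d x) \<le> B" and N: "0 < N"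
    and out: "\<And>x. x \<notin> {- 1<..<1} \<Longrightarrow> d x = 0"
  shows "(\<integral>\<^sup>+x. ennreal ((cmod (d x))\<^sup>2) \<partial>lborel)
    \<le> ennreal (2 / real N * (\<Sum>i<N. (cmod (\<integral>x. d x \<partial>uniform_measure lborel (block N i)))\<^sup>2)) + ennreal (2 / real N) * gagl d"
proof -
  let ?c = "\<lambda>i. \<integral>x. d x \<partial>uniform_measure lborel (block N i)"
  have bm[measurable]: "block N i \<in> sets borel" for i by (simp add: block_def)
  have "(\<integral>\<^sup>+x. ennreal ((cmod (d x))\<^sup>2) \<partial>lborel) \<le> (\<integral>\<^sup>+x. (\<Sum>i<N. ennreal ((cmod (d x))\<^sup>2) * indicator (block N i) x) \<partial>lborel)"
  proof (rule nn_integral_mono)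
    fix x
    have "ennreal ((cmod (d x))\<^sup>2) = ennreal ((cmod (d x))\<^sup>2) * indicator {- 1<..<1} x"
      using out[of x] by (auto split: split_indicator)
    also have "\<dots> \<le> ennreal ((cmod (d x))\<^sup>2) * (\<Sum>i<N. indicator (block N i) x)"
      by (intro mult_left_mono indicator_interval_le_sum_block N) auto
    finally show "ennreal ((cmod (d x))\<^sup>2) \<le> (\<Sum>i<N. ennreal ((cmod (d x))\<^sup>2) * indicator (block N i) x)"
      by (simp add: sum_distrib_left)
  qed
  also have "\<dots> = (\<Sum>i<N. \<integral>\<^sup>+x. ennreal ((cmod (d x))\<^sup>2) * indicator (block N i) x \<partial>lborel)"
    by (rule nn_integral_sum) measurable
  also have "\<dots> \<le> (\<Sum>i<N. ennreal (2 / real N * (cmod (?c i))\<^sup>2)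
      + ennreal (2 / real N) * (\<integral>\<^sup>+z. ennreal (lquot d z) * indicator (block N i \<times> block N i) z \<partial>(lborel \<Otimes>\<^sub>M lborel)))"
    unfolding block_def by (intro sum_mono interval_poincare[OF d bd]) (use N in simp)
  also have "\<dots> = (\<Sum>i<N. ennreal (2 / real N * (cmod (?c i))\<^sup>2))
      + ennreal (2 / real N) * (\<Sum>i<N. \<integral>\<^sup>+z. ennreal (lquot d z) * indicator (block N i \<times> block N i) z \<partial>(lborel \<Otimes>\<^sub>M lborel))"
    by (simp add: sum.distrib sum_distrib_left)
  also have "(\<Sum>i<N. ennreal (2 / real N * (cmod (?c i))\<^sup>2)) = ennreal (2 / real N * (\<Sum>i<N. (cmod (?c i))\<^sup>2))"
    by (subst sum_ennreal) (auto simp: sum_distrib_left)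
  also have "(\<Sum>i<N. \<integral>\<^sup>+z. ennreal (lquot d z) * indicator (block N i \<times> block N i) z \<partial>(lborel \<Otimes>\<^sub>M lborel))
      = (\<integral>\<^sup>+z. (\<Sum>i<N. ennreal (lquot d z) * indicator (block N i \<times> block N i) z) \<partial>(lborel \<Otimes>\<^sub>M lborel))"
    by (rule nn_integral_sum[symmetric]) measurable
  also have "\<dots> \<le> gagl d"
    unfolding gagl_def
  proof (rule nn_integral_mono)
    fix z
    have "(\<Sum>i<N. ennreal (lquot d z) * indicator (block N i \<times> block N i) z) \<le> ennreal (lquot d z) * 1"
      unfolding sum_distrib_left[symmetric] by (intro mult_left_mono sum_indicator_block_le N) simp
    then show "(\<Sum>i<N. ennreal (lquot d z) * indicator (block N i \<times> block N i) z) \<le> ennreal (lquot d z)" by simp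
  qed
  finally show ?thesis by (simp add: add_left_mono mult_left_mono)
qed

lemma gagl_diff_le:
  assumes [measurable]: "u \<in> borel_measurable borel" "v \<in> borel_measurable borel"
  shows "gagl (\<lambda>x. u x - v x) \<le> 2 * gagl u + 2 * gagl v"
proof -
  have pt: "lquot (\<lambda>x. u x - v x) z \<le> 2 * lquot u z + 2 * lquot v z" for z
  proof (cases z)
    case (Pair x y)
    have "(cmod ((u x - u y) - (v x - v y)))\<^sup>2 \<le> 2 * (cmod (u x - u y))\<^sup>2 + 2 * (cmod (v x - v y))\<^sup>2"
      by (rule norm_diff_sq_le)
    then show ?thesis
      unfolding Pair lquot_def by (simp add: algebra_simps add_divide_distrib[symmetric] divide_right_mono)
  qed
  have "gagl (\<lambda>x. u x - v x) \<le> (\<integral>\<^sup>+z. 2 * ennreal (lquot u z) + 2 * ennreal (lquot v z) \<partial>(lborel \<Otimes>\<^sub>M lborel))"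
    unfolding gagl_def
  proof (rule nn_integral_mono)
    fix z
    have "ennreal (lquot (\<lambda>x. u x - v x) z) \<le> ennreal (2 * lquot u z + 2 * lquot v z)"
      by (rule ennreal_leI[OF pt])
    then show "ennreal (lquot (\<lambda>x. u x - v x) z) \<le> 2 * ennreal (lquot u z) + 2 * ennreal (lquot v z)"
      by (simp add: ennreal_mult)
  qed
  also have "\<dots> = 2 * gagl u + 2 * gagl v"
    unfolding gagl_def by (simp add: nn_integral_add nn_integral_cmult)
  finally show ?thesis .
qed

text \<open>A diagonal subsequence makes all block averages converge; on blocks of length \<open>2 / N\<close> Poincare's
  inequality controls the remaining oscillation by the energy over \<open>N\<close>.\<close>

lemma line_map_subsequence:
  fixes u :: "nat \<Rightarrow> real \<Rightarrow> complex"
  assumes u: "\<And>n. line_map (u n)" and C: "\<And>n. gagl (u n) \<le> ennreal C" "0 \<le> C"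
    and out: "\<And>n x. x \<notin> {- 1<..<1} \<Longrightarrow> u n x = g x"
  obtains r where "strict_mono r" "AE x in lborel. convergent (\<lambda>k. u (r k) x)"
proof -
  have [measurable]: "u n \<in> borel_measurable borel" for n by (rule lmapD(1)[OF u])
  have un: "cmod (u n x) = 1" for n x by (rule lmapD(2)[OF u])
  \<comment> \<open>A number \<open>p\<close> codes a subdivision and a block of it; the successor
    excludes a subdivision into no blocks.\<close>
  define av where "av n p = (\<integral>x. u n x \<partial>uniform_measure lborel (block (Suc (fst (prod_decode p))) (snd (prod_decode p))))" for n p
  have pb: "prob_space (uniform_measure lborel (block (Suc N) i))" for N i
    by (intro prob_space_uniform_measure) (auto simp: block_def)
  have av_le: "cmod (av n p) \<le> 1" for n p
  proof -
    interpret prob_space "uniform_measure lborel (block (Suc (fst (prod_decode p))) (snd (prod_decode p)))" by (rule pb)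
    show ?thesis
      unfolding av_def
      using integral_norm_bound[of "uniform_measure lborel (block (Suc (fst (prod_decode p))) (snd (prod_decode p)))" "u n"]
        prob_space by (simp add: un)
  qed
  obtain r0 where r0: "strict_mono r0" "\<And>p. convergent (\<lambda>n. av (r0 n) p)"
    using subsequence_all_convergent[of av 1] av_le by blast
  define D where "D n m = (\<integral>\<^sup>+x. ennreal ((cmod (u n x - u m x))\<^sup>2) \<partial>lborel)" for n m
  have cauchy: "\<exists>M. \<forall>n\<ge>M. \<forall>m\<ge>M. D (r0 n) (r0 m) \<le> ennreal e" if e: "0 < e" for e
  proof -
    \<comment> \<open>The difference of two members has energy at most \<open>4 * C\<close>, so this
      choice keeps its contribution \<open>2 / real N * (4 * C)\<close> below
      \<open>e / 2\<close>.\<close>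
    obtain N0 :: nat where N0: "16 * C / e < real N0" using reals_Archimedean2 by blast
    define N where "N = Suc N0"
    have N: "0 < N" "16 * C / e < real N" using N0 by (auto simp: N_def)
    have small: "2 / real N * (4 * C) \<le> e / 2"
    proof -
      have "16 * C < real N * e" using N e by (simp add: pos_divide_less_eq)
      then show ?thesis using N(1) by (simp add: pos_divide_le_eq mult.commute)
    qed
    have "\<exists>M. \<forall>n\<ge>M. \<forall>m\<ge>M. (cmod (av (r0 n) p - av (r0 m) p))\<^sup>2 < e / 4" for p
    proof -
      have "Cauchy (\<lambda>n. av (r0 n) p)" using r0(2) by (rule convergent_Cauchy)
      moreover have "0 < sqrt (e / 4)" using e by simp
      ultimately obtain M where M: "\<And>n m. M \<le> n \<Longrightarrow> M \<le> m \<Longrightarrow> norm (av (r0 n) p - av (r0 m) p) < sqrt (e / 4)"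
        using CauchyD by blast
      have "(cmod (av (r0 n) p - av (r0 m) p))\<^sup>2 < e / 4" if "M \<le> n" "M \<le> m" for n m
      proof -
        have "(cmod (av (r0 n) p - av (r0 m) p))\<^sup>2 < (sqrt (e / 4))\<^sup>2"
          using M[OF that] by (intro power_strict_mono) auto
        then show ?thesis using e by simp
      qed
      then show ?thesis by blast
    qed
    then obtain Mf where Mf: "\<And>p n m. Mf p \<le> n \<Longrightarrow> Mf p \<le> m \<Longrightarrow> (cmod (av (r0 n) p - av (r0 m) p))\<^sup>2 < e / 4" by metis
    define M where "M = Max ((\<lambda>i. Mf (prod_encode (N0, i))) ` {..<N})"
    have M: "Mf (prod_encode (N0, i)) \<le> M" if "i < N" for i
      unfolding M_def using that by (intro Max_ge) auto
    have "D (r0 n) (r0 m) \<le> ennreal e" if nm: "M \<le> n" "M \<le> m" for n m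
    proof -
      define d where "d x = u (r0 n) x - u (r0 m) x" for x
      have [measurable]: "d \<in> borel_measurable borel" unfolding d_def[abs_def] by measurable
      have d_le: "cmod (d x) \<le> 2" for x
        using norm_triangle_ineq4[of "u (r0 n) x" "u (r0 m) x"] by (simp add: d_def un)
      have c: "(cmod (\<integral>x. d x \<partial>uniform_measure lborel (block N i)))\<^sup>2 \<le> e / 4" if "i < N" for i
      proof -
        interpret prob_space "uniform_measure lborel (block N i)" unfolding N_def by (rule pb)
        have "integrable (uniform_measure lborel (block N i)) (u k)" for k
          by (intro integrable_const_bound[where B=1]) (auto simp: un)
        then have "(\<integral>x. d x \<partial>uniform_measure lborel (block N i)) = av (r0 n) (prod_encode (N0, i)) - av (r0 m) (prod_encode (N0, i))"
          by (simp add: d_def av_def N_def)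
        then show ?thesis using Mf[of "prod_encode (N0, i)" n m] M[OF that] nm by simp
      qed
      have "D (r0 n) (r0 m) \<le> ennreal (2 / real N * (\<Sum>i<N. (cmod (\<integral>x. d x \<partial>uniform_measure lborel (block N i)))\<^sup>2)) + ennreal (2 / real N) * gagl d"
        unfolding D_def d_def[symmetric] by (rule L2_le_block_averages[where B=2]) (use d_le N out in \<open>auto simp: d_def\<close>)
      also have "\<dots> \<le> ennreal (e / 2) + ennreal (e / 2)"
      proof (rule add_mono)
        have "(\<Sum>i<N. (cmod (\<integral>x. d x \<partial>uniform_measure lborel (block N i)))\<^sup>2) \<le> (\<Sum>i<N. e / 4)"
          by (intro sum_mono c) auto
        then have "2 / real N * (\<Sum>i<N. (cmod (\<integral>x. d x \<partial>uniform_measure lborel (block N i)))\<^sup>2) \<le> 2 / real N * (real N * (e / 4))"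
          by (intro mult_left_mono) auto
        also have "\<dots> = e / 2" using N by simp
        finally show "ennreal (2 / real N * (\<Sum>i<N. (cmod (\<integral>x. d x \<partial>uniform_measure lborel (block N i)))\<^sup>2)) \<le> ennreal (e / 2)"
          by (rule ennreal_leI)
        have "gagl d \<le> 2 * gagl (u (r0 n)) + 2 * gagl (u (r0 m))" unfolding d_def by (rule gagl_diff_le) auto
        also have "\<dots> \<le> 2 * ennreal C + 2 * ennreal C" by (intro add_mono mult_left_mono C) auto
        also have "\<dots> = ennreal (4 * C)"
        proof -
          have "2 * ennreal C = ennreal (2 * C)" by (subst ennreal_mult) (use C in auto)
          then show ?thesis using C by (simp flip: ennreal_plus)
        qed
        finally have "ennreal (2 / real N) * gagl d \<le> ennreal (2 / real N) * ennreal (4 * C)" by (rule mult_left_mono) simp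
        also have "\<dots> = ennreal (2 / real N * (4 * C))" using C by (intro ennreal_mult[symmetric]) auto
        also have "\<dots> \<le> ennreal (e / 2)" by (rule ennreal_leI[OF small])
        finally show "ennreal (2 / real N) * gagl d \<le> ennreal (e / 2)" .
      qed
      also have "\<dots> = ennreal e" using e by (simp flip: ennreal_plus)
      finally show ?thesis .
    qed
    then show ?thesis by blast
  qed
  have "\<exists>M. \<forall>n\<ge>M. \<forall>m\<ge>M. D (r0 n) (r0 m) \<le> ennreal ((1 / 8) ^ k)" for k :: nat by (rule cauchy) simp
  then obtain M where M: "\<And>k n m. M k \<le> n \<Longrightarrow> M k \<le> m \<Longrightarrow> D (r0 n) (r0 m) \<le> ennreal ((1 / 8) ^ k)" by metis
  \<comment> \<open>Sums of successors are strictly increasing and dominate each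
    \<open>M k\<close>.\<close>
  define s where "s k = (\<Sum>i\<le>k. Suc (M i))" for k
  have s_mono: "strict_mono s" unfolding strict_mono_Suc_iff s_def by simp
  have s_ge: "M k \<le> s k" for k
  proof -
    have "Suc (M k) \<le> s k" unfolding s_def by (intro member_le_sum) auto
    then show ?thesis by simp
  qed
  define r where "r = r0 \<circ> s"
  \<comment> \<open>The weight \<open>4 ^ k\<close> against the rate \<open>(1 / 8) ^ k\<close>
    leaves a summable bound, and a weighted square below 1 makes the increment at most
    \<open>(1 / 2) ^ k\<close>, so the sequence telescopes.\<close>
  have "AE x in lborel. (\<lambda>k. 4 ^ k * (cmod (u (r (Suc k)) x - u (r k) x))\<^sup>2) \<longlonglongrightarrow> 0"
  proof (rule AE_tendsto_0_of_summable_nn_integral[where b="\<lambda>k. (1 / 2) ^ k"])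
    fix k
    have "(\<integral>\<^sup>+x. ennreal (4 ^ k * (cmod (u (r (Suc k)) x - u (r k) x))\<^sup>2) \<partial>lborel) = ennreal (4 ^ k) * D (r (Suc k)) (r k)"
      unfolding D_def by (subst nn_integral_cmult[symmetric]) (auto simp: ennreal_mult)
    also have "\<dots> \<le> ennreal (4 ^ k) * ennreal ((1 / 8) ^ k)"
    proof (rule mult_left_mono)
      have "s k \<le> s (Suc k)" using s_mono by (simp add: strict_mono_less_eq)
      then show "D (r (Suc k)) (r k) \<le> ennreal ((1 / 8) ^ k)"
        unfolding r_def o_def using s_ge[of k] by (intro M) auto
    qed simp
    also have "\<dots> = ennreal ((1 / 2) ^ k)"
      by (simp flip: ennreal_mult power_mult_distrib)
    finally show "(\<integral>\<^sup>+x. ennreal (4 ^ k * (cmod (u (r (Suc k)) x - u (r k) x))\<^sup>2) \<partial>lborel) \<le> ennreal ((1 / 2) ^ k)" .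
  qed auto
  then have "AE x in lborel. convergent (\<lambda>k. u (r k) x)"
  proof eventually_elim
    case (elim x)
    have "eventually (\<lambda>k. 4 ^ k * (cmod (u (r (Suc k)) x - u (r k) x))\<^sup>2 < 1) sequentially"
      by (rule order_tendstoD(2)[OF elim]) simp
    then have "eventually (\<lambda>k. norm (u (r (Suc k)) x - u (r k) x) \<le> (1 / 2) ^ k) sequentially"
    proof eventually_elim
      case (elim k)
      have "(2 ^ k * cmod (u (r (Suc k)) x - u (r k) x))\<^sup>2 \<le> 1\<^sup>2"
        using elim by (simp add: power_mult_distrib power_mult[symmetric] mult.commute[of k] power_mult)
      then have "2 ^ k * cmod (u (r (Suc k)) x - u (r k) x) \<le> 1" by (rule power2_le_imp_le) simp
      then show ?case by (simp add: power_divide pos_le_divide_eq mult.commute)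
    qed
    then have "summable (\<lambda>k. u (r (Suc k)) x - u (r k) x)"
      by (rule summable_comparison_test_ev) (simp add: summable_geometric)
    then have "convergent (\<lambda>n. \<Sum>k<n. u (r (Suc k)) x - u (r k) x)" by (simp add: summable_iff_convergent)
    then have "convergent (\<lambda>n. u (r n) x - u (r 0) x)" unfolding sum_lessThan_telescope[of "\<lambda>k. u (r k) x"] .
    then have "convergent (\<lambda>n. (u (r n) x - u (r 0) x) + u (r 0) x)" by (intro convergent_add convergent_const)
    then show ?case by simp
  qed
  moreover have "strict_mono r" unfolding r_def by (intro strict_mono_o r0 s_mono)
  ultimately show thesis using that by blast
qed

lemma gagl_mult_le:
  assumes [measurable]: "u \<in> borel_measurable borel" "w \<in> borel_measurable borel"
    and un: "\<And>x. cmod (u x) = 1" "\<And>x. cmod (w x) = 1" and r: "0 < r"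
  shows "gagl (\<lambda>x. u x * w x) \<le> ennreal (1 + r) * gagl u + ennreal (1 + 1 / r) * gagl w"
proof -
  have pt: "lquot (\<lambda>x. u x * w x) z \<le> (1 + r) * lquot u z + (1 + 1 / r) * lquot w z" for z
  proof (cases z)
    case (Pair x y)
    have "u x * w x - u y * w y = (u x - u y) * w x + u y * (w x - w y)" by (simp add: algebra_simps)
    then have "cmod (u x * w x - u y * w y) \<le> cmod (u x - u y) + cmod (w x - w y)"
      using norm_triangle_ineq[of "(u x - u y) * w x" "u y * (w x - w y)"] by (simp add: norm_mult un)
    then have "(cmod (u x * w x - u y * w y))\<^sup>2 \<le> (cmod (u x - u y) + cmod (w x - w y))\<^sup>2" by (intro power_mono) auto
    also have "\<dots> \<le> (1 + r) * (cmod (u x - u y))\<^sup>2 + (1 + 1 / r) * (cmod (w x - w y))\<^sup>2"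
      by (rule add_sq_le_weighted[OF r])
    finally have "(cmod (u x * w x - u y * w y))\<^sup>2 / \<bar>x - y\<bar>\<^sup>2
      \<le> ((1 + r) * (cmod (u x - u y))\<^sup>2 + (1 + 1 / r) * (cmod (w x - w y))\<^sup>2) / \<bar>x - y\<bar>\<^sup>2"
      by (rule divide_right_mono) simp
    then show ?thesis unfolding Pair lquot_def by (simp add: add_divide_distrib)
  qed
  have "gagl (\<lambda>x. u x * w x) \<le> (\<integral>\<^sup>+z. ennreal (1 + r) * ennreal (lquot u z) + ennreal (1 + 1 / r) * ennreal (lquot w z) \<partial>(lborel \<Otimes>\<^sub>M lborel))"
    unfolding gagl_def
  proof (rule nn_integral_mono)
    fix z
    have "ennreal (lquot (\<lambda>x. u x * w x) z) \<le> ennreal ((1 + r) * lquot u z + (1 + 1 / r) * lquot w z)"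
      by (rule ennreal_leI[OF pt])
    then show "ennreal (lquot (\<lambda>x. u x * w x) z) \<le> ennreal (1 + r) * ennreal (lquot u z) + ennreal (1 + 1 / r) * ennreal (lquot w z)"
      using r by (subst (asm) ennreal_plus) (auto simp: ennreal_mult)
  qed
  also have "\<dots> = ennreal (1 + r) * gagl u + ennreal (1 + 1 / r) * gagl w"
    unfolding gagl_def by (simp add: nn_integral_add nn_integral_cmult)
  finally show ?thesis .
qed

section \<open>Minimization with prescribed degrees on the gaps\<close>

definition gaps :: "real \<Rightarrow> real set" where
  "gaps a = {- 1<..<- a} \<union> {a<..<1}"

text \<open>The origin separates the two gaps. A map that is 1 off the gaps is the product of its
  two parts, each of which carries the winding of one gap.\<close>

definition rpart :: "(real \<Rightarrow> complex) \<Rightarrow> real \<Rightarrow> complex" where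
  "rpart v x = (if 0 < x then v x else 1)"

definition lpart :: "(real \<Rightarrow> complex) \<Rightarrow> real \<Rightarrow> complex" where
  "lpart v x = (if 0 < x then 1 else v x)"

lemma rpart_mult: "rpart (\<lambda>x. u x * v x) = (\<lambda>x. rpart u x * rpart v x)"
  and lpart_mult: "lpart (\<lambda>x. u x * v x) = (\<lambda>x. lpart u x * lpart v x)"
  by (auto simp: rpart_def lpart_def)

lemma rpart_lpart: "rpart v x * lpart v x = v x"
  by (simp add: rpart_def lpart_def)

lemma unit_mult_cnj: "cmod z = 1 \<Longrightarrow> z * cnj z = 1"
  using complex_norm_square[of z] by simp

lemma lpart_eq: "(\<And>x. cmod (v x) = 1) \<Longrightarrow> lpart v = (\<lambda>x. v x * cnj (rpart v x))"
  by (auto simp: rpart_def lpart_def unit_mult_cnj)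

text \<open>Cutting at the origin makes no jump, since \<open>v\<close> is 1 on a neighbourhood of
  it. Only interactions across the origin change: they vanish unless one point lies in the right
  gap, and then the distance is at least \<open>a\<close>.\<close>

lemma line_map_rpart:
  assumes v: "line_map v" and a: "0 < a" and one: "\<And>x. x \<notin> gaps a \<Longrightarrow> v x = 1"
  shows "line_map (rpart v)"
proof -
  note V = lmapD[OF v]
  note [measurable] = V(1)
  have [measurable]: "rpart v \<in> borel_measurable borel" unfolding rpart_def[abs_def] by measurable
  \<comment> \<open>8 is 4 times 2: the square of \<open>cmod (v x - 1)\<close> is at most 4 and
    \<open>1 + x\<^sup>2\<close> at most 2. The other factor compares \<open>1 + y\<^sup>2\<close>
    with the squared distance.\<close>
  define K where "K = 8 * (1 + 1 / a\<^sup>2)"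
  have key: "(cmod (v x - 1))\<^sup>2 / \<bar>x - y\<bar>\<^sup>2 \<le> K / ((1 + x\<^sup>2) * (1 + y\<^sup>2))" if xy: "0 < x" "y \<le> 0" for x y
  proof (cases "x \<in> gaps a")
    case False
    then show ?thesis using one by (simp add: K_def one_plus_sq_pos less_imp_le add_nonneg_nonneg)
  next
    case True
    then have x: "a < x" "x < 1" using xy a by (auto simp: gaps_def)
    define D where "D = \<bar>x - y\<bar>\<^sup>2"
    have "a \<le> \<bar>x - y\<bar>" "\<bar>y\<bar> \<le> \<bar>x - y\<bar>" using x xy by auto
    then have "a\<^sup>2 \<le> D" "\<bar>y\<bar>\<^sup>2 \<le> D" unfolding D_def using a by (intro power_mono; simp)+
    then have D: "a\<^sup>2 \<le> D" "y\<^sup>2 \<le> D" by simp_all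
    have D0: "0 < D" using D(1) a by (meson less_le_trans zero_less_power)
    have "1 \<le> D / a\<^sup>2" using D(1) a by (simp add: pos_le_divide_eq)
    then have "1 + y\<^sup>2 \<le> D * (1 + 1 / a\<^sup>2)" using D(2) by (simp add: algebra_simps)
    moreover have "1 + x\<^sup>2 \<le> 2" using x a by (simp add: power_le_one)
    ultimately have "(1 + x\<^sup>2) * (1 + y\<^sup>2) \<le> 2 * (D * (1 + 1 / a\<^sup>2))"
      using one_plus_sq_pos[of y] by (intro mult_mono) auto
    moreover have "4 * (2 * (D * (1 + 1 / a\<^sup>2))) = K * D" unfolding K_def by (simp only: mult_ac)
    ultimately have "4 * ((1 + x\<^sup>2) * (1 + y\<^sup>2)) \<le> K * D" by linarith
    moreover have "(cmod (v x - 1))\<^sup>2 \<le> 4"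
    proof -
      have "cmod (v x - 1) \<le> 2" using norm_triangle_ineq4[of "v x" 1] V(2)[of x] by simp
      then have "(cmod (v x - 1))\<^sup>2 \<le> 2\<^sup>2" by (intro power_mono) auto
      then show ?thesis by simp
    qed
    then have "(cmod (v x - 1))\<^sup>2 * ((1 + x\<^sup>2) * (1 + y\<^sup>2)) \<le> 4 * ((1 + x\<^sup>2) * (1 + y\<^sup>2))"
      by (intro mult_right_mono) (auto simp: one_plus_sq_pos less_imp_le)
    ultimately have "(cmod (v x - 1))\<^sup>2 * ((1 + x\<^sup>2) * (1 + y\<^sup>2)) \<le> K * D" by linarith
    then show ?thesis
      using D0 one_plus_sq_pos[of x] one_plus_sq_pos[of y]
      unfolding D_def[symmetric] by (simp add: pos_le_divide_eq pos_divide_le_eq)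
  qed
  have K0: "0 \<le> K" by (simp add: K_def)
  have dec: "0 \<le> K / ((1 + x\<^sup>2) * (1 + y\<^sup>2))" for x y
    using K0 one_plus_sq_pos[of x] one_plus_sq_pos[of y] by simp
  have "gagl (rpart v) < \<infinity>"
  proof (rule gagl_finite_of_decay[OF K0 V(1) V(3)])
    fix x y :: real
    show "lquot (rpart v) (x, y) \<le> lquot v (x, y) + K / ((1 + x\<^sup>2) * (1 + y\<^sup>2))"
    proof (cases "0 < x"; cases "0 < y")
      assume "0 < x" "0 < y"
      then show ?thesis using dec[of x y] by (simp add: lquot_def rpart_def)
    next
      assume "0 < x" "\<not> 0 < y"
      then have "lquot (rpart v) (x, y) \<le> K / ((1 + x\<^sup>2) * (1 + y\<^sup>2))"
        using key[of x y] by (simp add: lquot_def rpart_def)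
      then show ?thesis by (rule order_trans) simp
    next
      assume "\<not> 0 < x" "0 < y"
      then have "lquot (rpart v) (x, y) \<le> K / ((1 + x\<^sup>2) * (1 + y\<^sup>2))"
        using key[of y x] by (simp add: lquot_def rpart_def norm_minus_commute power2_commute mult.commute)
      then show ?thesis by (rule order_trans) simp
    next
      assume "\<not> 0 < x" "\<not> 0 < y"
      then show ?thesis using dec[of x y] by (simp add: lquot_def rpart_def add_nonneg_nonneg)
    qed
  qed
  then show ?thesis using V(2) by (simp add: line_map_def) (simp add: rpart_def)
qed

lemma line_map_lpart:
  assumes "line_map v" "0 < a" "\<And>x. x \<notin> gaps a \<Longrightarrow> v x = 1"
  shows "line_map (lpart v)" "degree_half (lpart v) = degree_half v - degree_half (rpart v)"
proof -
  have r: "line_map (rpart v)" by (rule line_map_rpart[OF assms])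
  note eq = lpart_eq[OF lmapD(2)[OF assms(1)]]
  show "line_map (lpart v)" unfolding eq by (rule line_map_mult[OF assms(1) line_map_cnj[OF r]])
  show "degree_half (lpart v) = degree_half v - degree_half (rpart v)"
    unfolding eq using degree_half_mult[OF assms(1) line_map_cnj[OF r]] degree_half_cnj[OF r] by simp
qed

lemma AE_lborel_pair:
  assumes "AE x in lborel. P (x::real)"
  shows "AE z in lborel \<Otimes>\<^sub>M lborel. P (fst z) \<and> P (snd z)"
  using AE_pair_fst[OF sigma_finite_lborel assms] AE_pair_snd[OF sigma_finite_lborel assms] by (rule AE_conjI)

text \<open>The two increments are both nonzero only when the points lie in different gaps. There
  the distance is at least \<open>a\<close>, so the integrand is bounded on a bounded square and
  dominated convergence applies.\<close>

lemma rpart_lpart_cross_tendsto_0: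
  assumes v: "\<And>n. line_map (v n)" and a: "0 < a" and one: "\<And>n x. x \<notin> gaps a \<Longrightarrow> v n x = 1"
    and lim: "AE x in lborel. (\<lambda>n. v n x) \<longlonglongrightarrow> 1"
  shows "(\<lambda>n. \<integral>\<^sup>+z. ennreal (sqrt (lquot (rpart (v n)) z) * sqrt (lquot (lpart (v n)) z)) \<partial>(lborel \<Otimes>\<^sub>M lborel)) \<longlonglongrightarrow> 0"
proof -
  note [measurable] = lmapD(1)[OF line_map_rpart[OF v a one]] lmapD(1)[OF line_map_lpart(1)[OF v a one]]
  define B where "B = {- 1..1::real} \<times> {- 1..1::real}"
  have un: "cmod (v n x) = 1" for n x by (rule lmapD(2)[OF v])
  have bd: "cmod (v n x - 1) \<le> 2" for n x using norm_triangle_ineq4[of "v n x" 1] un[of n x] by simp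
  have key: "cmod (rpart (v n) x - rpart (v n) y) / \<bar>x - y\<bar> * (cmod (lpart (v n) x - lpart (v n) y) / \<bar>x - y\<bar>) \<le> 4 / a\<^sup>2 * indicator B (x, y)" for n x y
  proof (cases "rpart (v n) x = rpart (v n) y \<or> lpart (v n) x = lpart (v n) y")
    case True
    then show ?thesis by (auto split: split_indicator)
  next
    case False
    have xg: "x \<in> gaps a \<and> y \<in> gaps a \<and> a \<le> \<bar>x - y\<bar>"
    proof -
      have "(0 < x \<and> \<not> 0 < y) \<or> (\<not> 0 < x \<and> 0 < y)"
        using False by (cases "0 < x"; cases "0 < y") (simp_all add: rpart_def lpart_def)
      moreover have "x \<in> gaps a" "y \<in> gaps a"
        using False one[of x n] one[of y n] by (auto simp: rpart_def lpart_def split: if_splits)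
      ultimately show ?thesis using a by (auto simp: gaps_def)
    qed
    have "cmod (rpart (v n) x - rpart (v n) y) \<le> 2" "cmod (lpart (v n) x - lpart (v n) y) \<le> 2"
      using norm_triangle_ineq4[of "rpart (v n) x" "rpart (v n) y"] norm_triangle_ineq4[of "lpart (v n) x" "lpart (v n) y"]
      by (auto simp: rpart_def lpart_def un split: if_splits)
    then have "cmod (rpart (v n) x - rpart (v n) y) / \<bar>x - y\<bar> \<le> 2 / a" "cmod (lpart (v n) x - lpart (v n) y) / \<bar>x - y\<bar> \<le> 2 / a"
      using xg a by (auto intro!: frac_le)
    then have "cmod (rpart (v n) x - rpart (v n) y) / \<bar>x - y\<bar> * (cmod (lpart (v n) x - lpart (v n) y) / \<bar>x - y\<bar>) \<le> (2 / a) * (2 / a)"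
      using a by (intro mult_mono) auto
    also have "\<dots> = 4 / a\<^sup>2 * indicator B (x, y)"
      using xg a by (auto simp: B_def gaps_def power2_eq_square split: split_indicator)
    finally show ?thesis .
  qed
  have "(\<lambda>n. \<integral>\<^sup>+z. ennreal (sqrt (lquot (rpart (v n)) z) * sqrt (lquot (lpart (v n)) z)) \<partial>(lborel \<Otimes>\<^sub>M lborel)) \<longlonglongrightarrow> (\<integral>\<^sup>+z. 0 \<partial>(lborel \<Otimes>\<^sub>M lborel :: (real \<times> real) measure))"
  proof (rule nn_integral_dominated_convergence[where w="\<lambda>z. ennreal (4 / a\<^sup>2) * indicator B z" and u'="\<lambda>_. 0"
      and M="lborel \<Otimes>\<^sub>M lborel :: (real \<times> real) measure"
      and u="\<lambda>n z. ennreal (sqrt (lquot (rpart (v n)) z) * sqrt (lquot (lpart (v n)) z))"])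
    show "AE z in lborel \<Otimes>\<^sub>M lborel. ennreal (sqrt (lquot (rpart (v n)) z) * sqrt (lquot (lpart (v n)) z)) \<le> ennreal (4 / a\<^sup>2) * indicator B z" for n
    proof (rule AE_I2)
      fix z :: "real \<times> real"
      obtain x y where z: "z = (x, y)" by (cases z)
      have "ennreal (sqrt (lquot (rpart (v n)) z) * sqrt (lquot (lpart (v n)) z)) \<le> ennreal (4 / a\<^sup>2 * indicator B z)"
        unfolding z sqrt_lquot by (rule ennreal_leI[OF key])
      then show "ennreal (sqrt (lquot (rpart (v n)) z) * sqrt (lquot (lpart (v n)) z)) \<le> ennreal (4 / a\<^sup>2) * indicator B z"
        by (cases "z \<in> B") (simp_all only: indicator_def if_True if_False of_bool_def mult_1_right mult_zero_right ennreal_0)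
    qed
    have Bm[measurable]: "B \<in> sets (lborel \<Otimes>\<^sub>M lborel)" unfolding B_def by (intro pair_measureI) auto
    then show "(\<lambda>z. ennreal (4 / a\<^sup>2) * indicator B z) \<in> borel_measurable (lborel \<Otimes>\<^sub>M lborel)" by measurable
    have "emeasure (lborel \<Otimes>\<^sub>M lborel) B = emeasure lborel {- 1..1::real} * emeasure lborel {- 1..1::real}"
      unfolding B_def by (rule lborel.emeasure_pair_measure_Times) auto
    then have "emeasure (lborel \<Otimes>\<^sub>M lborel) B < \<infinity>" by (simp add: ennreal_mult_less_top)
    then show "(\<integral>\<^sup>+z. ennreal (4 / a\<^sup>2) * indicator B z \<partial>(lborel \<Otimes>\<^sub>M lborel)) < \<infinity>"
      by (subst nn_integral_cmult_indicator[OF Bm]) (simp add: ennreal_mult_less_top)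
    show "AE z in lborel \<Otimes>\<^sub>M lborel. (\<lambda>n. ennreal (sqrt (lquot (rpart (v n)) z) * sqrt (lquot (lpart (v n)) z))) \<longlonglongrightarrow> 0"
      using AE_lborel_pair[OF lim]
    proof eventually_elim
      case (elim z)
      obtain x y where z: "z = (x, y)" by (cases z)
      have rl: "(\<lambda>n. rpart (v n) s) \<longlonglongrightarrow> 1" "(\<lambda>n. lpart (v n) s) \<longlonglongrightarrow> 1" if "s = x \<or> s = y" for s
        using elim that by ((cases "0 < s"; auto simp: z rpart_def lpart_def)+)
      have "(\<lambda>n. cmod (rpart (v n) x - rpart (v n) y) * (1 / \<bar>x - y\<bar>) * (cmod (lpart (v n) x - lpart (v n) y) * (1 / \<bar>x - y\<bar>)))
        \<longlonglongrightarrow> cmod (1 - 1) * (1 / \<bar>x - y\<bar>) * (cmod (1 - 1) * (1 / \<bar>x - y\<bar>))"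
        by (intro tendsto_intros rl) auto
      then have "(\<lambda>n. sqrt (lquot (rpart (v n)) z) * sqrt (lquot (lpart (v n)) z)) \<longlonglongrightarrow> 0"
        by (simp add: z sqrt_lquot)
      from tendsto_ennrealI[OF this] show ?case by (simp only: ennreal_0)
    qed
  qed measurable
  then show ?thesis by simp
qed

text \<open>The degrees are taken relative to \<open>h\<close>, because only the quotient is 1 off
  the gaps and can be cut at the origin. The set plays the part of the homotopy class of
  \<open>h\<close> with fixed values off the gaps.\<close>

definition admissible :: "real \<Rightarrow> (real \<Rightarrow> complex) \<Rightarrow> (real \<Rightarrow> complex) set" where
  "admissible a h = {u. line_map u \<and> (\<forall>x. x \<notin> gaps a \<longrightarrow> u x = h x) \<and>
     degree_half (rpart (\<lambda>x. u x * cnj (h x))) = 0 \<and> degree_half (lpart (\<lambda>x. u x * cnj (h x))) = 0}"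

lemma admissible_quotient:
  assumes h: "line_map h" and u: "u \<in> admissible a h" and a: "0 < a"
  shows "line_map (\<lambda>x. u x * cnj (h x))" "x \<notin> gaps a \<Longrightarrow> u x * cnj (h x) = 1"
    "line_map (rpart (\<lambda>x. u x * cnj (h x)))" "line_map (lpart (\<lambda>x. u x * cnj (h x)))"
proof -
  show 1: "line_map (\<lambda>x. u x * cnj (h x))" using u by (intro line_map_mult line_map_cnj h) (auto simp: admissible_def)
  show 2: "u x * cnj (h x) = 1" if "x \<notin> gaps a" for x
    using u that lmapD(2)[OF h, of x] by (simp add: admissible_def unit_mult_cnj)
  show "line_map (rpart (\<lambda>x. u x * cnj (h x)))" by (rule line_map_rpart[OF 1 a 2])
  show "line_map (lpart (\<lambda>x. u x * cnj (h x)))" by (rule line_map_lpart(1)[OF 1 a 2])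
qed

lemma admissible_perturb:
  assumes h: "line_map h" and u: "u \<in> admissible a h" and a: "0 < a"
    and v: "line_map v" "\<And>x. x \<notin> gaps a \<Longrightarrow> v x = 1"
    and d: "degree_half (rpart v) = 0" "degree_half (lpart v) = 0"
  shows "(\<lambda>x. u x * v x) \<in> admissible a h"
proof -
  note q = admissible_quotient[OF h u a]
  have eq: "(\<lambda>x. u x * v x * cnj (h x)) = (\<lambda>x. (u x * cnj (h x)) * v x)" by (auto simp: mult_ac)
  have "degree_half (rpart (\<lambda>x. u x * v x * cnj (h x))) = 0"
    unfolding eq rpart_mult[of "\<lambda>x. u x * cnj (h x)" v]
    using degree_half_mult[OF q(3) line_map_rpart[OF v(1) a v(2)]] u d by (simp add: admissible_def)
  moreover have "degree_half (lpart (\<lambda>x. u x * v x * cnj (h x))) = 0"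
    unfolding eq lpart_mult[of "\<lambda>x. u x * cnj (h x)" v]
    using degree_half_mult[OF q(4) line_map_lpart(1)[OF v(1) a v(2)]] u d by (simp add: admissible_def)
  moreover have "line_map (\<lambda>x. u x * v x)" using u v(1) by (intro line_map_mult) (auto simp: admissible_def)
  ultimately show ?thesis using u v(2) by (simp add: admissible_def)
qed

lemma ennreal_lincomb:
  "\<lbrakk>0 \<le> a; 0 \<le> b; 0 \<le> c; 0 \<le> d\<rbrakk> \<Longrightarrow> ennreal a * ennreal b + ennreal c * ennreal d = ennreal (a * b + c * d)"
  by (simp add: ennreal_mult ennreal_plus)

text \<open>Energy below \<open>2 * pi\<close> leaves no room for the concentration of a bubble, so the degrees on
  the two gaps pass to the limit.\<close>

lemma admissible_closed:
  assumes h: "line_map h" and a: "0 < a" and c: "c < 4 * pi\<^sup>2" "0 \<le> c"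
    and w: "\<And>n. w n \<in> admissible a h" and en: "\<And>n. gagl (w n) \<le> ennreal (c + e n)" and e: "e \<longlonglongrightarrow> 0" "\<And>n. 0 \<le> e n"
    and u: "line_map u" and uh: "\<And>x. x \<notin> gaps a \<Longrightarrow> u x = h x"
    and lim: "AE x in lborel. (\<lambda>n. w n x) \<longlonglongrightarrow> u x"
  shows "u \<in> admissible a h"
proof -
  have lw: "line_map (w n)" for n using w[of n] by (simp add: admissible_def)
  \<comment> \<open>The quotient of the sequence by its limit; a lost bubble would remain visible in
    it.\<close>
  define v where "v n x = w n x * cnj (u x)" for n x
  have lv: "line_map (v n)" for n unfolding v_def[abs_def] by (intro line_map_mult line_map_cnj lw u)
  have uu: "u x * cnj (u x) = 1" for x by (rule unit_mult_cnj[OF lmapD(2)[OF u]])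
  have uv: "u x * v n x = w n x" for n x using uu[of x] by (simp add: v_def mult_ac)
  have v1: "v n x = 1" if "x \<notin> gaps a" for n x
    using w[of n] that uh[OF that] uu[of x] by (simp add: admissible_def v_def)
  have vlim: "AE x in lborel. (\<lambda>n. v n x) \<longlonglongrightarrow> 1"
    using lim
  proof eventually_elim
    case (elim x)
    have "(\<lambda>n. v n x) \<longlonglongrightarrow> u x * cnj (u x)" unfolding v_def by (intro tendsto_intros elim)
    then show ?case by (simp add: uu)
  qed
  obtain E where E: "\<And>n. e n \<le> E" using convergent_imp_Bseq[of e] e(1)
    by (metis Bseq_def abs_le_D1 convergentI real_norm_def)
  obtain U where U: "gagl u = ennreal U" "0 \<le> U" using lmapD(3)[OF u] by (cases "gagl u") auto
  define X where "X n = (\<integral>\<^sup>+z. ennreal (sqrt (lquot u z) * sqrt (lquot (v n) z)) \<partial>(lborel \<Otimes>\<^sub>M lborel))" for n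
  define Y where "Y n = (\<integral>\<^sup>+z. ennreal (sqrt (lquot (rpart (v n)) z) * sqrt (lquot (lpart (v n)) z)) \<partial>(lborel \<Otimes>\<^sub>M lborel))" for n
  note [measurable] = lmapD(1)[OF u] lmapD(1)[OF lv] lmapD(1)[OF lw]
  have bnd: "gagl (v n) \<le> ennreal (2 * (c + E) + 2 * U)" for n
  proof -
    have cu: "gagl (\<lambda>x. cnj (u x)) = gagl u"
      unfolding gagl_def lquot_def by (simp flip: complex_cnj_diff)
    have gw: "gagl (w n) \<le> ennreal (c + E)" using E[of n] by (intro order_trans[OF en ennreal_leI]) simp
    have "gagl (v n) \<le> ennreal (1 + 1) * gagl (w n) + ennreal (1 + 1 / 1) * gagl (\<lambda>x. cnj (u x))"
      unfolding v_def[abs_def] by (rule gagl_mult_le) (auto simp: lmapD(2)[OF lw] lmapD(2)[OF u])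
    also have "\<dots> = ennreal 2 * gagl (w n) + ennreal 2 * ennreal U" unfolding cu U by simp
    also have "\<dots> \<le> ennreal 2 * ennreal (c + E) + ennreal 2 * ennreal U"
      by (intro add_mono mult_left_mono gw order_refl) simp
    also have "\<dots> = ennreal (2 * (c + E) + 2 * U)"
      using c E[of 0] e(2)[of 0] U by (intro ennreal_lincomb) auto
    finally show ?thesis .
  qed
  have X0: "X \<longlonglongrightarrow> 0"
    unfolding X_def
  proof (rule nn_integral_cross_tendsto_0)
    show "(\<integral>\<^sup>+z. ennreal ((sqrt (lquot u z))\<^sup>2) \<partial>(lborel \<Otimes>\<^sub>M lborel)) < \<infinity>" using U by (simp add: gagl_def)
    show "(\<integral>\<^sup>+z. ennreal ((sqrt (lquot (v n) z))\<^sup>2) \<partial>(lborel \<Otimes>\<^sub>M lborel)) \<le> ennreal (2 * (c + E) + 2 * U)" for n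
      using bnd[of n] by (simp add: gagl_def)
    show "AE z in lborel \<Otimes>\<^sub>M lborel. (\<lambda>n. sqrt (lquot (v n) z)) \<longlonglongrightarrow> 0"
      using AE_lborel_pair[OF vlim]
    proof eventually_elim
      case (elim z)
      obtain x y where z: "z = (x, y)" by (cases z)
      have "(\<lambda>n. cmod (v n x - v n y) * (1 / \<bar>x - y\<bar>)) \<longlonglongrightarrow> cmod (1 - 1) * (1 / \<bar>x - y\<bar>)"
        using elim by (intro tendsto_mult tendsto_norm tendsto_diff tendsto_const) (auto simp: z)
      then show ?case by (simp add: z sqrt_lquot)
    qed
  qed auto
  have Y0: "Y \<longlonglongrightarrow> 0" unfolding Y_def by (rule rpart_lpart_cross_tendsto_0[OF lv a v1 vlim])
  \<comment> \<open>The cross estimate is applied twice, to \<open>w n = u * v n\<close> and to the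
    two parts of \<open>v n\<close>. Up to vanishing terms, both parts together stay below one
    quantum, so neither can have nonzero degree.\<close>
  have le: "gagl (rpart (v n)) + gagl (lpart (v n)) \<le> ennreal (c + e n) + 2 * X n + 2 * Y n" for n
  proof -
    have "gagl u + gagl (v n) \<le> gagl (\<lambda>x. u x * v n x) + 2 * X n"
      unfolding X_def by (rule gagl_cross_mult) (auto simp: lmapD(2)[OF lv] lmapD(2)[OF u])
    then have "gagl (v n) \<le> ennreal (c + e n) + 2 * X n"
      unfolding uv using en[of n] by (meson add_increasing add_right_mono order_refl order_trans zero_le)
    moreover have "gagl (rpart (v n)) + gagl (lpart (v n)) \<le> gagl (\<lambda>x. rpart (v n) x * lpart (v n) x) + 2 * Y n"
      unfolding Y_def using lmapD[OF line_map_rpart[OF lv a v1]] lmapD[OF line_map_lpart(1)[OF lv a v1]]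
      by (intro gagl_cross_mult) auto
    ultimately show ?thesis unfolding rpart_lpart by (meson add_right_mono order_trans)
  qed
  have "(\<lambda>n. ennreal (c + e n) + 2 * X n + 2 * Y n) \<longlonglongrightarrow> ennreal (c + 0) + 2 * 0 + 2 * 0"
    by (intro tendsto_add tendsto_ennrealI tendsto_const e ennreal_tendsto_cmult X0 Y0) auto
  then have "eventually (\<lambda>n. ennreal (c + e n) + 2 * X n + 2 * Y n < ennreal (4 * pi\<^sup>2)) sequentially"
    using c by (intro order_tendstoD(2)) (auto simp: ennreal_less_iff)
  then obtain n where n: "ennreal (c + e n) + 2 * X n + 2 * Y n < ennreal (4 * pi\<^sup>2)"
    unfolding eventually_sequentially by blast
  have sm: "gagl (rpart (v n)) + gagl (lpart (v n)) < ennreal (4 * pi\<^sup>2)" using le[of n] n by (rule order_le_less_trans)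
  have lr: "line_map (rpart (v m))" and ll: "line_map (lpart (v m))" for m
    by (rule line_map_rpart[OF lv a] line_map_lpart(1)[OF lv a], erule v1)+
  have "gagl (rpart (v n)) \<le> gagl (rpart (v n)) + gagl (lpart (v n))" by simp
  then have "gagl (rpart (v n)) < ennreal (4 * pi\<^sup>2)" using sm by (rule order_le_less_trans)
  then have dr: "degree_half (rpart (v n)) = 0" by (rule degree_half_eq_0[OF lr])
  have "gagl (lpart (v n)) \<le> gagl (rpart (v n)) + gagl (lpart (v n))" by simp
  then have "gagl (lpart (v n)) < ennreal (4 * pi\<^sup>2)" using sm by (rule order_le_less_trans)
  then have dl: "degree_half (lpart (v n)) = 0" by (rule degree_half_eq_0[OF ll])
  \<comment> \<open>Relative to \<open>h\<close>, the degree of \<open>w n\<close> on either side is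
    that of \<open>q\<close> plus that of \<open>v n\<close>. The first and the last are 0.\<close>
  define q where "q x = u x * cnj (h x)" for x
  have lq: "line_map q" unfolding q_def[abs_def] by (intro line_map_mult line_map_cnj h u)
  have q1: "q x = 1" if "x \<notin> gaps a" for x using uh[OF that] unit_mult_cnj[OF lmapD(2)[OF h]] by (simp add: q_def)
  have eq: "(\<lambda>x. w n x * cnj (h x)) = (\<lambda>x. q x * v n x)"
    using uv[of _ n] by (auto simp: q_def mult_ac simp flip: uv[of _ n])
  have "degree_half (rpart (\<lambda>x. w n x * cnj (h x))) = 0" "degree_half (lpart (\<lambda>x. w n x * cnj (h x))) = 0"
    using w[of n] by (auto simp: admissible_def)
  then have "degree_half (rpart q) = 0" "degree_half (lpart q) = 0"
    unfolding eq rpart_mult lpart_mult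
    using degree_half_mult[OF line_map_rpart[OF lq a q1] lr[of n]] dr
      degree_half_mult[OF line_map_lpart(1)[OF lq a q1] ll[of n]] dl by simp_all
  then show ?thesis using u uh by (simp add: admissible_def q_def[abs_def])
qed

section \<open>Existence of minimizers\<close>

text \<open>The direct method: \<open>h\<close> itself is a competitor, so the infimum is below the
  quantum, and this puts the limit of a minimizing sequence back into the class. Fatou's lemma gives
  lower semicontinuity.\<close>

lemma minimizer_exists:
  assumes h: "line_map h" and small: "gagl h < ennreal (4 * pi\<^sup>2)" and a: "0 < a"
  obtains u where "u \<in> admissible a h" "\<And>v. v \<in> admissible a h \<Longrightarrow> gagl u \<le> gagl v"
proof -
  have hh: "h x * cnj (h x) = 1" for x by (rule unit_mult_cnj[OF lmapD(2)[OF h]])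
  have "rpart (\<lambda>x. h x * cnj (h x)) = (\<lambda>x. 1)" "lpart (\<lambda>x. h x * cnj (h x)) = (\<lambda>x. 1)"
    by (auto simp: hh rpart_def lpart_def)
  then have hA: "h \<in> admissible a h"
    using h degree_half_AE_1[of "\<lambda>x. 1"] by (simp add: admissible_def line_map_const)
  define I where "I = Inf (gagl ` admissible a h)"
  have I_le: "I \<le> gagl v" if "v \<in> admissible a h" for v unfolding I_def using that by (rule INF_lower)
  have "I < ennreal (4 * pi\<^sup>2)" using I_le[OF hA] small by (rule order_le_less_trans)
  then obtain c where c: "I = ennreal c" "0 \<le> c" "c < 4 * pi\<^sup>2"
    by (cases I) (auto simp: ennreal_less_iff)
  have "\<exists>w. w \<in> admissible a h \<and> gagl w \<le> ennreal (c + 1 / real (Suc n))" for n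
  proof -
    have "I < ennreal (c + 1 / real (Suc n))" unfolding c(1) using c(2) by (subst ennreal_less_iff) auto
    then obtain y where "y \<in> gagl ` admissible a h" "y < ennreal (c + 1 / real (Suc n))" unfolding I_def by (auto simp: Inf_less_iff)
    then show ?thesis by (auto intro: less_imp_le)
  qed
  then obtain w where w: "\<And>n. w n \<in> admissible a h" "\<And>n. gagl (w n) \<le> ennreal (c + 1 / real (Suc n))" by metis
  have lw: "line_map (w n)" for n using w(1)[of n] by (simp add: admissible_def)
  have out: "w n x = h x" if "x \<notin> {- 1<..<1}" for n x
  proof -
    have "x \<notin> gaps a" using that a by (auto simp: gaps_def)
    then show ?thesis using w(1)[of n] by (simp add: admissible_def)
  qed
  have "gagl (w n) \<le> ennreal (c + 1)" for n
    by (rule order_trans[OF w(2) ennreal_leI]) simp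
  then obtain r where r: "strict_mono r" "AE x in lborel. convergent (\<lambda>k. w (r k) x)"
    using line_map_subsequence[of w "c + 1" h] lw out c(2) by auto
  define L where "L x = lim (\<lambda>k. w (r k) x)" for x
  \<comment> \<open>The default 1 acts only where the sequence diverges, a null set inside the gaps;
    off the gaps the sequence is constant and the limit is \<open>h\<close>.\<close>
  define u where "u x = (if cmod (L x) = 1 then L x else 1)" for x
  note [measurable] = lmapD(1)[OF lw]
  have [measurable]: "L \<in> borel_measurable borel" unfolding L_def[abs_def] by measurable
  have um[measurable]: "u \<in> borel_measurable borel" unfolding u_def[abs_def] by measurable
  have conv: "(\<lambda>k. w (r k) x) \<longlonglongrightarrow> u x" if "convergent (\<lambda>k. w (r k) x)" for x
  proof -
    have L: "(\<lambda>k. w (r k) x) \<longlonglongrightarrow> L x" unfolding L_def using that by (simp add: convergent_LIMSEQ_iff)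
    have "(\<lambda>k. cmod (w (r k) x)) \<longlonglongrightarrow> cmod (L x)" by (intro tendsto_norm L)
    then have "(\<lambda>k. 1::real) \<longlonglongrightarrow> cmod (L x)" by (simp add: lmapD(2)[OF lw])
    then have "cmod (L x) = 1" by (simp add: LIMSEQ_const_iff)
    then show ?thesis using L by (simp add: u_def)
  qed
  have lim: "AE x in lborel. (\<lambda>k. w (r k) x) \<longlonglongrightarrow> u x" using r(2) by eventually_elim (rule conv)
  have uh: "u x = h x" if "x \<notin> gaps a" for x
  proof -
    have eq: "w n x = h x" for n using w(1)[of n] that by (simp add: admissible_def)
    then have "convergent (\<lambda>k. w (r k) x)" by (simp add: convergent_const)
    from conv[OF this] show ?thesis by (simp add: eq LIMSEQ_const_iff)
  qed
  have r_ge: "k \<le> r k" for k using r(1) by (rule seq_suble)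
  have e0: "(\<lambda>k. 1 / real (Suc (r k))) \<longlonglongrightarrow> 0"
  proof -
    have "(\<lambda>n. 1 / real (Suc n)) \<longlonglongrightarrow> 0" using LIMSEQ_inverse_real_of_nat by (simp add: inverse_eq_divide)
    from LIMSEQ_subseq_LIMSEQ[OF this r(1)] show ?thesis by (simp add: o_def)
  qed
  have gu: "gagl u \<le> I"
  proof -
    have "gagl u = (\<integral>\<^sup>+z. liminf (\<lambda>k. ennreal (lquot (w (r k)) z)) \<partial>(lborel \<Otimes>\<^sub>M lborel))"
      unfolding gagl_def
    proof (rule nn_integral_cong_AE)
      show "AE z in lborel \<Otimes>\<^sub>M lborel. ennreal (lquot u z) = liminf (\<lambda>k. ennreal (lquot (w (r k)) z))"
        using AE_lborel_pair[OF lim]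
      proof eventually_elim
        case (elim z)
        obtain x y where z: "z = (x, y)" by (cases z)
        have "(\<lambda>k. (cmod (w (r k) x - w (r k) y))\<^sup>2 * (1 / \<bar>x - y\<bar>\<^sup>2)) \<longlonglongrightarrow> (cmod (u x - u y))\<^sup>2 * (1 / \<bar>x - y\<bar>\<^sup>2)"
          using elim by (intro tendsto_mult tendsto_power tendsto_norm tendsto_diff tendsto_const) (auto simp: z)
        then have "(\<lambda>k. ennreal (lquot (w (r k)) z)) \<longlonglongrightarrow> ennreal (lquot u z)"
          by (intro tendsto_ennrealI) (simp add: z lquot_def)
        then show ?case by (rule lim_imp_Liminf[OF trivial_limit_sequentially, symmetric])
      qed
    qed
    also have "\<dots> \<le> liminf (\<lambda>k. gagl (w (r k)))"
      unfolding gagl_def by (rule nn_integral_liminf) measurable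
    also have "\<dots> \<le> liminf (\<lambda>k. ennreal (c + 1 / real (Suc (r k))))"
      by (intro Liminf_mono always_eventually allI w(2))
    also have "\<dots> = ennreal (c + 0)"
      by (intro lim_imp_Liminf tendsto_ennrealI tendsto_add tendsto_const e0) simp
    finally show ?thesis by (simp add: c(1))
  qed
  have lu: "line_map u" using gu c(1) by (auto simp: line_map_def u_def um intro: order_le_less_trans)
  have "u \<in> admissible a h"
    by (rule admissible_closed[OF h a c(3,2) w(1) w(2) e0 _ lu uh lim]) auto
  then show thesis using that gu I_le order_trans by blast
qed

section \<open>First variation of the energy\<close>

text \<open>The squared chord is 2 minus twice the real part of \<open>p = u x * cnj (u y)\<close>,
  and the perturbation rotates \<open>p\<close> by \<delta>. The remainders
  \<open>1 - cos \<delta>\<close> and \<open>sin \<delta> - \<delta>\<close> are both at most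
  \<open>\<delta>\<^sup>2 / 2\<close> in modulus. An upper bound suffices, as \<epsilon> may have
  either sign.\<close>

lemma lquot_variation:
  fixes \<phi> :: "real \<Rightarrow> real"
  assumes un: "\<And>x. cmod (u x) = 1"
  shows "lquot (\<lambda>x. u x * cis (\<epsilon> * \<phi> x)) (x, y) \<le> lquot u (x, y)
    + \<epsilon> * (2 * Im (u x * cnj (u y)) * (\<phi> x - \<phi> y) / \<bar>x - y\<bar>\<^sup>2) + 2 * \<epsilon>\<^sup>2 * lquot (\<lambda>x. of_real (\<phi> x)) (x, y)"
proof -
  define p where "p = u x * cnj (u y)"
  define \<delta> where "\<delta> = \<epsilon> * (\<phi> x - \<phi> y)"
  have p1: "cmod p = 1" by (simp add: p_def norm_mult un)
  have dist_unit: "(cmod (a - b))\<^sup>2 = 2 - 2 * Re (a * cnj b)" if "cmod a = 1" "cmod b = 1" for a b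
  proof -
    have "(cmod a)\<^sup>2 = 1" "(cmod b)\<^sup>2 = 1" using that by simp_all
    then show ?thesis unfolding cmod_power2 by (simp add: power2_eq_square algebra_simps)
  qed
  have A: "(cmod (u x - u y))\<^sup>2 = 2 - 2 * Re p" unfolding p_def by (rule dist_unit) (rule un)+
  have "(u x * cis (\<epsilon> * \<phi> x)) * cnj (u y * cis (\<epsilon> * \<phi> y)) = p * cis \<delta>"
  proof -
    have "cis (\<epsilon> * \<phi> x) * cnj (cis (\<epsilon> * \<phi> y)) = cis \<delta>" by (simp add: cis_cnj cis_mult \<delta>_def algebra_simps)
    then show ?thesis unfolding p_def by (metis (no_types, opaque_lifting) complex_cnj_mult mult.assoc mult.commute)
  qed
  then have B: "(cmod (u x * cis (\<epsilon> * \<phi> x) - u y * cis (\<epsilon> * \<phi> y)))\<^sup>2 = 2 - 2 * Re (p * cis \<delta>)"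
    using dist_unit[of "u x * cis (\<epsilon> * \<phi> x)" "u y * cis (\<epsilon> * \<phi> y)"] by (simp add: norm_mult un)
  have re: "\<bar>Re p\<bar> \<le> 1" "\<bar>Im p\<bar> \<le> 1" using abs_Re_le_cmod[of p] abs_Im_le_cmod[of p] p1 by auto
  have c: "1 - cos \<delta> \<le> \<delta>\<^sup>2 / 2" "0 \<le> 1 - cos \<delta>"
  proof -
    have "1 - cos \<delta> = 2 * (sin (\<delta> / 2))\<^sup>2" using cos_double_sin[of "\<delta> / 2"] by simp
    also have "\<dots> \<le> 2 * (\<delta> / 2)\<^sup>2" using abs_sin_x_le_abs_x[of "\<delta> / 2"] by (simp add: abs_le_square_iff[symmetric])
    finally show "1 - cos \<delta> \<le> \<delta>\<^sup>2 / 2" by (simp add: power2_eq_square)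
  qed simp
  have s: "\<bar>sin \<delta> - \<delta>\<bar> \<le> \<delta>\<^sup>2 / 2"
    using Maclaurin_sin_bound[of \<delta> 2] by (simp add: sin_coeff_def numeral_2_eq_2)
  have "2 - 2 * Re (p * cis \<delta>) = (2 - 2 * Re p) + 2 * Im p * \<delta> + (2 * (Re p * (1 - cos \<delta>)) + 2 * (Im p * (sin \<delta> - \<delta>)))"
    by (simp add: algebra_simps)
  moreover have "Re p * (1 - cos \<delta>) \<le> \<delta>\<^sup>2 / 2"
  proof -
    have "Re p * (1 - cos \<delta>) \<le> 1 * (1 - cos \<delta>)" using re c by (intro mult_right_mono) auto
    then show ?thesis using c by simp
  qed
  moreover have "Im p * (sin \<delta> - \<delta>) \<le> \<delta>\<^sup>2 / 2"
  proof -
    have "Im p * (sin \<delta> - \<delta>) \<le> \<bar>Im p\<bar> * \<bar>sin \<delta> - \<delta>\<bar>" by (simp flip: abs_mult)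
    also have "\<dots> \<le> 1 * (\<delta>\<^sup>2 / 2)" using re s by (intro mult_mono) auto
    finally show ?thesis by simp
  qed
  ultimately have "2 - 2 * Re (p * cis \<delta>) \<le> (2 - 2 * Re p) + 2 * Im p * \<delta> + 2 * \<delta>\<^sup>2" by linarith
  have "(cmod (u x * cis (\<epsilon> * \<phi> x) - u y * cis (\<epsilon> * \<phi> y)))\<^sup>2
      \<le> (cmod (u x - u y))\<^sup>2 + \<epsilon> * (2 * Im p * (\<phi> x - \<phi> y)) + 2 * \<epsilon>\<^sup>2 * (\<phi> x - \<phi> y)\<^sup>2"
  proof -
    have "\<delta>\<^sup>2 = \<epsilon>\<^sup>2 * (\<phi> x - \<phi> y)\<^sup>2" "2 * Im p * \<delta> = \<epsilon> * (2 * Im p * (\<phi> x - \<phi> y))"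
      by (simp_all add: \<delta>_def power_mult_distrib)
    then show ?thesis
      using \<open>2 - 2 * Re (p * cis \<delta>) \<le> (2 - 2 * Re p) + 2 * Im p * \<delta> + 2 * \<delta>\<^sup>2\<close> unfolding A B by linarith
  qed
  then have "(cmod (u x * cis (\<epsilon> * \<phi> x) - u y * cis (\<epsilon> * \<phi> y)))\<^sup>2 / \<bar>x - y\<bar>\<^sup>2
      \<le> ((cmod (u x - u y))\<^sup>2 + \<epsilon> * (2 * Im p * (\<phi> x - \<phi> y)) + 2 * \<epsilon>\<^sup>2 * (\<phi> x - \<phi> y)\<^sup>2) / \<bar>x - y\<bar>\<^sup>2"
    by (rule divide_right_mono) simp
  then show ?thesis
    by (simp add: lquot_def p_def add_divide_distrib flip: of_real_diff)
qed

lemma integrable_lquot: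
  assumes [measurable]: "u \<in> borel_measurable borel" and fin: "gagl u < \<infinity>"
  shows "integrable (lborel \<Otimes>\<^sub>M lborel) (lquot u)" "gagl u = ennreal (\<integral>z. lquot u z \<partial>(lborel \<Otimes>\<^sub>M lborel))"
proof -
  show i: "integrable (lborel \<Otimes>\<^sub>M lborel) (lquot u)"
    using fin by (intro integrableI_nonneg) (auto simp: gagl_def)
  show "gagl u = ennreal (\<integral>z. lquot u z \<partial>(lborel \<Otimes>\<^sub>M lborel))"
    unfolding gagl_def using i by (intro nn_integral_eq_integral) auto
qed

text \<open>Minimality and the second-order bound give
  \<open>0 \<le> \<epsilon> * l + 2 * \<epsilon>\<^sup>2 * \<Phi>\<close> for every real \<epsilon>,
  which forces the linear coefficient to vanish. The weak form is half of that coefficient.\<close>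

lemma euler_lagrange:
  fixes \<phi> :: "real \<Rightarrow> real"
  assumes u: "line_map u" and [measurable]: "\<phi> \<in> borel_measurable borel" and fin: "gagl (\<lambda>x. of_real (\<phi> x)) < \<infinity>"
    and min: "\<And>\<epsilon>. gagl u \<le> gagl (\<lambda>x. u x * cis (\<epsilon> * \<phi> x))"
  shows "(LINT (x, y)|(lebesgue :: (real \<times> real) measure).
     ((u x - u y) \<bullet> (\<i> * u x * complex_of_real (\<phi> x) - \<i> * u y * complex_of_real (\<phi> y))) / \<bar>x - y\<bar>\<^sup>2) = 0"
proof -
  note U = lmapD[OF u]
  note [measurable] = U(1)
  let ?M = "lborel \<Otimes>\<^sub>M lborel :: (real \<times> real) measure"
  let ?\<phi> = "\<lambda>x. complex_of_real (\<phi> x)"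
  define L where "L z = 2 * Im (u (fst z) * cnj (u (snd z))) * (\<phi> (fst z) - \<phi> (snd z)) / \<bar>fst z - snd z\<bar>\<^sup>2" for z
  have Lm[measurable]: "L \<in> borel_measurable ?M" unfolding L_def[abs_def] by measurable
  have m\<phi>[measurable]: "?\<phi> \<in> borel_measurable borel" by measurable
  note iu = integrable_lquot[OF U(1) U(3)] and i\<phi> = integrable_lquot[OF m\<phi> fin]
  have L_le: "\<bar>L z\<bar> \<le> lquot u z + lquot ?\<phi> z" for z
  proof -
    obtain x y where z: "z = (x, y)" by (cases z)
    have "\<bar>Im (u x * cnj (u y))\<bar> \<le> cmod (u x - u y)"
    proof -
      have "Im (u x * cnj (u y)) = Im ((u x - u y) * cnj (u y))" by (simp add: algebra_simps)
      also have "\<bar>\<dots>\<bar> \<le> cmod ((u x - u y) * cnj (u y))" by (rule abs_Im_le_cmod)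
      finally show ?thesis by (simp add: norm_mult U)
    qed
    then have "2 * \<bar>Im (u x * cnj (u y))\<bar> * \<bar>\<phi> x - \<phi> y\<bar> \<le> 2 * cmod (u x - u y) * \<bar>\<phi> x - \<phi> y\<bar>"
      by (intro mult_right_mono mult_left_mono) auto
    also have "\<dots> \<le> (cmod (u x - u y))\<^sup>2 + \<bar>\<phi> x - \<phi> y\<bar>\<^sup>2"
      using zero_le_power2[of "cmod (u x - u y) - \<bar>\<phi> x - \<phi> y\<bar>"] by (simp only: power2_diff)
    finally have "2 * \<bar>Im (u x * cnj (u y))\<bar> * \<bar>\<phi> x - \<phi> y\<bar> / \<bar>x - y\<bar>\<^sup>2 \<le> ((cmod (u x - u y))\<^sup>2 + \<bar>\<phi> x - \<phi> y\<bar>\<^sup>2) / \<bar>x - y\<bar>\<^sup>2"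
      by (rule divide_right_mono) simp
    moreover have "\<bar>L z\<bar> = 2 * \<bar>Im (u x * cnj (u y))\<bar> * \<bar>\<phi> x - \<phi> y\<bar> / \<bar>x - y\<bar>\<^sup>2"
      unfolding L_def z fst_conv snd_conv abs_divide abs_mult by simp
    ultimately show ?thesis by (simp add: z lquot_def add_divide_distrib flip: of_real_diff)
  qed
  have iL: "integrable ?M L"
    by (rule Bochner_Integration.integrable_bound[OF Bochner_Integration.integrable_add[OF iu(1) i\<phi>(1)]])
      (use L_le in \<open>auto intro!: AE_I2 order_trans[OF L_le]\<close>)
  define l where "l = (\<integral>z. L z \<partial>?M)"
  define \<Phi> where "\<Phi> = (\<integral>z. lquot ?\<phi> z \<partial>?M)"
  have \<Phi>0: "0 \<le> \<Phi>" unfolding \<Phi>_def by (rule integral_nonneg_AE) auto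
  have quad: "0 \<le> \<epsilon> * l + 2 * \<epsilon>\<^sup>2 * \<Phi>" for \<epsilon>
  proof -
    let ?v = "\<lambda>x. u x * cis (\<epsilon> * \<phi> x)"
    have lv: "line_map ?v" by (rule line_map_mult[OF u degree_half_cis(1)]) (use fin in auto)
    note iv = integrable_lquot[OF lmapD(1)[OF lv] lmapD(3)[OF lv]]
    have ir: "integrable ?M (\<lambda>z. lquot u z + \<epsilon> * L z + 2 * \<epsilon>\<^sup>2 * lquot ?\<phi> z)"
      using iu(1) iL i\<phi>(1) by (intro Bochner_Integration.integrable_add integrable_mult_right)
    have "(\<integral>z. lquot u z \<partial>?M) \<le> (\<integral>z. lquot ?v z \<partial>?M)"
    proof -
      have "ennreal (\<integral>z. lquot u z \<partial>?M) \<le> ennreal (\<integral>z. lquot ?v z \<partial>?M)"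
        using min[of \<epsilon>] iu(2) iv(2) by simp
      moreover have "0 \<le> (\<integral>z. lquot ?v z \<partial>?M)" by (rule integral_nonneg_AE) auto
      ultimately show ?thesis by (simp add: ennreal_le_iff)
    qed
    also have "\<dots> \<le> (\<integral>z. lquot u z + \<epsilon> * L z + 2 * \<epsilon>\<^sup>2 * lquot ?\<phi> z \<partial>?M)"
    proof (rule integral_mono[OF iv(1) ir])
      fix z :: "real \<times> real"
      obtain x y where z: "z = (x, y)" by (cases z)
      show "lquot ?v z \<le> lquot u z + \<epsilon> * L z + 2 * \<epsilon>\<^sup>2 * lquot ?\<phi> z"
        using lquot_variation[of u \<epsilon> \<phi> x y] U(2) by (simp add: z L_def)
    qed
    also have "\<dots> = (\<integral>z. lquot u z \<partial>?M) + \<epsilon> * l + 2 * \<epsilon>\<^sup>2 * \<Phi>"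
      unfolding l_def \<Phi>_def using iu(1) iL i\<phi>(1) by simp
    finally show ?thesis by simp
  qed
  have l0: "l = 0"
  proof (rule ccontr)
    assume "l \<noteq> 0"
    \<comment> \<open>Small enough for the quadratic term to be at most half of the linear one; the
      added 1 covers \<open>\<Phi> = 0\<close>.\<close>
    define t where "t = 1 / (4 * (\<Phi> + 1))"
    have t: "0 < t" "2 * t * \<Phi> \<le> 1 / 2" using \<Phi>0 by (auto simp: t_def field_simps)
    have "0 \<le> (- (t * l)) * l + 2 * (- (t * l))\<^sup>2 * \<Phi>" by (rule quad)
    also have "\<dots> = t * l\<^sup>2 * (2 * t * \<Phi> - 1)" by (simp add: power2_eq_square algebra_simps)
    also have "\<dots> < 0" using t \<open>l \<noteq> 0\<close> by (intro mult_pos_neg mult_pos_pos) auto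
    finally show False by simp
  qed
  have eq: "((u x - u y) \<bullet> (\<i> * u x * ?\<phi> x - \<i> * u y * ?\<phi> y)) / \<bar>x - y\<bar>\<^sup>2 = L (x, y) / 2" for x y
  proof -
    have num: "(u x - u y) \<bullet> (\<i> * u x * ?\<phi> x - \<i> * u y * ?\<phi> y) = Im (u x * cnj (u y)) * (\<phi> x - \<phi> y)"
      by (simp add: inner_complex_def algebra_simps)
    have half: "m * d / D = 2 * m * d / D / 2" for m d D :: real by simp
    show ?thesis unfolding num L_def fst_conv snd_conv by (rule half)
  qed
  have fe: "(\<lambda>(x, y). ((u x - u y) \<bullet> (\<i> * u x * ?\<phi> x - \<i> * u y * ?\<phi> y)) / \<bar>x - y\<bar>\<^sup>2) = (\<lambda>z. L z / 2)"
    by (rule ext) (simp only: case_prod_beta eq prod.collapse)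
  \<comment> \<open>\<open>L\<close> is Borel measurable, so completing the measure does not change
    its integral.\<close>
  have "(LINT z|(lebesgue :: (real \<times> real) measure). L z / 2) = (LINT z|lborel. L z / 2)"
    using Lm by (intro integral_completion) (auto simp: lborel_prod)
  also have "\<dots> = l / 2" unfolding l_def lborel_prod by simp
  finally show ?thesis unfolding fe by (simp add: l0)
qed

lemma arctan_max_lipschitz: "\<bar>arctan (max 0 x) - arctan (max 0 y)\<bar> \<le> \<bar>arctan x - arctan y\<bar>"
proof -
  have "arctan (max 0 z) = max 0 (arctan z)" for z by (cases "0 \<le> z") (auto simp: max_def)
  moreover have "\<bar>max 0 a - max 0 b\<bar> \<le> \<bar>a - b\<bar>" for a b :: real by (auto simp: max_def)
  ultimately show ?thesis by simp
qed

text \<open>The derivative vanishes off the support and is bounded by \<open>B\<close> on the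
  interval from -1 to 1, where \<open>1 + x\<^sup>2\<close> is at most 2. It is therefore bounded by
  \<open>2 * B\<close> times the derivative of \<open>arctan\<close>, and monotonicity of
  \<open>2 * B * arctan t - s * \<phi> t\<close> for both signs \<open>s\<close> gives the Lipschitz
  bound.\<close>

lemma test_function_facts:
  assumes \<phi>: "test_function (gaps a) \<phi>" and a: "0 < a"
  shows "continuous_on UNIV \<phi>" "\<And>x. x \<notin> gaps a \<Longrightarrow> \<phi> x = 0"
    and "\<exists>K\<ge>0. \<forall>x y. \<bar>\<phi> x - \<phi> y\<bar> \<le> K * \<bar>arctan x - arctan y\<bar>"
proof -
  define S where "S = closure {x. \<phi> x \<noteq> 0}"
  have d: "((deriv ^^ n) \<phi>) differentiable (at x)" for n x using \<phi> by (simp add: test_function_def)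
  have S: "S \<subseteq> gaps a" using \<phi> by (simp add: test_function_def S_def)
  have d0: "\<phi> differentiable (at x)" for x using d[of 0 x] by simp
  have d1: "deriv \<phi> differentiable (at x)" for x using d[of 1 x] by simp
  show "continuous_on UNIV \<phi>"
    using d0 by (intro continuous_at_imp_continuous_on ballI differentiable_imp_continuous_within)
  have c1: "continuous_on UNIV (deriv \<phi>)"
    using d1 by (intro continuous_at_imp_continuous_on ballI differentiable_imp_continuous_within)
  have D: "(\<phi> has_real_derivative deriv \<phi> x) (at x)" for x
    using d0[of x] by (simp add: DERIV_deriv_iff_real_differentiable)
  have out: "\<phi> x = 0" if "x \<notin> S" for x
    using that closure_subset[of "{x. \<phi> x \<noteq> 0}"] by (auto simp: S_def)
  show "\<phi> x = 0" if "x \<notin> gaps a" for x using that S by (intro out) auto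
  have dout: "deriv \<phi> x = 0" if "x \<notin> S" for x
  proof -
    have "((\<lambda>_. 0) has_real_derivative deriv \<phi> x) (at x)"
    proof (rule has_field_derivative_transform_within_open[OF D[of x], of "- S"])
      show "open (- S)" by (simp add: S_def open_Compl)
      show "\<phi> z = 0" if "z \<in> - S" for z using that by (intro out) simp
    qed (use that in simp)
    then show ?thesis by (rule DERIV_unique[OF _ DERIV_const])
  qed
  have "compact (deriv \<phi> ` {- 1..1})" by (intro compact_continuous_image continuous_on_subset[OF c1]) auto
  then obtain B where B: "\<And>x. x \<in> {- 1..1} \<Longrightarrow> \<bar>deriv \<phi> x\<bar> \<le> B"
    using compact_imp_bounded bounded_iff by (metis imageI real_norm_def)
  have B0: "0 \<le> B" using B[of 0] by simp
  have bd: "\<bar>deriv \<phi> x\<bar> \<le> 2 * B * inverse (1 + x\<^sup>2)" for x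
  proof (cases "x \<in> S")
    case True
    then have x: "\<bar>x\<bar> \<le> 1" using S a by (auto simp: gaps_def)
    have "1 + x\<^sup>2 \<le> 2" using abs_square_le_1[of x] x by simp
    then have "1 \<le> 2 * inverse (1 + x\<^sup>2)" using one_plus_sq_pos[of x] by (simp add: inverse_eq_divide pos_le_divide_eq)
    then have "B * 1 \<le> B * (2 * inverse (1 + x\<^sup>2))" using B0 by (rule mult_left_mono)
    moreover have "\<bar>deriv \<phi> x\<bar> \<le> B" using x by (intro B) auto
    ultimately show ?thesis by (simp add: mult_ac)
  next
    case False
    then show ?thesis using B0 one_plus_sq_pos[of x] by (simp add: dout)
  qed
  have mono: "s * \<phi> y - s * \<phi> x \<le> 2 * B * (arctan y - arctan x)" if "x \<le> y" "\<bar>s\<bar> = 1" for x y s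
  proof -
    have "2 * B * arctan x - s * \<phi> x \<le> 2 * B * arctan y - s * \<phi> y"
    proof (rule DERIV_nonneg_imp_nondecreasing[OF that(1)])
      fix t
      have "((\<lambda>t. 2 * B * arctan t - s * \<phi> t) has_real_derivative 2 * B * inverse (1 + t\<^sup>2) - s * deriv \<phi> t) (at t)"
        by (intro DERIV_diff DERIV_cmult DERIV_arctan D)
      moreover have "s * deriv \<phi> t \<le> \<bar>s\<bar> * \<bar>deriv \<phi> t\<bar>" by (simp flip: abs_mult)
      then have "0 \<le> 2 * B * inverse (1 + t\<^sup>2) - s * deriv \<phi> t" using bd[of t] that(2) by simp
      ultimately show "\<exists>d. ((\<lambda>t. 2 * B * arctan t - s * \<phi> t) has_real_derivative d) (at t) \<and> 0 \<le> d" by blast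
    qed
    then show ?thesis by (simp add: algebra_simps)
  qed
  have "\<bar>\<phi> x - \<phi> y\<bar> \<le> 2 * B * \<bar>arctan x - arctan y\<bar>" for x y
  proof (cases "x \<le> y")
    case True
    then have "arctan x \<le> arctan y" by (simp add: arctan_le_iff)
    then show ?thesis using mono[OF True, of 1] mono[OF True, of "- 1"] by (simp add: abs_le_iff)
  next
    case False
    then have le: "y \<le> x" by simp
    then have "arctan y \<le> arctan x" by (simp add: arctan_le_iff)
    then show ?thesis using mono[OF le, of 1] mono[OF le, of "- 1"] by (simp add: abs_le_iff)
  qed
  then show "\<exists>K\<ge>0. \<forall>x y. \<bar>\<phi> x - \<phi> y\<bar> \<le> K * \<bar>arctan x - arctan y\<bar>"
    using B0 by (intro exI[of _ "2 * B"]) auto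
qed

lemma gagl_finite_test:
  fixes \<phi> :: "real \<Rightarrow> real"
  assumes lip: "\<And>x y. \<bar>\<phi> x - \<phi> y\<bar> \<le> K * \<bar>arctan x - arctan y\<bar>" and out: "\<And>x. 1 \<le> \<bar>x\<bar> \<Longrightarrow> \<phi> x = 0"
  shows "gagl (\<lambda>x. of_real (\<phi> x)) < \<infinity>"
proof (rule gagl_finite_arctan_lipschitz[OF lip])
  have "eventually (\<lambda>x. 0 = \<phi> x) at_top"
    using eventually_ge_at_top[of "1::real"] by eventually_elim (simp add: out)
  then show "(\<phi> \<longlongrightarrow> 0) at_top" by (rule Lim_transform_eventually[OF tendsto_const])
  have "eventually (\<lambda>x. 0 = \<phi> x) at_bot"
    using eventually_le_at_bot[of "-1::real"] by eventually_elim (simp add: out)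
  then show "(\<phi> \<longlongrightarrow> 0) at_bot" by (rule Lim_transform_eventually[OF tendsto_const])
qed

text \<open>The perturbation \<open>cis (\<epsilon> * \<phi> x)\<close> and its right part, with
  phase \<open>\<epsilon> * \<phi> (max 0 x)\<close>, have single-valued phases of finite energy.
  Their degrees are 0, so the perturbed map stays in the class and can be compared with
  \<open>u\<close>.\<close>

lemma minimizer_half_harmonic:
  assumes h: "line_map h" and a: "0 < a" and u: "u \<in> admissible a h"
    and min: "\<And>v. v \<in> admissible a h \<Longrightarrow> gagl u \<le> gagl v" and uH: "u \<in> Hdot_half_circle"
  shows "half_harmonic_in (gaps a) u"
  unfolding half_harmonic_in_def
proof (intro conjI allI impI uH)
  fix \<phi> assume "test_function (gaps a) \<phi>"
  note T = test_function_facts[OF this a]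
  have lu: "line_map u" using u by (simp add: admissible_def)
  have [measurable]: "\<phi> \<in> borel_measurable borel" using T(1) by (rule borel_measurable_continuous_onI)
  obtain K where K: "0 \<le> K" "\<And>x y. \<bar>\<phi> x - \<phi> y\<bar> \<le> K * \<bar>arctan x - arctan y\<bar>" using T(3) by blast
  have out: "\<phi> x = 0" if "1 \<le> \<bar>x\<bar>" for x using that a by (intro T(2)) (auto simp: gaps_def)
  have \<phi>0: "\<phi> 0 = 0" using a by (intro T(2)) (auto simp: gaps_def)
  have fin: "gagl (\<lambda>x. of_real (\<phi> x)) < \<infinity>" by (rule gagl_finite_test[OF K(2) out])
  have finr: "gagl (\<lambda>x. of_real (\<phi> (max 0 x))) < \<infinity>"
  proof (rule gagl_finite_test)
    show "\<bar>\<phi> (max 0 x) - \<phi> (max 0 y)\<bar> \<le> K * \<bar>arctan x - arctan y\<bar>" for x y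
      by (rule order_trans[OF K(2) mult_left_mono[OF arctan_max_lipschitz K(1)]])
    show "\<phi> (max 0 x) = 0" if "1 \<le> \<bar>x\<bar>" for x
      using out[of x] \<phi>0 that by (cases "0 \<le> x") (auto simp: max_def)
  qed
  show "(LINT (x, y)|(lebesgue :: (real \<times> real) measure).
     ((u x - u y) \<bullet> (\<i> * u x * complex_of_real (\<phi> x) - \<i> * u y * complex_of_real (\<phi> y))) / \<bar>x - y\<bar>\<^sup>2) = 0"
  proof (rule euler_lagrange[OF lu _ fin])
    fix \<epsilon>
    let ?v = "\<lambda>x. cis (\<epsilon> * \<phi> x)"
    have v: "line_map ?v" "degree_half ?v = 0" using degree_half_cis[OF _ fin] by auto
    have v1: "?v x = 1" if "x \<notin> gaps a" for x using T(2)[OF that] by simp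
    have r: "rpart ?v = (\<lambda>x. cis (\<epsilon> * \<phi> (max 0 x)))" by (auto simp: rpart_def \<phi>0 max_def)
    have dr: "degree_half (rpart ?v) = 0" unfolding r using finr by (intro degree_half_cis(2)) measurable
    have dl: "degree_half (lpart ?v) = 0" using line_map_lpart(2)[OF v(1) a v1] v(2) dr by simp
    show "gagl u \<le> gagl (\<lambda>x. u x * ?v x)"
      by (rule min[OF admissible_perturb[OF h u a v(1) v1 dr dl]])
  qed simp
qed

section \<open>Representatives on the line and the competing phases\<close>

lemma line_map_Hdot_half_circle:
  assumes "line_map u"
  shows "u \<in> Hdot_half_circle" "energy u = ennreal (1 / (2 * pi)) * gagl u"
proof -
  note U = lmapD[OF assms]
  have g: "gagliardo u = gagl u" by (rule gagliardo_eq_gagl) (use U in auto)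
  have "u \<in> borel_measurable lebesgue" using U(1) by (intro measurable_completion) simp
  then show "u \<in> Hdot_half_circle" using U(2,3) by (simp add: Hdot_half_circle_def Hdot_half_def g)
  show "energy u = ennreal (1 / (2 * pi)) * gagl u" by (simp add: energy_def g)
qed

lemma Hdot_half_circle_borel_version:
  assumes "g \<in> Hdot_half_circle"
  obtains g' where "line_map g'" "AE x in lebesgue. g x = g' x" "gagliardo g = gagl g'"
proof -
  have m: "g \<in> borel_measurable lebesgue" and fin: "gagliardo g < \<infinity>" and un: "AE x in lebesgue. cmod (g x) = 1"
    using assms by (auto simp: Hdot_half_circle_def Hdot_half_def)
  obtain b where b[measurable]: "b \<in> borel_measurable borel" and ae: "AE x in lebesgue. g x = b x"
    using lebesgue_borel_version[OF m] by blast
  define g' where "g' x = (if cmod (b x) = 1 then b x else 1)" for x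
  have m'[measurable]: "g' \<in> borel_measurable borel" unfolding g'_def[abs_def] by measurable
  have ae': "AE x in lebesgue. g x = g' x" using ae un by eventually_elim (simp add: g'_def)
  have eq: "gagliardo g = gagl g'" by (rule gagliardo_eq_gagl[OF m' ae'])
  have "line_map g'" using m' fin eq by (simp add: line_map_def g'_def)
  then show thesis using that ae' eq by blast
qed

text \<open>The phase is a full turn near the origin and 0 beyond 1. The right part starts from that
  full turn and loses it, whence the degree -1.\<close>

lemma cutoff_phase:
  assumes \<kappa>: "cutoff a0 \<kappa>" and a: "0 < a" "a \<le> a0"
  shows "line_map (\<lambda>x. cis (2 * pi * \<kappa> x))" "x \<notin> gaps a \<Longrightarrow> cis (2 * pi * \<kappa> x) = 1"
    "line_map (rpart (\<lambda>x. cis (2 * pi * \<kappa> x)))" "degree_half (rpart (\<lambda>x. cis (2 * pi * \<kappa> x))) = - 1"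
proof -
  have [measurable]: "\<kappa> \<in> borel_measurable borel" by (rule cutoff_measurable[OF \<kappa>])
  show "line_map (\<lambda>x. cis (2 * pi * \<kappa> x))" by (rule degree_half_cis(1)[OF _ cutoff_gagl_finite[OF \<kappa>]]) simp
  obtain K where K: "\<And>x y. \<bar>\<kappa> x - \<kappa> y\<bar> \<le> K * \<bar>arctan x - arctan y\<bar>" using \<kappa> by (auto simp: cutoff_def)
  have "\<kappa> 0 = 1" "\<And>x. 1 \<le> x \<Longrightarrow> \<kappa> x = 0" using \<kappa> a by (auto simp: cutoff_def)
  from degree_half_one_sided_phase[OF _ K this]
  show "line_map (rpart (\<lambda>x. cis (2 * pi * \<kappa> x)))" "degree_half (rpart (\<lambda>x. cis (2 * pi * \<kappa> x))) = - 1"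
    by (simp_all add: rpart_def[abs_def])
  show "cis (2 * pi * \<kappa> x) = 1" if "x \<notin> gaps a" for x
  proof -
    have "\<bar>x\<bar> \<le> a \<or> 1 \<le> \<bar>x\<bar>" using that by (auto simp: gaps_def)
    then have "\<kappa> x = 1 \<or> \<kappa> x = 0" using \<kappa> a by (auto simp: cutoff_def)
    then show ?thesis by auto
  qed
qed

theorem theorem1p2:
  fixes k :: nat and \<Lambda> :: real
  assumes "k \<ge> 1" and "0 \<le> \<Lambda>" and "\<Lambda> < 2 * pi"
  shows "\<exists>a0>0. \<forall>a::real. 0 < a \<and> a \<le> a0 \<longrightarrow>
    (\<forall>g \<in> Hdot_half_circle. energy g \<le> ennreal \<Lambda> \<longrightarrow>
      (\<exists>u :: nat \<Rightarrow> real \<Rightarrow> complex.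
        (\<forall>j\<le>k. u j \<in> Hdot_half_circle \<and>
               half_harmonic_in ({-1<..<-a} \<union> {a<..<1}) (u j) \<and>
               (AE x in lebesgue. x \<notin> {-1<..<-a} \<union> {a<..<1} \<longrightarrow> u j x = g x) \<and>
               energy (u j) < ennreal (2 * pi) \<and>
               degree_half (u j) = 0) \<and>
        (\<forall>i\<le>k. \<forall>j\<le>k. i \<noteq> j \<longrightarrow> \<not> (AE x in lebesgue. u i x = u j x))))"
proof -
  \<comment> \<open>The Young parameter for the product \<open>g' * w ^ j\<close>: with
    \<open>r * (2 * pi)\<close> equal to half the margin \<open>2 * pi - \<Lambda>\<close>, the
    enlarged energy \<open>(1 + r) * \<Lambda>\<close> stays below \<open>2 * pi\<close>.\<close>
  define r where "r = (2 * pi - \<Lambda>) / (4 * pi)"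
  have r: "0 < r" using assms(3) by (simp add: r_def)
  \<comment> \<open>The room left below \<open>4 * pi\<^sup>2\<close> for the phase factors; half of
    it will be used.\<close>
  define G where "G = 4 * pi\<^sup>2 - (1 + r) * (2 * pi * \<Lambda>)"
  have G: "0 < G"
  proof -
    have "r * \<Lambda> \<le> r * (2 * pi)" using r assms(3) by (intro mult_left_mono) auto
    also have "\<dots> = (2 * pi - \<Lambda>) / 2" by (simp add: r_def)
    finally have "(1 + r) * \<Lambda> < 2 * pi" using assms(3) by (simp add: algebra_simps)
    then have "2 * pi * ((1 + r) * \<Lambda>) < 2 * pi * (2 * pi)" by (intro mult_strict_left_mono) auto
    then show ?thesis by (simp add: G_def power2_eq_square algebra_simps)
  qed
  \<comment> \<open>An upper bound, valid for all \<open>j \<le> k\<close>, for the factor with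
    which the energy of the cutoff enters that of \<open>h j\<close>.\<close>
  define M where "M = (1 + 1 / r) * ((2 * pi * real k)\<^sup>2 + 1)"
  have M: "0 < M" unfolding M_def using r by (intro mult_pos_pos add_pos_pos add_nonneg_pos) auto
  obtain a0 \<kappa> where \<kappa>: "0 < a0" "cutoff a0 \<kappa>" "gagl (\<lambda>x. of_real (\<kappa> x)) \<le> ennreal (G / (2 * M))"
    using cutoff_small_energy[of "G / (2 * M)"] G M by auto
  have [measurable]: "\<kappa> \<in> borel_measurable borel" by (rule cutoff_measurable[OF \<kappa>(2)])
  show ?thesis
  proof (intro exI[of _ a0] conjI allI impI ballI)
    fix a g
    assume a: "0 < a \<and> a \<le> a0" and g: "g \<in> Hdot_half_circle" "energy g \<le> ennreal \<Lambda>"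
    obtain g' where g': "line_map g'" "AE x in lebesgue. g x = g' x" "gagliardo g = gagl g'"
      using Hdot_half_circle_borel_version[OF g(1)] by blast
    obtain C where C: "gagl g' = ennreal C" "0 \<le> C" using lmapD(3)[OF g'(1)] by (cases "gagl g'") auto
    have C_le: "C \<le> 2 * pi * \<Lambda>"
    proof -
      have "ennreal (1 / (2 * pi) * C) \<le> ennreal \<Lambda>"
        using g(2) C by (simp add: energy_def g'(3) flip: ennreal_mult)
      then have "1 / (2 * pi) * C \<le> \<Lambda>" using assms(2) by (simp only: ennreal_le_iff)
      then show ?thesis by (simp add: pos_divide_le_eq mult_ac)
    qed
    \<comment> \<open>The phase at \<kappa>-plateau heights 1 and 0 is a multiple of a full turn, so
      powers of \<open>w\<close> leave the values off the gaps unchanged as long as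
      \<open>a \<le> a0\<close>.\<close>
    define w where "w x = cis (2 * pi * \<kappa> x)" for x
    note W = cutoff_phase[OF \<kappa>(2), of a, folded w_def[abs_def] w_def]
    have lw: "line_map w" and w1: "\<And>x. x \<notin> gaps a \<Longrightarrow> w x = 1" and lrw: "line_map (rpart w)"
      and drw: "degree_half (rpart w) = - 1" using W a by auto
    define h where "h j x = g' x * w x ^ j" for j x
    have lh: "line_map (h j)" for j unfolding h_def[abs_def] by (intro line_map_mult line_map_power(1) lw g')
    have small: "gagl (h j) < ennreal (4 * pi\<^sup>2)" if "j \<le> k" for j
    proof -
      have wj: "w x ^ j = cis ((2 * pi * real j) * \<kappa> x)" for x
        unfolding w_def by (subst Complex.DeMoivre) (simp add: mult_ac)
      have "gagl (\<lambda>x. w x ^ j) \<le> ennreal ((2 * pi * real j)\<^sup>2) * gagl (\<lambda>x. of_real (\<kappa> x))"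
        unfolding wj by (rule gagl_cis_le) simp
      also have "\<dots> \<le> ennreal ((2 * pi * real k)\<^sup>2 + 1) * ennreal (G / (2 * M))"
      proof (intro mult_mono ennreal_leI \<kappa>(3))
        have "(2 * pi * real j)\<^sup>2 \<le> (2 * pi * real k)\<^sup>2" using that by (intro power_mono mult_left_mono) auto
        then show "(2 * pi * real j)\<^sup>2 \<le> (2 * pi * real k)\<^sup>2 + 1" by linarith
      qed auto
      also have "\<dots> = ennreal (((2 * pi * real k)\<^sup>2 + 1) * (G / (2 * M)))"
        using G M by (intro ennreal_mult[symmetric]) auto
      finally have gw: "gagl (\<lambda>x. w x ^ j) \<le> ennreal (((2 * pi * real k)\<^sup>2 + 1) * (G / (2 * M)))" .
      have "gagl (h j) \<le> ennreal (1 + r) * gagl g' + ennreal (1 + 1 / r) * gagl (\<lambda>x. w x ^ j)"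
        unfolding h_def[abs_def]
        by (rule gagl_mult_le) (use lmapD[OF g'(1)] lmapD[OF line_map_power(1)[OF lw]] r in auto)
      also have "\<dots> \<le> ennreal (1 + r) * ennreal (2 * pi * \<Lambda>) + ennreal (1 + 1 / r) * ennreal (((2 * pi * real k)\<^sup>2 + 1) * (G / (2 * M)))"
        unfolding C(1) by (intro add_mono mult_left_mono gw ennreal_leI C_le) auto
      also have "\<dots> = ennreal ((1 + r) * (2 * pi * \<Lambda>) + (1 + 1 / r) * (((2 * pi * real k)\<^sup>2 + 1) * (G / (2 * M))))"
        using r G M assms(2) by (intro ennreal_lincomb mult_nonneg_nonneg divide_nonneg_nonneg add_nonneg_nonneg) auto
      also have "(1 + 1 / r) * (((2 * pi * real k)\<^sup>2 + 1) * (G / (2 * M))) = G / 2"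
      proof -
        have "(1 + 1 / r) * (((2 * pi * real k)\<^sup>2 + 1) * (G / (2 * M))) = M * (G / (2 * M))"
          unfolding M_def by (simp only: mult.assoc)
        then show ?thesis using M by simp
      qed
      also have "ennreal ((1 + r) * (2 * pi * \<Lambda>) + G / 2) < ennreal (4 * pi\<^sup>2)"
      proof -
        have "A + (B - A) / 2 < B" if "0 < B - A" for A B :: real using that by (simp add: field_simps)
        then have "(1 + r) * (2 * pi * \<Lambda>) + G / 2 < 4 * pi\<^sup>2" using G unfolding G_def .
        moreover have "0 \<le> (1 + r) * (2 * pi * \<Lambda>) + G / 2" using r assms(2) G by (intro add_nonneg_nonneg mult_nonneg_nonneg) auto
        ultimately show ?thesis by (simp only: ennreal_less_iff)
      qed
      finally show ?thesis .
    qed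
    \<comment> \<open>The restriction on \<open>j\<close> sits under the existential quantifier so
      that the axiom of choice yields one function on all indices.\<close>
    have "\<forall>j. \<exists>u. j \<le> k \<longrightarrow> u \<in> admissible a (h j) \<and> (\<forall>v\<in>admissible a (h j). gagl u \<le> gagl v)"
    proof
      fix j
      show "\<exists>u. j \<le> k \<longrightarrow> u \<in> admissible a (h j) \<and> (\<forall>v\<in>admissible a (h j). gagl u \<le> gagl v)"
      proof (cases "j \<le> k")
        case True
        show ?thesis
        proof (rule minimizer_exists[OF lh small[OF True] conjunct1[OF a]])
          fix u
          assume "u \<in> admissible a (h j)" "\<And>v. v \<in> admissible a (h j) \<Longrightarrow> gagl u \<le> gagl v"
          then show ?thesis by blast
        qed
      qed simp
    qed
    from choice[OF this] obtain u where u: "\<And>j. j \<le> k \<Longrightarrow> u j \<in> admissible a (h j)"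
      "\<And>j v. j \<le> k \<Longrightarrow> v \<in> admissible a (h j) \<Longrightarrow> gagl (u j) \<le> gagl v" by blast
    have lu: "line_map (u j)" if "j \<le> k" for j using u(1)[OF that] by (simp add: admissible_def)
    have gu: "gagl (u j) < ennreal (4 * pi\<^sup>2)" if "j \<le> k" for j
    proof -
      have hh: "h j x * cnj (h j x) = 1" for x by (rule unit_mult_cnj[OF lmapD(2)[OF lh]])
      have "rpart (\<lambda>x. h j x * cnj (h j x)) = (\<lambda>x. 1)" "lpart (\<lambda>x. h j x * cnj (h j x)) = (\<lambda>x. 1)"
        by (auto simp: hh rpart_def lpart_def)
      then have "h j \<in> admissible a (h j)"
        using lh degree_half_AE_1[of "\<lambda>x. 1"] by (simp add: admissible_def line_map_const)
      from u(2)[OF that this] show ?thesis using small[OF that] by (rule order_le_less_trans)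
    qed
    have one: "u j \<in> Hdot_half_circle \<and>
               half_harmonic_in ({-1<..<-a} \<union> {a<..<1}) (u j) \<and>
               (AE x in lebesgue. x \<notin> {-1<..<-a} \<union> {a<..<1} \<longrightarrow> u j x = g x) \<and>
               energy (u j) < ennreal (2 * pi) \<and>
               degree_half (u j) = 0" if j: "j \<le> k" for j
    proof (intro conjI)
      show uH: "u j \<in> Hdot_half_circle" by (rule line_map_Hdot_half_circle(1)[OF lu[OF j]])
      show "half_harmonic_in ({-1<..<-a} \<union> {a<..<1}) (u j)"
        using minimizer_half_harmonic[OF lh _ u(1)[OF j] u(2)[OF j] uH] a by (simp add: gaps_def)
      show "AE x in lebesgue. x \<notin> {-1<..<-a} \<union> {a<..<1} \<longrightarrow> u j x = g x"
        using g'(2)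
      proof eventually_elim
        case (elim x)
        show ?case
        proof
          assume "x \<notin> {-1<..<-a} \<union> {a<..<1}"
          then have x: "x \<notin> gaps a" by (simp add: gaps_def)
          then have "u j x = h j x" using u(1)[OF j] by (simp add: admissible_def)
          then show "u j x = g x" using elim w1[OF x] by (simp add: h_def)
        qed
      qed
      obtain c where c: "gagl (u j) = ennreal c" "0 \<le> c" using lmapD(3)[OF lu[OF j]] by (cases "gagl (u j)") auto
      then have "c < 4 * pi\<^sup>2" using gu[OF j] by (simp add: ennreal_less_iff)
      then have "1 / (2 * pi) * c < 2 * pi" by (simp add: pos_divide_less_eq power2_eq_square)
      then show "energy (u j) < ennreal (2 * pi)"
        using c by (simp add: line_map_Hdot_half_circle(2)[OF lu[OF j]] ennreal_less_iff flip: ennreal_mult)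
      show "degree_half (u j) = 0" by (rule degree_half_eq_0[OF lu[OF j] gu[OF j]])
    qed
    have distinct: "\<not> (AE x in lebesgue. u i x = u j x)" if ij: "i \<le> k" "j \<le> k" "i \<noteq> j" for i j
    proof
      assume ae: "AE x in lebesgue. u i x = u j x"
      define q where "q j x = u j x * cnj (h j x)" for j x
      have dq: "degree_half (rpart (q m)) = 0" "line_map (rpart (q m))" if "m \<le> k" for m
        using u(1)[OF that] admissible_quotient(3)[OF lh u(1)[OF that]] a
        unfolding q_def[abs_def] by (auto simp: admissible_def)
      \<comment> \<open>This is the right part of \<open>u m * cnj (g' x)\<close>, written so that
        its degree can be read off: 0 from \<open>q m\<close>, and \<open>- int m\<close> from the
        power of \<open>w\<close>. Maps \<open>u i\<close> and \<open>u j\<close> that agree almost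
        everywhere would give \<open>F i\<close> and \<open>F j\<close> the same degree.\<close>
      define F where "F m x = rpart (q m) x * rpart w x ^ m" for m x
      have lF: "line_map (F m)" "degree_half (F m) = - int m" if "m \<le> k" for m
        using line_map_mult[OF dq(2)[OF that] line_map_power(1)[OF lrw]]
          degree_half_mult[OF dq(2)[OF that] line_map_power(1)[OF lrw], of m] line_map_power(2)[OF lrw, of m] dq(1)[OF that] drw
        unfolding F_def[abs_def] by auto
      have Fe: "F m x = rpart (\<lambda>x. u m x * cnj (g' x)) x" for m x
      proof (cases "0 < x")
        case True
        have "w x ^ m * cnj (w x ^ m) = 1"
          using unit_mult_cnj[OF lmapD(2)[OF line_map_power(1)[OF lw]]] .
        then have "cnj (w x) ^ m * w x ^ m = 1" by (simp add: mult.commute)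
        then show ?thesis using True by (simp add: F_def q_def h_def rpart_def mult.assoc)
      qed (simp add: F_def rpart_def)
      have "AE x in lborel. F i x * cnj (F j x) = 1"
        using ae unfolding AE_completion_iff
      proof eventually_elim
        case (elim x)
        have "F i x = F j x" unfolding Fe rpart_def by (simp add: elim)
        then show ?case using unit_mult_cnj[OF lmapD(2)[OF lF(1)[OF ij(2)]]] by simp
      qed
      from degree_half_AE_1[OF line_map_mult[OF lF(1)[OF ij(1)] line_map_cnj[OF lF(1)[OF ij(2)]]] this]
      have "- int i + int j = 0"
        using degree_half_mult[OF lF(1)[OF ij(1)] line_map_cnj[OF lF(1)[OF ij(2)]]]
          degree_half_cnj[OF lF(1)[OF ij(2)]] lF(2) ij by simp
      then show False using ij(3) by simp
    qed
    show "\<exists>u :: nat \<Rightarrow> real \<Rightarrow> complex.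
        (\<forall>j\<le>k. u j \<in> Hdot_half_circle \<and>
               half_harmonic_in ({-1<..<-a} \<union> {a<..<1}) (u j) \<and>
               (AE x in lebesgue. x \<notin> {-1<..<-a} \<union> {a<..<1} \<longrightarrow> u j x = g x) \<and>
               energy (u j) < ennreal (2 * pi) \<and>
               degree_half (u j) = 0) \<and>
        (\<forall>i\<le>k. \<forall>j\<le>k. i \<noteq> j \<longrightarrow> \<not> (AE x in lebesgue. u i x = u j x))"
      using one distinct by (intro exI[of _ u] conjI allI impI) blast+
  qed (rule \<kappa>(1))
qed

end
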